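(* Let $\Phi$ be a Young function with $\Phi,\widetilde\Phi\in\Delta_2$, $Q\subset\mathbb{R}^N$ bounded open, $\{T(x)\}$ an $N$-dimensional dynamical system on $(\Omega,\mathscr{M},\mu)$, and $E$ a fundamental sequence. Let $(u_\epsilon)_{\epsilon\in E}$ be a sequence in $W^1L^\Phi_{D_x}(Q;L^\Phi(\Omega))$ such that $(u_\epsilon)$ is bounded in $L^\Phi(Q\times\Omega)$ and $(D_xu_\epsilon)$ is bounded in $L^\Phi(Q\times\Omega)^N$. Then there exist $u_0\in W^1L^\Phi_{D_x}(Q;I^\Phi_{nv}(\Omega))$, $u_1\in L^1(Q;W^1_\#L^\Phi(\Omega))$ with $\overline D_\omega u_1\in L^\Phi(Q\times\Omega)^N$, and a subsequence $E'\subset E$ such that, as $E'\ni\epsilon\to0$: (ii) $u_\epsilon\to u_0$ weakly stochastically two-scale in the mean in $L^\Phi(Q\times\Omega)$; (iii) $D_xu_\epsilon\to D_xu_0+\overline D_\omega u_1$ weakly stochastically two-scale in the mean in $L^\Phi(Q\times\Omega)^N$. Moreover, if $\widetilde\Phi\in\Delta'$, then $u_1\in L^\Phi(Q;W^1_\#L^\Phi(\Omega))$.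
   Context: Young function $\Phi$ (continuous convex, $\Phi(t)>0$ for $t>0$, $\Phi(t)/t\to0$ at $0$ and $\to\infty$ at $\infty$), conjugate $\widetilde\Phi(t)=\sup_{s\ge0}(st-\Phi(s))$, $\Delta_2$: $\Phi(2t)\le k\Phi(t)$ for $t\ge t_0$; $\Delta'$: $\Phi(ts)\le\beta\Phi(t)\Phi(s)$ for all $t,s\ge0$. Standing assumption: $L^\Phi(\Omega)$ is separable and reflexive. $N$-dimensional dynamical system: invertible bimeasurable maps $T(x)$ of the probability space $(\Omega,\mathscr{M},\mu)$, $T(0)=\mathrm{id}$, $T(x_1+x_2)=T(x_1)\circ T(x_2)$, $\mu$-preserving, jointly measurable. Fundamental sequence: $E=(\epsilon_n)$, $0<\epsilon_n\le1$, $\epsilon_n\to0$. Stochastic derivative $D_{i,\Phi}f$: strong $L^\Phi(\Omega)$-limit of $(f\circ T(te_i)-f)/t$. $\mathcal{C}^\infty(\Omega)$: $f\in L^\infty(\Omega)$ with all iterated stochastic derivatives in $L^\infty(\Omega)$. $W^1_\#L^\Phi(\Omega)$: completion of $\mathcal{C}^\infty(\Omega)$ for the seminorm $\sum_i\|D_{i,\Phi}u\|_{L^\Phi(\Omega)}$; $\overline D_\omega$ the continuous extension of the stochastic gradient to $W^1_\#L^\Phi(\Omega)\to L^\Phi(\Omega)^N$. $I^\Phi_{nv}(\Omega)$: the closed subspace of $f\in L^\Phi(\Omega)$ with $f\circ T(x)=f$ $\mu$-a.e. for every $x\in\mathbb{R}^N$. $W^1L^\Phi_{D_x}(Q;L^\Phi(\Omega))=\{v\in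 L^\Phi(Q\times\Omega):\partial v/\partial x_i\in L^\Phi(Q\times\Omega),1\le i\le N\}$ (distributional derivatives in $x$), and $W^1L^\Phi_{D_x}(Q;I^\Phi_{nv}(\Omega))$ its subset of $v$ with $v(x,\cdot)\in I^\Phi_{nv}(\Omega)$ for a.e. $x$. A sequence $(u_\epsilon)$ in $L^\Phi(Q\times\Omega)$ weakly stochastically two-scale converges in the mean to $u_0$ if $\iint_{Q\times\Omega}u_\epsilon(x,\omega)f(x,T(\epsilon^{-1}x)\omega)dxd\mu\to\iint_{Q\times\Omega}u_0f\,dxd\mu$ for all $f\in\mathcal{C}^\infty_0(Q)\otimes\mathcal{C}^\infty(\Omega)$ (finite sums of products $\varphi(x)\psi(\omega)$); for vector-valued sequences, componentwise. *)

theory Defs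
  imports "HOL-Probability.Probability"
begin

definition young_function :: "(real \<Rightarrow> real) \<Rightarrow> bool" where
  "young_function \<Phi> \<longleftrightarrow>
     continuous_on {0..} \<Phi> \<and> convex_on {0..} \<Phi> \<and> \<Phi> 0 = 0 \<and>
     (\<forall>t>0. \<Phi> t > 0) \<and>
     ((\<lambda>t. \<Phi> t / t) \<longlongrightarrow> 0) (at_right 0) \<and>
     filterlim (\<lambda>t. \<Phi> t / t) at_top at_top"

definition young_conj :: "(real \<Rightarrow> real) \<Rightarrow> real \<Rightarrow> real" where
  "young_conj \<Phi> t = (SUP s\<in>{0..}. s * t - \<Phi> s)"

definition delta2 :: "(real \<Rightarrow> real) \<Rightarrow> bool" where
  "delta2 \<Phi> \<longleftrightarrow> (\<exists>k t0. t0 \<ge> 0 \<and> (\<forall>t\<ge>t0. \<Phi> (2 * t) \<le> k * \<Phi> t))"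

definition delta_prime :: "(real \<Rightarrow> real) \<Rightarrow> bool" where
  "delta_prime \<Phi> \<longleftrightarrow> (\<exists>\<beta>>0. \<forall>t\<ge>0. \<forall>s\<ge>0. \<Phi> (t * s) \<le> \<beta> * \<Phi> t * \<Phi> s)"

definition orlicz :: "(real \<Rightarrow> real) \<Rightarrow> 'a measure \<Rightarrow> ('a \<Rightarrow> real) \<Rightarrow> bool" where
  "orlicz \<Phi> M f \<longleftrightarrow> f \<in> borel_measurable M \<and>
     (\<exists>k>0. (\<integral>\<^sup>+x. ennreal (\<Phi> (\<bar>f x\<bar> / k)) \<partial>M) < \<infinity>)"

definition lux :: "(real \<Rightarrow> real) \<Rightarrow> 'a measure \<Rightarrow> ('a \<Rightarrow> real) \<Rightarrow> real" where
  "lux \<Phi> M f = Inf {k. k > 0 \<and> (\<integral>\<^sup>+x. ennreal (\<Phi> (\<bar>f x\<bar> / k)) \<partial>M) \<le> 1}"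

definition orlicz_separable :: "(real \<Rightarrow> real) \<Rightarrow> 'a measure \<Rightarrow> bool" where
  "orlicz_separable \<Phi> M \<longleftrightarrow>
     (\<exists>D. countable D \<and> (\<forall>d\<in>D. orlicz \<Phi> M d) \<and>
        (\<forall>f. orlicz \<Phi> M f \<longrightarrow> (\<forall>e>0. \<exists>d\<in>D. lux \<Phi> M (\<lambda>x. f x - d x) < e)))"

definition dynamical_system :: "'w measure \<Rightarrow> (real^'n \<Rightarrow> 'w \<Rightarrow> 'w) \<Rightarrow> bool" where
  "dynamical_system M T \<longleftrightarrow>
     prob_space M \<and>
     (\<forall>x. T x \<in> measurable M M \<and> bij_betw (T x) (space M) (space M) \<and>
          (\<forall>A\<in>sets M. T x ` A \<in> sets M) \<and> distr M M (T x) = M) \<and>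
     (\<forall>\<omega>\<in>space M. T 0 \<omega> = \<omega>) \<and>
     (\<forall>x1 x2. \<forall>\<omega>\<in>space M. T (x1 + x2) \<omega> = T x1 (T x2 \<omega>)) \<and>
     (\<lambda>(x, \<omega>). T x \<omega>) \<in> measurable (lborel \<Otimes>\<^sub>M M) M"

definition fundamental_seq :: "(nat \<Rightarrow> real) \<Rightarrow> bool" where
  "fundamental_seq eps \<longleftrightarrow> (\<forall>n. 0 < eps n \<and> eps n \<le> 1) \<and> eps \<longlonglongrightarrow> 0"

definition stoch_deriv ::
  "(real \<Rightarrow> real) \<Rightarrow> 'w measure \<Rightarrow> (real^'n \<Rightarrow> 'w \<Rightarrow> 'w) \<Rightarrow> 'n \<Rightarrow> ('w \<Rightarrow> real) \<Rightarrow> ('w \<Rightarrow> real) \<Rightarrow> bool" where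
  "stoch_deriv \<Phi> M T i f g \<longleftrightarrow> orlicz \<Phi> M f \<and> orlicz \<Phi> M g \<and>
     ((\<lambda>t. lux \<Phi> M (\<lambda>\<omega>. (f (T (t *\<^sub>R axis i 1) \<omega>) - f \<omega>) / t - g \<omega>)) \<longlongrightarrow> 0) (at 0)"

inductive iter_sd ::
  "(real \<Rightarrow> real) \<Rightarrow> 'w measure \<Rightarrow> (real^'n \<Rightarrow> 'w \<Rightarrow> 'w) \<Rightarrow> ('w \<Rightarrow> real) \<Rightarrow> ('w \<Rightarrow> real) \<Rightarrow> bool"
  for \<Phi> M T f where
  refl: "iter_sd \<Phi> M T f f"
| step: "iter_sd \<Phi> M T f g \<Longrightarrow> stoch_deriv \<Phi> M T i g h \<Longrightarrow> iter_sd \<Phi> M T f h"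

definition bounded_ae :: "'w measure \<Rightarrow> ('w \<Rightarrow> real) \<Rightarrow> bool" where
  "bounded_ae M f \<longleftrightarrow> f \<in> borel_measurable M \<and> (\<exists>C. AE \<omega> in M. \<bar>f \<omega>\<bar> \<le> C)"

definition smooth_omega ::
  "(real \<Rightarrow> real) \<Rightarrow> 'w measure \<Rightarrow> (real^'n \<Rightarrow> 'w \<Rightarrow> 'w) \<Rightarrow> ('w \<Rightarrow> real) \<Rightarrow> bool" where
  "smooth_omega \<Phi> M T f \<longleftrightarrow>
     (\<forall>g. iter_sd \<Phi> M T f g \<longrightarrow> bounded_ae M g \<and> (\<forall>i::'n. \<exists>h. stoch_deriv \<Phi> M T i g h))"

text \<open>\<open>W^1_\<sharp>L^\<Phi>(\<Omega>)\<close> is identified (isometrically, via \<open>\<overline>D_\<omega>\<close>) with the closure in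
  \<open>L^\<Phi>(\<Omega>)^N\<close> (norm \<open>\<Sum>\<^sub>i \<parallel>\<cdot>\<parallel>\<close>) of the stochastic gradients of \<open>C^\<infinity>(\<Omega>)\<close> functions.
  This predicate says that the vector function \<open>v\<close> is such a gradient \<open>\<overline>D_\<omega> u\<close>.\<close>
definition in_W1sharp_grad ::
  "(real \<Rightarrow> real) \<Rightarrow> 'w measure \<Rightarrow> (real^'n \<Rightarrow> 'w \<Rightarrow> 'w) \<Rightarrow> ('n \<Rightarrow> 'w \<Rightarrow> real) \<Rightarrow> bool" where
  "in_W1sharp_grad \<Phi> M T v \<longleftrightarrow> (\<forall>i. orlicz \<Phi> M (v i)) \<and>
     (\<forall>e>0. \<exists>u Du. smooth_omega \<Phi> M T u \<and> (\<forall>i. stoch_deriv \<Phi> M T i u (Du i)) \<and>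
        (\<Sum>i\<in>UNIV. lux \<Phi> M (\<lambda>\<omega>. v i \<omega> - Du i \<omega>)) < e)"

inductive iter_pd :: "(real^'n \<Rightarrow> real) \<Rightarrow> (real^'n \<Rightarrow> real) \<Rightarrow> bool" for \<phi> where
  refl: "iter_pd \<phi> \<phi>"
| step: "iter_pd \<phi> \<psi> \<Longrightarrow> iter_pd \<phi> (\<lambda>x. frechet_derivative \<psi> (at x) (axis i 1))"

definition smooth_Rn :: "(real^'n \<Rightarrow> real) \<Rightarrow> bool" where
  "smooth_Rn \<phi> \<longleftrightarrow> (\<forall>\<psi>. iter_pd \<phi> \<psi> \<longrightarrow> (\<forall>x. \<psi> differentiable (at x)))"

definition Cc_inf :: "(real^'n) set \<Rightarrow> (real^'n \<Rightarrow> real) \<Rightarrow> bool" where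
  "Cc_inf Q \<phi> \<longleftrightarrow> smooth_Rn \<phi> \<and>
     (\<exists>K. compact K \<and> K \<subseteq> Q \<and> (\<forall>x. x \<notin> K \<longrightarrow> \<phi> x = 0))"

definition partial :: "(real^'n \<Rightarrow> real) \<Rightarrow> 'n \<Rightarrow> real^'n \<Rightarrow> real" where
  "partial \<phi> i x = frechet_derivative \<phi> (at x) (axis i 1)"

abbreviation QM :: "(real^'n) set \<Rightarrow> (real^'n) measure" where
  "QM Q \<equiv> restrict_space lborel Q"

abbreviation QOm :: "(real^'n) set \<Rightarrow> 'w measure \<Rightarrow> ((real^'n) \<times> 'w) measure" where
  "QOm Q M \<equiv> QM Q \<Otimes>\<^sub>M M"

text \<open>Distributional derivative in \<open>x_i\<close>: \<open>\<partial>v/\<partial>x_i = w\<close> in the sense of \<open>L^\<Phi>(\<Omega>)\<close>-valued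
  distributions on \<open>Q\<close>, tested against \<open>\<phi>(x)\<psi>(\<omega>)\<close>, \<open>\<phi>\<in>C_c^\<infinity>(Q)\<close>, \<open>\<psi>\<in>L^\<infinity>(\<Omega>)\<close>.\<close>
definition has_Dx ::
  "(real^'n) set \<Rightarrow> 'w measure \<Rightarrow> ((real^'n) \<times> 'w \<Rightarrow> real) \<Rightarrow> 'n \<Rightarrow> ((real^'n) \<times> 'w \<Rightarrow> real) \<Rightarrow> bool" where
  "has_Dx Q M v i w \<longleftrightarrow>
     (\<forall>\<phi> \<psi>. Cc_inf Q \<phi> \<longrightarrow> bounded_ae M \<psi> \<longrightarrow>
        (\<integral>z. v z * partial \<phi> i (fst z) * \<psi> (snd z) \<partial>QOm Q M) =
        - (\<integral>z. w z * \<phi> (fst z) * \<psi> (snd z) \<partial>QOm Q M))"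

definition W1Dx ::
  "(real \<Rightarrow> real) \<Rightarrow> (real^'n) set \<Rightarrow> 'w measure \<Rightarrow> ((real^'n) \<times> 'w \<Rightarrow> real) \<Rightarrow> ('n \<Rightarrow> (real^'n) \<times> 'w \<Rightarrow> real) \<Rightarrow> bool" where
  "W1Dx \<Phi> Q M v Dv \<longleftrightarrow> orlicz \<Phi> (QOm Q M) v \<and>
     (\<forall>i. orlicz \<Phi> (QOm Q M) (Dv i) \<and> has_Dx Q M v i (Dv i))"

definition invariant ::
  "(real \<Rightarrow> real) \<Rightarrow> 'w measure \<Rightarrow> (real^'n \<Rightarrow> 'w \<Rightarrow> 'w) \<Rightarrow> ('w \<Rightarrow> real) \<Rightarrow> bool" where
  "invariant \<Phi> M T f \<longleftrightarrow> orlicz \<Phi> M f \<and> (\<forall>y. AE \<omega> in M. f (T y \<omega>) = f \<omega>)"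

definition two_scale_test ::
  "(real \<Rightarrow> real) \<Rightarrow> (real^'n) set \<Rightarrow> 'w measure \<Rightarrow> (real^'n \<Rightarrow> 'w \<Rightarrow> 'w) \<Rightarrow> (real^'n \<Rightarrow> 'w \<Rightarrow> real) \<Rightarrow> bool" where
  "two_scale_test \<Phi> Q M T f \<longleftrightarrow>
     (\<exists>(m::nat) \<phi> \<psi>. (\<forall>k<m. Cc_inf Q (\<phi> k) \<and> smooth_omega \<Phi> M T (\<psi> k)) \<and>
        f = (\<lambda>x \<omega>. \<Sum>k<m. \<phi> k x * \<psi> k \<omega>))"

definition two_scale_conv ::
  "(real \<Rightarrow> real) \<Rightarrow> (real^'n) set \<Rightarrow> 'w measure \<Rightarrow> (real^'n \<Rightarrow> 'w \<Rightarrow> 'w) \<Rightarrow>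
   (nat \<Rightarrow> real) \<Rightarrow> (nat \<Rightarrow> (real^'n) \<times> 'w \<Rightarrow> real) \<Rightarrow> ((real^'n) \<times> 'w \<Rightarrow> real) \<Rightarrow> bool" where
  "two_scale_conv \<Phi> Q M T eps u u0 \<longleftrightarrow>
     (\<forall>f. two_scale_test \<Phi> Q M T f \<longrightarrow>
        (\<lambda>n. \<integral>z. u n z * f (fst z) (T (inverse (eps n) *\<^sub>R fst z) (snd z)) \<partial>QOm Q M)
          \<longlonglongrightarrow> (\<integral>z. u0 z * f (fst z) (snd z) \<partial>QOm Q M))"

end

theory Submission
  imports Defs
begin

text \<open>
  The shear \<open>(x, \<omega>) \<mapsto> (x, T(x/\<epsilon>)\<omega>)\<close> preserves the measure on \<open>Q \<times> \<Omega>\<close>, so stochastic two-scale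
  convergence of \<open>u\<^sub>\<epsilon>\<close> is weak \<open>L\<^sup>1\<close> convergence of the sheared functions; the latter are uniformly
  integrable because \<open>\<Phi>\<close> is superlinear, and the Dunford--Pettis theorem provides limits \<open>u\<^sub>0\<close> of
  \<open>u\<^sub>\<epsilon>\<close> and \<open>W\<close> of \<open>D\<^sub>x u\<^sub>\<epsilon>\<close>.

  Testing the derivative with \<open>\<phi>(x) (\<rho> * h)(T(x/\<epsilon>)\<omega>)\<close>, where \<open>\<rho> * h\<close> is the mollification of \<open>h\<close> along
  the flow, produces a term of order \<open>1/\<epsilon>\<close>. Its vanishing in the limit makes \<open>u\<^sub>0\<close> invariant, the symmetry
  of second derivatives makes \<open>W\<close> curl-free along the flow, and invariant \<open>h\<close> identify \<open>D\<^sub>x u\<^sub>0\<close>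
  with the conditional expectation of \<open>W\<close> on the invariant sets.

  The remainder \<open>g = W - D\<^sub>x u\<^sub>0\<close> is curl-free without invariant part. The difference of two mollifiers of small
  and large radius is a divergence, so by curl-freeness the difference of the two mollifications of \<open>g\<close>
  is a stochastic gradient. It tends to \<open>g\<close>, since the large-radius averages vanish in the limit by the mean
  ergodic theorem. The \<open>\<Delta>'\<close>-condition on the conjugate is dual to \<open>\<Phi> x * \<Phi> y \<le> \<Phi> (b * x * y)\<close>, which
  bounds \<open>\<Phi>\<close> of the norm of a section by the modular of the section.
\<close>

section \<open>Smooth functions of compact support\<close>

text \<open>All limits are taken weakly against bounded functions. This loses nothing, because the
  modular is weakly lower semicontinuous; the condition Delta_2 on \<Phi> then gives the limits
  finite modular at every scale, so that truncations are dense in modular and bounded functions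
  suffice for the strong statements. A gradient has to be approximated for almost every x
  separately, yet nothing is chosen depending on x. The flow acts on Q x Omega through the second
  coordinate alone, so the approximating kernels are chosen once for the product, and smallness of
  the modulars there descends to almost every section by Fatou's lemma; only the index used at x
  depends on x. The null sets cause one more obstacle: on the product, invariance under y holds
  outside a null set that depends on y. Fubini gives it on almost every section for almost every y,
  and the group law extends it to every y. For the same reason invariant sets are taken modulo null
  sets throughout.\<close>

lemma smooth_Rn_coinduct:
  assumes F: "\<And>f. f \<in> F \<Longrightarrow> (\<forall>x. f differentiable (at x)) \<and> (\<forall>i. partial f i \<in> F)" and "f \<in> F"
  shows "smooth_Rn f"
proof -
  \<comment> \<open>All iterated partials stay in \<open>F\<close>, so smoothness is proved by
    exhibiting any set of differentiable functions that is closed under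
    \<open>partial\<close>.\<close>
  have "\<psi> \<in> F" if "iter_pd f \<psi>" for \<psi>
    using that
  proof induction
    case refl then show ?case by fact
  next
    case (step \<psi> i)
    then show ?case using F[of \<psi>] by (auto simp: partial_def[abs_def])
  qed
  then show ?thesis unfolding smooth_Rn_def using F by blast
qed

lemma smooth_Rn_differentiable: "smooth_Rn f \<Longrightarrow> f differentiable (at x)"
  unfolding smooth_Rn_def by (blast intro: iter_pd.refl)

lemma smooth_Rn_partial: 
  assumes "smooth_Rn f" shows "smooth_Rn (partial f i)"
proof -
  have "iter_pd f \<psi>" if "iter_pd (partial f i) \<psi>" for \<psi>
    using that
  proof induction
    case refl
    then show ?case using iter_pd.step[OF iter_pd.refl, of f i] by (simp add: partial_def[abs_def])
  next
    case (step \<psi> i)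
    then show ?case by (blast intro: iter_pd.step)
  qed
  then show ?thesis using assms unfolding smooth_Rn_def by blast
qed

lemma partial_eqI: "(f has_derivative f') (at x) \<Longrightarrow> partial f i x = f' (axis i 1)"
  unfolding partial_def by (metis frechet_derivative_at)

lemma has_derivative_frechet: "f differentiable (at x) \<Longrightarrow> (f has_derivative frechet_derivative f (at x)) (at x)"
  by (simp add: frechet_derivative_works)

lemma partial_const: "partial (\<lambda>x. c) i = (\<lambda>x. 0)"
  by (rule ext) (rule partial_eqI, rule has_derivative_const)

lemma partial_add:
  assumes "f differentiable (at x)" "g differentiable (at x)"
  shows "partial (\<lambda>x. f x + g x) i x = partial f i x + partial g i x"
  unfolding partial_def
  using partial_eqI[OF has_derivative_add[OF assms[THEN has_derivative_frechet]], of i]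
  by (simp add: partial_def)

lemma partial_mult:
  assumes "f differentiable (at x)" "g differentiable (at x)"
  shows "partial (\<lambda>x. f x * g x) i x = f x * partial g i x + partial f i x * g x"
  using partial_eqI[OF has_derivative_mult[OF assms[THEN has_derivative_frechet]], of i]
  by (simp add: partial_def)

text \<open>Partials of sums and products leave a set of generators but stay in the algebra that it
  generates. With this algebra as an inductive predicate, smoothness becomes a question about the
  partials of the generators alone.\<close>

inductive gen_alg :: "((real^'n \<Rightarrow> real) \<Rightarrow> bool) \<Rightarrow> (real^'n \<Rightarrow> real) \<Rightarrow> bool" for B where
  base: "B f \<Longrightarrow> gen_alg B f"
| const: "gen_alg B (\<lambda>x. c)"
| add: "gen_alg B f \<Longrightarrow> gen_alg B g \<Longrightarrow> gen_alg B (\<lambda>x. f x + g x)"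
| mult: "gen_alg B f \<Longrightarrow> gen_alg B g \<Longrightarrow> gen_alg B (\<lambda>x. f x * g x)"

lemma smooth_Rn_gen_alg:
  assumes B: "\<And>f. B f \<Longrightarrow> (\<forall>x. f differentiable (at x)) \<and> (\<forall>i. gen_alg B (partial f i))" and "gen_alg B f"
  shows "smooth_Rn f"
proof (rule smooth_Rn_coinduct[where F="Collect (gen_alg B)"])
  fix f assume "f \<in> Collect (gen_alg B)"
  then have "gen_alg B f" by simp
  then show "(\<forall>x. f differentiable (at x)) \<and> (\<forall>i. partial f i \<in> Collect (gen_alg B))"
  proof induction
    case (base f) then show ?case using B by auto
  next
    case (const c) then show ?case by (simp add: partial_const gen_alg.const)
  next
    case (add f g)
    then have "partial (\<lambda>x. f x + g x) i = (\<lambda>x. partial f i x + partial g i x)" for i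
      by (auto simp: partial_add)
    then show ?case using add by (auto intro: gen_alg.add)
  next
    case (mult f g)
    then have "partial (\<lambda>x. f x * g x) i = (\<lambda>x. f x * partial g i x + partial f i x * g x)" for i
      by (auto simp: partial_mult)
    moreover have "gen_alg B (\<lambda>x. f x * partial g i x + partial f i x * g x)" for i
      using mult by (intro gen_alg.add gen_alg.mult) auto
    ultimately show ?case using mult by auto
  qed
qed (use assms in simp)

lemma gen_alg_smooth: "gen_alg smooth_Rn f \<Longrightarrow> smooth_Rn f"
  by (rule smooth_Rn_gen_alg) (auto intro: smooth_Rn_differentiable smooth_Rn_partial gen_alg.base)

lemma smooth_Rn_const: "smooth_Rn (\<lambda>x. c)"
  and smooth_Rn_add: "smooth_Rn f \<Longrightarrow> smooth_Rn g \<Longrightarrow> smooth_Rn (\<lambda>x. f x + g x)"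
  and smooth_Rn_mult: "smooth_Rn f \<Longrightarrow> smooth_Rn g \<Longrightarrow> smooth_Rn (\<lambda>x. f x * g x)"
  by (rule gen_alg_smooth, blast intro: gen_alg.intros)+

lemma smooth_Rn_prod:
  "(\<And>i. i \<in> I \<Longrightarrow> smooth_Rn (f i)) \<Longrightarrow> smooth_Rn (\<lambda>x. \<Prod>i\<in>I. f i x)"
  by (induction I rule: infinite_finite_induct) (auto intro: smooth_Rn_const smooth_Rn_mult)

lemma smooth_RnI_partial:
  assumes "\<And>x. f differentiable (at x)" "\<And>i. smooth_Rn (partial f i)"
  shows "smooth_Rn f"
proof (rule smooth_Rn_coinduct[where F="insert f (Collect smooth_Rn)"])
qed (use assms in \<open>auto intro: smooth_Rn_differentiable smooth_Rn_partial\<close>)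

lemma differentiable_affine_comp:
  fixes f :: "real^'n \<Rightarrow> real"
  assumes "f differentiable (at (a + c *\<^sub>R x))"
  shows "((\<lambda>x. f (a + c *\<^sub>R x)) has_derivative (\<lambda>h. frechet_derivative f (at (a + c *\<^sub>R x)) (c *\<^sub>R h))) (at x)"
proof -
  have "((\<lambda>x. a + c *\<^sub>R x) has_derivative (\<lambda>h. c *\<^sub>R h)) (at x)"
    by (auto intro!: derivative_eq_intros)
  from has_derivative_compose[OF this has_derivative_frechet[OF assms]] show ?thesis .
qed

lemma partial_affine:
  fixes f :: "real^'n \<Rightarrow> real"
  assumes "f differentiable (at (a + c *\<^sub>R x))"
  shows "partial (\<lambda>x. f (a + c *\<^sub>R x)) i x = c * partial f i (a + c *\<^sub>R x)"
proof -
  have l: "linear (frechet_derivative f (at (a + c *\<^sub>R x)))"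
    using assms by (rule linear_frechet_derivative)
  show ?thesis using partial_eqI[OF differentiable_affine_comp[OF assms], of i]
    unfolding linear_cmul[OF l] by (simp add: partial_def)
qed

lemma smooth_Rn_affine:
  fixes f :: "real^'n \<Rightarrow> real"
  assumes "smooth_Rn f"
  shows "smooth_Rn (\<lambda>x. f (a + c *\<^sub>R x))"
proof -
  define B where "B g \<longleftrightarrow> (\<exists>h. smooth_Rn h \<and> g = (\<lambda>x. h (a + c *\<^sub>R x)))" for g
  show ?thesis
  proof (rule smooth_Rn_gen_alg[of B])
    fix g assume "B g"
    then obtain h where h: "smooth_Rn h" "g = (\<lambda>x. h (a + c *\<^sub>R x))" by (auto simp: B_def)
    have "partial g i = (\<lambda>x. c * partial h i (a + c *\<^sub>R x))" for i
      by (auto simp: h smooth_Rn_differentiable partial_affine)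
    moreover have "gen_alg B (\<lambda>x. c * partial h i (a + c *\<^sub>R x))" for i
      by (rule gen_alg.mult[OF gen_alg.const gen_alg.base])
         (use h in \<open>auto simp: B_def intro: smooth_Rn_partial\<close>)
    moreover have "g differentiable (at x)" for x
      unfolding h using differentiable_affine_comp[OF smooth_Rn_differentiable[OF h(1)]]
      by (auto simp: differentiable_def)
    ultimately show "(\<forall>x. g differentiable (at x)) \<and> (\<forall>i. gen_alg B (partial g i))" by simp
  qed (use assms in \<open>auto simp: B_def intro!: gen_alg.base\<close>)
qed

text \<open>Restriction to a coordinate line turns \<open>partial\<close> into a derivative in one
  real variable, where the mean value theorem and uniqueness of derivatives are available.\<close>

lemma partial_line:
  fixes f :: "real^'n \<Rightarrow> real"
  assumes "f differentiable (at (x + t *\<^sub>R axis i 1))"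
  shows "((\<lambda>t. f (x + t *\<^sub>R axis i 1)) has_real_derivative partial f i (x + t *\<^sub>R axis i 1)) (at t)"
proof -
  let ?p = "x + t *\<^sub>R axis i 1"
  have "((\<lambda>t. x + t *\<^sub>R axis i 1) has_derivative (\<lambda>h. h *\<^sub>R axis i 1)) (at t)"
    by (auto intro!: derivative_eq_intros)
  from has_derivative_compose[OF this has_derivative_frechet[OF assms]]
  have "((\<lambda>t. f (x + t *\<^sub>R axis i 1)) has_derivative (\<lambda>h. frechet_derivative f (at ?p) (h *\<^sub>R axis i 1))) (at t)" .
  moreover have "linear (frechet_derivative f (at ?p))" using assms by (rule linear_frechet_derivative)
  moreover have "(\<lambda>h. h * partial f i ?p) = (*) (partial f i ?p)" by auto
  ultimately show ?thesis by (simp add: has_field_derivative_def linear_cmul partial_def)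
qed

text \<open>A whole sequence \<open>H\<close> is treated at once, because the derivative of one
  member may be a combination of other members; it only has to lie in the algebra generated by all
  of them.\<close>

lemma smooth_Rn_coord:
  fixes H :: "nat \<Rightarrow> real \<Rightarrow> real"
  assumes d: "\<And>n t. (H n has_real_derivative H' n t) (at t)"
    and H': "\<And>n. gen_alg (\<lambda>f. \<exists>n. f = (\<lambda>x. H n (c * x $ j + d))) (\<lambda>x::real^'n. H' n (c * x $ j + d))"
  shows "smooth_Rn (\<lambda>x::real^'n. H n (c * x $ j + d))"
proof -
  define B where "B f \<longleftrightarrow> (\<exists>n. f = (\<lambda>x::real^'n. H n (c * x $ j + d)))" for f
  have D: "((\<lambda>x::real^'n. H n (c * x $ j + d)) has_derivative (\<lambda>h. H' n (c * x $ j + d) * (c * h $ j))) (at x)" for n x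
  proof -
    have "((\<lambda>x::real^'n. c * x $ j + d) has_derivative (\<lambda>h. c * h $ j)) (at x)"
      by (auto intro!: derivative_eq_intros bounded_linear_imp_has_derivative bounded_linear_vec_nth)
    from has_derivative_compose[OF this] d[of n, unfolded has_field_derivative_def]
    show ?thesis by blast
  qed
  show ?thesis
  proof (rule smooth_Rn_gen_alg[of B])
    fix g assume "B g"
    then obtain n where h: "g = (\<lambda>x. H n (c * x $ j + d))" by (auto simp: B_def)
    have "partial g i = (\<lambda>x. H' n (c * x $ j + d) * (c * axis i 1 $ j))" for i
      unfolding h by (rule ext) (rule partial_eqI[OF D])
    then have "gen_alg B (partial g i)" for i
      using gen_alg.mult[OF H'[of n] gen_alg.const] by (simp add: B_def[abs_def])
    then show "(\<forall>x. g differentiable (at x)) \<and> (\<forall>i. gen_alg B (partial g i))"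
      unfolding h using D by (auto simp: differentiable_def)
  qed (auto simp: B_def intro!: gen_alg.base)
qed

section \<open>Cutoff functions that are flat at the origin\<close>

definition exp_cut :: "nat \<Rightarrow> real \<Rightarrow> real" where
  "exp_cut n t = (if t > 0 then (1/t)^n * exp (-(1/t)) else 0)"

text \<open>The powers of 1/t are carried along so that the family is closed under differentiation
  up to linear combinations; \<open>n = 0\<close> is the classical exp(-1/t). Away from 0 this is
  the product rule. At 0 the right difference quotient is (1/t)^(n+1) exp(-1/t), where the
  exponential beats the power.\<close>

lemma exp_cut_deriv:
  "(exp_cut n has_real_derivative (exp_cut (n + 2) t - real n * exp_cut (n + 1) t)) (at t)"
proof (cases "t = 0")
  case False
  show ?thesis
  proof (cases "t > 0")
    case True
    have i: "((\<lambda>t. 1/t) has_real_derivative - ((1/t)^2)) (at t)"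
      using True by (auto intro!: derivative_eq_intros simp: power2_eq_square)
    have e: "((\<lambda>t. exp (-(1/t))) has_real_derivative exp (-(1/t)) * (1/t)^2) (at t)"
      using DERIV_chain2[OF DERIV_exp DERIV_minus[OF i]] by simp
    have "((\<lambda>t. (1/t)^n * exp (-(1/t))) has_real_derivative (exp_cut (n + 2) t - real n * exp_cut (n + 1) t)) (at t)"
      by (rule DERIV_cong[OF DERIV_mult[OF DERIV_power[OF i, of n] e]])
         (use True in \<open>cases n; simp add: exp_cut_def algebra_simps power2_eq_square\<close>)
    moreover have "eventually (\<lambda>s. s > 0) (nhds t)" 
      using True eventually_nhds_in_open[of "{0<..}" t] by auto
    then have "eventually (\<lambda>s. exp_cut n s = (1/s)^n * exp (-(1/s))) (nhds t)"
      by eventually_elim (simp add: exp_cut_def)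
    ultimately show ?thesis by (subst DERIV_cong_ev[OF HOL.refl _ HOL.refl])
  next
    case f: False
    with False have t: "t < 0" by simp
    have "((\<lambda>t. 0) has_real_derivative (exp_cut (n + 2) t - real n * exp_cut (n + 1) t)) (at t)"
      using t by (auto simp: exp_cut_def)
    moreover have "eventually (\<lambda>s. s < 0) (nhds t)" 
      using t eventually_nhds_in_open[of "{..<0}" t] by auto
    then have "eventually (\<lambda>s. exp_cut n s = 0) (nhds t)"
      by eventually_elim (simp add: exp_cut_def)
    ultimately show ?thesis by (subst DERIV_cong_ev[OF HOL.refl _ HOL.refl])
  qed
next
  case True
  have "((\<lambda>s::real. s ^ Suc n / exp s) \<longlongrightarrow> 0) at_top"
    by (rule tendsto_power_div_exp_0)
  then have "((\<lambda>t::real. (inverse t) ^ Suc n / exp (inverse t)) \<longlongrightarrow> 0) (at_right 0)"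
    by (rule filterlim_compose) (rule filterlim_inverse_at_top_right)
  then have R: "((\<lambda>h. exp_cut n h / h) \<longlongrightarrow> 0) (at_right 0)"
    by (rule filterlim_cong[THEN iffD1, OF HOL.refl HOL.refl, rotated])
       (auto simp: eventually_at_filter exp_cut_def exp_minus field_simps)
  have L: "((\<lambda>h. exp_cut n h / h) \<longlongrightarrow> 0) (at_left 0)"
    by (rule tendsto_eventually) (auto simp: eventually_at_filter exp_cut_def)
  have "((\<lambda>h. exp_cut n h / h) \<longlongrightarrow> 0) (at 0)"
    using L R by (simp add: filterlim_split_at)
  then show ?thesis using True by (simp add: DERIV_def exp_cut_def[of _ 0])
qed

lemma smooth_Rn_exp_cut: "smooth_Rn (\<lambda>x::real^'n. exp_cut n (c * x $ j + d))"
proof (rule smooth_Rn_coord[OF exp_cut_deriv])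
  fix n
  let ?B = "\<lambda>f. \<exists>n. f = (\<lambda>x::real^'n. exp_cut n (c * x $ j + d))"
  have "gen_alg ?B (\<lambda>x. exp_cut (n + 2) (c * x $ j + d) + (- real n) * exp_cut (n + 1) (c * x $ j + d))"
    by (intro gen_alg.add gen_alg.mult gen_alg.const; rule gen_alg.base; blast)
  then show "gen_alg ?B (\<lambda>x. exp_cut (n + 2) (c * x $ j + d) - real n * exp_cut (n + 1) (c * x $ j + d))"
    by simp
qed

section \<open>Test functions: closure properties and bounds\<close>

lemma smooth_Rn_continuous: "smooth_Rn f \<Longrightarrow> continuous_on UNIV f"
  by (meson continuous_at_imp_continuous_on differentiable_imp_continuous_within smooth_Rn_differentiable)

lemma smooth_Rn_borel[measurable_dest]: "smooth_Rn f \<Longrightarrow> f \<in> borel_measurable borel"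
  by (intro borel_measurable_continuous_onI smooth_Rn_continuous)

lemma Cc_inf_smooth: "Cc_inf Q f \<Longrightarrow> smooth_Rn f"
  by (simp add: Cc_inf_def)

lemma Cc_inf_borel[measurable_dest]: "Cc_inf Q f \<Longrightarrow> f \<in> borel_measurable borel"
  by (intro smooth_Rn_borel Cc_inf_smooth)

lemma Cc_inf_mono: "Cc_inf Q f \<Longrightarrow> Q \<subseteq> Q' \<Longrightarrow> Cc_inf Q' f"
  unfolding Cc_inf_def by blast

lemma Cc_inf_mult: "Cc_inf Q f \<Longrightarrow> smooth_Rn g \<Longrightarrow> Cc_inf Q (\<lambda>x. f x * g x)"
  unfolding Cc_inf_def by (auto intro: smooth_Rn_mult)

lemma Cc_inf_add: 
  assumes "Cc_inf Q f" "Cc_inf Q g" shows "Cc_inf Q (\<lambda>x. f x + g x)"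
proof -
  obtain K L where "compact K" "K \<subseteq> Q" "\<forall>x. x \<notin> K \<longrightarrow> f x = 0" "compact L" "L \<subseteq> Q" "\<forall>x. x \<notin> L \<longrightarrow> g x = 0"
    using assms unfolding Cc_inf_def by blast
  then show ?thesis using assms unfolding Cc_inf_def
    by (auto intro!: smooth_Rn_add exI[of _ "K \<union> L"])
qed

lemma Cc_inf_partial: 
  assumes "Cc_inf Q f" shows "Cc_inf Q (partial f i)"
proof -
  obtain K where K: "compact K" "K \<subseteq> Q" "\<And>x. x \<notin> K \<Longrightarrow> f x = 0" and s: "smooth_Rn f"
    using assms unfolding Cc_inf_def by blast
  have "partial f i x = 0" if "x \<notin> K" for x
  proof -
    have "open (- K)" using K(1) by (simp add: compact_imp_closed open_Compl)
    have "(f has_derivative (\<lambda>h. 0)) (at x)"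
      by (rule has_derivative_transform_within_open[OF has_derivative_const \<open>open (- K)\<close>])
         (use that K in auto)
    then show ?thesis using partial_eqI by fastforce
  qed
  then show ?thesis using K s unfolding Cc_inf_def by (auto intro: smooth_Rn_partial)
qed

lemma Cc_inf_supp_ball: 
  assumes "Cc_inf Q f" obtains r where "r > 0" "\<And>x. norm x > r \<Longrightarrow> f x = 0"
proof -
  obtain K where K: "compact K" "\<And>x. x \<notin> K \<Longrightarrow> f x = 0"
    using assms unfolding Cc_inf_def by blast
  obtain r where "r > 0" "\<And>x. x \<in> K \<Longrightarrow> norm x \<le> r"
    using compact_imp_bounded[OF K(1)] unfolding bounded_pos by blast
  then show ?thesis using K by (intro that[of r]) force+
qed

lemma Cc_inf_bounded:
  assumes "Cc_inf Q f" obtains C where "C > 0" "\<And>x. \<bar>f x\<bar> \<le> C"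
proof -
  obtain K where K: "compact K" "\<And>x. x \<notin> K \<Longrightarrow> f x = 0" and s: "smooth_Rn f"
    using assms unfolding Cc_inf_def by blast
  have "bounded (f ` K)"
    by (intro compact_imp_bounded compact_continuous_image K continuous_on_subset[OF smooth_Rn_continuous[OF s]]) auto
  then obtain C where "C > 0" "\<And>x. x \<in> K \<Longrightarrow> \<bar>f x\<bar> \<le> C" unfolding bounded_pos by auto
  then show ?thesis using K by (intro that[of C]) (force, metis abs_zero less_imp_le)
qed

lemma integrable_cball_bound:
  fixes f :: "'a::euclidean_space \<Rightarrow> real"
  assumes "f \<in> borel_measurable borel" "\<And>x. \<bar>f x\<bar> \<le> C * indicator (cball 0 r) x"
  shows "integrable lborel f"
proof (rule Bochner_Integration.integrable_bound)
  have "integrable lborel (indicat_real (cball (0::'a) r))"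
    using emeasure_lborel_cball_finite[of "0::'a" r] by (auto simp: integrable_indicator_iff)
  then show "integrable lborel (\<lambda>x. C * indicator (cball (0::'a) r) x)" by simp
qed (use assms order_trans[OF assms(2) abs_ge_self] in auto)

lemma Cc_inf_bound_cball:
  assumes "Cc_inf Q f" obtains C r where "C > 0" "r > 0" "\<And>x. \<bar>f x\<bar> \<le> C * indicator (cball 0 r) x"
proof -
  obtain r where r: "r > 0" "\<And>x. norm x > r \<Longrightarrow> f x = 0" using Cc_inf_supp_ball[OF assms] by blast
  obtain C where C: "C > 0" "\<And>x. \<bar>f x\<bar> \<le> C" using Cc_inf_bounded[OF assms] by blast
  show ?thesis using r C by (intro that[of C r]) (auto simp: indicator_def not_le)
qed

lemma Cc_inf_integrable:
  assumes "Cc_inf Q f" shows "integrable lborel f"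
proof -
  obtain C r where "\<And>x. \<bar>f x\<bar> \<le> C * indicator (cball 0 r) x" using Cc_inf_bound_cball[OF assms] by blast
  then show ?thesis using Cc_inf_borel[OF assms] by (rule integrable_cball_bound[rotated])
qed

lemma Cc_inf_affine:
  assumes "Cc_inf UNIV f" "c \<noteq> 0" shows "Cc_inf UNIV (\<lambda>x. f (a + c *\<^sub>R x))"
proof -
  obtain K where K: "compact K" "\<And>x. x \<notin> K \<Longrightarrow> f x = 0" and s: "smooth_Rn f"
    using assms unfolding Cc_inf_def by blast
  have "compact ((\<lambda>x. (1/c) *\<^sub>R x - (1/c) *\<^sub>R a) ` K)"
    by (intro compact_continuous_image K continuous_intros)
  moreover have "x \<in> (\<lambda>x. (1/c) *\<^sub>R x - (1/c) *\<^sub>R a) ` K" if "a + c *\<^sub>R x \<in> K" for x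
    using that assms(2) by (intro image_eqI[OF _ that]) (simp add: scaleR_right_distrib)
  ultimately show ?thesis using K(2) s unfolding Cc_inf_def 
    by (blast intro: smooth_Rn_affine)
qed

section \<open>Translates and difference quotients in L1\<close>

lemma integral_cball_tendsto_0:
  fixes F :: "'b::real_normed_vector \<Rightarrow> 'a::euclidean_space \<Rightarrow> real"
  assumes m: "\<And>t. F t \<in> borel_measurable borel"
    and b: "\<And>t y. norm t \<le> 1 \<Longrightarrow> t \<noteq> 0 \<Longrightarrow> \<bar>F t y\<bar> \<le> C * indicator (cball 0 r) y"
    and lim: "\<And>y. ((\<lambda>t. F t y) \<longlongrightarrow> 0) (at 0)"
  shows "((\<lambda>t. \<integral>y. F t y \<partial>lborel) \<longlongrightarrow> 0) (at 0)"
  unfolding tendsto_at_iff_sequentially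
proof (intro allI impI)
  fix X :: "nat \<Rightarrow> 'b" assume X: "\<forall>i. X i \<in> UNIV - {0}" "X \<longlonglongrightarrow> 0"
  \<comment> \<open>The bound is available only for \<open>norm t \<le> 1\<close>; the finitely many
    other members of the sequence are replaced by 0 to make dominated convergence
    applicable.\<close>
  define G where "G n y = (if norm (X n) \<le> 1 then F (X n) y else 0)" for n y
  have ev: "eventually (\<lambda>n. norm (X n) \<le> 1) sequentially"
    using tendstoD[OF X(2) zero_less_one] by eventually_elim auto
  have C: "0 \<le> C * indicator (cball 0 r) y" for y :: 'a
  proof -
    obtain n where "norm (X n) \<le> 1" using ev by (auto simp: eventually_sequentially)
    then show ?thesis using b[of "X n" y] X by fastforce
  qed
  have "(\<lambda>n. \<integral>y. G n y \<partial>lborel) \<longlonglongrightarrow> (\<integral>y. 0 \<partial>(lborel :: 'a measure))"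
  proof (rule integral_dominated_convergence[where w="\<lambda>y. C * indicator (cball 0 r) y"])
    show "integrable lborel (\<lambda>y::'a. C * indicator (cball 0 r) y)"
      by (rule integrable_cball_bound[where C=C and r=r])
         (use C in \<open>auto intro!: borel_measurable_times borel_measurable_indicator\<close>)
    show "AE y in lborel. (\<lambda>n. G n y) \<longlonglongrightarrow> 0"
    proof (rule AE_I2)
      fix y
      have "(\<lambda>n. F (X n) y) \<longlonglongrightarrow> 0"
        using lim[of y] X unfolding tendsto_at_iff_sequentially by (auto simp: o_def)
      moreover have "eventually (\<lambda>n. F (X n) y = G n y) sequentially"
        using ev by eventually_elim (simp add: G_def)
      ultimately show "(\<lambda>n. G n y) \<longlonglongrightarrow> 0" by (rule Lim_transform_eventually)
    qed
    show "AE y in lborel. norm (G n y) \<le> C * indicator (cball 0 r) y" for n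
      using X b[of "X n"] C by (intro AE_I2) (auto simp: G_def)
    show "G n \<in> borel_measurable lborel" for n using m[of "X n"] by (auto simp: G_def[abs_def])
  qed simp
  moreover have "eventually (\<lambda>n. (\<integral>y. G n y \<partial>lborel) = ((\<lambda>t. \<integral>y. F t y \<partial>lborel) \<circ> X) n) sequentially"
    using ev by eventually_elim (simp add: G_def)
  ultimately show "((\<lambda>t. \<integral>y. F t y \<partial>lborel) \<circ> X) \<longlonglongrightarrow> 0"
    by (simp add: Lim_transform_eventually)
qed

lemma Cc_inf_translation_L1:
  fixes \<rho> :: "real^'n \<Rightarrow> real"
  assumes \<rho>: "Cc_inf UNIV \<rho>"
  shows "((\<lambda>h. \<integral>y. \<bar>\<rho> (y - h) - \<rho> y\<bar> \<partial>lborel) \<longlongrightarrow> 0) (at 0)"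
proof -
  obtain C r where b: "C > 0" "r > 0" "\<And>x. \<bar>\<rho> x\<bar> \<le> C * indicator (cball 0 r) x"
    using Cc_inf_bound_cball[OF \<rho>] by blast
  note [measurable] = Cc_inf_borel[OF \<rho>]
  show ?thesis
  proof (rule integral_cball_tendsto_0[where C="2*C" and r="r+1"])
    fix t y :: "real^'n" assume t: "norm t \<le> 1"
    show "\<bar>\<bar>\<rho> (y - t) - \<rho> y\<bar>\<bar> \<le> 2 * C * indicator (cball 0 (r+1)) y"
    proof (cases "norm y \<le> r + 1")
      case True
      have "\<bar>\<rho> x\<bar> \<le> C" for x using b(3)[of x] b(1) by (cases "norm x \<le> r") auto
      from this[of "y - t"] this[of y] show ?thesis using True by auto
    next
      case False
      then have "norm (y - t) > r" using t norm_triangle_ineq2[of y t] by linarith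
      then show ?thesis using False b(3)[of "y - t"] b(3)[of y] by (auto simp: indicator_def)
    qed
  next
    fix y
    have "isCont \<rho> y" using smooth_Rn_continuous[OF Cc_inf_smooth[OF \<rho>]] continuous_on_eq_continuous_at by blast
    then have "((\<lambda>h. \<rho> (y - h)) \<longlongrightarrow> \<rho> (y - 0)) (at 0)"
      by (intro isCont_tendsto_compose[of _ \<rho>] tendsto_intros) auto
    then have "((\<lambda>h. \<bar>\<rho> (y - h) - \<rho> y\<bar>) \<longlongrightarrow> \<bar>\<rho> (y - 0) - \<rho> y\<bar>) (at 0)"
      by (intro tendsto_intros)
    then show "((\<lambda>h. \<bar>\<rho> (y - h) - \<rho> y\<bar>) \<longlongrightarrow> 0) (at 0)" by simp
  qed simp
qed

text \<open>The quotient is that of a translation by -t, hence tends to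
  \<open>- partial \<rho> i\<close>. This is the direction in which a kernel moves when the base
  point moves along a flow, and it is the origin of the minus signs in the stochastic derivatives of
  mollifications.\<close>

lemma Cc_inf_diff_quotient_L1:
  fixes \<rho> :: "real^'n \<Rightarrow> real"
  assumes \<rho>: "Cc_inf UNIV \<rho>"
  shows "((\<lambda>t. \<integral>y. \<bar>(\<rho> (y - t *\<^sub>R axis i 1) - \<rho> y) / t + partial \<rho> i y\<bar> \<partial>lborel) \<longlongrightarrow> 0) (at 0)"
proof -
  obtain r where r: "r > 0" "\<And>x. norm x > r \<Longrightarrow> \<rho> x = 0" using Cc_inf_supp_ball[OF \<rho>] by blast
  obtain s where s: "s > 0" "\<And>x. norm x > s \<Longrightarrow> partial \<rho> i x = 0"
    using Cc_inf_supp_ball[OF Cc_inf_partial[OF \<rho>]] by blast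
  obtain C where C: "C > 0" "\<And>x. \<bar>partial \<rho> i x\<bar> \<le> C" using Cc_inf_bounded[OF Cc_inf_partial[OF \<rho>]] by blast
  note [measurable] = Cc_inf_borel[OF \<rho>] Cc_inf_borel[OF Cc_inf_partial[OF \<rho>]]
  note d = smooth_Rn_differentiable[OF Cc_inf_smooth[OF \<rho>]]
  \<comment> \<open>By the mean value inequality the quotient obeys the bound \<open>C\<close> of
    the partial itself, so \<open>2*C\<close> dominates the sum. The radius \<open>r+s+1\<close>
    covers both supports and all shifts of length at most 1.\<close>
  have lip: "\<bar>\<rho> (y - t *\<^sub>R axis i 1) - \<rho> y\<bar> \<le> C * \<bar>t\<bar>" for t y
    using field_differentiable_bound[of UNIV "\<lambda>t. \<rho> (y + t *\<^sub>R axis i 1)" "\<lambda>t. partial \<rho> i (y + t *\<^sub>R axis i 1)" C "- t" 0]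
      partial_line[OF d] C by simp
  show ?thesis
  proof (rule integral_cball_tendsto_0[where C="2*C" and r="r+s+1"])
    fix t :: real and y :: "real^'n" assume t: "norm t \<le> 1" "t \<noteq> 0"
    show "\<bar>\<bar>(\<rho> (y - t *\<^sub>R axis i 1) - \<rho> y) / t + partial \<rho> i y\<bar>\<bar> \<le> 2 * C * indicator (cball 0 (r+s+1)) y"
    proof (cases "norm y \<le> r + s + 1")
      case True
      have "\<bar>(\<rho> (y - t *\<^sub>R axis i 1) - \<rho> y) / t\<bar> \<le> C"
        using lip[of y t] t by (simp add: divide_simps)
      with C(2)[of y] have "\<bar>(\<rho> (y - t *\<^sub>R axis i 1) - \<rho> y) / t + partial \<rho> i y\<bar> \<le> 2 * C" by linarith
      then show ?thesis using True by auto
    next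
      case False
      have "norm (t *\<^sub>R axis i 1 :: real^'n) \<le> 1" using t by simp
      then have "norm (y - t *\<^sub>R axis i 1) > r" 
        using False s(1) norm_triangle_ineq2[of y "t *\<^sub>R axis i 1"] by linarith
      then show ?thesis using False r s by (auto simp: indicator_def)
    qed
  next
    fix y
    have "((\<lambda>t. \<rho> (y + t *\<^sub>R axis i 1)) has_real_derivative partial \<rho> i y) (at (- 0))"
      using partial_line[OF d, where x=y and t=0] by simp
    then have "((\<lambda>t. \<rho> (y + (- t) *\<^sub>R axis i 1)) has_real_derivative - partial \<rho> i y) (at 0)"
      using DERIV_mirror[of "\<lambda>t. \<rho> (y + t *\<^sub>R axis i 1)" "partial \<rho> i y" 0] by simp
    then have "((\<lambda>t. (\<rho> (y - t *\<^sub>R axis i 1) - \<rho> y) / t) \<longlongrightarrow> - partial \<rho> i y) (at 0)"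
      by (simp add: DERIV_def)
    from tendsto_rabs[OF tendsto_add[OF this tendsto_const[of "partial \<rho> i y"]]]
    show "((\<lambda>t. \<bar>(\<rho> (y - t *\<^sub>R axis i 1) - \<rho> y) / t + partial \<rho> i y\<bar>) \<longlongrightarrow> 0) (at 0)" by simp
  qed simp
qed

lemma lborel_integral_shift:
  fixes f :: "'a::euclidean_space \<Rightarrow> real"
  shows "(\<integral>y. f (y - h) \<partial>lborel) = (\<integral>y. f y \<partial>lborel)"
    and "integrable lborel f \<Longrightarrow> integrable lborel (\<lambda>y. f (y - h))"
proof -
  have eq: "distr lborel borel ((+) (- h)) = (lborel :: 'a measure)" by (rule lborel_distr_plus)
  have *: "f \<in> borel_measurable borel \<longleftrightarrow> (\<lambda>y. f (y - h)) \<in> borel_measurable borel"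
  proof
    assume "(\<lambda>y. f (y - h)) \<in> borel_measurable borel"
    then have "(\<lambda>y. f ((y + h) - h)) \<in> borel_measurable borel"
      by (rule measurable_compose[rotated]) simp
    then show "f \<in> borel_measurable borel" by simp
  qed (simp add: measurable_compose[rotated])
  show "integrable lborel f \<Longrightarrow> integrable lborel (\<lambda>y. f (y - h))"
    using integrable_distr[of "(+) (- h)" lborel borel f] unfolding eq by simp
  show "(\<integral>y. f (y - h) \<partial>lborel) = (\<integral>y. f y \<partial>lborel)"
  proof (cases "f \<in> borel_measurable borel")
    case True
    then show ?thesis using integral_distr[of "(+) (- h)" lborel borel f] unfolding eq by simp
  next
    \<comment> \<open>Neither side is measurable, hence neither is integrable, and both integrals
      have the default value 0.\<close>
    case False
    then have "\<not> integrable lborel f" "\<not> integrable lborel (\<lambda>y. f (y - h))" 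
      using * borel_measurable_integrable by force+
    then show ?thesis by (simp add: not_integrable_integral_eq)
  qed
qed

lemma lborel_integral_reflect:
  fixes f :: "'a::euclidean_space \<Rightarrow> real"
  assumes "f \<in> borel_measurable borel"
  shows "(\<integral>y. f (- y) \<partial>lborel) = (\<integral>y. f y \<partial>lborel)"
proof -
  have "lborel = distr lborel borel (uminus :: 'a \<Rightarrow> 'a)"
    using lborel_affine[of "-1" "0::'a"] by (simp add: density_1)
  then show ?thesis using integral_distr[of "uminus :: 'a \<Rightarrow> 'a" lborel borel f] assms by simp
qed

text \<open>Difference quotients have integral 0 by translation invariance, and they converge to
  minus the partial in L1.\<close>

lemma Cc_inf_integral_partial:
  fixes \<rho> :: "real^'n \<Rightarrow> real"
  assumes \<rho>: "Cc_inf UNIV \<rho>"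
  shows "(\<integral>y. partial \<rho> i y \<partial>lborel) = 0"
proof -
  note I = Cc_inf_integrable[OF \<rho>] Cc_inf_integrable[OF Cc_inf_partial[OF \<rho>, of i]]
  have "\<bar>\<integral>y. partial \<rho> i y \<partial>lborel\<bar> \<le> (\<integral>y. \<bar>(\<rho> (y - t *\<^sub>R axis i 1) - \<rho> y) / t + partial \<rho> i y\<bar> \<partial>lborel)" for t
  proof -
    have "(\<integral>y. (\<rho> (y - t *\<^sub>R axis i 1) - \<rho> y) / t + partial \<rho> i y \<partial>lborel) = (\<integral>y. partial \<rho> i y \<partial>lborel)"
      using I lborel_integral_shift(2)[OF I(1)] by (simp add: lborel_integral_shift(1))
    then show ?thesis using integral_abs_bound[of lborel "\<lambda>y. (\<rho> (y - t *\<^sub>R axis i 1) - \<rho> y) / t + partial \<rho> i y"] by simp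
  qed
  then have "\<bar>\<integral>y. partial \<rho> i y \<partial>lborel\<bar> \<le> 0"
    by (intro tendsto_lowerbound[OF Cc_inf_diff_quotient_L1[OF \<rho>]]) (auto intro: always_eventually)
  then show ?thesis by simp
qed

section \<open>Smooth approximation of indicators of open sets\<close>

lemma exp_cut_smooth_comp: "smooth_Rn (\<lambda>x::real^'n. exp_cut n (d + c * x $ j))"
  using smooth_Rn_exp_cut[of n c j d] by (simp add: add.commute)

lemma box_approx:
  fixes a b :: "real^'n"
  obtains \<phi> where "\<And>k::nat. Cc_inf (cbox a b) (\<phi> k)" "\<And>k x. 0 \<le> \<phi> k x" "\<And>k x. \<phi> k x \<le> 1"
    "\<And>x. (\<lambda>k. \<phi> k x) \<longlonglongrightarrow> indicator (box a b) x"
proof -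
  \<comment> \<open>For t > 0 this is exp(-1/((k+1) t)), which tends to 1 as k grows; for t \<le> 0
    it is 0.\<close>
  define e where "e k t = exp_cut 0 (real (Suc k) * t)" for k t
  define \<phi> where "\<phi> k x = (\<Prod>i\<in>UNIV. e k (x $ i - a $ i) * e k (b $ i - x $ i))" for k and x :: "real^'n"
  have e01: "0 \<le> e k t" "e k t \<le> 1" "t \<le> 0 \<Longrightarrow> e k t = 0" for k t
    by (auto simp: e_def exp_cut_def zero_less_mult_iff)
  have lim: "(\<lambda>k. e k t) \<longlonglongrightarrow> 1" if "t > 0" for t
  proof -
    have "(\<lambda>k. exp (- (inverse (real (Suc k)) * (1 / t)))) \<longlonglongrightarrow> exp (- (0 * (1 / t)))"
      by (intro tendsto_intros LIMSEQ_inverse_real_of_nat)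
    moreover have "exp (- (inverse (real (Suc k)) * (1 / t))) = e k t" for k
      using that by (simp add: e_def exp_cut_def inverse_eq_divide)
    ultimately show ?thesis by simp
  qed
  have sm: "smooth_Rn (\<lambda>x::real^'n. e k (x $ i - a $ i))" "smooth_Rn (\<lambda>x::real^'n. e k (b $ i - x $ i))" for k i
    using smooth_Rn_exp_cut[of 0 "real (Suc k)" i "- real (Suc k) * a $ i"]
      smooth_Rn_exp_cut[of 0 "- real (Suc k)" i "real (Suc k) * b $ i"]
    by (auto simp: e_def algebra_simps)
  have z: "\<phi> k x = 0" if "x \<notin> box a b" for k x
  proof -
    have "\<not> (\<forall>i. a $ i < x $ i \<and> x $ i < b $ i)" using that by (simp add: mem_box_cart)
    then obtain i where "x $ i \<le> a $ i \<or> b $ i \<le> x $ i" by (auto simp: not_less)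
    then have "e k (x $ i - a $ i) * e k (b $ i - x $ i) = 0" using e01(3) by auto
    then show ?thesis unfolding \<phi>_def by (intro prod_zero) auto
  qed
  have 1: "Cc_inf (cbox a b) (\<phi> k)" for k
  proof -
    have "smooth_Rn (\<phi> k)" unfolding \<phi>_def[abs_def] by (intro smooth_Rn_prod smooth_Rn_mult sm)
    moreover have "\<phi> k x = 0" if "x \<notin> cbox a b" for x using z[of x k] that box_subset_cbox by blast
    ultimately show ?thesis unfolding Cc_inf_def by (auto intro!: exI[of _ "cbox a b"])
  qed
  have 2: "0 \<le> \<phi> k x" "\<phi> k x \<le> 1" for k x
    unfolding \<phi>_def using e01 by (auto intro!: prod_nonneg prod_le_1 mult_le_one)
  have 3: "(\<lambda>k. \<phi> k x) \<longlonglongrightarrow> indicator (box a b) x" for x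
  proof (cases "x \<in> box a b")
    case True
    have "(\<lambda>k. \<phi> k x) \<longlonglongrightarrow> (\<Prod>i\<in>(UNIV::'n set). 1 * 1)" unfolding \<phi>_def
      by (intro tendsto_prod tendsto_mult lim) (use True in \<open>auto simp: mem_box_cart\<close>)
    then show ?thesis using True by simp
  qed (use z in simp)
  show ?thesis by (rule that[of \<phi>]) (use 1 2 3 in auto)
qed

text \<open>A smooth substitute for the maximum: when all values lie in the unit interval,
  \<open>1 - (\<Prod>i<m. 1 - \<phi> i x)\<close> is at least every \<open>\<phi> i x\<close>, and
  it vanishes where all of them do.\<close>

lemma Cc_inf_union_fun:
  assumes "\<And>i::nat. i < m \<Longrightarrow> Cc_inf U (\<phi> i)"
  shows "Cc_inf U (\<lambda>x. 1 - (\<Prod>i<m. 1 - \<phi> i x))"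
  using assms
proof (induction m)
  case 0
  then show ?case by (auto simp: Cc_inf_def smooth_Rn_const intro!: exI[of _ "{}"])
next
  case (Suc m)
  let ?P = "\<lambda>x. \<Prod>i<m. 1 - \<phi> i x"
  have "smooth_Rn (\<lambda>x. 1 + (-1) * \<phi> i x)" if "i < Suc m" for i
    using Suc.prems[OF that] by (intro smooth_Rn_add smooth_Rn_mult smooth_Rn_const) (simp add: Cc_inf_smooth)
  then have "smooth_Rn ?P" by (intro smooth_Rn_prod) (auto simp: less_Suc_eq)
  then have "Cc_inf U (\<lambda>x. (1 - ?P x) + \<phi> m x * ?P x)"
    by (intro Cc_inf_add Cc_inf_mult Suc) (use Suc.prems in auto)
  then show ?case by (simp add: algebra_simps)
qed

text \<open>Lindelof's theorem exhausts \<open>U\<close> by countably many open boxes whose closed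
  boxes stay inside \<open>U\<close>; the latter is what gives the supports in
  \<open>U\<close>.\<close>

lemma open_approx:
  fixes U :: "(real^'n) set"
  assumes U: "open U"
  obtains \<phi> where "\<And>k::nat. Cc_inf U (\<phi> k)" "\<And>k x. 0 \<le> \<phi> k x" "\<And>k x. \<phi> k x \<le> 1"
    "\<And>x. (\<lambda>k. \<phi> k x) \<longlonglongrightarrow> indicator U x"
proof -
  define F where "F = {box a b |a b::real^'n. cbox a b \<subseteq> U}"
  have un: "\<Union>F = U"
  proof
    show "\<Union>F \<subseteq> U" using box_subset_cbox by (force simp: F_def)
    show "U \<subseteq> \<Union>F"
    proof
      fix x assume "x \<in> U"
      then obtain a b where "cbox a b \<subseteq> U" "x \<in> box a b"
        using open_contains_cbox assms by metis
      then show "x \<in> \<Union>F" by (auto simp: F_def)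
    qed
  qed
  obtain F' where F': "F' \<subseteq> F" "countable F'" "\<Union>F' = \<Union>F"
    by (rule Lindelof[of F]) (auto simp: F_def open_box)
  \<comment> \<open>The empty set is added because an enumeration by natural numbers requires a
    nonempty set.\<close>
  define B where "B = from_nat_into (insert {} F')"
  have rB: "range B = insert {} F'" unfolding B_def using F' by (intro range_from_nat_into) auto
  then have UB: "(\<Union>i. B i) = U" using F' un by auto
  have "\<exists>\<phi>. (\<forall>k::nat. Cc_inf U (\<phi> k)) \<and> (\<forall>k x. 0 \<le> \<phi> k x \<and> \<phi> k x \<le> 1) \<and> (\<forall>x. (\<lambda>k. \<phi> k x) \<longlonglongrightarrow> indicat_real (B i) x)" for i
  proof -
    have "B i = {} \<or> B i \<in> F" using rB F' by blast
    then obtain a b where ab: "B i = box a b" "cbox a b \<subseteq> U"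
    proof
      assume e: "B i = {}"
      have "box 1 0 = ({}::(real^'n) set)" "cbox 1 0 = ({}::(real^'n) set)" by (force simp: mem_box_cart)+
      with e show ?thesis using that[of 1 0] by auto
    qed (use that in \<open>auto simp: F_def\<close>)
    obtain \<phi> where "\<And>k::nat. Cc_inf (cbox a b) (\<phi> k)" "\<And>k x. 0 \<le> \<phi> k x" "\<And>k x. \<phi> k x \<le> 1"
    "\<And>x. (\<lambda>k. \<phi> k x) \<longlonglongrightarrow> indicator (box a b) x" using box_approx[of a b] by blast
    then show ?thesis using ab by (intro exI[of _ \<phi>]) (auto intro: Cc_inf_mono)
  qed
  then obtain \<phi> where \<phi>: "\<And>i k. Cc_inf U (\<phi> i k)" "\<And>i k x. 0 \<le> \<phi> i k x" "\<And>i k x. \<phi> i k x \<le> 1"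
    "\<And>i x. (\<lambda>k. \<phi> i k x) \<longlonglongrightarrow> indicat_real (B i) x" by metis
  \<comment> \<open>One index governs both the number of boxes and the quality of approximation in
    each of them. At a point of box \<open>i\<close> the single factor with that index already
    drives the product to 0.\<close>
  define \<psi> where "\<psi> k x = 1 - (\<Prod>i<k. 1 - \<phi> i k x)" for k x
  have p01: "0 \<le> (\<Prod>i\<in>I. 1 - \<phi> i k x)" "(\<Prod>i\<in>I. 1 - \<phi> i k x) \<le> 1" for I k x
    using \<phi>(2,3) by (auto intro!: prod_nonneg prod_le_1)
  show ?thesis
  proof (rule that[of \<psi>])
    show "Cc_inf U (\<psi> k)" for k unfolding \<psi>_def[abs_def] by (rule Cc_inf_union_fun) (rule \<phi>)
    show "0 \<le> \<psi> k x" "\<psi> k x \<le> 1" for k x unfolding \<psi>_def using p01 by auto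
    show "(\<lambda>k. \<psi> k x) \<longlonglongrightarrow> indicator U x" for x
    proof (cases "x \<in> U")
      case True
      then obtain i where i: "x \<in> B i" using UB by blast
      have "(\<lambda>k. 1 - \<phi> i k x) \<longlonglongrightarrow> 1 - 1" using \<phi>(4)[of i x] i by (intro tendsto_intros) simp
      then have l: "(\<lambda>k. 1 - \<phi> i k x) \<longlonglongrightarrow> 0" by simp
      have "(\<lambda>k. \<Prod>i<k. 1 - \<phi> i k x) \<longlonglongrightarrow> 0"
      proof (rule tendsto_sandwich[OF _ _ tendsto_const l])
        show "\<forall>\<^sub>F k in sequentially. 0 \<le> (\<Prod>i<k. 1 - \<phi> i k x)" using p01 by simp
        have "(\<Prod>i<k. 1 - \<phi> i k x) \<le> 1 - \<phi> i k x" if "i < k" for k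
        proof -
          have "(\<Prod>i<k. 1 - \<phi> i k x) = (1 - \<phi> i k x) * (\<Prod>j\<in>{..<k}-{i}. 1 - \<phi> j k x)"
            using that by (subst prod.remove[of _ i]) auto
          also have "\<dots> \<le> (1 - \<phi> i k x) * 1" by (intro mult_left_mono p01) (use \<phi>(3) in auto)
          finally show ?thesis by simp
        qed
        then show "\<forall>\<^sub>F k in sequentially. (\<Prod>i<k. 1 - \<phi> i k x) \<le> 1 - \<phi> i k x"
          using eventually_gt_at_top[of i] by (rule eventually_mono[rotated])
      qed
      then have "(\<lambda>k. \<psi> k x) \<longlonglongrightarrow> 1 - 0" unfolding \<psi>_def by (intro tendsto_intros)
      then show ?thesis using True by simp
    next
      case False
      then have "\<phi> i k x = 0" for i k using \<phi>(1)[of i k] unfolding Cc_inf_def by blast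
      then show ?thesis using False by (simp add: \<psi>_def)
    qed
  qed
qed

section \<open>Product mollifiers of arbitrary radius\<close>

definition bump :: "real \<Rightarrow> real" where
  "bump t = exp_cut 0 (1 + t) * exp_cut 0 (1 - t)"

lemma bump_nonneg: "0 \<le> bump t" and bump_minus: "bump (- t) = bump t"
  and bump_zero: "1 \<le> \<bar>t\<bar> \<Longrightarrow> bump t = 0" and bump_pos: "\<bar>t\<bar> < 1 \<Longrightarrow> 0 < bump t"
  by (auto simp: bump_def exp_cut_def abs_if split: if_splits)

lemma smooth_Rn_bump: "smooth_Rn (\<lambda>x::real^'n. bump (c * x $ j))"
  unfolding bump_def using exp_cut_smooth_comp[of 0 1 c j] exp_cut_smooth_comp[of 0 1 "- c" j]
  by (intro smooth_Rn_mult) auto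

lemma continuous_exp_cut: "continuous_on UNIV (exp_cut n)"
  by (intro continuous_at_imp_continuous_on ballI DERIV_isCont[OF exp_cut_deriv])

lemma continuous_bump: "continuous_on UNIV bump"
  unfolding bump_def[abs_def] 
  by (intro continuous_intros continuous_on_compose2[OF continuous_exp_cut]) auto

text \<open>The oriented integral covers negative arguments. The constants attained beyond 1 and
  below -1 differ, but they cancel in the difference of two rescaled copies, which is how this
  primitive is used.\<close>

definition bump_prim :: "real \<Rightarrow> real" where
  "bump_prim u = (LBINT y=ereal 0..ereal u. bump y)"

lemma bump_prim_deriv: "(bump_prim has_real_derivative bump u) (at u)"
proof -
  have "((\<lambda>u. LBINT y=ereal 0..ereal u. bump y) has_vector_derivative bump u) (at u within {min 0 (u-1)..max 0 (u+1)})"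
    by (rule interval_integral_FTC2) (auto intro: continuous_on_subset[OF continuous_bump])
  moreover have "at u within {min 0 (u-1)..max 0 (u+1)} = at u"
    by (rule at_within_Icc_at) auto
  ultimately show ?thesis
    unfolding has_real_derivative_iff_has_vector_derivative bump_prim_def[abs_def] by (simp only:)
qed

lemma bump_prim_const: "1 \<le> t \<Longrightarrow> bump_prim t = bump_prim 1" "t \<le> -1 \<Longrightarrow> bump_prim t = bump_prim (-1)"
proof -
  have *: "bump_prim b = bump_prim a" if "a \<le> b" and *: "\<And>s. a \<le> s \<Longrightarrow> s \<le> b \<Longrightarrow> bump s = 0" for a b
  proof (cases "a < b")
    case True
    have "(bump_prim has_real_derivative 0) (at x)" if "a < x" "x < b" for x
      using bump_prim_deriv[of x] that * by simp
    then show ?thesis using True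
      by (intro DERIV_isconst_end continuous_at_imp_continuous_on ballI DERIV_isCont[OF bump_prim_deriv])
  qed (use that in auto)
  show "1 \<le> t \<Longrightarrow> bump_prim t = bump_prim 1" by (rule *) (auto intro!: bump_zero)
  show "t \<le> -1 \<Longrightarrow> bump_prim t = bump_prim (-1)" by (rule *[symmetric]) (auto intro!: bump_zero)
qed

text \<open>The type argument carries the dimension, the only thing on which the mass
  depends.\<close>

definition mol_mass :: "'n::finite itself \<Rightarrow> real" where
  "mol_mass _ = (\<integral>y. (\<Prod>i\<in>UNIV. bump (y $ i)) \<partial>(lborel :: (real^'n) measure))"

text \<open>A product of one-dimensional profiles instead of a radial function: it allows a change
  of radius in a single coordinate while the other factors stay put.\<close>

definition mol :: "real \<Rightarrow> real^'n \<Rightarrow> real" where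
  "mol r y = (\<Prod>i\<in>UNIV. bump (y $ i / r) / r) / mol_mass TYPE('n)"

lemma smooth_Rn_bump_div: "smooth_Rn (\<lambda>x::real^'n. bump (x $ i / r) / r)"
  using smooth_Rn_mult[OF smooth_Rn_bump[of "1/r" i] smooth_Rn_const[of "1/r"]] by simp

lemma Cc_inf_coord_bound:
  fixes f :: "real^'n \<Rightarrow> real"
  assumes "smooth_Rn f" "\<And>x i. \<bar>x $ i\<bar> > r \<Longrightarrow> f x = 0"
  shows "Cc_inf UNIV f"
  unfolding Cc_inf_def
proof (intro conjI exI[of _ "cbox (\<chi> i. - r) (\<chi> i. r)"] allI impI)
  fix x assume "x \<notin> cbox (\<chi> i. - r) (\<chi> i. r :: real^'n)"
  then have "\<exists>i. \<not> (- r \<le> x $ i \<and> x $ i \<le> r)" by (simp add: mem_box_cart)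
  then obtain i where "\<bar>x $ i\<bar> > r" by (metis abs_le_iff minus_le_iff not_le)
  then show "f x = 0" by (rule assms(2)) 
qed (use assms in auto)

lemma Cc_inf_bump_prod:
  assumes "r > 0" shows "Cc_inf UNIV (\<lambda>y::real^'n. \<Prod>i\<in>UNIV. bump (y $ i / r) / r)"
proof (rule Cc_inf_coord_bound[where r=r])
  fix x :: "real^'n" and i assume "r < \<bar>x $ i\<bar>"
  then have "bump (x $ i / r) = 0" using assms by (intro bump_zero) auto
  then show "(\<Prod>i\<in>UNIV. bump (x $ i / r) / r) = 0" by (intro prod_zero) auto
qed (intro smooth_Rn_prod smooth_Rn_bump_div)

lemma mol_mass_pos: "mol_mass TYPE('n::finite) > 0"
proof -
  let ?f = "\<lambda>y::real^'n. \<Prod>i\<in>UNIV. bump (y $ i)"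
  have I: "integrable lborel ?f" using Cc_inf_integrable[OF Cc_inf_bump_prod[of 1]] by simp
  have nn: "0 \<le> ?f y" for y by (auto intro!: prod_nonneg bump_nonneg)
  have "\<not> (AE y in lborel. ?f y = 0)"
  proof
    assume "AE y in lborel. ?f y = 0"
    then have "AE y in lborel. (y::real^'n) \<notin> box (vec (-1)) (vec 1)"
    proof eventually_elim
      case (elim y)
      then obtain i where "bump (y $ i) = 0" by auto
      then have "\<not> \<bar>y $ i\<bar> < 1" using bump_pos[of "y $ i"] by auto
      then show ?case by (simp add: mem_box_cart) (metis abs_less_iff minus_less_iff)
    qed
    then have "emeasure lborel (box (vec (-1)) (vec 1) :: (real^'n) set) = 0"
      by (subst (asm) AE_iff_measurable) auto
    moreover have "box (vec (-1)) (vec 1) \<noteq> ({} :: (real^'n) set)"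
      by (auto simp: mem_box_cart set_eq_iff intro!: exI[of _ 0])
    ultimately show False
      using open_not_negligible[of "box (vec (-1)) (vec 1) :: (real^'n) set"]
      by (auto simp: negligible_iff_emeasure0)
  qed
  then have "integral\<^sup>L lborel ?f \<noteq> 0" using integral_nonneg_eq_0_iff_AE[OF I] nn by auto
  moreover have "integral\<^sup>L lborel ?f \<ge> 0" using nn by simp
  ultimately show ?thesis by (simp add: mol_mass_def)
qed

lemma mol_nonneg: "r > 0 \<Longrightarrow> 0 \<le> mol r y"
  unfolding mol_def by (intro divide_nonneg_pos prod_nonneg mol_mass_pos ballI) (auto intro: bump_nonneg)

lemma mol_minus: "mol r (- y) = mol r y"
  by (simp add: mol_def bump_minus)

lemma mol_zero: "r > 0 \<Longrightarrow> \<bar>y $ i\<bar> > r \<Longrightarrow> mol r y = 0"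
  unfolding mol_def using bump_zero[of "y $ i / r"] by (auto intro!: exI[of _ i])

lemma mol_Cc_inf: "r > 0 \<Longrightarrow> Cc_inf UNIV (mol r :: real^'n \<Rightarrow> real)"
  using Cc_inf_mult[OF Cc_inf_bump_prod smooth_Rn_const, of r "1 / mol_mass TYPE('n)"]
  by (simp add: mol_def[abs_def])

lemma mol_scale: "r > 0 \<Longrightarrow> mol r (r *\<^sub>R y) = mol 1 y / r ^ CARD('n)" for y :: "real^'n"
  by (simp add: mol_def prod_dividef)

lemma lborel_integral_scale:
  fixes f :: "real^'n \<Rightarrow> real"
  assumes "r > 0" "f \<in> borel_measurable borel"
  shows "(\<integral>y. f y \<partial>lborel) = r ^ CARD('n) * (\<integral>y. f (r *\<^sub>R y) \<partial>lborel)"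
proof -
  have "(\<integral>y. f y \<partial>lborel) = (\<integral>y. f y \<partial>density (distr lborel borel (\<lambda>x. 0 + r *\<^sub>R x)) (\<lambda>_. \<bar>r\<bar>^DIM(real^'n)))"
    using lborel_affine[of r "0 :: real^'n"] assms by simp
  also have "\<dots> = r ^ CARD('n) * (\<integral>y. f (r *\<^sub>R y) \<partial>lborel)"
    using assms by (subst integral_density) (auto simp: integral_distr ennreal_power[symmetric])
  finally show ?thesis .
qed

lemma mol_integral: assumes "r > 0" shows "(\<integral>y. mol r y \<partial>(lborel :: (real^'n) measure)) = 1"
proof -
  have "(\<integral>y. mol r y \<partial>(lborel :: (real^'n) measure)) = (\<integral>y. mol 1 y \<partial>(lborel :: (real^'n) measure))"
    using assms by (subst lborel_integral_scale[OF assms]) (auto simp: mol_scale intro: Cc_inf_borel[OF mol_Cc_inf])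
  also have "\<dots> = 1" using mol_mass_pos[where 'n='n] by (simp add: mol_def mol_mass_def)
  finally show ?thesis .
qed

text \<open>Rescaling by r turns the shift of the wide kernel by \<open>h\<close> into the shift of
  the unit kernel by h/r, and the latter tends to 0.\<close>

lemma mol_shift_L1:
  fixes h :: "real^'n"
  shows "((\<lambda>r. \<integral>y. \<bar>mol r (y - h) - mol r y\<bar> \<partial>lborel) \<longlongrightarrow> 0) at_top"
proof (cases "h = 0")
  case False
  have eq: "(\<integral>y. \<bar>mol r (y - h) - mol r y\<bar> \<partial>lborel) = (\<integral>y. \<bar>mol 1 (y - (1/r) *\<^sub>R h) - mol 1 y\<bar> \<partial>lborel)" if r: "r > 0" for r
  proof -
    have [measurable]: "mol r \<in> borel_measurable borel" by (intro Cc_inf_borel[OF mol_Cc_inf] r)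
    have "mol r (r *\<^sub>R y - h) = mol 1 (y - (1/r) *\<^sub>R h) / r ^ CARD('n)" for y
      using mol_scale[OF r, of "y - (1/r) *\<^sub>R h"] r by (simp add: scaleR_right_diff_distrib)
    then have "\<bar>mol r (r *\<^sub>R y - h) - mol r (r *\<^sub>R y)\<bar> = \<bar>mol 1 (y - (1/r) *\<^sub>R h) - mol 1 y\<bar> / r ^ CARD('n)" for y
      using r by (simp add: mol_scale diff_divide_distrib[symmetric])
    then show ?thesis using r by (subst lborel_integral_scale[OF r]) simp_all
  qed
  have "((\<lambda>r. (1/r) *\<^sub>R h) \<longlongrightarrow> 0 *\<^sub>R h) at_top" by (intro tendsto_intros tendsto_divide_0[OF tendsto_const] filterlim_at_top_imp_at_infinity filterlim_ident)
  then have "filterlim (\<lambda>r. (1/r) *\<^sub>R h) (at 0) at_top" using False 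
    by (auto simp: filterlim_at intro: eventually_mono[OF eventually_gt_at_top[of 0]])
  from filterlim_compose[OF Cc_inf_translation_L1[OF mol_Cc_inf] this]
  have "((\<lambda>r. \<integral>y. \<bar>mol 1 (y - (1/r) *\<^sub>R h) - mol 1 y\<bar> \<partial>lborel) \<longlongrightarrow> 0) at_top" by simp
  then show ?thesis
    by (rule Lim_transform_eventually) (auto simp: eq intro: eventually_mono[OF eventually_gt_at_top[of 0]])
qed simp

text \<open>Exchanging the radius one coordinate at a time exhibits the difference of two kernels as a
  divergence of compactly supported smooth functions.\<close>
lemma mol_diff_divergence:
  assumes d: "\<delta> > 0" and R: "R > 0"
  shows "\<exists>\<kappa>. (\<forall>j::'n. Cc_inf UNIV (\<kappa> j)) \<and> (\<forall>y::real^'n. mol \<delta> y - mol R y = (\<Sum>j\<in>UNIV. partial (\<kappa> j) j y))"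
proof -
  \<comment> \<open>\<open>J\<close> collects the coordinates whose radius has already been changed
    from \<open>\<delta>\<close> to \<open>R\<close>; the induction on \<open>J\<close> is a
    telescoping sum.\<close>
  define m where "m J y = (\<Prod>i\<in>UNIV. if i \<in> J then bump (y $ i / R) / R else bump (y $ i / \<delta>) / \<delta>) / mol_mass TYPE('n)" 
    for J and y :: "real^'n"
  \<comment> \<open>The two one-dimensional profiles have equal mass, so the difference of their
    primitives vanishes outside a bounded interval on both sides.\<close>
  define B where "B t = bump_prim (t / \<delta>) - bump_prim (t / R)" for t
  have B': "(B has_real_derivative (bump (t / \<delta>) / \<delta> - bump (t / R) / R)) (at t)" for t
    unfolding B_def[abs_def] using d R
    by (auto intro!: derivative_eq_intros DERIV_chain2[OF bump_prim_deriv])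
  have B0: "B t = 0" if "\<bar>t\<bar> > max \<delta> R" for t
  proof (cases "t > 0")
    case True
    then have "1 \<le> t / \<delta>" "1 \<le> t / R" using that d R by auto
    then show ?thesis unfolding B_def using bump_prim_const(1)[of "t / \<delta>"] bump_prim_const(1)[of "t / R"] by simp
  next
    case False
    then have "t / \<delta> \<le> -1" "t / R \<le> -1" using that d R by (auto simp: divide_simps)
    then show ?thesis unfolding B_def using bump_prim_const(2)[of "t / \<delta>"] bump_prim_const(2)[of "t / R"] by simp
  qed
  have "\<exists>\<kappa>. (\<forall>j::'n. Cc_inf UNIV (\<kappa> j)) \<and> (\<forall>y::real^'n. m {} y - m J y = (\<Sum>j\<in>J. partial (\<kappa> j) j y))" if "finite J" for J
    using that
  proof induction
    case empty
    show ?case using mol_Cc_inf[OF d] by (intro exI[of _ "\<lambda>_. mol \<delta>"]) auto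
  next
    case (insert j J)
    then obtain \<kappa> where \<kappa>: "\<And>j. Cc_inf UNIV (\<kappa> j)" "\<And>y. m {} y - m J y = (\<Sum>j\<in>J. partial (\<kappa> j) j y)" by blast
    define P where "P y = (\<Prod>i\<in>UNIV-{j}. if i \<in> J then bump (y $ i / R) / R else bump (y $ i / \<delta>) / \<delta>) / mol_mass TYPE('n)" for y :: "real^'n"
    \<comment> \<open>The factor \<open>P\<close> does not depend on coordinate \<open>j\<close>, so
      differentiating in that coordinate affects \<open>B\<close> alone and produces exactly the
      exchange of one profile.\<close>
    define k where "k y = P y * B (y $ j)" for y
    have DB: "((\<lambda>y::real^'n. B (y $ j)) has_derivative (\<lambda>h. (bump (y $ j / \<delta>) / \<delta> - bump (y $ j / R) / R) * h $ j)) (at y)" for y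
    proof -
      have "((\<lambda>y::real^'n. y $ j) has_derivative (\<lambda>h. h $ j)) (at y)"
        by (intro bounded_linear_imp_has_derivative bounded_linear_vec_nth)
      from has_derivative_compose[OF this B'[unfolded has_field_derivative_def]] show ?thesis .
    qed
    have smB: "smooth_Rn (\<lambda>y::real^'n. B (y $ j))"
    proof (rule smooth_RnI_partial)
      show "(\<lambda>y::real^'n. B (y $ j)) differentiable (at x)" for x using DB by (auto simp: differentiable_def)
      have "partial (\<lambda>y::real^'n. B (y $ j)) i = (\<lambda>y. (bump (y $ j / \<delta>) / \<delta> + (-1) * (bump (y $ j / R) / R)) * axis i 1 $ j)" for i
        by (rule ext) (simp add: partial_eqI[OF DB])
      then show "smooth_Rn (partial (\<lambda>y::real^'n. B (y $ j)) i)" for i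
        by (simp only:) (intro smooth_Rn_mult smooth_Rn_add smooth_Rn_const smooth_Rn_bump_div)
    qed
    have "smooth_Rn (\<lambda>x::real^'n. if i \<in> J then bump (x $ i / R) / R else bump (x $ i / \<delta>) / \<delta>)" for i
      by (cases "i \<in> J") (simp_all add: smooth_Rn_bump_div)
    then have "smooth_Rn (\<lambda>y. (\<Prod>i\<in>UNIV-{j}. if i \<in> J then bump (y $ i / R) / R else bump (y $ i / \<delta>) / \<delta>) * (1 / mol_mass TYPE('n)))"
      by (intro smooth_Rn_mult smooth_Rn_prod smooth_Rn_const) simp
    then have smP: "smooth_Rn P" by (simp add: P_def[abs_def])
    have smk: "smooth_Rn k" unfolding k_def[abs_def] by (intro smooth_Rn_mult smP smB)
    have k: "Cc_inf UNIV k"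
    proof (rule Cc_inf_coord_bound[OF smk, where r="max \<delta> R"])
      fix x :: "real^'n" and i assume x: "max \<delta> R < \<bar>x $ i\<bar>"
      show "k x = 0"
      proof (cases "i = j")
        case True then show ?thesis using B0[OF x] by (simp add: k_def)
      next
        case False
        have "bump (x $ i / R) = 0" "bump (x $ i / \<delta>) = 0" using x d R by (auto intro!: bump_zero)
        then have "P x = 0" using False by (auto simp: P_def intro!: prod_zero bexI[of _ i])
        then show ?thesis by (simp add: k_def)
      qed
    qed
    have pk: "partial k j y = P y * (bump (y $ j / \<delta>) / \<delta> - bump (y $ j / R) / R)" for y
    proof -
      have Pc: "P (y + t *\<^sub>R axis j 1) = P y" for t
      proof -
        have *: "(y + t *\<^sub>R axis j 1) $ i = y $ i" if "i \<in> UNIV - {j}" for i using that by (simp add: axis_def)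
        show ?thesis unfolding P_def by (intro arg_cong2[where f="(/)"] prod.cong HOL.refl) (simp only: *)
      qed
      have "((\<lambda>t. k (y + t *\<^sub>R axis j 1)) has_real_derivative partial k j y) (at 0)"
        using partial_line[OF smooth_Rn_differentiable[OF smk], where x=y and t=0] by simp
      moreover have "((\<lambda>t. P y * B (t + y $ j)) has_real_derivative P y * (bump (y $ j / \<delta>) / \<delta> - bump (y $ j / R) / R)) (at 0)"
      proof -
        have "((\<lambda>t. t + y $ j) has_real_derivative 1) (at 0)" by (auto intro!: derivative_eq_intros)
        from DERIV_chain2[OF B' this] show ?thesis by (intro DERIV_cmult) simp
      qed
      moreover have "k (y + t *\<^sub>R axis j 1) = P y * B (t + y $ j)" for t
        unfolding k_def Pc by (simp add: add.commute)
      ultimately show ?thesis using DERIV_unique[of _ "partial k j y" 0] by simp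
    qed
    have mJ: "m J y - m (insert j J) y = partial k j y" for y
    proof -
      have *: "m I y = (if j \<in> I then bump (y $ j / R) / R else bump (y $ j / \<delta>) / \<delta>) *
          (\<Prod>i\<in>UNIV-{j}. if i \<in> I then bump (y $ i / R) / R else bump (y $ i / \<delta>) / \<delta>) / mol_mass TYPE('n)" for I
        unfolding m_def by (subst prod.remove[of _ j]) simp_all
      have "(\<Prod>i\<in>UNIV-{j}. if i \<in> insert j J then bump (y $ i / R) / R else bump (y $ i / \<delta>) / \<delta>)
          = (\<Prod>i\<in>UNIV-{j}. if i \<in> J then bump (y $ i / R) / R else bump (y $ i / \<delta>) / \<delta>)"
        by (rule prod.cong) auto
      then have "m (insert j J) y = P y * (bump (y $ j / R) / R)" unfolding * P_def by (simp add: mult.commute)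
      moreover have "m J y = P y * (bump (y $ j / \<delta>) / \<delta>)" unfolding * P_def using insert(2) by (simp add: mult.commute)
      ultimately show ?thesis by (simp only: pk right_diff_distrib)
    qed
    show ?case
    proof (intro exI[of _ "\<kappa>(j := k)"] conjI allI)
      show "Cc_inf UNIV ((\<kappa>(j := k)) i)" for i using k \<kappa> by simp
      fix y
      have "(\<Sum>i\<in>insert j J. partial ((\<kappa>(j := k)) i) i y) = partial k j y + (\<Sum>i\<in>J. partial (\<kappa> i) i y)"
        using insert by (auto intro!: sum.cong)
      then show "m {} y - m (insert j J) y = (\<Sum>i\<in>insert j J. partial ((\<kappa>(j := k)) i) i y)"
        using mJ[of y] \<kappa>(2)[of y] by simp
    qed
  qed
  from this[of UNIV] show ?thesis by (simp add: m_def mol_def)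
qed

section \<open>Modulars of Young functions\<close>

definition trunc :: "nat \<Rightarrow> real \<Rightarrow> real" where "trunc m t = max (- real m) (min (real m) t)"

lemma trunc_meas[measurable]: "trunc m \<in> borel_measurable borel"
  unfolding trunc_def[abs_def] by measurable

lemma trunc_bound: "\<bar>trunc m t\<bar> \<le> real m" and trunc_le: "\<bar>trunc m t\<bar> \<le> \<bar>t\<bar>" and trunc_diff_le: "\<bar>t - trunc m t\<bar> \<le> \<bar>t\<bar>"
  and trunc_eq: "\<bar>t\<bar> \<le> real m \<Longrightarrow> trunc m t = t"
  unfolding trunc_def by linarith+

locale young =
  fixes \<Phi> :: "real \<Rightarrow> real"
  assumes young: "young_function \<Phi>"
begin

lemma zero: "\<Phi> 0 = 0" and pos: "t > 0 \<Longrightarrow> \<Phi> t > 0" and cvx: "convex_on {0..} \<Phi>" and cont: "continuous_on {0..} \<Phi>"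
  using young unfolding young_function_def by auto

lemma nonneg: "t \<ge> 0 \<Longrightarrow> \<Phi> t \<ge> 0"
  using zero pos[of t] by (cases "t = 0") auto

lemma scale: assumes "0 \<le> c" "c \<le> 1" "0 \<le> t" shows "\<Phi> (c * t) \<le> c * \<Phi> t"
proof -
  have "\<Phi> ((1 - c) *\<^sub>R 0 + c *\<^sub>R t) \<le> (1 - c) * \<Phi> 0 + c * \<Phi> t"
    by (rule convex_onD[OF cvx]) (use assms in auto)
  then show ?thesis by (simp add: zero)
qed

lemma mono: assumes "0 \<le> s" "s \<le> t" shows "\<Phi> s \<le> \<Phi> t"
proof (cases "t = 0")
  case False
  then have "\<Phi> ((s / t) * t) \<le> (s / t) * \<Phi> t" using assms by (intro scale) auto
  also have "\<dots> \<le> 1 * \<Phi> t" using assms False by (intro mult_right_mono nonneg) auto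
  finally show ?thesis using False by simp
qed (use assms in auto)

lemma midpoint: assumes "0 \<le> s" "0 \<le> t" shows "\<Phi> (s + t) \<le> \<Phi> (2 * s) + \<Phi> (2 * t)"
proof -
  have "\<Phi> (s + t) \<le> \<Phi> (2 * max s t)" using assms by (intro mono) auto
  also have "\<dots> \<le> \<Phi> (2 * s) + \<Phi> (2 * t)" 
    using nonneg[of "2 * s"] nonneg[of "2 * t"] assms by (auto simp: max_def)
  finally show ?thesis .
qed

lemma cont_abs: "continuous_on UNIV (\<lambda>t. \<Phi> \<bar>t\<bar>)"
  by (rule continuous_on_compose2[OF cont]) (auto intro: continuous_intros)

lemma borel_abs[measurable]: "(\<lambda>t. \<Phi> \<bar>t\<bar>) \<in> borel_measurable borel"
  by (rule borel_measurable_continuous_onI[OF cont_abs])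

text \<open>A monotone selection of slopes of supporting lines. Monotonicity makes \<open>s\<close>
  Borel measurable and bounds it by \<open>s (real j)\<close> where the argument is at most
  \<open>j\<close>; the proof of weak lower semicontinuity needs both.\<close>

lemma subgradient:
  "\<exists>s. (\<forall>a. 0 \<le> s a) \<and> mono s \<and> (\<forall>a\<ge>0. \<forall>b\<ge>0. \<Phi> a + s a * (b - a) \<le> \<Phi> b)"
proof -
  \<comment> \<open>For a > 0 this is the infimum of the chord slopes to the right. At 0 the slope 0
    supports because \<open>\<Phi>\<close> is nonnegative; on negative arguments the value 0 merely
    keeps \<open>s\<close> monotone.\<close>
  define s where "s a = (if a \<le> 0 then 0 else Inf ((\<lambda>t. (\<Phi> a - \<Phi> t) / (a - t)) ` ({a<..} \<inter> {0..})))" for a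
  have 3: "\<Phi> a + s a * (b - a) \<le> \<Phi> b" if "0 \<le> a" "0 \<le> b" for a b
  proof (cases "a = 0")
    case True then show ?thesis using that nonneg zero by (simp add: s_def)
  next
    case False
    then have a: "a > 0" using that by simp
    have "a \<in> interior {0..}" using a by (simp add: interior_real_atLeast)
    from convex_le_Inf_differential[OF cvx this, of b] that(2) show ?thesis using a by (simp add: s_def)
  qed
  have 1: "0 \<le> s a" for a
  proof (cases "a > 0")
    case True
    have "s a * a \<ge> \<Phi> a" using 3[of a 0] True zero by simp
    then show ?thesis using nonneg[of a] True by (smt (verit) mult_neg_pos)
  qed (simp add: s_def)
  have 2: "s a \<le> s b" if "a \<le> b" for a b
  proof (cases "a > 0 \<and> a < b")
    case True
    have "(s b - s a) * (b - a) \<ge> 0" using 3[of a b] 3[of b a] True by (simp add: algebra_simps)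
    then show ?thesis using True by (simp add: zero_le_mult_iff)
  next
    case False
    then show ?thesis using that 1[of b] by (auto simp: s_def)
  qed
  show ?thesis using 1 2 3 by (intro exI[of _ s]) (auto simp: monotone_def)
qed

text \<open>The additive form of \<Phi>(t)/t tending to infinity. With small \<open>e\<close> it
  turns a modular bound into uniform integrability, with e = 1 it gives the embedding into
  L1.\<close>

lemma superlinear: assumes "e > 0" shows "\<exists>L\<ge>0. \<forall>t\<ge>0. t \<le> L + e * \<Phi> t"
proof -
  have "eventually (\<lambda>t. \<Phi> t / t \<ge> 1 / e) at_top"
    using young unfolding young_function_def filterlim_at_top by blast
  then obtain N where N: "\<And>t. t \<ge> N \<Longrightarrow> \<Phi> t / t \<ge> 1 / e" by (auto simp: eventually_at_top_linorder)
  show ?thesis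
  proof (intro exI[of _ "max 1 N"] conjI allI impI)
    fix t :: real assume t: "t \<ge> 0"
    show "t \<le> max 1 N + e * \<Phi> t"
    proof (cases "t \<le> max 1 N")
      case True
      then show ?thesis using nonneg[OF t] assms by (smt (verit) mult_nonneg_nonneg)
    next
      case False
      then have "\<Phi> t / t \<ge> 1 / e" "t > 0" using N[of t] by auto
      then have "t \<le> e * \<Phi> t" using assms by (simp add: field_simps)
      then show ?thesis by auto
    qed
  qed auto
qed

section \<open>The modular and the Luxemburg norm\<close>

definition modl :: "'a measure \<Rightarrow> ('a \<Rightarrow> real) \<Rightarrow> ennreal" where
  "modl M f = (\<integral>\<^sup>+x. ennreal (\<Phi> \<bar>f x\<bar>) \<partial>M)"

lemma modl_cong_AE: "AE x in M. f x = g x \<Longrightarrow> modl M f = modl M g"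
  unfolding modl_def by (rule nn_integral_cong_AE) auto

lemma modl_mono_AE: "AE x in M. \<bar>f x\<bar> \<le> \<bar>g x\<bar> \<Longrightarrow> modl M f \<le> modl M g"
  unfolding modl_def by (rule nn_integral_mono_AE) (auto intro!: ennreal_leI mono elim: eventually_mono)

lemma modl_mono: "(\<And>x. x \<in> space M \<Longrightarrow> \<bar>f x\<bar> \<le> \<bar>g x\<bar>) \<Longrightarrow> modl M f \<le> modl M g"
  by (rule modl_mono_AE) auto

lemma modl_add:
  assumes [measurable]: "f \<in> borel_measurable M" "g \<in> borel_measurable M"
  shows "modl M (\<lambda>x. f x + g x) \<le> modl M (\<lambda>x. 2 * f x) + modl M (\<lambda>x. 2 * g x)"
proof -
  have "modl M (\<lambda>x. f x + g x) \<le> (\<integral>\<^sup>+x. ennreal (\<Phi> \<bar>2 * f x\<bar>) + ennreal (\<Phi> \<bar>2 * g x\<bar>) \<partial>M)"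
    unfolding modl_def
  proof (rule nn_integral_mono)
    fix x
    have "\<Phi> \<bar>f x + g x\<bar> \<le> \<Phi> (\<bar>f x\<bar> + \<bar>g x\<bar>)" by (intro mono) auto
    also have "\<dots> \<le> \<Phi> \<bar>2 * f x\<bar> + \<Phi> \<bar>2 * g x\<bar>" using midpoint[of "\<bar>f x\<bar>" "\<bar>g x\<bar>"] by (simp add: abs_mult)
    finally show "ennreal (\<Phi> \<bar>f x + g x\<bar>) \<le> ennreal (\<Phi> \<bar>2 * f x\<bar>) + ennreal (\<Phi> \<bar>2 * g x\<bar>)"
      by (subst ennreal_plus[symmetric]) (auto intro: nonneg ennreal_leI)
  qed
  also have "\<dots> = modl M (\<lambda>x. 2 * f x) + modl M (\<lambda>x. 2 * g x)"
    unfolding modl_def by (rule nn_integral_add) measurable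
  finally show ?thesis .
qed

lemma modl_scale:
  assumes "0 \<le> c" "c \<le> 1" and [measurable]: "f \<in> borel_measurable M"
  shows "modl M (\<lambda>x. c * f x) \<le> ennreal c * modl M f"
proof -
  have "modl M (\<lambda>x. c * f x) \<le> (\<integral>\<^sup>+x. ennreal c * ennreal (\<Phi> \<bar>f x\<bar>) \<partial>M)"
    unfolding modl_def using scale[OF assms(1,2)]
    by (intro nn_integral_mono) (auto simp: ennreal_mult[symmetric] nonneg assms abs_mult intro!: ennreal_leI)
  also have "\<dots> = ennreal c * modl M f" unfolding modl_def by (rule nn_integral_cmult) measurable
  finally show ?thesis .
qed

text \<open>The supporting line at \<open>a\<close> is integrated. Since \<open>a\<close> only has
  to lie below the mean of \<bar>b\<bar>, which may be infinite, the inequality applies at every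
  point of a convolution, whether or not the averaged function is integrable there.\<close>

lemma jensen_nn:
  assumes "emeasure N (space N) = 1" and [measurable]: "b \<in> borel_measurable N" and a: "0 \<le> a" "ennreal a \<le> (\<integral>\<^sup>+y. ennreal \<bar>b y\<bar> \<partial>N)"
  shows "ennreal (\<Phi> a) \<le> (\<integral>\<^sup>+y. ennreal (\<Phi> \<bar>b y\<bar>) \<partial>N)"
proof -
  obtain s where s: "\<And>a. 0 \<le> s a" "\<And>a b. 0 \<le> a \<Longrightarrow> 0 \<le> b \<Longrightarrow> \<Phi> a + s a * (b - a) \<le> \<Phi> b"
    using subgradient by auto
  \<comment> \<open>The term \<open>s a * a\<close> is added on both sides so that nothing has to be
    subtracted in \<open>ennreal\<close>; it is finite and cancels at the end.\<close>
  have "ennreal (\<Phi> a) + ennreal (s a * a) \<le> ennreal (\<Phi> a) + ennreal (s a) * (\<integral>\<^sup>+y. ennreal \<bar>b y\<bar> \<partial>N)"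
    using a s(1) by (subst ennreal_mult) (auto intro!: add_left_mono mult_left_mono)
  also have "\<dots> = (\<integral>\<^sup>+y. ennreal (\<Phi> a) + ennreal (s a) * ennreal \<bar>b y\<bar> \<partial>N)"
    by (subst nn_integral_add) (auto simp: nn_integral_cmult assms(1))
  also have "\<dots> \<le> (\<integral>\<^sup>+y. ennreal (\<Phi> \<bar>b y\<bar>) + ennreal (s a * a) \<partial>N)"
  proof (rule nn_integral_mono)
    fix y
    have "\<Phi> a + s a * \<bar>b y\<bar> \<le> \<Phi> \<bar>b y\<bar> + s a * a" using s(2)[of a "\<bar>b y\<bar>"] a by (simp add: algebra_simps)
    then show "ennreal (\<Phi> a) + ennreal (s a) * ennreal \<bar>b y\<bar> \<le> ennreal (\<Phi> \<bar>b y\<bar>) + ennreal (s a * a)"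
      using a s(1) nonneg by (simp add: ennreal_mult[symmetric] ennreal_plus[symmetric] del: ennreal_plus)
  qed
  also have "\<dots> = (\<integral>\<^sup>+y. ennreal (\<Phi> \<bar>b y\<bar>) \<partial>N) + ennreal (s a * a)"
    by (subst nn_integral_add) (auto simp: assms(1))
  finally have "ennreal (s a * a) + ennreal (\<Phi> a) \<le> ennreal (s a * a) + (\<integral>\<^sup>+y. ennreal (\<Phi> \<bar>b y\<bar>) \<partial>N)"
    by (simp only: add.commute)
  then show ?thesis unfolding ennreal_add_left_cancel_le by simp
qed

lemma orlicz_iff: "orlicz \<Phi> M f \<longleftrightarrow> f \<in> borel_measurable M \<and> (\<exists>k>0. modl M (\<lambda>x. f x / k) < \<infinity>)"
  unfolding orlicz_def modl_def by (auto simp: abs_divide)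

lemma lux_eq: "lux \<Phi> M f = Inf {k. k > 0 \<and> modl M (\<lambda>x. f x / k) \<le> 1}"
  unfolding lux_def modl_def by (intro arg_cong[where f=Inf] Collect_cong conj_cong) (auto simp: abs_divide)

lemma modl_div_mono: "0 < k \<Longrightarrow> k \<le> l \<Longrightarrow> modl M (\<lambda>x. f x / l) \<le> modl M (\<lambda>x. f x / k)"
  by (rule modl_mono) (auto simp: abs_divide intro: frac_le)

lemma lux_le: "0 < k \<Longrightarrow> modl M (\<lambda>x. f x / k) \<le> 1 \<Longrightarrow> lux \<Phi> M f \<le> k"
  unfolding lux_eq by (rule cInf_lower) (auto intro!: bdd_belowI[of _ 0])

text \<open>By convexity a further division by \<open>1 + m\<close> brings a modular of at most
  \<open>m\<close> below m/(1+m); the summand 1 covers m = 0.\<close>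

lemma modl_div_finite_le:
  assumes k: "k > 0" and [measurable]: "f \<in> borel_measurable M" and le: "modl M (\<lambda>x. f x / k) \<le> ennreal m" and m: "0 \<le> m"
  shows "modl M (\<lambda>x. f x / (k * (1 + m))) \<le> 1"
proof -
  have "modl M (\<lambda>x. (1 / (1 + m)) * (f x / k)) \<le> ennreal (1 / (1 + m)) * modl M (\<lambda>x. f x / k)"
    by (rule modl_scale) (use m in auto)
  also have "\<dots> \<le> ennreal (1 / (1 + m)) * ennreal m" by (intro mult_left_mono le) auto
  also have "\<dots> \<le> 1" using m by (simp add: ennreal_mult[symmetric] divide_simps)
  finally show ?thesis by (simp add: mult.commute)
qed

lemma lux_le_modl:
  assumes "k > 0" "f \<in> borel_measurable M" "modl M (\<lambda>x. f x / k) \<le> ennreal m" "0 \<le> m"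
  shows "lux \<Phi> M f \<le> k * (1 + m)"
  using assms by (intro lux_le modl_div_finite_le) auto

lemma orlicz_lux_nonempty:
  assumes "orlicz \<Phi> M f" shows "\<exists>k>0. modl M (\<lambda>x. f x / k) \<le> 1"
proof -
  obtain k where k: "k > 0" "modl M (\<lambda>x. f x / k) < \<infinity>" and m: "f \<in> borel_measurable M"
    using assms unfolding orlicz_iff by blast
  then obtain m where "modl M (\<lambda>x. f x / k) = ennreal m" "0 \<le> m" by (cases "modl M (\<lambda>x. f x / k)") auto
  then show ?thesis using k m modl_div_finite_le[of k f M m] by (intro exI[of _ "k * (1 + m)"]) auto
qed

lemma lux_nonneg: assumes "orlicz \<Phi> M f" shows "0 \<le> lux \<Phi> M f"
  unfolding lux_eq by (rule cInf_greatest) (use orlicz_lux_nonempty[OF assms] in auto)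

text \<open>The strict inequality spares the question whether the infimum defining the norm is
  attained.\<close>

lemma modl_lux_less:
  assumes "orlicz \<Phi> M f" "lux \<Phi> M f < k" shows "modl M (\<lambda>x. f x / k) \<le> 1"
proof -
  obtain l where l: "l > 0" "modl M (\<lambda>x. f x / l) \<le> 1" "l < k"
    using cInf_lessD[OF _ assms(2)[unfolded lux_eq]] orlicz_lux_nonempty[OF assms(1)] by auto
  then show ?thesis using modl_div_mono[of l k M f] by (meson less_imp_le order_trans)
qed

text \<open>On the interval up to \<open>l * C\<close> the convex function lies below its chord from
  0. For uniformly bounded functions, convergence in L1 therefore forces convergence in modular at
  every scale.\<close>

lemma modl_bounded_L1:
  assumes [measurable]: "f \<in> borel_measurable M" and C: "C > 0" "AE x in M. \<bar>f x\<bar> \<le> C" and l: "0 \<le> l" and I: "integrable M f"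
  shows "modl M (\<lambda>x. l * f x) \<le> ennreal (\<Phi> (l * C) / C * (\<integral>x. \<bar>f x\<bar> \<partial>M))"
proof -
  have "modl M (\<lambda>x. l * f x) \<le> (\<integral>\<^sup>+x. ennreal (\<Phi> (l * C) / C) * ennreal \<bar>f x\<bar> \<partial>M)"
    unfolding modl_def
  proof (rule nn_integral_mono_AE, use C(2) in eventually_elim)
    case (elim x)
    have "\<Phi> ((\<bar>f x\<bar> / C) * (l * C)) \<le> (\<bar>f x\<bar> / C) * \<Phi> (l * C)"
      using elim C l by (intro scale) auto
    then have "\<Phi> \<bar>l * f x\<bar> \<le> \<Phi> (l * C) / C * \<bar>f x\<bar>" using C l by (simp add: abs_mult mult.commute)
    then show ?case using C l by (subst ennreal_mult[symmetric]) (auto intro!: ennreal_leI divide_nonneg_pos nonneg)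
  qed
  also have "\<dots> = ennreal (\<Phi> (l * C) / C) * (\<integral>\<^sup>+x. ennreal \<bar>f x\<bar> \<partial>M)" by (rule nn_integral_cmult) measurable
  also have "\<dots> = ennreal (\<Phi> (l * C) / C) * ennreal (\<integral>x. \<bar>f x\<bar> \<partial>M)"
    using I by (subst nn_integral_eq_integral) auto
  also have "\<dots> = ennreal (\<Phi> (l * C) / C * (\<integral>x. \<bar>f x\<bar> \<partial>M))"
    using C l by (subst ennreal_mult) (auto intro!: divide_nonneg_pos nonneg)
  finally show ?thesis .
qed

lemma modl_integrable:
  assumes "finite_measure M" and [measurable]: "f \<in> borel_measurable M" and k: "k > 0" and fin: "modl M (\<lambda>x. f x / k) < \<infinity>"
  shows "integrable M f"
proof -
  interpret finite_measure M by fact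
  obtain L where L: "L \<ge> 0" "\<And>t. t \<ge> 0 \<Longrightarrow> t \<le> L + 1 * \<Phi> t" using superlinear[of 1] by auto
  have "integrable M (\<lambda>x. \<Phi> \<bar>f x / k\<bar>)"
    using fin unfolding modl_def by (intro integrableI_nonneg AE_I2 nonneg) (auto simp del: abs_divide)
  then have "integrable M (\<lambda>x. k * (L + \<Phi> \<bar>f x / k\<bar>))" by auto
  then show ?thesis
  proof (rule Bochner_Integration.integrable_bound)
    show "AE x in M. norm (f x) \<le> norm (k * (L + \<Phi> \<bar>f x / k\<bar>))"
    proof (rule AE_I2)
      fix x
      have "\<bar>f x / k\<bar> \<le> L + \<Phi> \<bar>f x / k\<bar>" using L(2)[of "\<bar>f x / k\<bar>"] by simp
      then have "\<bar>f x\<bar> \<le> k * (L + \<Phi> \<bar>f x / k\<bar>)" using k by (simp add: abs_divide field_simps)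
      then show "norm (f x) \<le> norm (k * (L + \<Phi> \<bar>f x / k\<bar>))" by simp
    qed
  qed simp
qed

lemma orlicz_integrable: "finite_measure M \<Longrightarrow> orlicz \<Phi> M f \<Longrightarrow> integrable M f"
  unfolding orlicz_iff using modl_integrable by blast

lemma bounded_orlicz:
  assumes "finite_measure M" and [measurable]: "f \<in> borel_measurable M" and "AE x in M. \<bar>f x\<bar> \<le> C"
  shows "orlicz \<Phi> M f"
proof -
  interpret finite_measure M by fact
  have "modl M f \<le> (\<integral>\<^sup>+x. ennreal (\<Phi> \<bar>C\<bar>) \<partial>M)" unfolding modl_def
    using assms(3) by (intro nn_integral_mono_AE) (auto intro!: ennreal_leI mono elim!: eventually_mono)
  also have "\<dots> < \<infinity>" by (simp add: ennreal_mult_less_top emeasure_eq_measure)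
  finally show ?thesis unfolding orlicz_iff by (auto intro!: exI[of _ 1])
qed

lemma bounded_lux_le:
  assumes "prob_space M" and [measurable]: "f \<in> borel_measurable M" and C: "AE x in M. \<bar>f x\<bar> \<le> C" "0 < C" 
  shows "lux \<Phi> M f \<le> C * (1 + \<Phi> 1)"
proof (rule lux_le_modl)
  interpret prob_space M by fact
  have "modl M (\<lambda>x. f x / C) \<le> (\<integral>\<^sup>+x. ennreal (\<Phi> 1) \<partial>M)" unfolding modl_def
    using C by (intro nn_integral_mono_AE) (auto intro!: ennreal_leI mono elim!: eventually_mono)
  then show "modl M (\<lambda>x. f x / C) \<le> ennreal (\<Phi> 1)" by (simp add: emeasure_space_1)
qed (use assms nonneg[of 1] in auto)

text \<open>The doubling condition is iterated until the power of 2 exceeds \<open>l\<close>. Since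
  it holds only from a threshold on, the values below it are paid for by the additive constant
  \<open>L\<close>, harmless on a finite measure space.\<close>

lemma delta2_bound:
  assumes "delta2 \<Phi>" "l \<ge> 0" shows "\<exists>K L. 0 \<le> K \<and> 0 \<le> L \<and> (\<forall>t\<ge>0. \<Phi> (l * t) \<le> K * \<Phi> t + L)"
proof -
  obtain k t0 where k: "t0 \<ge> 0" "\<And>t. t \<ge> t0 \<Longrightarrow> \<Phi> (2 * t) \<le> k * \<Phi> t" using assms(1) unfolding delta2_def by blast
  \<comment> \<open>The doubling constant comes without a sign, hence its absolute value.\<close>
  have two: "\<Phi> (2 * t) \<le> \<bar>k\<bar> * \<Phi> t + \<Phi> (2 * t0)" if t: "t \<ge> 0" for t
  proof (cases "t \<ge> t0")
    case True
    have "\<Phi> (2 * t) \<le> \<bar>k\<bar> * \<Phi> t" using k(2)[OF True] nonneg[OF t] by (smt (verit) mult_right_mono)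
    then show ?thesis using nonneg[of "2 * t0"] k by simp
  next
    case False
    then have "\<Phi> (2 * t) \<le> \<Phi> (2 * t0)" using t by (intro mono) auto
    then show ?thesis using nonneg[OF t] by (smt (verit) mult_nonneg_nonneg abs_ge_zero)
  qed
  have pw: "\<exists>K L. 0 \<le> K \<and> 0 \<le> L \<and> (\<forall>t\<ge>0. \<Phi> (2 ^ n * t) \<le> K * \<Phi> t + L)" for n
  proof (induction n)
    case 0 show ?case by (rule exI[of _ 1], rule exI[of _ 0]) auto
  next
    case (Suc n)
    then obtain K L where KL: "0 \<le> K" "0 \<le> L" "\<And>t. t \<ge> 0 \<Longrightarrow> \<Phi> (2 ^ n * t) \<le> K * \<Phi> t + L" by blast
    have "\<Phi> (2 ^ Suc n * t) \<le> (\<bar>k\<bar> * K) * \<Phi> t + (\<bar>k\<bar> * L + \<Phi> (2 * t0))" if "t \<ge> 0" for t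
    proof -
      have "\<Phi> (2 * (2 ^ n * t)) \<le> \<bar>k\<bar> * \<Phi> (2 ^ n * t) + \<Phi> (2 * t0)" by (rule two) (use that in auto)
      also have "\<bar>k\<bar> * \<Phi> (2 ^ n * t) \<le> \<bar>k\<bar> * (K * \<Phi> t + L)" by (intro mult_left_mono KL that) auto
      finally show ?thesis by (simp add: algebra_simps)
    qed
    then show ?case using KL nonneg[of "2 * t0"] k(1) by (intro exI[of _ "\<bar>k\<bar> * K"] exI[of _ "\<bar>k\<bar> * L + \<Phi> (2 * t0)"]) auto
  qed
  obtain n where n: "l \<le> 2 ^ n" using real_arch_pow[of 2 l] by (auto intro: less_imp_le)
  obtain K L where "0 \<le> K" "0 \<le> L" "\<And>t. t \<ge> 0 \<Longrightarrow> \<Phi> (2 ^ n * t) \<le> K * \<Phi> t + L" using pw by blast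
  moreover have "\<Phi> (l * t) \<le> \<Phi> (2 ^ n * t)" if "t \<ge> 0" for t
    using n that \<open>l \<ge> 0\<close> by (intro mono mult_right_mono) auto
  ultimately show ?thesis by (meson order_trans)
qed

lemma delta2_modl_finite:
  assumes "delta2 \<Phi>" "finite_measure M" "orlicz \<Phi> M f"
  shows "modl M (\<lambda>x. l * f x) < \<infinity>"
proof -
  interpret finite_measure M by fact
  obtain k where k: "k > 0" "modl M (\<lambda>x. f x / k) < \<infinity>" and [measurable]: "f \<in> borel_measurable M"
    using assms(3) unfolding orlicz_iff by blast
  obtain K L where KL: "0 \<le> K" "0 \<le> L" "\<And>t. t \<ge> 0 \<Longrightarrow> \<Phi> (\<bar>l\<bar> * k * t) \<le> K * \<Phi> t + L"
    using delta2_bound[OF assms(1), of "\<bar>l\<bar> * k"] k by auto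
  have "modl M (\<lambda>x. l * f x) \<le> (\<integral>\<^sup>+x. ennreal K * ennreal (\<Phi> \<bar>f x / k\<bar>) + ennreal L \<partial>M)"
    unfolding modl_def
  proof (rule nn_integral_mono)
    fix x
    have "\<Phi> \<bar>l * f x\<bar> \<le> K * \<Phi> \<bar>f x / k\<bar> + L" using KL(3)[of "\<bar>f x / k\<bar>"] k by (simp add: abs_mult abs_divide)
    then show "ennreal (\<Phi> \<bar>l * f x\<bar>) \<le> ennreal K * ennreal (\<Phi> \<bar>f x / k\<bar>) + ennreal L"
      using KL nonneg by (simp add: ennreal_mult[symmetric] ennreal_plus[symmetric] ennreal_leI del: ennreal_plus)
  qed
  also have "\<dots> = ennreal K * modl M (\<lambda>x. f x / k) + ennreal L * emeasure M (space M)"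
    unfolding modl_def by (subst nn_integral_add) (auto simp: nn_integral_cmult simp del: abs_divide)
  also have "\<dots> < \<infinity>" using k by (simp add: ennreal_mult_less_top emeasure_eq_measure)
  finally show ?thesis .
qed

lemma modl_trunc_tendsto:
  assumes [measurable]: "f \<in> borel_measurable M" and "modl M (\<lambda>x. l * f x) < \<infinity>"
  shows "(\<lambda>m. modl M (\<lambda>x. l * (f x - trunc m (f x)))) \<longlonglongrightarrow> 0"
proof -
  have "(\<lambda>m. modl M (\<lambda>x. l * (f x - trunc m (f x)))) \<longlonglongrightarrow> (\<integral>\<^sup>+x. 0 \<partial>M)"
    unfolding modl_def
  proof (rule nn_integral_dominated_convergence[where w="\<lambda>x. ennreal (\<Phi> \<bar>l * f x\<bar>)"])
    show "(\<integral>\<^sup>+x. ennreal (\<Phi> \<bar>l * f x\<bar>) \<partial>M) < \<infinity>" using assms(2) unfolding modl_def .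
    show "AE x in M. ennreal (\<Phi> \<bar>l * (f x - trunc m (f x))\<bar>) \<le> ennreal (\<Phi> \<bar>l * f x\<bar>)" for m
      using trunc_diff_le by (intro AE_I2 ennreal_leI mono) (auto simp: abs_mult intro!: mult_left_mono)
    show "AE x in M. (\<lambda>m. ennreal (\<Phi> \<bar>l * (f x - trunc m (f x))\<bar>)) \<longlonglongrightarrow> 0"
    proof (rule AE_I2)
      fix x
      obtain m0 :: nat where "\<bar>f x\<bar> \<le> real m0" using real_arch_simple by blast
      then have "\<forall>m\<ge>m0. ennreal (\<Phi> \<bar>l * (f x - trunc m (f x))\<bar>) = 0"
        using zero by (auto simp: trunc_eq)
      then show "(\<lambda>m. ennreal (\<Phi> \<bar>l * (f x - trunc m (f x))\<bar>)) \<longlonglongrightarrow> 0"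
        by (intro tendsto_eventually) (auto simp: eventually_sequentially)
    qed
  qed auto
  then show ?thesis by simp
qed

section \<open>The conjugate function and the product inequality\<close>

lemma young_conj_bdd: "bdd_above ((\<lambda>s. s * t - \<Phi> s) ` {0..})"
proof (cases "t \<le> 0")
  case True
  have "s * t - \<Phi> s \<le> 0" if "s \<ge> 0" for s using nonneg[OF that] True that by (smt (verit) mult_nonneg_nonpos)
  then show ?thesis by (auto intro!: bdd_aboveI2[where M=0])
next
  case False
  \<comment> \<open>With the coefficient 1/t the term in \<Phi>(s) cancels after multiplication by
    t. Boundedness matters because the supremum in the definition of the conjugate is one of real
    numbers.\<close>
  then obtain L where L: "\<And>s. s \<ge> 0 \<Longrightarrow> s \<le> L + (1 / t) * \<Phi> s" using superlinear[of "1 / t"] by auto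
  have "s * t - \<Phi> s \<le> L * t" if "s \<ge> 0" for s using L[OF that] False by (simp add: field_simps)
  then show ?thesis by (auto intro!: bdd_aboveI2[where M="L * t"])
qed

lemma young_ineq: "0 \<le> s \<Longrightarrow> s * t \<le> \<Phi> s + young_conj \<Phi> t"
  using cSUP_upper[OF _ young_conj_bdd, of s t] unfolding young_conj_def by (auto simp: algebra_simps)

text \<open>For s up to \<open>x\<close> the product with the chord slope is at most \<Phi>(x) and
  the term -\<Phi>(s) is dropped; for larger s convexity puts the chord through \<open>x\<close>
  below \<Phi>(s), and the difference is at most 0.\<close>

lemma young_conj_slope: assumes "x > 0" shows "young_conj \<Phi> (\<Phi> x / x) \<le> \<Phi> x"
  unfolding young_conj_def
proof (rule cSUP_least)
  fix s :: real assume "s \<in> {0..}"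
  then have s: "0 \<le> s" by simp
  show "s * (\<Phi> x / x) - \<Phi> s \<le> \<Phi> x"
  proof (cases "s \<le> x")
    case True
    then have "s * (\<Phi> x / x) \<le> x * (\<Phi> x / x)" using assms nonneg[of x] by (intro mult_right_mono) auto
    then show ?thesis using nonneg[OF s] assms by simp
  next
    case False
    then have "\<Phi> ((x / s) * s) \<le> (x / s) * \<Phi> s" using assms by (intro scale) auto
    then have "s * (\<Phi> x / x) \<le> \<Phi> s" using False assms by (simp add: field_simps)
    then show ?thesis using nonneg[of x] assms by simp
  qed
qed auto

text \<open>The slopes \<open>\<Phi> x / x\<close> and \<open>\<Phi> y / y\<close> inserted into the \<open>\<Delta>'\<close>-condition of the conjugate
  give the reverse inequality for \<open>\<Phi>\<close> itself.\<close>
lemma delta_prime_conj: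
  assumes "delta_prime (young_conj \<Phi>)"
  shows "\<exists>b>0. \<forall>x\<ge>0. \<forall>y\<ge>0. \<Phi> x * \<Phi> y \<le> \<Phi> (b * x * y)"
proof -
  obtain \<beta> where b: "\<beta> > 0" "\<And>t s. t \<ge> 0 \<Longrightarrow> s \<ge> 0 \<Longrightarrow> young_conj \<Phi> (t * s) \<le> \<beta> * young_conj \<Phi> t * young_conj \<Phi> s"
    using assms unfolding delta_prime_def by blast
  have conj_nonneg: "0 \<le> young_conj \<Phi> t" for t using young_ineq[of 0 t] zero by simp
  have "\<Phi> x * \<Phi> y \<le> \<Phi> ((\<beta> + 1) * x * y)" if xy: "x > 0" "y > 0" for x y
  proof -
    define s where "s = (\<Phi> x / x) * (\<Phi> y / y)"
    have "young_conj \<Phi> s \<le> \<beta> * young_conj \<Phi> (\<Phi> x / x) * young_conj \<Phi> (\<Phi> y / y)"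
      unfolding s_def using xy nonneg[of x] nonneg[of y] by (intro b) auto
    also have "\<dots> \<le> \<beta> * \<Phi> x * \<Phi> y"
      using b(1) xy young_conj_slope[OF xy(1)] young_conj_slope[OF xy(2)] nonneg[of x]
      by (intro mult_mono mult_nonneg_nonneg conj_nonneg) auto
    \<comment> \<open>Young's inequality at the point (\<beta>+1)xy. Of the \<beta>+1 copies of
      \<Phi>(x)\<Phi>(y) on the left, \<beta> cancel against the bound for the conjugate and exactly
      one remains.\<close>
    finally have "(\<beta> + 1) * x * y * s \<le> \<Phi> ((\<beta> + 1) * x * y) + \<beta> * \<Phi> x * \<Phi> y"
      using young_ineq[of "(\<beta> + 1) * x * y" s] b xy by auto
    moreover have "(\<beta> + 1) * x * y * s = (\<beta> + 1) * \<Phi> x * \<Phi> y" using xy by (simp add: s_def)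
    ultimately show ?thesis by (simp add: algebra_simps)
  qed
  then have "\<Phi> x * \<Phi> y \<le> \<Phi> ((\<beta> + 1) * x * y)" if "x \<ge> 0" "y \<ge> 0" for x y
    using that zero by (cases "x = 0 \<or> y = 0") auto
  then show ?thesis using b by (intro exI[of _ "\<beta> + 1"]) auto
qed

text \<open>For k below the norm the modular at scale k exceeds 1. Multiplied by \<Phi>(k), the
  integrand is bounded through the product inequality by a function free of k; then k increases to
  the norm, by continuity of \<Phi>.\<close>

lemma delta_prime_lux:
  assumes b: "b > 0" "\<And>x y. x \<ge> 0 \<Longrightarrow> y \<ge> 0 \<Longrightarrow> \<Phi> x * \<Phi> y \<le> \<Phi> (b * x * y)"
    and f: "orlicz \<Phi> M f"
  shows "ennreal (\<Phi> (lux \<Phi> M f)) \<le> modl M (\<lambda>x. b * f x)"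
proof (cases "lux \<Phi> M f = 0")
  case False
  have [measurable]: "f \<in> borel_measurable M" using f by (simp add: orlicz_iff)
  define L where "L = lux \<Phi> M f"
  have L: "L > 0" using False lux_nonneg[OF f] by (simp add: L_def)
  have le: "ennreal (\<Phi> k) \<le> modl M (\<lambda>x. b * f x)" if k: "0 < k" "k < L" for k
  proof -
    have "\<not> modl M (\<lambda>x. f x / k) \<le> 1" using lux_le[of k M f] k by (auto simp: L_def)
    then have "ennreal (\<Phi> k) * 1 \<le> ennreal (\<Phi> k) * modl M (\<lambda>x. f x / k)" by (intro mult_left_mono) auto
    also have "\<dots> = (\<integral>\<^sup>+x. ennreal (\<Phi> k) * ennreal (\<Phi> \<bar>f x / k\<bar>) \<partial>M)"
      unfolding modl_def by (rule nn_integral_cmult[symmetric]) measurable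
    also have "\<dots> \<le> modl M (\<lambda>x. b * f x)" unfolding modl_def
    proof (rule nn_integral_mono)
      fix x
      have "\<Phi> k * \<Phi> \<bar>f x / k\<bar> \<le> \<Phi> \<bar>b * f x\<bar>" using b(2)[of k "\<bar>f x / k\<bar>"] k b(1) by (simp add: abs_mult abs_divide)
      then show "ennreal (\<Phi> k) * ennreal (\<Phi> \<bar>f x / k\<bar>) \<le> ennreal (\<Phi> \<bar>b * f x\<bar>)"
        using k nonneg by (simp add: ennreal_mult[symmetric] ennreal_leI)
    qed
    finally show ?thesis by simp
  qed
  have "((\<lambda>k. \<Phi> \<bar>k\<bar>) \<longlongrightarrow> \<Phi> \<bar>L\<bar>) (at_left L)"
    using cont_abs by (auto simp: continuous_on_def intro: tendsto_within_subset)
  then have "((\<lambda>k. ennreal (\<Phi> \<bar>k\<bar>)) \<longlongrightarrow> ennreal (\<Phi> \<bar>L\<bar>)) (at_left L)" by (intro tendsto_ennrealI)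
  moreover have "eventually (\<lambda>k. ennreal (\<Phi> \<bar>k\<bar>) \<le> modl M (\<lambda>x. b * f x)) (at_left L)"
    using eventually_at_left_real[of 0 L] L by (auto elim!: eventually_mono intro: le)
  ultimately have "ennreal (\<Phi> \<bar>L\<bar>) \<le> modl M (\<lambda>x. b * f x)" by (intro tendsto_upperbound) auto
  then show ?thesis using L by (simp add: L_def)
qed (simp add: zero)

end

section \<open>Weak compactness\<close>

lemma LIMSEQ_approx:
  fixes x :: "nat \<Rightarrow> real"
  assumes "\<And>e. e > 0 \<Longrightarrow> \<exists>y l'. y \<longlonglongrightarrow> l' \<and> (\<forall>n. \<bar>x n - y n\<bar> \<le> e) \<and> \<bar>l - l'\<bar> \<le> e"
  shows "x \<longlonglongrightarrow> l"
proof (rule LIMSEQ_I)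
  fix e :: real assume "0 < e"
  then obtain y l' where y: "y \<longlonglongrightarrow> l'" "\<And>n. \<bar>x n - y n\<bar> \<le> e / 4" "\<bar>l - l'\<bar> \<le> e / 4"
    using assms[of "e / 4"] by auto
  obtain N where N: "\<And>n. n \<ge> N \<Longrightarrow> \<bar>y n - l'\<bar> < e / 4" using LIMSEQ_D[OF y(1), of "e / 4"] \<open>0 < e\<close> by auto
  then have "norm (x n - l) < e" if "n \<ge> N" for n using y(2)[of n] y(3) N[OF that] unfolding real_norm_def by argo
  then show "\<exists>no. \<forall>n\<ge>no. norm (x n - l) < e" by blast
qed

lemma convergent_approx:
  fixes x :: "nat \<Rightarrow> real"
  assumes "\<And>e. e > 0 \<Longrightarrow> \<exists>y. convergent y \<and> (\<forall>n. \<bar>x n - y n\<bar> \<le> e)"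
  shows "convergent x"
proof -
  have "Cauchy x"
  proof (rule CauchyI)
    fix e :: real assume "0 < e"
    then obtain y where y: "convergent y" "\<And>n. \<bar>x n - y n\<bar> \<le> e / 4"
      using assms[of "e / 4"] by auto
    obtain N where N: "\<And>m n. m \<ge> N \<Longrightarrow> n \<ge> N \<Longrightarrow> \<bar>y m - y n\<bar> < e / 4" 
      using CauchyD[OF convergent_Cauchy[OF y(1)], of "e / 4"] \<open>0 < e\<close> by auto
    have "norm (x m - x n) < e" if "m \<ge> N" "n \<ge> N" for m n using y(2)[of n] y(2)[of m] N[OF that] unfolding real_norm_def by argo
    then show "\<exists>M. \<forall>m\<ge>M. \<forall>n\<ge>M. norm (x m - x n) < e" by blast
  qed
  then show ?thesis by (simp add: Cauchy_convergent_iff)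
qed

text \<open>Weak convergence in L1, with test functions bounded everywhere on the space;
  \<open>wconv_AE_bounded\<close> later admits those bounded almost everywhere.\<close>

definition wconv :: "'a measure \<Rightarrow> (nat \<Rightarrow> 'a \<Rightarrow> real) \<Rightarrow> ('a \<Rightarrow> real) \<Rightarrow> bool" where
  "wconv M v u \<longleftrightarrow> (\<forall>F\<in>borel_measurable M. (\<exists>C. \<forall>x\<in>space M. \<bar>F x\<bar> \<le> C) \<longrightarrow>
     (\<lambda>n. \<integral>x. v n x * F x \<partial>M) \<longlonglongrightarrow> (\<integral>x. u x * F x \<partial>M))"

lemma wconvD: 
  assumes "wconv M v u" "F \<in> borel_measurable M" "\<And>x. x \<in> space M \<Longrightarrow> \<bar>F x\<bar> \<le> C"
  shows "(\<lambda>n. \<integral>x. v n x * F x \<partial>M) \<longlonglongrightarrow> (\<integral>x. u x * F x \<partial>M)"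
  using assms unfolding wconv_def by blast

lemma wconv_subseq: "wconv M v u \<Longrightarrow> strict_mono r \<Longrightarrow> wconv M (v \<circ> r) u"
  unfolding wconv_def using LIMSEQ_subseq_LIMSEQ by (fastforce simp: o_def)

definition unif_int :: "'a measure \<Rightarrow> (nat \<Rightarrow> 'a \<Rightarrow> real) \<Rightarrow> bool" where
  "unif_int M v \<longleftrightarrow> (\<forall>n. integrable M (v n)) \<and> (\<exists>B. \<forall>n. (\<integral>x. \<bar>v n x\<bar> \<partial>M) \<le> B) \<and>
     (\<forall>e>0. \<exists>d>0. \<forall>n. \<forall>A\<in>sets M. measure M A < d \<longrightarrow> (\<integral>x. \<bar>v n x\<bar> * indicator A x \<partial>M) \<le> e)"

lemma integrable_mult_bounded:
  fixes v F :: "'a \<Rightarrow> real"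
  assumes "integrable M v" "F \<in> borel_measurable M" "AE x in M. \<bar>F x\<bar> \<le> C"
  shows "integrable M (\<lambda>x. v x * F x)"
proof (rule Bochner_Integration.integrable_bound)
  show "integrable M (\<lambda>x. C * v x)" using assms by simp
  show "AE x in M. norm (v x * F x) \<le> norm (C * v x)" using assms(3)
  proof eventually_elim
    case (elim x)
    then have "\<bar>F x\<bar> * \<bar>v x\<bar> \<le> \<bar>C\<bar> * \<bar>v x\<bar>" by (intro mult_right_mono) auto
    then show ?case by (simp add: abs_mult mult.commute)
  qed
qed (use assms in auto)

section \<open>Uniform integrability and the Dunford-Pettis theorem\<close>

lemma unif_int_mono:
  assumes "unif_int M v" and "\<And>n. w n \<in> borel_measurable M" and le: "\<And>n x. \<bar>w n x\<bar> \<le> \<bar>v n x\<bar>"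
  shows "unif_int M w"
proof -
  have v: "integrable M (v n)" for n using assms unfolding unif_int_def by blast
  have w: "integrable M (w n)" for n
    by (rule Bochner_Integration.integrable_bound[OF v]) (use assms in auto)
  have vA: "integrable M (\<lambda>x. \<bar>v n x\<bar> * indicator A x)" "integrable M (\<lambda>x. \<bar>w n x\<bar> * indicator A x)" if "A \<in> sets M" for n A
    by (intro integrable_mult_bounded[where C=1] integrable_abs v w; use that in \<open>auto simp: indicator_def\<close>)+
  have 1: "(\<integral>x. \<bar>w n x\<bar> \<partial>M) \<le> (\<integral>x. \<bar>v n x\<bar> \<partial>M)" for n
    using v w le by (intro integral_mono) auto
  have 2: "(\<integral>x. \<bar>w n x\<bar> * indicator A x \<partial>M) \<le> (\<integral>x. \<bar>v n x\<bar> * indicator A x \<partial>M)" if "A \<in> sets M" for n A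
    using vA[OF that] le by (intro integral_mono mult_right_mono) auto
  show ?thesis using assms(1) w unfolding unif_int_def using 1 2 by (meson order_trans)
qed

lemma unif_int_subseq: "unif_int M v \<Longrightarrow> unif_int M (v \<circ> r)"
  unfolding unif_int_def o_def by meson

text \<open>For nonnegative functions the indefinite integrals \<open>a n\<close> are measures, and
  so is their limit, which makes the Radon-Nikodym theorem for measures sufficient. The signed case
  is treated by positive and negative parts.\<close>

locale dp_nonneg = finite_measure M for M :: "'a measure" +
  fixes v :: "nat \<Rightarrow> 'a \<Rightarrow> real"
  assumes ui: "unif_int M v" and vnn: "\<And>n x. 0 \<le> v n x"
begin

definition a where "a n A = (\<integral>x. v n x * indicator A x \<partial>M)"

lemma vint: "integrable M (v n)" using ui unfolding unif_int_def by blast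

lemma vmeas[measurable]: "v n \<in> borel_measurable M" using vint by auto

lemma vA: "A \<in> sets M \<Longrightarrow> integrable M (\<lambda>x. v n x * indicator A x)"
  by (intro integrable_mult_bounded[where C=1] vint) (auto simp: indicator_def)

lemma a_nonneg: "0 \<le> a n A" unfolding a_def using vnn by simp

lemma a_bound: "\<exists>B. \<forall>n. \<forall>A\<in>sets M. a n A \<le> B"
proof -
  obtain B where B: "\<And>n. (\<integral>x. \<bar>v n x\<bar> \<partial>M) \<le> B" using ui unfolding unif_int_def by blast
  have "a n A \<le> B" if "A \<in> sets M" for n A
  proof -
    have "a n A \<le> (\<integral>x. \<bar>v n x\<bar> \<partial>M)" unfolding a_def
      using vint vA[OF that] vnn by (intro integral_mono) (auto simp: indicator_def)
    then show ?thesis using B[of n] by simp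
  qed
  then show ?thesis by blast
qed

lemma a_ui: "e > 0 \<Longrightarrow> \<exists>d>0. \<forall>n. \<forall>A\<in>sets M. measure M A < d \<longrightarrow> a n A \<le> e"
  using ui vnn unfolding unif_int_def a_def by simp

lemma a_union: 
  assumes "A \<in> sets M" "B \<in> sets M" "A \<inter> B = {}" shows "a n (A \<union> B) = a n A + a n B"
proof -
  have "v n x * indicator (A \<union> B) x = v n x * indicator A x + v n x * indicator B x" for x
    using assms(3) by (auto simp: indicator_def)
  then show ?thesis unfolding a_def using vA assms by simp
qed

lemma a_empty: "a n {} = 0" by (simp add: a_def)

lemma a_null: "A \<in> null_sets M \<Longrightarrow> a n A = 0"
  unfolding a_def by (rule integral_eq_zero_AE) (auto dest: AE_not_in elim!: eventually_mono)

lemma a_finite: "finite I \<Longrightarrow> (\<And>i. i \<in> I \<Longrightarrow> A i \<in> sets M) \<Longrightarrow> disjoint_family_on A I \<Longrightarrow> a n (\<Union>i\<in>I. A i) = (\<Sum>i\<in>I. a n (A i))"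
proof (induction I rule: finite_induct)
  case (insert i I)
  then have "a n (A i \<union> (\<Union>i\<in>I. A i)) = a n (A i) + a n (\<Union>i\<in>I. A i)"
    by (intro a_union sets.finite_UN) (auto simp: disjoint_family_on_def)
  then show ?case using insert by (auto simp: disjoint_family_on_def)
qed (simp add: a_empty)

lemma a_tail:
  assumes A: "range A \<subseteq> sets M" "disjoint_family A" and e: "e > 0"
  shows "\<exists>m0::nat. \<forall>m\<ge>m0. \<forall>n. \<bar>a n (\<Union>i. A i) - (\<Sum>i<m. a n (A i))\<bar> \<le> e"
proof -
  obtain d where d: "d > 0" "\<And>n A. A \<in> sets M \<Longrightarrow> measure M A < d \<Longrightarrow> a n A \<le> e" using a_ui[OF e] by blast
  have [measurable]: "A i \<in> sets M" for i using A by blast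
  have "(\<lambda>m. measure M (\<Union>i<m. A i)) \<longlonglongrightarrow> measure M (\<Union>m. (\<Union>i<m. A i))"
    by (rule finite_Lim_measure_incseq) (auto simp: incseq_def; force)+
  moreover have "(\<Union>m. (\<Union>i<m. A i)) = (\<Union>i. A i)" by auto
  ultimately have "(\<lambda>m. measure M (\<Union>i<m. A i)) \<longlonglongrightarrow> measure M (\<Union>i. A i)" by simp
  then obtain m0 where m0: "\<And>m. m \<ge> m0 \<Longrightarrow> \<bar>measure M (\<Union>i<m. A i) - measure M (\<Union>i. A i)\<bar> < d"
    using LIMSEQ_D[of _ _ d] d(1) by (metis real_norm_def)
  have "\<bar>a n (\<Union>i. A i) - (\<Sum>i<m. a n (A i))\<bar> \<le> e" if "m \<ge> m0" for n m
  proof -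
    let ?T = "(\<Union>i. A i) - (\<Union>i<m. A i)"
    have "measure M ?T = measure M (\<Union>i. A i) - measure M (\<Union>i<m. A i)"
      by (rule finite_measure_Diff) auto
    then have "a n ?T \<le> e" using m0[OF that] by (intro d) auto
    moreover have "a n (?T \<union> (\<Union>i<m. A i)) = a n ?T + a n (\<Union>i<m. A i)" by (intro a_union) auto
    moreover have "?T \<union> (\<Union>i<m. A i) = (\<Union>i. A i)" by auto
    moreover have "a n (\<Union>i<m. A i) = (\<Sum>i<m. a n (A i))"
      using A(2) by (intro a_finite) (auto simp: disjoint_family_on_def)
    ultimately show ?thesis using a_nonneg[of n ?T] by simp
  qed
  then show ?thesis by blast
qed

text \<open>The sets where some \<open>v n\<close> is below a rational level generate a
  sigma-algebra for which all \<open>v n\<close> are measurable. Their finite intersections are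
  still countable in number, as a diagonal argument requires, although the sigma-algebra of
  \<open>M\<close> may not be countably generated.\<close>

lemma generator:
  obtains C where "countable C" "Int_stable C" "C \<subseteq> sets M" "space M \<in> C" 
    "\<And>n. v n \<in> borel_measurable (sigma (space M) C)"
proof -
  define B where "B = insert (space M) (range (\<lambda>(n, q::rat). {x \<in> space M. v n x < of_rat q}))"
  \<comment> \<open>Intersecting with \<open>space M\<close> gives the empty intersection a meaning
    and puts the whole space into \<open>C\<close>.\<close>
  define C where "C = (\<lambda>X. space M \<inter> \<Inter>X) ` {X. X \<subseteq> B \<and> finite X}"
  have Bs: "B \<subseteq> sets M" by (auto simp: B_def)
  have "countable B" by (auto simp: B_def)
  then have 1: "countable C" unfolding C_def 
    by (intro countable_image) (metis (no_types, lifting) Collect_cong conj_commute countable_Collect_finite_subset)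
  have 2: "Int_stable C"
  proof (rule Int_stableI)
    fix a b assume "a \<in> C" "b \<in> C"
    then obtain X Y where "a = space M \<inter> \<Inter>X" "X \<subseteq> B" "finite X" "b = space M \<inter> \<Inter>Y" "Y \<subseteq> B" "finite Y"
      by (auto simp: C_def)
    then show "a \<inter> b \<in> C" unfolding C_def by (intro image_eqI[of _ _ "X \<union> Y"]) auto
  qed
  have Cs: "C \<subseteq> sets M"
  proof
    fix A assume "A \<in> C"
    then obtain X where X: "A = space M \<inter> \<Inter>X" "X \<subseteq> B" "finite X" by (auto simp: C_def)
    show "A \<in> sets M"
    proof (cases "X = {}")
      case False then show ?thesis using X Bs sets.finite_INT[of X id M] by (auto intro!: sets.Int)
    qed (use X in simp)
  qed
  have 4: "space M \<in> C" unfolding C_def by (rule image_eqI[of _ _ "{}"]) auto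
  have BC: "B \<subseteq> C"
  proof
    fix b assume b: "b \<in> B"
    then have "b \<subseteq> space M" using Bs sets.sets_into_space by blast
    then show "b \<in> C" unfolding C_def using b by (intro image_eqI[of _ _ "{b}"]) auto
  qed
  have CP: "C \<subseteq> Pow (space M)" using Cs sets.sets_into_space by blast
  have 5: "v n \<in> borel_measurable (sigma (space M) C)" for n
    unfolding borel_measurable_iff_less
  proof
    fix c :: real
    have "{x \<in> space M. v n x < c} = (\<Union>q\<in>{q::rat. of_rat q < c}. {x \<in> space M. v n x < of_rat q})"
      using of_rat_dense by (auto intro: less_trans) (metis of_rat_dense)
    also have "\<dots> \<in> sets (sigma (space M) C)"
    proof (intro sets.countable_UN')
      have "{x \<in> space M. v n x < of_rat q} \<in> B" for q unfolding B_def by (rule insertI2, rule range_eqI[of _ _ "(n, q)"]) simp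
      then show "(\<lambda>q. {x \<in> space M. v n x < of_rat q}) ` {q. of_rat q < c} \<subseteq> sets (sigma (space M) C)" using BC CP by auto
    qed auto
    finally show "{w \<in> space (sigma (space M) C). v n w < c} \<in> sets (sigma (space M) C)" using CP by simp
  qed
  show ?thesis by (rule that[OF 1 2 Cs 4 5])
qed

text \<open>A diagonal subsequence converges on the countable generator, hence on all of the
  sigma-algebra \<open>G\<close> that it generates; the limit measure has a density. A test function
  that is not \<open>G\<close>-measurable is replaced by its conditional expectation on
  \<open>G\<close>, which changes no integral against \<open>v n\<close> or the density.\<close>

lemma dunford_pettis: "\<exists>r u. strict_mono r \<and> integrable M u \<and> (\<forall>x. 0 \<le> u x) \<and> wconv M (v \<circ> r) u"
proof -
  obtain C where C: "countable C" "Int_stable C" "C \<subseteq> sets M" "space M \<in> C" 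
    and vG': "\<And>n. v n \<in> borel_measurable (sigma (space M) C)" using generator by blast
  define G where "G = sigma (space M) C"
  have CP: "C \<subseteq> Pow (space M)" using C(3) sets.sets_into_space by blast
  have sG: "space G = space M" "sets G = sigma_sets (space M) C" unfolding G_def using CP by auto
  have GM: "sets G \<subseteq> sets M" unfolding sG using C(3) sets.sigma_sets_subset by blast
  have sub: "subalgebra M G" unfolding subalgebra_def using sG(1) GM by simp
  interpret G: finite_measure_subalgebra M G by unfold_locales (rule sub)
  have vG[measurable]: "v n \<in> borel_measurable G" for n using vG' by (simp add: G_def)
  obtain B where B: "\<And>n A. A \<in> sets M \<Longrightarrow> a n A \<le> B" using a_bound by blast
  define A where "A = from_nat_into C"
  have rA: "range A = C" unfolding A_def using C by (intro range_from_nat_into) auto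
  interpret D: subseqs "\<lambda>k s. convergent (\<lambda>n. a (s n) (A k))"
  proof
    fix k and s :: "nat \<Rightarrow> nat"
    have "A k \<in> sets M" using rA C by blast
    then have "bounded (range (\<lambda>n. a (s n) (A k)))" unfolding bounded_iff 
      using a_nonneg B by (auto intro!: exI[of _ B])
    then obtain l r where "strict_mono r" "((\<lambda>n. a (s n) (A k)) \<circ> r) \<longlonglongrightarrow> l"
      using bounded_imp_convergent_subsequence by blast
    then show "\<exists>r'. strict_mono r' \<and> convergent (\<lambda>n. a ((s \<circ> r') n) (A k))" by (auto simp: o_def convergent_def)
  qed
  define r where "r = D.diagseq"
  have r: "strict_mono r" unfolding r_def by (rule D.subseq_diagseq)
  have cC: "convergent (\<lambda>n. a (r n) E)" if "E \<in> C" for E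
  proof -
    obtain k where k: "E = A k" using rA \<open>E \<in> C\<close> by (metis imageE)
    have "convergent (\<lambda>n. a ((D.diagseq \<circ> (+) (Suc k)) n) (A k))"
    proof (rule D.diagseq_holds)
      fix r s :: "nat \<Rightarrow> nat" and n assume "strict_mono r" "convergent (\<lambda>m. a (s m) (A n))"
      then show "convergent (\<lambda>m. a ((s \<circ> r) m) (A n))"
        using convergent_subseq_convergent[of "\<lambda>m. a (s m) (A n)" r] by (simp add: o_def)
    qed
    then have "convergent (\<lambda>n. a (r (n + Suc k)) E)" by (simp add: r_def k add.commute)
    then show ?thesis by (subst (asm) convergent_ignore_initial_segment)
  qed
  have cG: "convergent (\<lambda>n. a (r n) E)" if "E \<in> sets G" for E
    using C(2) CP that[unfolded sG(2)]
  proof (induction rule: sigma_sets_induct_disjoint)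
    case (basic E) then show ?case by (rule cC)
  next
    case empty then show ?case by (simp add: a_empty convergent_const)
  next
    case (compl E)
    then have "E \<in> sets M" using GM sG by blast
    then have "a n (E \<union> (space M - E)) = a n E + a n (space M - E)" for n by (intro a_union) auto
    moreover have "E \<union> (space M - E) = space M" using \<open>E \<in> sets M\<close> sets.sets_into_space by blast
    ultimately have "a n (space M - E) = a n (space M) - a n E" for n by simp
    then show ?case using convergent_diff[OF cC[OF C(4)] compl(2)] by simp
  next
    \<comment> \<open>Here \<open>a_tail\<close> makes the values on the union a uniform limit of
      finite sums of convergent sequences.\<close>
    case (union E)
    have E: "range E \<subseteq> sets M" using union GM sG by blast
    show ?case
    proof (rule convergent_approx)
      fix e :: real assume "e > 0"
      then obtain m where "\<And>n. \<bar>a n (\<Union>i. E i) - (\<Sum>i<m. a n (E i))\<bar> \<le> e" using a_tail[OF E union(1)] by blast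
      then show "\<exists>y. convergent y \<and> (\<forall>n. \<bar>a (r n) (\<Union>i. E i) - y n\<bar> \<le> e)"
        using union(3) by (intro exI[of _ "\<lambda>n. \<Sum>i<m. a (r n) (E i)"] conjI convergent_sum) auto
    qed
  qed
  define \<nu> where "\<nu> E = lim (\<lambda>n. a (r n) E)" for E
  have lim: "(\<lambda>n. a (r n) E) \<longlonglongrightarrow> \<nu> E" if "E \<in> sets G" for E
    unfolding \<nu>_def using cG[OF that] by (simp add: convergent_LIMSEQ_iff)
  have nn: "0 \<le> \<nu> E" if "E \<in> sets G" for E using LIMSEQ_le_const[OF lim[OF that]] a_nonneg by blast
  define N where "N = measure_of (space M) (sets G) (\<lambda>E. ennreal (\<nu> E))"
  have sumsN: "(\<lambda>i. \<nu> (E i)) sums \<nu> (\<Union>i. E i)" if E: "range E \<subseteq> sets G" "disjoint_family E" for E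
    unfolding sums_def
  proof (rule LIMSEQ_I)
    fix e :: real assume "e > 0"
    then obtain m0 where m0: "\<And>m n. m \<ge> m0 \<Longrightarrow> \<bar>a n (\<Union>i. E i) - (\<Sum>i<m. a n (E i))\<bar> \<le> e / 2"
      using a_tail[of E "e/2"] E order_trans[OF E(1) GM] by (metis half_gt_zero)
    have "norm ((\<Sum>i<m. \<nu> (E i)) - \<nu> (\<Union>i. E i)) < e" if "m \<ge> m0" for m
    proof -
      have "(\<lambda>n. \<bar>a (r n) (\<Union>i. E i) - (\<Sum>i<m. a (r n) (E i))\<bar>) \<longlonglongrightarrow> \<bar>\<nu> (\<Union>i. E i) - (\<Sum>i<m. \<nu> (E i))\<bar>"
        using E by (intro tendsto_intros lim) auto
      then have "\<bar>\<nu> (\<Union>i. E i) - (\<Sum>i<m. \<nu> (E i))\<bar> \<le> e / 2" using m0[OF that] by (intro LIMSEQ_le_const2) auto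
      then show ?thesis using \<open>e > 0\<close> by (simp add: abs_minus_commute)
    qed
    then show "\<exists>no. \<forall>n\<ge>no. norm ((\<Sum>i<n. \<nu> (E i)) - \<nu> (\<Union>i. E i)) < e" by blast
  qed
  have emN: "emeasure N E = ennreal (\<nu> E)" if "E \<in> sets G" for E
    unfolding N_def
  proof (rule emeasure_measure_of_sigma)
    show "sigma_algebra (space M) (sets G)" using sets.sigma_algebra_axioms[of G] sG(1) by simp
    have "\<nu> {} = 0" unfolding \<nu>_def by (simp add: a_empty)
    then show "positive (sets G) (\<lambda>E. ennreal (\<nu> E))" by (simp add: positive_def)
    show "countably_additive (sets G) (\<lambda>E. ennreal (\<nu> E))"
    proof (rule countably_additiveI)
      fix E :: "nat \<Rightarrow> 'a set" assume E: "range E \<subseteq> sets G" "disjoint_family E"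
      show "(\<Sum>i. ennreal (\<nu> (E i))) = ennreal (\<nu> (\<Union>i. E i))"
        using E by (intro suminf_ennreal_eq sumsN nn) auto
    qed
  qed fact
  have setsN: "sets N = sets G" "space N = space M" unfolding N_def using sG by (metis sets.sets_measure_of_eq, metis sets.space_measure_of_eq)
  define MG where "MG = restr_to_subalg M G"
  have sMG: "sets MG = sets G" "space MG = space M" unfolding MG_def by (rule sets_restr_to_subalg[OF sub], rule space_restr_to_subalg)
  interpret MG: finite_measure MG unfolding MG_def by (rule finite_measure_restr_to_subalg[OF sub]) unfold_locales 
  have "absolutely_continuous MG N" unfolding absolutely_continuous_def
  proof
    fix E assume "E \<in> null_sets MG"
    then have E: "E \<in> null_sets M" "E \<in> sets G" unfolding MG_def null_sets_restr_to_subalg[OF sub] by auto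
    have "\<nu> E = 0" unfolding \<nu>_def using a_null[OF E(1)] by simp
    then show "E \<in> null_sets N" using emN[OF E(2)] setsN E(2) by (auto intro: null_setsI)
  qed
  moreover have "finite_measure N" by (rule finite_measureI) (use emN[of "space M"] sG setsN sets.top[of G] in auto)
  ultimately obtain f where f: "f \<in> borel_measurable MG" "density MG f = N"
    using MG.Radon_Nikodym_finite_measure[of N] setsN sMG by auto
  have fG[measurable]: "f \<in> borel_measurable G" using f(1) measurable_cong_sets[OF sMG(1) HOL.refl] by blast
  have fM[measurable]: "f \<in> borel_measurable M" using measurable_from_subalg[OF sub fG] .
  have fint: "(\<integral>\<^sup>+x. f x * indicator E x \<partial>M) = ennreal (\<nu> E)" if E: "E \<in> sets G" for E
  proof -
    have [measurable]: "E \<in> sets G" by fact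
    have "(\<integral>\<^sup>+x. f x * indicator E x \<partial>M) = (\<integral>\<^sup>+x. f x * indicator E x \<partial>MG)"
      
    proof (rule nn_integral_subalgebra[symmetric])
      show "(\<lambda>x. f x * indicator E x) \<in> borel_measurable MG"
        using f(1) E sMG by (intro borel_measurable_times_ennreal borel_measurable_indicator) auto
    qed (use sMG GM emeasure_restr_to_subalg[OF sub] in \<open>auto simp: MG_def\<close>)
    also have "\<dots> = emeasure (density MG f) E" using f(1) E sMG by (subst emeasure_density) auto
    finally show ?thesis using f emN[OF E] by simp
  qed
  have "(\<integral>\<^sup>+x. f x \<partial>M) = ennreal (\<nu> (space M))"
    using fint[of "space M"] sets.top[of G] sG(1) by (metis (no_types, lifting) indicator_simps(1) mult.right_neutral nn_integral_cong)
  then have fin: "(\<integral>\<^sup>+x. f x \<partial>M) < \<infinity>" by simp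
  define u where "u x = enn2real (f x)" for x
  have uf: "AE x in M. ennreal (u x) = f x"
    using nn_integral_PInf_AE[OF fM] fin by (auto simp: u_def less_top elim!: eventually_mono)
  have [measurable]: "u \<in> borel_measurable M" "u \<in> borel_measurable G" unfolding u_def[abs_def] by measurable
  have uint: "integrable M u"
    by (rule integrableI_nonneg) (use fin nn_integral_cong_AE[OF uf] in \<open>auto simp: u_def\<close>)
  have uE: "(\<integral>x. u x * indicator E x \<partial>M) = \<nu> E" if E: "E \<in> sets G" for E
  proof -
    have EM[measurable]: "E \<in> sets M" using E GM by blast
    have "(\<integral>\<^sup>+x. ennreal (u x * indicator E x) \<partial>M) = (\<integral>\<^sup>+x. f x * indicator E x \<partial>M)"
      using uf by (intro nn_integral_cong_AE) (auto elim!: eventually_mono simp: indicator_def)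
    then show ?thesis
      using fint[OF E] nn[OF E] by (subst integral_eq_nn_integral) (auto simp: u_def)
  qed
  have conG: "(\<lambda>n. \<integral>x. v (r n) x * F x \<partial>M) \<longlonglongrightarrow> (\<integral>x. u x * F x \<partial>M)"
    if F[measurable]: "F \<in> borel_measurable G" and K: "\<And>x. x \<in> space M \<Longrightarrow> \<bar>F x\<bar> \<le> K" for F K
  proof (rule LIMSEQ_approx)
    fix e :: real assume e: "e > 0"
    have FM[measurable]: "F \<in> borel_measurable M" by (rule measurable_from_subalg[OF sub F])
    define D where "D = max (\<bar>B\<bar>) (\<integral>x. u x \<partial>M)"
    \<comment> \<open>The mesh 1/m is small against \<open>D\<close>, a common bound for the masses
      of all \<open>v n\<close> and of \<open>u\<close>.\<close>
    obtain m :: nat where m: "D / e < real m" "m > 0" using reals_Archimedean2[of "max (D / e) 0"] by auto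
    define J where "J = {- \<lceil>real m * \<bar>K\<bar>\<rceil> - 1..\<lceil>real m * \<bar>K\<bar>\<rceil> + 1}"
    define E where "E j = {x \<in> space M. \<lfloor>real m * F x\<rfloor> = j}" for j
    \<comment> \<open>\<open>F\<close> rounded down to multiples of 1/m. Boundedness of
      \<open>F\<close> makes \<open>J\<close> finite, so convergence on sets gives convergence of
      the integrals against \<open>Fm\<close>.\<close>
    define Fm where "Fm x = (\<Sum>j\<in>J. (real_of_int j / real m) * indicator (E j) x)" for x
    have EG: "E j \<in> sets G" for j unfolding E_def sG(1)[symmetric] by measurable
    have EM[measurable]: "E j \<in> sets M" for j using EG GM by blast
    have Fm: "Fm x = real_of_int \<lfloor>real m * F x\<rfloor> / real m" if x: "x \<in> space M" for x
    proof -
      have b: "\<bar>real m * F x\<bar> \<le> real m * \<bar>K\<bar>" using K[OF x] by (simp add: abs_mult mult_left_mono)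
      have "\<lfloor>real m * F x\<rfloor> \<in> J" using b unfolding J_def by (auto; linarith)
      then show ?thesis unfolding Fm_def using x
        by (subst sum.remove[of _ "\<lfloor>real m * F x\<rfloor>"]) (auto simp: J_def E_def intro!: sum.neutral)
    qed
    have Fm_close: "\<bar>F x - Fm x\<bar> \<le> 1 / real m" if x: "x \<in> space M" for x
    proof -
      have "\<bar>real m * F x - real_of_int \<lfloor>real m * F x\<rfloor>\<bar> \<le> 1" by linarith
      then have "\<bar>(real m * F x - real_of_int \<lfloor>real m * F x\<rfloor>) / real m\<bar> \<le> 1 / real m"
        using m by (simp add: divide_right_mono)
      then show ?thesis using m Fm[OF x] by (simp add: diff_divide_distrib)
    qed
    have [measurable]: "Fm \<in> borel_measurable M" unfolding Fm_def[abs_def] by measurable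
    have intFm: "(\<integral>x. w x * Fm x \<partial>M) = (\<Sum>j\<in>J. (real_of_int j / real m) * (\<integral>x. w x * indicator (E j) x \<partial>M))" if w: "integrable M w" for w
    proof -
      have "integrable M (\<lambda>x. w x * indicator (E j) x)" for j by (intro integrable_mult_bounded[where C=1] w) (auto simp: indicator_def)
      then show ?thesis unfolding Fm_def sum_distrib_left
        by (subst Bochner_Integration.integral_sum) (auto simp: mult.left_commute intro!: sum.cong)
    qed
    have close: "\<bar>(\<integral>x. w x * F x \<partial>M) - (\<integral>x. w x * Fm x \<partial>M)\<bar> \<le> e" 
      if w: "integrable M w" "\<And>x. 0 \<le> w x" "(\<integral>x. w x \<partial>M) \<le> D" for w
    proof -
      have FK: "AE x in M. \<bar>F x\<bar> \<le> K" using K by simp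
      have FmK: "AE x in M. \<bar>Fm x\<bar> \<le> K + 1 / real m" 
      proof (rule AE_I2)
        fix x assume "x \<in> space M"
        then show "\<bar>Fm x\<bar> \<le> K + 1 / real m" using K[of x] Fm_close[of x] by linarith
      qed
      have i: "integrable M (\<lambda>x. w x * F x)" "integrable M (\<lambda>x. w x * Fm x)"
        using integrable_mult_bounded[OF w(1) FM FK] integrable_mult_bounded[OF w(1) _ FmK] by auto
      have "\<bar>(\<integral>x. w x * F x \<partial>M) - (\<integral>x. w x * Fm x \<partial>M)\<bar> = \<bar>\<integral>x. w x * (F x - Fm x) \<partial>M\<bar>"
        using i by (simp add: right_diff_distrib)
      also have "\<dots> \<le> (\<integral>x. \<bar>w x * (F x - Fm x)\<bar> \<partial>M)" by (rule integral_abs_bound)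
      also have "\<dots> \<le> (\<integral>x. w x * (1 / real m) \<partial>M)"
      proof (rule integral_mono)
        show "integrable M (\<lambda>x. \<bar>w x * (F x - Fm x)\<bar>)" using Bochner_Integration.integrable_diff[OF i] by (simp add: right_diff_distrib)
        show "\<bar>w x * (F x - Fm x)\<bar> \<le> w x * (1 / real m)" if "x \<in> space M" for x
          using Fm_close[OF that] w(2)[of x] by (simp add: abs_mult mult_left_mono del: times_divide_eq_right)
      qed (use w in auto)
      also have "\<dots> = (\<integral>x. w x \<partial>M) / real m" by simp
      also have "\<dots> \<le> D / real m" using w(3) by (simp add: divide_right_mono)
      also have "\<dots> \<le> e" using m e by (simp add: field_simps)
      finally show ?thesis .
    qed
    have lim2: "(\<lambda>n. \<integral>x. v (r n) x * Fm x \<partial>M) \<longlonglongrightarrow> (\<integral>x. u x * Fm x \<partial>M)"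
      unfolding intFm[OF vint] intFm[OF uint] uE[OF EG] a_def[symmetric]
      by (intro tendsto_intros lim EG)
    have vD: "(\<integral>x. v n x \<partial>M) \<le> D" for n
    proof -
      have "(\<integral>x. v n x \<partial>M) = a n (space M)" unfolding a_def by (intro Bochner_Integration.integral_cong) auto
      then show ?thesis using B[of "space M" n] by (simp add: D_def)
    qed
    show "\<exists>y l'. y \<longlonglongrightarrow> l' \<and> (\<forall>n. \<bar>(\<integral>x. v (r n) x * F x \<partial>M) - y n\<bar> \<le> e) \<and> \<bar>(\<integral>x. u x * F x \<partial>M) - l'\<bar> \<le> e"
      by (rule exI[of _ "\<lambda>n. \<integral>x. v (r n) x * Fm x \<partial>M"], rule exI[of _ "\<integral>x. u x * Fm x \<partial>M"])
         (use lim2 close[OF vint vnn vD] close[OF uint] in \<open>auto simp: D_def u_def\<close>)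
  qed
  have "wconv M (v \<circ> r) u" unfolding wconv_def
  proof (intro ballI impI)
    fix F :: "'a \<Rightarrow> real" assume F[measurable]: "F \<in> borel_measurable M" and "\<exists>C. \<forall>x\<in>space M. \<bar>F x\<bar> \<le> C"
    then obtain K where K: "\<And>x. x \<in> space M \<Longrightarrow> \<bar>F x\<bar> \<le> K" by blast
    have FI: "integrable M F" by (rule integrable_const_bound[of _ K]) (use K in auto)
    \<comment> \<open>The conditional expectation is bounded only almost everywhere; it is clamped
      so that the convergence for everywhere bounded functions applies.\<close>
    define E where "E x = max (-K) (min K (real_cond_exp M G F x))" for x
    have [measurable]: "E \<in> borel_measurable G" unfolding E_def[abs_def] by measurable
    have EM: "E \<in> borel_measurable M" by (rule measurable_from_subalg[OF sub]) simp
    have "AE x in M. real_cond_exp M G F x \<le> K" "AE x in M. real_cond_exp M G F x \<ge> -K"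
      using G.real_cond_exp_le_c[OF FI, of K] G.real_cond_exp_ge_c[OF FI, of "-K"] K by (auto simp: abs_le_iff minus_le_iff)
    then have EE: "AE x in M. E x = real_cond_exp M G F x" by eventually_elim (simp add: E_def)
    have eq: "(\<integral>x. w x * E x \<partial>M) = (\<integral>x. w x * F x \<partial>M)" if w: "integrable M w" "w \<in> borel_measurable G" for w
    proof -
      have "(\<integral>x. w x * E x \<partial>M) = (\<integral>x. w x * real_cond_exp M G F x \<partial>M)"
        using EE w EM by (intro integral_cong_AE borel_measurable_times) (auto elim!: eventually_mono)
      also have "\<dots> = (\<integral>x. w x * F x \<partial>M)"
        using w K by (intro G.real_cond_exp_intg(2) integrable_mult_bounded[where C=K]) auto
      finally show ?thesis .
    qed
    show "(\<lambda>n. \<integral>x. (v \<circ> r) n x * F x \<partial>M) \<longlonglongrightarrow> (\<integral>x. u x * F x \<partial>M)"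
      using conG[of E "\<bar>K\<bar>"] eq[OF vint vG] eq[OF uint] by (auto simp: E_def)
  qed
  then show ?thesis using r uint by (intro exI[of _ r] exI[of _ u]) (auto simp: u_def)
qed

end

theorem dunford_pettis:
  assumes "finite_measure M" "unif_int M v"
  shows "\<exists>r u. strict_mono r \<and> integrable M u \<and> wconv M (v \<circ> r) u"
proof -
  interpret finite_measure M by fact
  have vm[measurable]: "v n \<in> borel_measurable M" and vi: "integrable M (v n)" for n using assms(2) unfolding unif_int_def by auto
  define p q where "p n x = max (v n x) 0" and "q n x = max (- v n x) 0" for n x
  have up: "unif_int M p" "unif_int M q"
    by (rule unif_int_mono[OF assms(2)]; auto simp: p_def[abs_def] q_def[abs_def])+
  interpret p: dp_nonneg M p by unfold_locales (use up in \<open>auto simp: p_def\<close>)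
  obtain r1 u1 where 1: "strict_mono r1" "integrable M u1" "wconv M (p \<circ> r1) u1" using p.dunford_pettis by blast
  interpret q: dp_nonneg M "q \<circ> r1" by unfold_locales (use unif_int_subseq[OF up(2)] in \<open>auto simp: q_def\<close>)
  obtain r2 u2 where 2: "strict_mono r2" "integrable M u2" "wconv M ((q \<circ> r1) \<circ> r2) u2" using q.dunford_pettis by blast
  have 3: "wconv M ((p \<circ> r1) \<circ> r2) u1" by (rule wconv_subseq[OF 1(3) 2(1)])
  have "wconv M (v \<circ> (r1 \<circ> r2)) (\<lambda>x. u1 x - u2 x)" unfolding wconv_def
  proof (intro ballI impI)
    fix F :: "'a \<Rightarrow> real" assume F[measurable]: "F \<in> borel_measurable M" and b: "\<exists>C. \<forall>x\<in>space M. \<bar>F x\<bar> \<le> C"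
    then obtain C where C: "AE x in M. \<bar>F x\<bar> \<le> C" by auto
    have pi: "integrable M (p n)" "integrable M (q n)" for n using up unfolding unif_int_def by auto
    have "v n x = p n x - q n x" for n x by (auto simp: p_def q_def max_def)
    then have eq: "(\<integral>x. v n x * F x \<partial>M) = (\<integral>x. p n x * F x \<partial>M) - (\<integral>x. q n x * F x \<partial>M)" for n
      using integrable_mult_bounded[OF _ F C] pi by (simp add: left_diff_distrib)
    have equ: "(\<integral>x. (u1 x - u2 x) * F x \<partial>M) = (\<integral>x. u1 x * F x \<partial>M) - (\<integral>x. u2 x * F x \<partial>M)"
      using integrable_mult_bounded[OF _ F C] 1 2 by (simp add: left_diff_distrib)
    show "(\<lambda>n. \<integral>x. (v \<circ> (r1 \<circ> r2)) n x * F x \<partial>M) \<longlonglongrightarrow> (\<integral>x. (u1 x - u2 x) * F x \<partial>M)"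
      unfolding o_def eq equ using 2(3) 3 b F unfolding wconv_def o_def by (intro tendsto_diff) auto
  qed
  then show ?thesis using 1 2 by (intro exI[of _ "r1 \<circ> r2"] exI[of _ "\<lambda>x. u1 x - u2 x"]) (auto intro: strict_mono_o)
qed

section \<open>Weak compactness of modular balls\<close>

context young
begin

text \<open>The criterion of de la Vallee-Poussin: \<bar>v\<bar> is at most a constant plus a small
  multiple of \<Phi>(\<bar>v\<bar>/k), and the integrals of the latter are at most 1.\<close>

lemma modl_unif_int:
  assumes "finite_measure M" and [measurable]: "\<And>n. v n \<in> borel_measurable M" and k: "k > 0"
    and b: "\<And>n::nat. modl M (\<lambda>x. v n x / k) \<le> 1"
  shows "unif_int M v"
proof -
  interpret finite_measure M by fact
  have vi: "integrable M (v n)" for n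
    using b[of n] by (intro modl_integrable[OF assms(1) _ k]) (auto simp: le_less_trans)
  have \<Phi>i: "integrable M (\<lambda>x. \<Phi> \<bar>v n x / k\<bar>)" for n
    using b[of n] unfolding modl_def
    by (intro integrableI_nonneg AE_I2 nonneg) (auto simp del: abs_divide simp: le_less_trans)
  have \<Phi>1: "(\<integral>x. \<Phi> \<bar>v n x / k\<bar> \<partial>M) \<le> 1" for n
  proof -
    have "ennreal (\<integral>x. \<Phi> \<bar>v n x / k\<bar> \<partial>M) \<le> 1"
      using b[of n] nn_integral_eq_integral[OF \<Phi>i[of n]] nonneg unfolding modl_def by simp
    then show ?thesis by simp
  qed
  have main: "\<exists>L\<ge>0. \<forall>n. \<forall>A\<in>sets M. (\<integral>x. \<bar>v n x\<bar> * indicator A x \<partial>M) \<le> L * measure M A + e" if e: "e > 0" for e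
  proof -
    obtain L where L: "L \<ge> 0" "\<And>t. t \<ge> 0 \<Longrightarrow> t \<le> L + (e / k) * \<Phi> t" using superlinear[of "e / k"] e k by auto
    have "(\<integral>x. \<bar>v n x\<bar> * indicator A x \<partial>M) \<le> (k * L) * measure M A + e" if A[measurable]: "A \<in> sets M" for n A
    proof -
      have "(\<integral>x. \<bar>v n x\<bar> * indicator A x \<partial>M) \<le> (\<integral>x. (k * L) * indicator A x + e * \<Phi> \<bar>v n x / k\<bar> \<partial>M)"
      proof (rule integral_mono)
        show "integrable M (\<lambda>x. \<bar>v n x\<bar> * indicator A x)"
          by (intro integrable_mult_bounded[where C=1] integrable_abs vi) (auto simp: indicator_def)
        have "integrable M (\<lambda>x. indicator A x :: real)" by (simp add: integrable_indicator_iff less_top[symmetric])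
        then show "integrable M (\<lambda>x. (k * L) * indicator A x + e * \<Phi> \<bar>v n x / k\<bar>)"
          using \<Phi>i[of n] by (intro Bochner_Integration.integrable_add integrable_mult_right)
        fix x
        have "\<bar>v n x\<bar> = k * \<bar>v n x / k\<bar>" using k by (simp add: abs_divide)
        also have "\<dots> \<le> k * (L + (e / k) * \<Phi> \<bar>v n x / k\<bar>)" using k by (intro mult_left_mono L) auto
        also have "\<dots> = k * L + e * \<Phi> \<bar>v n x / k\<bar>" using k by (simp add: algebra_simps)
        finally show "\<bar>v n x\<bar> * indicator A x \<le> (k * L) * indicator A x + e * \<Phi> \<bar>v n x / k\<bar>"
          using e nonneg[of "\<bar>v n x / k\<bar>"] by (auto simp: indicator_def simp del: abs_divide)
      qed
      also have "\<dots> = (k * L) * measure M A + e * (\<integral>x. \<Phi> \<bar>v n x / k\<bar> \<partial>M)"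
        using \<Phi>i[of n] by (subst Bochner_Integration.integral_add) (auto simp del: abs_divide simp: integrable_indicator_iff less_top[symmetric])
      also have "\<dots> \<le> (k * L) * measure M A + e" using \<Phi>1[of n] e by (simp del: abs_divide)
      finally show ?thesis .
    qed
    then show ?thesis using L k by (intro exI[of _ "k * L"]) auto
  qed
  show ?thesis unfolding unif_int_def
  proof (intro conjI allI impI)
    show "integrable M (v n)" for n by (rule vi)
    obtain L where "\<And>n A. A \<in> sets M \<Longrightarrow> (\<integral>x. \<bar>v n x\<bar> * indicator A x \<partial>M) \<le> L * measure M A + 1"
      using main[of 1] by auto
    from this[of "space M"] have "(\<integral>x. \<bar>v n x\<bar> * indicator (space M) x \<partial>M) \<le> L * measure M (space M) + 1" for n by simp
    moreover have "(\<integral>x. \<bar>v n x\<bar> * indicator (space M) x \<partial>M) = (\<integral>x. \<bar>v n x\<bar> \<partial>M)" for n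
      by (intro Bochner_Integration.integral_cong) auto
    ultimately have "(\<integral>x. \<bar>v n x\<bar> \<partial>M) \<le> L * measure M (space M) + 1" for n by simp
    then show "\<exists>B. \<forall>n. (\<integral>x. \<bar>v n x\<bar> \<partial>M) \<le> B" by blast
    fix e :: real assume e: "e > 0"
    obtain L where L: "L \<ge> 0" "\<And>n A. A \<in> sets M \<Longrightarrow> (\<integral>x. \<bar>v n x\<bar> * indicator A x \<partial>M) \<le> L * measure M A + e / 2"
      using main[of "e / 2"] e by auto
    \<comment> \<open>The summand 1 in the threshold avoids a division by 0 when \<open>L\<close> is
      0.\<close>
    have "(\<integral>x. \<bar>v n x\<bar> * indicator A x \<partial>M) \<le> e" if "A \<in> sets M" "measure M A < e / (2 * (L + 1))" for n A
    proof -
      have "L * measure M A \<le> (L + 1) * (e / 2 / (L + 1))" using that L(1) by (intro mult_mono) auto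
      also have "\<dots> = e / 2" using L(1) by (subst nonzero_mult_div_cancel_left[symmetric, of "L + 1"]) auto
      finally show ?thesis using L(2)[OF that(1), of n] by simp
    qed
    then show "\<exists>d>0. \<forall>n. \<forall>A\<in>sets M. measure M A < d \<longrightarrow> (\<integral>x. \<bar>v n x\<bar> * indicator A x \<partial>M) \<le> e"
      using e L(1) by (intro exI[of _ "e / (2 * (L + 1))"]) auto
  qed
qed

text \<open>Weak lower semicontinuity by supporting lines: \<Phi> at \<open>v n\<close> is bounded
  below by the line that supports it at \<open>u\<close>. Its linear part pairs \<open>v n\<close>
  with one fixed function, bounded on the set where \<bar>u\<bar> is at most \<open>j\<close>, so
  the limit in \<open>n\<close> is admissible there; then \<open>j\<close> grows.\<close>

lemma modl_wconv:
  assumes "finite_measure M" and w: "wconv M v u" and ui: "integrable M u" and vi: "\<And>n. integrable M (v n)"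
    and b: "\<And>n. modl M (v n) \<le> ennreal m" and m: "0 \<le> m"
  shows "modl M u \<le> ennreal m"
proof -
  interpret finite_measure M by fact
  have [measurable]: "u \<in> borel_measurable M" "\<And>n. v n \<in> borel_measurable M" using ui vi by auto
  obtain s where s: "\<And>a. 0 \<le> s a" "mono_on UNIV s" "\<And>a b. 0 \<le> a \<Longrightarrow> 0 \<le> b \<Longrightarrow> \<Phi> a + s a * (b - a) \<le> \<Phi> b"
    using subgradient by auto
  have [measurable]: "s \<in> borel_measurable borel" by (rule borel_measurable_mono) (rule s(2))
  have \<Phi>i: "integrable M (\<lambda>x. \<Phi> \<bar>v n x\<bar>)" for n
    using b[of n] unfolding modl_def by (intro integrableI_nonneg AE_I2 nonneg) (auto intro: le_less_trans)
  have \<Phi>1: "(\<integral>x. \<Phi> \<bar>v n x\<bar> \<partial>M) \<le> m" for n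
  proof -
    have "ennreal (\<integral>x. \<Phi> \<bar>v n x\<bar> \<partial>M) \<le> ennreal m"
      using b[of n] nn_integral_eq_integral[OF \<Phi>i[of n]] nonneg unfolding modl_def by simp
    then show ?thesis using m by simp
  qed
  define A where "A j = {x \<in> space M. \<bar>u x\<bar> \<le> real j}" for j
  have [measurable]: "A j \<in> sets M" for j unfolding A_def by measurable
  have main: "(\<integral>\<^sup>+x. ennreal (\<Phi> \<bar>u x\<bar> * indicator (A j) x) \<partial>M) \<le> ennreal m" for j
  proof -
    define F where "F x = s \<bar>u x\<bar> * sgn (u x) * indicator (A j) x" for x
    have [measurable]: "F \<in> borel_measurable M" unfolding F_def[abs_def] by measurable
    have Fb: "\<bar>F x\<bar> \<le> s (real j)" for x
      using s(1) mono_onD[OF s(2), of "\<bar>u x\<bar>" "real j"] by (auto simp: F_def A_def indicator_def abs_mult abs_sgn_eq)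
    have Fi: "integrable M (\<lambda>x. v n x * F x)" "integrable M (\<lambda>x. u x * F x)" for n
      by (intro integrable_mult_bounded[where C="s (real j)"] vi ui AE_I2 Fb; simp)+
    have \<Phi>A: "integrable M (\<lambda>x. \<Phi> \<bar>u x\<bar> * indicator (A j) x)"
    proof (rule integrable_const_bound[of _ "\<Phi> (real j)"])
      have "\<Phi> \<bar>u x\<bar> \<le> \<Phi> (real j)" if "x \<in> A j" for x using that by (intro mono) (auto simp: A_def)
      then show "AE x in M. norm (\<Phi> \<bar>u x\<bar> * indicator (A j) x) \<le> \<Phi> (real j)"
        using nonneg by (auto simp: indicator_def)
    qed simp
    have ineq: "(\<integral>x. \<Phi> \<bar>u x\<bar> * indicator (A j) x \<partial>M) \<le> m - (\<integral>x. v n x * F x \<partial>M) + (\<integral>x. u x * F x \<partial>M)" for n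
    proof -
      have "(\<integral>x. \<Phi> \<bar>u x\<bar> * indicator (A j) x \<partial>M) \<le> (\<integral>x. \<Phi> \<bar>v n x\<bar> - v n x * F x + u x * F x \<partial>M)"
      proof (rule integral_mono[OF \<Phi>A])
        show "integrable M (\<lambda>x. \<Phi> \<bar>v n x\<bar> - v n x * F x + u x * F x)" using \<Phi>i Fi by simp
        fix x
        have "\<Phi> \<bar>u x\<bar> + s \<bar>u x\<bar> * (\<bar>v n x\<bar> - \<bar>u x\<bar>) \<le> \<Phi> \<bar>v n x\<bar>" by (rule s(3)) auto
        moreover have "s \<bar>u x\<bar> * (sgn (u x) * v n x) \<le> s \<bar>u x\<bar> * \<bar>v n x\<bar>"
          by (intro mult_left_mono s(1)) (auto simp: sgn_if)
        moreover have "s \<bar>u x\<bar> * \<bar>u x\<bar> = u x * (s \<bar>u x\<bar> * sgn (u x))" by (simp add: sgn_if)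
        ultimately show "\<Phi> \<bar>u x\<bar> * indicator (A j) x \<le> \<Phi> \<bar>v n x\<bar> - v n x * F x + u x * F x"
          using nonneg[of "\<bar>v n x\<bar>"] unfolding F_def by (cases "x \<in> A j") (auto simp: algebra_simps)
      qed
      also have "\<dots> = (\<integral>x. \<Phi> \<bar>v n x\<bar> \<partial>M) - (\<integral>x. v n x * F x \<partial>M) + (\<integral>x. u x * F x \<partial>M)" using \<Phi>i Fi by simp
      finally show ?thesis using \<Phi>1[of n] by simp
    qed
    have "(\<lambda>n. \<integral>x. v n x * F x \<partial>M) \<longlonglongrightarrow> (\<integral>x. u x * F x \<partial>M)"
      by (rule wconvD[OF w _ Fb]) simp
    then have "(\<lambda>n. m - (\<integral>x. v n x * F x \<partial>M) + (\<integral>x. u x * F x \<partial>M)) \<longlonglongrightarrow> m - (\<integral>x. u x * F x \<partial>M) + (\<integral>x. u x * F x \<partial>M)"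
      by (intro tendsto_intros)
    then have "(\<integral>x. \<Phi> \<bar>u x\<bar> * indicator (A j) x \<partial>M) \<le> m" using ineq LIMSEQ_le_const by fastforce
    then show ?thesis using \<Phi>A nonneg by (subst nn_integral_eq_integral) (auto intro: ennreal_leI)
  qed
  have "(\<lambda>j. \<integral>\<^sup>+x. ennreal (\<Phi> \<bar>u x\<bar> * indicator (A j) x) \<partial>M) \<longlonglongrightarrow> (\<integral>\<^sup>+x. ennreal (\<Phi> \<bar>u x\<bar> * indicator (space M) x) \<partial>M)"
  proof (rule nn_integral_LIMSEQ)
    show "incseq (\<lambda>j x. ennreal (\<Phi> \<bar>u x\<bar> * indicator (A j) x))"
      unfolding incseq_def le_fun_def
      by (intro allI impI ennreal_leI mult_left_mono nonneg indicator_leI) (auto simp: A_def indicator_def)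
    fix x
    obtain j0 :: nat where "\<bar>u x\<bar> \<le> real j0" using real_arch_simple by blast
    then have "\<forall>j\<ge>j0. ennreal (\<Phi> \<bar>u x\<bar> * indicator (A j) x) = ennreal (\<Phi> \<bar>u x\<bar> * indicator (space M) x)"
      by (auto simp: A_def indicator_def)
    then show "(\<lambda>j. ennreal (\<Phi> \<bar>u x\<bar> * indicator (A j) x)) \<longlonglongrightarrow> ennreal (\<Phi> \<bar>u x\<bar> * indicator (space M) x)"
      by (intro tendsto_eventually) (auto simp: eventually_sequentially)
  qed auto
  then have "(\<integral>\<^sup>+x. ennreal (\<Phi> \<bar>u x\<bar> * indicator (space M) x) \<partial>M) \<le> ennreal m"
    using main by (intro LIMSEQ_le_const2) auto
  moreover have "(\<integral>\<^sup>+x. ennreal (\<Phi> \<bar>u x\<bar> * indicator (space M) x) \<partial>M) = modl M u"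
    unfolding modl_def by (intro nn_integral_cong) auto
  ultimately show ?thesis by simp
qed

lemma wconv_cmult: "wconv M v u \<Longrightarrow> wconv M (\<lambda>n x. v n x * c) (\<lambda>x. u x * c)"
proof -
  have "(\<integral>x. (w x * c) * F x \<partial>M) = c * (\<integral>x. w x * F x \<partial>M)" for w F :: "_ \<Rightarrow> real"
    by (simp add: mult.commute mult.left_commute flip: integral_mult_right_zero)
  then show "wconv M v u \<Longrightarrow> ?thesis" unfolding wconv_def by (auto intro!: tendsto_mult_left)
qed

lemma orlicz_weak_compact:
  assumes "finite_measure M" and [measurable]: "\<And>n. v n \<in> borel_measurable M" and k: "k > 0"
    and b: "\<And>n::nat. modl M (\<lambda>x. v n x / k) \<le> 1"
  shows "\<exists>r u. strict_mono r \<and> integrable M u \<and> orlicz \<Phi> M u \<and> wconv M (v \<circ> r) u"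
proof -
  have ui: "unif_int M v" by (rule modl_unif_int[OF assms])
  obtain r u where ru: "strict_mono r" "integrable M u" "wconv M (v \<circ> r) u" using dunford_pettis[OF assms(1) ui] by blast
  have "modl M (\<lambda>x. u x * (1 / k)) \<le> ennreal 1"
  proof (rule modl_wconv[OF assms(1) wconv_cmult[OF ru(3)]])
    show "integrable M (\<lambda>x. (v \<circ> r) n x * (1 / k))" for n using ui unfolding unif_int_def by auto
    show "modl M (\<lambda>x. (v \<circ> r) n x * (1 / k)) \<le> ennreal 1" for n using b[of "r n"] by simp
  qed (use ru in auto)
  then have "modl M (\<lambda>x. u x / k) < \<infinity>" by (auto intro: le_less_trans)
  then have "orlicz \<Phi> M u" unfolding orlicz_iff using k ru(2) by auto
  then show ?thesis using ru by blast
qed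

end

text \<open>A measurable function is an almost everywhere limit of continuous ones, which are
  clamped to the bound \<open>C\<close> and converge in L1 on the ball of radius 2. That ball
  contains all translates of the unit ball by vectors of length at most 1, so the two outer terms of
  the triangle inequality are controlled uniformly in \<open>h\<close>.\<close>

lemma translation_L1_local:
  fixes K :: "real^'n \<Rightarrow> real"
  assumes [measurable]: "K \<in> borel_measurable borel" and C: "\<And>y. \<bar>K y\<bar> \<le> C"
  shows "((\<lambda>h. \<integral>y. indicator (cball 0 1) y * \<bar>K (y + h) - K y\<bar> \<partial>lborel) \<longlongrightarrow> 0) (at 0)"
proof -
  have C0: "0 \<le> C" using C[of 0] by simp
  have "K measurable_on UNIV"
    by (rule lebesgue_measurable_imp_measurable_on_real) (auto intro: measurable_completion)
  then obtain N g where N: "negligible N" and g: "\<And>n. continuous_on UNIV (g n)" "\<And>x. x \<notin> N \<Longrightarrow> (\<lambda>n. g n x) \<longlonglongrightarrow> K x"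
    unfolding measurable_on_def by auto
  define k where "k n x = max (- C) (min C (g n x))" for n x
  have kc: "continuous_on UNIV (k n)" for n unfolding k_def[abs_def] by (intro continuous_intros g)
  have kb: "\<bar>k n x\<bar> \<le> C" for n x using C0 by (auto simp: k_def)
  have [measurable]: "k n \<in> borel_measurable borel" for n by (rule borel_measurable_continuous_onI[OF kc])
  have kl: "(\<lambda>n. k n x) \<longlonglongrightarrow> K x" if "x \<notin> N" for x
  proof -
    have "(\<lambda>n. k n x) \<longlonglongrightarrow> max (- C) (min C (K x))" unfolding k_def by (intro tendsto_intros g that)
    moreover have "max (- C) (min C (K x)) = K x" using C[of x] by (auto simp: abs_le_iff)
    ultimately show ?thesis by simp
  qed
  have "AE x in lebesgue. x \<notin> N" using N by (simp add: AE_not_in negligible_iff_null_sets)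
  then have AEN: "AE x in lborel. x \<notin> N" by (simp add: AE_completion_iff)
  let ?B = "cball (0::real^'n) 1" and ?B2 = "cball (0::real^'n) 2"
  have cb[measurable]: "cball (0::real^'n) r \<in> sets borel" for r by (simp add: borel_closed)
  have tri: "\<bar>indicator B y * \<bar>a - b\<bar>\<bar> \<le> 2 * C * indicator B y" if "\<bar>a\<bar> \<le> C" "\<bar>b\<bar> \<le> C" for B a b and y :: "real^'n"
    using that by (cases "y \<in> B") auto
  have I2: "integrable lborel (\<lambda>y. indicator ?B2 y * \<bar>K y - k n y\<bar>)" for n
    by (rule integrable_cball_bound[OF _ tri[OF C kb]]) measurable
  have "(\<lambda>n. \<integral>y. indicator ?B2 y * \<bar>K y - k n y\<bar> \<partial>lborel) \<longlonglongrightarrow> (\<integral>y. 0 \<partial>(lborel::(real^'n) measure))"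
  proof (rule integral_dominated_convergence[where w="\<lambda>y. 2 * C * indicator ?B2 y"])
    show "integrable lborel (\<lambda>y. 2 * C * indicator ?B2 y)"
      by (rule integrable_cball_bound[where C="2*C" and r=2]) (measurable, use C0 in auto)
    show "AE y in lborel. norm (indicator ?B2 y * \<bar>K y - k n y\<bar>) \<le> 2 * C * indicator ?B2 y" for n
    proof (rule AE_I2)
      fix y show "norm (indicator ?B2 y * \<bar>K y - k n y\<bar>) \<le> 2 * C * indicator ?B2 y"
        using tri[OF C kb] by simp
    qed
    show "AE y in lborel. (\<lambda>n. indicator ?B2 y * \<bar>K y - k n y\<bar>) \<longlonglongrightarrow> 0"
      using AEN
    proof eventually_elim
      case (elim y)
      have "(\<lambda>n. indicator ?B2 y * \<bar>K y - k n y\<bar>) \<longlonglongrightarrow> indicator ?B2 y * \<bar>K y - K y\<bar>"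
        by (intro tendsto_intros kl elim)
      then show ?case by simp
    qed
  qed auto
  then have D0: "(\<lambda>n. \<integral>y. indicator ?B2 y * \<bar>K y - k n y\<bar> \<partial>lborel) \<longlonglongrightarrow> 0" by simp
  show ?thesis
  proof (rule tendstoI)
    fix e :: real assume e: "e > 0"
    obtain n where n: "(\<integral>y. indicator ?B2 y * \<bar>K y - k n y\<bar> \<partial>lborel) < e / 4"
      using order_tendstoD(2)[OF D0, of "e / 4"] e by (auto simp: eventually_sequentially)
    define D where "D = (\<integral>y. indicator ?B2 y * \<bar>K y - k n y\<bar> \<partial>lborel)"
    have mid: "((\<lambda>h. \<integral>y. indicator ?B y * \<bar>k n (y + h) - k n y\<bar> \<partial>lborel) \<longlongrightarrow> 0) (at 0)"
    proof (rule integral_cball_tendsto_0[where C="2*C" and r=1])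
      fix t y show "\<bar>indicator ?B y * \<bar>k n (y + t) - k n y\<bar>\<bar> \<le> 2 * C * indicator ?B y"
        by (rule tri[OF kb kb])
    next
      fix y
      have "isCont (k n) y" using kc continuous_on_eq_continuous_at by blast
      then have "((\<lambda>h. k n (y + h)) \<longlongrightarrow> k n (y + 0)) (at 0)"
        by (intro isCont_tendsto_compose[of _ "k n"] tendsto_intros) auto
      then have "((\<lambda>h. indicator ?B y * \<bar>k n (y + h) - k n y\<bar>) \<longlongrightarrow> indicator ?B y * \<bar>k n (y + 0) - k n y\<bar>) (at 0)"
        by (intro tendsto_intros)
      then show "((\<lambda>h. indicator ?B y * \<bar>k n (y + h) - k n y\<bar>) \<longlongrightarrow> 0) (at 0)" by simp
    qed simp
    have le: "(\<integral>y. indicator ?B y * \<bar>K (y + h) - K y\<bar> \<partial>lborel) \<le> 2 * D + (\<integral>y. indicator ?B y * \<bar>k n (y + h) - k n y\<bar> \<partial>lborel)"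
      if h: "norm h \<le> 1" for h
    proof -
      let ?f = "\<lambda>y. indicator ?B2 (y + h) * \<bar>K (y + h) - k n (y + h)\<bar>"
      have f: "integrable lborel ?f" "(\<integral>y. ?f y \<partial>lborel) = D"
        using lborel_integral_shift[of "\<lambda>y. indicator ?B2 y * \<bar>K y - k n y\<bar>" "- h"] I2 by (auto simp: D_def)
      have i: "integrable lborel (\<lambda>y. indicator ?B y * \<bar>w (y + h) - w y\<bar>)" if "\<And>x. \<bar>w x\<bar> \<le> C" and [measurable]: "w \<in> borel_measurable borel" for w
        by (rule integrable_cball_bound[OF _ tri[OF that(1) that(1)]]) measurable
      have "(\<integral>y. indicator ?B y * \<bar>K (y + h) - K y\<bar> \<partial>lborel) \<le> 
         (\<integral>y. ?f y + indicator ?B2 y * \<bar>K y - k n y\<bar> + indicator ?B y * \<bar>k n (y + h) - k n y\<bar> \<partial>lborel)"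
      proof (rule integral_mono)
        show "integrable lborel (\<lambda>y. indicator ?B y * \<bar>K (y + h) - K y\<bar>)" by (rule i) (use C in auto)
        show "integrable lborel (\<lambda>y. ?f y + indicator ?B2 y * \<bar>K y - k n y\<bar> + indicator ?B y * \<bar>k n (y + h) - k n y\<bar>)"
          by (intro Bochner_Integration.integrable_add f I2 i kb) simp
        fix y
        show "indicator ?B y * \<bar>K (y + h) - K y\<bar> \<le> ?f y + indicator ?B2 y * \<bar>K y - k n y\<bar> + indicator ?B y * \<bar>k n (y + h) - k n y\<bar>"
        proof (cases "norm y \<le> 1")
          case True
          then have "norm (y + h) \<le> 2" "norm y \<le> 2" using h norm_triangle_ineq[of y h] by auto
          then show ?thesis using True by (auto simp: indicator_def)
        qed simp
      qed
      also have "\<dots> = 2 * D + (\<integral>y. indicator ?B y * \<bar>k n (y + h) - k n y\<bar> \<partial>lborel)"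
      proof -
        have "integrable lborel (\<lambda>y. indicator ?B y * \<bar>k n (y + h) - k n y\<bar>)" by (intro i kb) simp
        then show ?thesis
          using f I2[of n] by (subst Bochner_Integration.integral_add, (simp; fail), (simp; fail))+ (simp add: D_def)
      qed
      finally show ?thesis .
    qed
    have "eventually (\<lambda>h::real^'n. norm h \<le> 1) (at 0)" by (auto simp: eventually_at intro!: exI[of _ 1])
    moreover have "eventually (\<lambda>h. (\<integral>y. indicator ?B y * \<bar>k n (y + h) - k n y\<bar> \<partial>lborel) < e / 4) (at 0)"
      using order_tendstoD(2)[OF mid, of "e / 4"] e by simp
    ultimately show "eventually (\<lambda>h. dist (\<integral>y. indicator ?B y * \<bar>K (y + h) - K y\<bar> \<partial>lborel) 0 < e) (at 0)"
    proof eventually_elim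
      case (elim h)
      have "0 \<le> (\<integral>y. indicator ?B y * \<bar>K (y + h) - K y\<bar> \<partial>lborel)" by (intro Bochner_Integration.integral_nonneg) simp
      then show ?case using le[OF elim(1)] elim(2) n D_def e by simp
    qed
  qed
qed

section \<open>Mollification along a flow\<close>

text \<open>Kept abstract because two flows are needed: \<open>T\<close> on Omega, and on Q x Omega
  the flow that moves only the second coordinate. The measure is merely finite, since the product
  has the mass of Q.\<close>

locale flow = finite_measure P for P :: "'a measure" +
  fixes S :: "real^'n \<Rightarrow> 'a \<Rightarrow> 'a"
  assumes joint: "(\<lambda>(y, z). S y z) \<in> measurable (lborel \<Otimes>\<^sub>M P) P"
    and pres: "distr P P (S y) = P"
    and S_zero: "z \<in> space P \<Longrightarrow> S 0 z = z"
    and S_add: "z \<in> space P \<Longrightarrow> S (x + y) z = S x (S y z)"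
begin

lemma joint'[measurable]: "(\<lambda>w. S (fst w) (snd w)) \<in> measurable (borel \<Otimes>\<^sub>M P) P"
proof -
  have "sets (borel \<Otimes>\<^sub>M P) = sets ((lborel :: (real^'n) measure) \<Otimes>\<^sub>M P)" by (intro sets_pair_measure_cong) auto
  from measurable_cong_sets[OF this HOL.refl, of P] joint show ?thesis by (simp add: case_prod_beta')
qed

lemma S_comp[measurable (raw)]:
  assumes "f \<in> measurable N borel" "g \<in> measurable N P" shows "(\<lambda>x. S (f x) (g x)) \<in> measurable N P"
  using measurable_compose[OF measurable_Pair[OF assms] joint'] by simp

lemma S_meas[measurable]: "S y \<in> measurable P P"
  using S_comp[of "\<lambda>_. y" P "\<lambda>x. x"] by simp

lemma S_space: "z \<in> space P \<Longrightarrow> S y z \<in> space P"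
  using measurable_space[OF S_meas] .

lemma S_inv: "z \<in> space P \<Longrightarrow> S (- y) (S y z) = z" "z \<in> space P \<Longrightarrow> S y (S (- y) z) = z"
  using S_add[of z "- y" y] S_add[of z y "- y"] S_zero by auto

lemma nn_integral_S: assumes [measurable]: "f \<in> borel_measurable P" shows "(\<integral>\<^sup>+z. f (S y z) \<partial>P) = (\<integral>\<^sup>+z. f z \<partial>P)"
  using nn_integral_distr[of "S y" P P f] unfolding pres by simp

lemma integrable_S: assumes "integrable P (f :: 'a \<Rightarrow> real)" shows "integrable P (\<lambda>z. f (S y z))"
  using integrable_distr[of "S y" P P f] unfolding pres using assms by simp

lemma integral_S: assumes [measurable]: "(f :: 'a \<Rightarrow> real) \<in> borel_measurable P" shows "(\<integral>z. f (S y z) \<partial>P) = (\<integral>z. f z \<partial>P)"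
  using integral_distr[of "S y" P P f] unfolding pres by simp

lemma AE_S: assumes "AE z in P. Q z" shows "AE z in P. Q (S y z)"
  using AE_distrD[of "S y" P P Q] unfolding pres using assms by simp

sublocale LP: pair_sigma_finite lborel P
  by (simp add: pair_sigma_finite_def lborel.sigma_finite_measure_axioms sigma_finite_measure_axioms)

text \<open>An average along the orbit of \<open>z\<close>. Where the integrand is not integrable
  the value is the default 0, which is why linearity in the kernel or in the function is stated
  almost everywhere.\<close>

definition conv :: "(real^'n \<Rightarrow> real) \<Rightarrow> ('a \<Rightarrow> real) \<Rightarrow> 'a \<Rightarrow> real" where
  "conv \<sigma> f z = (\<integral>y. \<sigma> y * f (S y z) \<partial>lborel)"

lemma conv_meas[measurable]:
  assumes [measurable]: "\<sigma> \<in> borel_measurable borel" "f \<in> borel_measurable P"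
  shows "conv \<sigma> f \<in> borel_measurable P"
proof -
  have "(\<lambda>w. S (snd w) (fst w)) \<in> measurable (P \<Otimes>\<^sub>M borel) P"
    by (intro S_comp measurable_snd measurable_fst)
  then have "(\<lambda>(z, y). \<sigma> y * f (S y z)) \<in> borel_measurable (P \<Otimes>\<^sub>M borel)"
    unfolding case_prod_beta
    by (intro borel_measurable_times measurable_compose[OF measurable_snd assms(1)] measurable_compose[OF _ assms(2)])
  then have "(\<lambda>(z, y). \<sigma> y * f (S y z)) \<in> borel_measurable (P \<Otimes>\<^sub>M lborel)"
    by (simp cong: measurable_cong_sets)
  then show ?thesis unfolding conv_def[abs_def] by (rule lborel.borel_measurable_lebesgue_integral)
qed

lemma pair_integrable:
  fixes \<sigma> :: "real^'n \<Rightarrow> real" and f :: "'a \<Rightarrow> real"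
  assumes \<sigma>: "integrable lborel \<sigma>" and f: "integrable P f"
  shows "integrable (lborel \<Otimes>\<^sub>M P) (\<lambda>(y, z). \<sigma> y * f (S y z))"
proof (rule LP.Fubini_integrable)
  have [measurable]: "\<sigma> \<in> borel_measurable borel" "f \<in> borel_measurable P" using assms by auto
  show "(\<lambda>(y, z). \<sigma> y * f (S y z)) \<in> borel_measurable (lborel \<Otimes>\<^sub>M P)" by measurable
  have "(\<integral>z. norm (\<sigma> y * f (S y z)) \<partial>P) = \<bar>\<sigma> y\<bar> * (\<integral>z. \<bar>f z\<bar> \<partial>P)" for y
    using integral_S[of "\<lambda>z. \<bar>f z\<bar>" y] by (simp add: abs_mult)
  then show "integrable lborel (\<lambda>y. \<integral>z. norm (case (y, z) of (y, z) \<Rightarrow> \<sigma> y * f (S y z)) \<partial>P)"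
    using \<sigma> by simp
  show "AE y in lborel. integrable P (\<lambda>z. case (y, z) of (y, z) \<Rightarrow> \<sigma> y * f (S y z))"
    using integrable_S[OF f] by simp
qed

lemma conv_integrable: "integrable lborel \<sigma> \<Longrightarrow> integrable P f \<Longrightarrow> integrable P (conv \<sigma> f)"
  unfolding conv_def[abs_def] using LP.integrable_snd[OF pair_integrable] by simp

lemma conv_AE_integrable: 
  fixes \<sigma> :: "real^'n \<Rightarrow> real" and f :: "'a \<Rightarrow> real"
  shows "integrable lborel \<sigma> \<Longrightarrow> integrable P f \<Longrightarrow> AE z in P. integrable lborel (\<lambda>y. \<sigma> y * f (S y z))"
  using LP.AE_integrable_snd[OF pair_integrable] by simp

lemma conv_L1:
  assumes \<sigma>: "integrable lborel \<sigma>" and f: "integrable P f"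
  shows "(\<integral>z. \<bar>conv \<sigma> f z\<bar> \<partial>P) \<le> (\<integral>y. \<bar>\<sigma> y\<bar> \<partial>lborel) * (\<integral>z. \<bar>f z\<bar> \<partial>P)"
proof -
  have [measurable]: "f \<in> borel_measurable P" using f by auto
  have i: "integrable lborel (\<lambda>y. \<bar>\<sigma> y\<bar>)" "integrable P (\<lambda>z. \<bar>f z\<bar>)" using assms by auto
  have "(\<integral>z. \<bar>conv \<sigma> f z\<bar> \<partial>P) \<le> (\<integral>z. conv (\<lambda>y. \<bar>\<sigma> y\<bar>) (\<lambda>z. \<bar>f z\<bar>) z \<partial>P)"
  proof (rule integral_mono)
    show "integrable P (\<lambda>z. \<bar>conv \<sigma> f z\<bar>)" using conv_integrable[OF assms] by simp
    show "integrable P (conv (\<lambda>y. \<bar>\<sigma> y\<bar>) (\<lambda>z. \<bar>f z\<bar>))" by (rule conv_integrable[OF i])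
    show "\<bar>conv \<sigma> f z\<bar> \<le> conv (\<lambda>y. \<bar>\<sigma> y\<bar>) (\<lambda>z. \<bar>f z\<bar>) z" for z
      unfolding conv_def using integral_abs_bound[of lborel "\<lambda>y. \<sigma> y * f (S y z)"] by (simp add: abs_mult)
  qed
  also have "\<dots> = (\<integral>y. (\<integral>z. \<bar>\<sigma> y\<bar> * \<bar>f (S y z)\<bar> \<partial>P) \<partial>lborel)"
    unfolding conv_def using LP.Fubini_integral[OF pair_integrable[OF i]] by simp
  also have "\<dots> = (\<integral>y. \<bar>\<sigma> y\<bar> \<partial>lborel) * (\<integral>z. \<bar>f z\<bar> \<partial>P)"
    using integral_S[of "\<lambda>z. \<bar>f z\<bar>"] by simp
  finally show ?thesis .
qed

text \<open>The group law turns a motion of the base point into a translation of the kernel;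
  regularity of the kernel thus becomes regularity along the flow.\<close>

lemma conv_shift: assumes "z \<in> space P" shows "conv \<sigma> f (S h z) = conv (\<lambda>y. \<sigma> (y - h)) f z"
proof -
  have "(\<integral>y. \<sigma> (y - h) * f (S y z) \<partial>lborel) = (\<integral>y. \<sigma> ((y + h) - h) * f (S (y + h) z) \<partial>lborel)"
    using lborel_integral_shift(1)[of "\<lambda>y. \<sigma> (y - h) * f (S y z)" "- h"] by simp
  then show ?thesis unfolding conv_def using S_add[OF assms] by simp
qed

lemma conv_bound:
  assumes z: "z \<in> space P" and C: "\<And>z. z \<in> space P \<Longrightarrow> \<bar>f z\<bar> \<le> C" and \<sigma>: "integrable lborel \<sigma>"
  shows "\<bar>conv \<sigma> f z\<bar> \<le> C * (\<integral>y. \<bar>\<sigma> y\<bar> \<partial>lborel)"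
proof -
  have C0: "0 \<le> C" using C[OF z] by simp
  have "\<bar>conv \<sigma> f z\<bar> \<le> (\<integral>y. \<bar>\<sigma> y * f (S y z)\<bar> \<partial>lborel)" unfolding conv_def by (rule integral_abs_bound)
  also have "\<dots> \<le> (\<integral>y. C * \<bar>\<sigma> y\<bar> \<partial>lborel)"
  proof (rule integral_mono')
    show "integrable lborel (\<lambda>y. C * \<bar>\<sigma> y\<bar>)" using \<sigma> by simp
    show "\<bar>\<sigma> y * f (S y z)\<bar> \<le> C * \<bar>\<sigma> y\<bar>" for y
      using C[OF S_space[OF z, of y]] mult_right_mono[of "\<bar>f (S y z)\<bar>" C "\<bar>\<sigma> y\<bar>"] by (simp add: abs_mult mult.commute)
  qed (use C0 in auto)
  finally show ?thesis by simp
qed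

lemma conv_bound_integrable:
  fixes \<sigma> :: "real^'n \<Rightarrow> real" and f :: "'a \<Rightarrow> real"
  assumes z: "z \<in> space P" and C: "\<And>z. z \<in> space P \<Longrightarrow> \<bar>f z\<bar> \<le> C" and [measurable]: "f \<in> borel_measurable P" and \<sigma>: "integrable lborel \<sigma>"
  shows "integrable lborel (\<lambda>y. \<sigma> y * f (S y z))"
proof (rule Bochner_Integration.integrable_bound)
  show "integrable lborel (\<lambda>y. C * \<sigma> y)" using \<sigma> by simp
  have [measurable]: "\<sigma> \<in> borel_measurable borel" using \<sigma> by auto
  have "(\<lambda>y. S y z) \<in> measurable borel P" by (intro S_comp measurable_ident_sets measurable_const z) simp
  then show "(\<lambda>y. \<sigma> y * f (S y z)) \<in> borel_measurable lborel" by simp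
  show "AE y in lborel. norm (\<sigma> y * f (S y z)) \<le> norm (C * \<sigma> y)"
  proof (rule AE_I2)
    fix y
    have "\<bar>f (S y z)\<bar> * \<bar>\<sigma> y\<bar> \<le> \<bar>C\<bar> * \<bar>\<sigma> y\<bar>" using C[OF S_space[OF z, of y]] by (intro mult_right_mono) auto
    then show "norm (\<sigma> y * f (S y z)) \<le> norm (C * \<sigma> y)" by (simp add: abs_mult mult.commute)
  qed
qed

lemma conv_adjoint:
  assumes \<sigma>: "integrable lborel \<sigma>" and f: "integrable P f" and [measurable]: "h \<in> borel_measurable P"
    and C: "\<And>z. z \<in> space P \<Longrightarrow> \<bar>h z\<bar> \<le> C"
  shows "(\<integral>z. conv \<sigma> f z * h z \<partial>P) = (\<integral>z. f z * conv (\<lambda>y. \<sigma> (- y)) h z \<partial>P)"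
proof -
  have [measurable]: "\<sigma> \<in> borel_measurable borel" "f \<in> borel_measurable P" using assms by auto
  have fst_bound: "\<bar>a\<bar> \<le> C \<Longrightarrow> norm (b * a) \<le> norm (C * b)" for a b :: real
    using mult_right_mono[of "\<bar>a\<bar>" "\<bar>C\<bar>" "\<bar>b\<bar>"] by (auto simp: abs_mult mult.commute)
  have i1: "integrable (lborel \<Otimes>\<^sub>M P) (\<lambda>(y, z). \<sigma> y * f (S y z) * h z)"
  proof (rule Bochner_Integration.integrable_bound)
    show "integrable (lborel \<Otimes>\<^sub>M P) (\<lambda>w. C * (case w of (y, z) \<Rightarrow> \<sigma> y * f (S y z)))"
      using pair_integrable[OF \<sigma> f] by simp
    show "AE w in lborel \<Otimes>\<^sub>M P. norm (case w of (y, z) \<Rightarrow> \<sigma> y * f (S y z) * h z) \<le> norm (C * (case w of (y, z) \<Rightarrow> \<sigma> y * f (S y z)))"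
      using C fst_bound by (intro AE_I2) (auto simp: space_pair_measure split: prod.split simp del: real_norm_def)
  qed measurable
  have i0: "integrable (lborel \<Otimes>\<^sub>M P) (\<lambda>(y, z). \<sigma> y * f z)"
  proof (rule LP.Fubini_integrable)
    show "integrable lborel (\<lambda>y. \<integral>z. norm (case (y, z) of (y, z) \<Rightarrow> \<sigma> y * f z) \<partial>P)" using \<sigma> by (simp add: abs_mult)
  qed (use f in auto)
  have i2: "integrable (lborel \<Otimes>\<^sub>M P) (\<lambda>(y, z). \<sigma> y * f z * h (S (- y) z))"
  proof (rule Bochner_Integration.integrable_bound)
    show "integrable (lborel \<Otimes>\<^sub>M P) (\<lambda>w. C * (case w of (y, z) \<Rightarrow> \<sigma> y * f z))"
      using i0 by simp
    show "AE w in lborel \<Otimes>\<^sub>M P. norm (case w of (y, z) \<Rightarrow> \<sigma> y * f z * h (S (- y) z)) \<le> norm (C * (case w of (y, z) \<Rightarrow> \<sigma> y * f z))"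
      using C fst_bound S_space by (intro AE_I2) (auto simp: space_pair_measure split: prod.split simp del: real_norm_def)
  qed measurable
  have "(\<integral>z. conv \<sigma> f z * h z \<partial>P) = (\<integral>z. (\<integral>y. \<sigma> y * f (S y z) * h z \<partial>lborel) \<partial>P)"
    unfolding conv_def by simp
  also have "\<dots> = (\<integral>y. (\<integral>z. \<sigma> y * f (S y z) * h z \<partial>P) \<partial>lborel)"
    by (rule LP.Fubini_integral[OF i1])
  also have "\<dots> = (\<integral>y. (\<integral>z. \<sigma> y * f z * h (S (- y) z) \<partial>P) \<partial>lborel)"
  proof (rule Bochner_Integration.integral_cong[OF HOL.refl])
    fix y
    have "(\<integral>z. \<sigma> y * f z * h (S (- y) z) \<partial>P) = (\<integral>z. \<sigma> y * f (S y z) * h (S (- y) (S y z)) \<partial>P)"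
      by (rule integral_S[symmetric]) measurable
    also have "\<dots> = (\<integral>z. \<sigma> y * f (S y z) * h z \<partial>P)"
      by (intro Bochner_Integration.integral_cong HOL.refl) (simp add: S_inv)
    finally show "(\<integral>z. \<sigma> y * f (S y z) * h z \<partial>P) = (\<integral>z. \<sigma> y * f z * h (S (- y) z) \<partial>P)" ..
  qed
  also have "\<dots> = (\<integral>z. (\<integral>y. \<sigma> y * f z * h (S (- y) z) \<partial>lborel) \<partial>P)"
    by (rule LP.Fubini_integral[OF i2, symmetric])
  also have "\<dots> = (\<integral>z. f z * conv (\<lambda>y. \<sigma> (- y)) h z \<partial>P)"
  proof (rule Bochner_Integration.integral_cong[OF HOL.refl])
    fix z assume z: "z \<in> space P"
    have [measurable]: "(\<lambda>y. S y z) \<in> measurable borel P" by (intro S_comp measurable_ident_sets measurable_const z) simp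
    have "(\<integral>y. \<sigma> y * f z * h (S (- y) z) \<partial>lborel) = f z * (\<integral>y. \<sigma> y * h (S (- y) z) \<partial>lborel)"
    proof -
      have "(\<lambda>y. \<sigma> y * f z * h (S (- y) z)) = (\<lambda>y. f z * (\<sigma> y * h (S (- y) z)))" by (auto simp: algebra_simps)
      then show ?thesis by simp
    qed
    also have "(\<integral>y. \<sigma> y * h (S (- y) z) \<partial>lborel) = (\<integral>y. \<sigma> (- y) * h (S y z) \<partial>lborel)"
      using lborel_integral_reflect[of "\<lambda>y. \<sigma> (- y) * h (S y z)"] by simp
    finally show "(\<integral>y. \<sigma> y * f z * h (S (- y) z) \<partial>lborel) = f z * conv (\<lambda>y. \<sigma> (- y)) h z" by (simp add: conv_def)
  qed
  finally show ?thesis .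
qed

text \<open>Minkowski's inequality for integrals. Only displacements in the support of the kernel
  enter, so it covers kernels of small radius as well as, with e = 0, exact invariance.\<close>

lemma conv_diff_L1:
  assumes \<sigma>: "integrable lborel \<sigma>" and f: "integrable P f" and e: "0 \<le> e"
    and le: "\<And>y. \<sigma> y \<noteq> 0 \<Longrightarrow> (\<integral>z. \<bar>f (S y z) - f z\<bar> \<partial>P) \<le> e"
  shows "(\<integral>z. \<bar>conv \<sigma> f z - (\<integral>y. \<sigma> y \<partial>lborel) * f z\<bar> \<partial>P) \<le> e * (\<integral>y. \<bar>\<sigma> y\<bar> \<partial>lborel)"
proof -
  have [measurable]: "\<sigma> \<in> borel_measurable borel" "f \<in> borel_measurable P" using assms by auto
  have i0: "integrable (lborel \<Otimes>\<^sub>M P) (\<lambda>(y, z). \<sigma> y * f z)"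
  proof (rule LP.Fubini_integrable)
    show "integrable lborel (\<lambda>y. \<integral>z. norm (case (y, z) of (y, z) \<Rightarrow> \<sigma> y * f z) \<partial>P)" using \<sigma> by (simp add: abs_mult)
  qed (use f in auto)
  have i1: "integrable (lborel \<Otimes>\<^sub>M P) (\<lambda>(y, z). \<sigma> y * (f (S y z) - f z))"
    using Bochner_Integration.integrable_diff[OF pair_integrable[OF \<sigma> f] i0] by (simp add: case_prod_beta' right_diff_distrib)
  then have i2: "integrable (lborel \<Otimes>\<^sub>M P) (\<lambda>(y, z). \<bar>\<sigma> y\<bar> * \<bar>f (S y z) - f z\<bar>)"
    using integrable_abs[OF i1] by (simp add: case_prod_beta' abs_mult)
  have "(\<integral>z. \<bar>conv \<sigma> f z - (\<integral>y. \<sigma> y \<partial>lborel) * f z\<bar> \<partial>P) \<le> (\<integral>z. (\<integral>y. \<bar>\<sigma> y\<bar> * \<bar>f (S y z) - f z\<bar> \<partial>lborel) \<partial>P)"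
  proof (rule integral_mono_AE)
    show "integrable P (\<lambda>z. \<bar>conv \<sigma> f z - (\<integral>y. \<sigma> y \<partial>lborel) * f z\<bar>)" using conv_integrable[OF \<sigma> f] f by simp
    show "integrable P (\<lambda>z. \<integral>y. \<bar>\<sigma> y\<bar> * \<bar>f (S y z) - f z\<bar> \<partial>lborel)" using LP.integrable_snd[OF i2] by simp
    show "AE z in P. \<bar>conv \<sigma> f z - (\<integral>y. \<sigma> y \<partial>lborel) * f z\<bar> \<le> (\<integral>y. \<bar>\<sigma> y\<bar> * \<bar>f (S y z) - f z\<bar> \<partial>lborel)"
      using conv_AE_integrable[OF \<sigma> f]
    proof eventually_elim
      case (elim z)
      have "conv \<sigma> f z - (\<integral>y. \<sigma> y \<partial>lborel) * f z = (\<integral>y. \<sigma> y * (f (S y z) - f z) \<partial>lborel)"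
        using elim \<sigma> by (simp add: conv_def right_diff_distrib)
      then show ?case using integral_abs_bound[of lborel "\<lambda>y. \<sigma> y * (f (S y z) - f z)"] by (simp add: abs_mult)
    qed
  qed
  also have "\<dots> = (\<integral>y. (\<integral>z. \<bar>\<sigma> y\<bar> * \<bar>f (S y z) - f z\<bar> \<partial>P) \<partial>lborel)"
    using LP.Fubini_integral[OF i2] by simp
  also have "\<dots> \<le> (\<integral>y. e * \<bar>\<sigma> y\<bar> \<partial>lborel)"
  proof (rule integral_mono)
    show "integrable lborel (\<lambda>y. \<integral>z. \<bar>\<sigma> y\<bar> * \<bar>f (S y z) - f z\<bar> \<partial>P)" using LP.integrable_fst[OF i2] by simp
    show "integrable lborel (\<lambda>y. e * \<bar>\<sigma> y\<bar>)" using \<sigma> by simp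
    show "(\<integral>z. \<bar>\<sigma> y\<bar> * \<bar>f (S y z) - f z\<bar> \<partial>P) \<le> e * \<bar>\<sigma> y\<bar>" for y
      using le[of y] mult_left_mono[OF le, of y "\<bar>\<sigma> y\<bar>"] by (cases "\<sigma> y = 0") (auto simp: mult.commute)
  qed
  finally show ?thesis by simp
qed

end

section \<open>Strong continuity and approximate identities\<close>

context flow
begin

lemma bounded_integrable:
  assumes "f \<in> borel_measurable P" "\<And>z. z \<in> space P \<Longrightarrow> \<bar>f z\<bar> \<le> (C::real)" shows "integrable P f"
  by (rule integrable_const_bound[of _ C]) (use assms in auto)

text \<open>On a single orbit the function is a bounded measurable function on R^N, whose translates
  are continuous locally in L1. Integrating over the unit ball of times and over \<open>P\<close>,
  Fubini and invariance return the desired integral multiplied by the volume \<open>b\<close> of the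
  ball.\<close>

lemma strong_continuity:
  assumes [measurable]: "(f :: 'a \<Rightarrow> real) \<in> borel_measurable P" and C: "\<And>z. z \<in> space P \<Longrightarrow> \<bar>f z\<bar> \<le> C"
  shows "((\<lambda>h. \<integral>z. \<bar>f (S h z) - f z\<bar> \<partial>P) \<longlongrightarrow> 0) (at 0)"
  unfolding tendsto_at_iff_sequentially
proof (intro allI impI)
  fix X :: "nat \<Rightarrow> real^'n" assume X: "\<forall>i. X i \<in> UNIV - {0}" "X \<longlonglongrightarrow> 0"
  let ?B = "cball (0::real^'n) 1"
  have Bs[measurable]: "?B \<in> sets borel" by (simp add: borel_closed)
  define b where "b = measure lborel ?B"
  have Bi: "integrable lborel (indicator ?B :: _ \<Rightarrow> real)" "(\<integral>y. indicator ?B y \<partial>lborel) = b"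
    using emeasure_lborel_cball_finite[of "0::real^'n" 1] by (auto simp: integrable_indicator_iff b_def)
  have "b > 0" using content_cball_pos[of 1 "0::real^'n"] by (simp add: b_def)
  define G where "G h y z = indicator ?B y * \<bar>f (S (y + h) z) - f (S y z)\<bar>" for h y z
  define \<psi> where "\<psi> h z = (\<integral>y. G h y z \<partial>lborel)" for h z
  have Gb: "\<bar>G h y z\<bar> \<le> 2 * C * indicator ?B y" if "z \<in> space P" for h y z
    using C[OF S_space[OF that, of "y + h"]] C[OF S_space[OF that, of y]] by (cases "y \<in> ?B") (auto simp: G_def)
  have Gm[measurable]: "(\<lambda>(y, z). G h y z) \<in> borel_measurable (lborel \<Otimes>\<^sub>M P)" for h
    unfolding G_def by measurable
  have Gz: "(\<integral>z. G h y z \<partial>P) = indicator ?B y * (\<integral>z. \<bar>f (S h z) - f z\<bar> \<partial>P)" for h y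
  proof -
    have "(\<integral>z. \<bar>f (S (y + h) z) - f (S y z)\<bar> \<partial>P) = (\<integral>z. \<bar>f (S h (S y z)) - f (S y z)\<bar> \<partial>P)"
      by (rule Bochner_Integration.integral_cong[OF HOL.refl]) (simp add: S_add add.commute[of y h])
    also have "\<dots> = (\<integral>z. \<bar>f (S h z) - f z\<bar> \<partial>P)" by (rule integral_S) measurable
    finally show ?thesis by (simp add: G_def)
  qed
  have Gi: "integrable (lborel \<Otimes>\<^sub>M P) (\<lambda>(y, z). G h y z)" for h
  proof (rule LP.Fubini_integrable)
    have "norm (G h y z) = G h y z" for y z by (simp add: G_def)
    then show "integrable lborel (\<lambda>y. \<integral>z. norm (case (y, z) of (y, z) \<Rightarrow> G h y z) \<partial>P)" using Gz Bi by simp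
    show "AE y in lborel. integrable P (\<lambda>z. case (y, z) of (y, z) \<Rightarrow> G h y z)"
    proof (rule AE_I2)
      fix y
      have "(\<lambda>z. G h y z) \<in> borel_measurable P" unfolding G_def by measurable
      then have "integrable P (\<lambda>z. G h y z)" using Gb by (rule bounded_integrable)
      then show "integrable P (\<lambda>z. case (y, z) of (y, z) \<Rightarrow> G h y z)" by simp
    qed
  qed simp
  have fub: "(\<integral>z. \<psi> h z \<partial>P) = b * (\<integral>z. \<bar>f (S h z) - f z\<bar> \<partial>P)" for h
    unfolding \<psi>_def using LP.Fubini_integral[OF Gi] Gz Bi by simp
  have "(\<lambda>i. \<integral>z. \<psi> (X i) z \<partial>P) \<longlonglongrightarrow> (\<integral>z. 0 \<partial>P)"
  proof (rule integral_dominated_convergence[where w="\<lambda>z. 2 * C * b"])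
    show "AE z in P. (\<lambda>i. \<psi> (X i) z) \<longlonglongrightarrow> 0"
    proof (rule AE_I2)
      fix z assume z: "z \<in> space P"
      have [measurable]: "(\<lambda>y. S y z) \<in> measurable borel P" by (intro S_comp measurable_ident_sets measurable_const z) simp
      have "((\<lambda>h. \<psi> h z) \<longlongrightarrow> 0) (at 0)" unfolding \<psi>_def G_def
        by (rule translation_L1_local[of "\<lambda>y. f (S y z)" C]) (use C S_space[OF z] in auto)
      then show "(\<lambda>i. \<psi> (X i) z) \<longlonglongrightarrow> 0"
        using X unfolding tendsto_at_iff_sequentially by (auto simp: o_def)
    qed
    show "AE z in P. norm (\<psi> (X i) z) \<le> 2 * C * b" for i
    proof (rule AE_I2)
      fix z assume z: "z \<in> space P"
      have "\<bar>\<psi> (X i) z\<bar> \<le> (\<integral>y. \<bar>G (X i) y z\<bar> \<partial>lborel)" unfolding \<psi>_def by (rule integral_abs_bound)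
      also have "\<dots> \<le> (\<integral>y. 2 * C * indicator ?B y \<partial>lborel)"
        by (rule integral_mono') (use Bi Gb[OF z] C[OF z] in auto)
      finally show "norm (\<psi> (X i) z) \<le> 2 * C * b" using Bi by simp
    qed
    show "\<psi> (X i) \<in> borel_measurable P" for i using LP.integrable_snd[OF Gi[of "X i"]] unfolding \<psi>_def[abs_def] by auto
  qed auto
  then have "(\<lambda>i. (1 / b) * (b * (\<integral>z. \<bar>f (S (X i) z) - f z\<bar> \<partial>P))) \<longlonglongrightarrow> (1 / b) * 0" unfolding fub by (intro tendsto_mult_left) simp
  then show "((\<lambda>h. \<integral>z. \<bar>f (S h z) - f z\<bar> \<partial>P) \<circ> X) \<longlonglongrightarrow> 0" using \<open>b > 0\<close> by (simp add: o_def)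
qed

lemma mol_norm:
  assumes "r > 0" "mol r y \<noteq> 0" shows "norm (y::real^'n) \<le> real CARD('n) * r"
proof -
  have "\<bar>y $ i\<bar> \<le> r" for i using mol_zero[OF assms(1), of y i] assms(2) by force
  then have "(\<Sum>i\<in>UNIV. \<bar>y $ i\<bar>) \<le> (\<Sum>i\<in>(UNIV::'n set). r)" by (intro sum_mono)
  then show ?thesis using norm_le_l1_cart[of y] by simp
qed

lemma mol_integrable: "r > 0 \<Longrightarrow> integrable lborel (mol r :: real^'n \<Rightarrow> real)"
  by (rule Cc_inf_integrable[OF mol_Cc_inf])

lemma mol_abs_integral: "r > 0 \<Longrightarrow> (\<integral>y. \<bar>mol r (y::real^'n)\<bar> \<partial>lborel) = 1"
  using mol_integral[of r, where 'n='n] by (simp add: mol_nonneg)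

lemma approx_identity_bounded:
  assumes f[measurable]: "f \<in> borel_measurable P" and C: "\<And>z. z \<in> space P \<Longrightarrow> \<bar>f z\<bar> \<le> C" and e: "e > 0"
  shows "eventually (\<lambda>r. (\<integral>z. \<bar>conv (mol r) f z - f z\<bar> \<partial>P) \<le> e) (at_right 0)"
proof -
  have fi: "integrable P f" by (rule bounded_integrable[OF f C])
  have "eventually (\<lambda>h. (\<integral>z. \<bar>f (S h z) - f z\<bar> \<partial>P) < e) (at 0)"
    using order_tendstoD(2)[OF strong_continuity[OF f C]] e by blast
  then obtain d where d: "d > 0" "\<And>h. h \<noteq> 0 \<Longrightarrow> norm h < d \<Longrightarrow> (\<integral>z. \<bar>f (S h z) - f z\<bar> \<partial>P) < e"
    by (auto simp: eventually_at)
  have z: "(\<integral>z. \<bar>f (S 0 z) - f z\<bar> \<partial>P) = 0" using S_zero by (intro integral_eq_zero_AE) auto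
  have main: "(\<integral>z. \<bar>conv (mol r) f z - f z\<bar> \<partial>P) \<le> e" if r: "r > 0" "real CARD('n) * r < d" for r
  proof -
  have "(\<integral>z. \<bar>conv (mol r) f z - (\<integral>y. mol r y \<partial>(lborel :: (real^'n) measure)) * f z\<bar> \<partial>P) \<le> e * (\<integral>y. \<bar>mol r y\<bar> \<partial>(lborel :: (real^'n) measure))"
  proof (rule conv_diff_L1[OF mol_integrable[OF r(1)] fi])
    fix y :: "real^'n" assume "mol r y \<noteq> 0"
    then have "norm y < d" using mol_norm[OF r(1), of y] r(2) by simp
    then show "(\<integral>z. \<bar>f (S y z) - f z\<bar> \<partial>P) \<le> e" using d(2)[of y] z e by (cases "y = 0") auto
  qed (use e in simp)
  then show ?thesis using r(1) mol_integral[OF r(1), where 'n='n] mol_abs_integral[OF r(1)] by auto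
  qed
  have "eventually (\<lambda>r. r \<in> {0<..<d / real CARD('n)}) (at_right 0)"
    using d(1) by (intro eventually_at_right_real) auto
  then show ?thesis by eventually_elim (auto intro!: main simp: field_simps)
qed

lemma conv_diff_AE:
  assumes "integrable lborel \<sigma>" "integrable P f" "integrable P g"
  shows "AE z in P. conv \<sigma> (\<lambda>z. f z - g z) z = conv \<sigma> f z - conv \<sigma> g z"
  using conv_AE_integrable[OF assms(1,2)] conv_AE_integrable[OF assms(1,3)]
  by eventually_elim (simp add: conv_def right_diff_distrib)

lemma L1_zero_AE: "integrable P (f :: 'a \<Rightarrow> real) \<Longrightarrow> (\<integral>z. \<bar>f z\<bar> \<partial>P) \<le> 0 \<Longrightarrow> AE z in P. f z = 0"
  using integral_nonneg_eq_0_iff_AE[of P "\<lambda>z. \<bar>f z\<bar>"] by (simp add: antisym)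

lemma trunc_L1:
  assumes "integrable P f" "e > 0" shows "\<exists>m. (\<integral>z. \<bar>f z - trunc m (f z)\<bar> \<partial>P) \<le> e"
proof -
  have [measurable]: "f \<in> borel_measurable P" using assms by auto
  have "(\<lambda>m. \<integral>z. \<bar>f z - trunc m (f z)\<bar> \<partial>P) \<longlonglongrightarrow> (\<integral>z. 0 \<partial>P)"
  proof (rule integral_dominated_convergence[where w="\<lambda>z. \<bar>f z\<bar>"])
    show "AE z in P. (\<lambda>m. \<bar>f z - trunc m (f z)\<bar>) \<longlonglongrightarrow> 0"
    proof (rule AE_I2)
      fix z
      obtain m0 :: nat where "\<bar>f z\<bar> \<le> real m0" using real_arch_simple by blast
      then have "\<forall>m\<ge>m0. \<bar>f z - trunc m (f z)\<bar> = 0" by (auto simp: trunc_eq)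
      then show "(\<lambda>m. \<bar>f z - trunc m (f z)\<bar>) \<longlonglongrightarrow> 0" by (intro tendsto_eventually) (auto simp: eventually_sequentially)
    qed
  qed (use assms trunc_diff_le in auto)
  then have "eventually (\<lambda>m. (\<integral>z. \<bar>f z - trunc m (f z)\<bar> \<partial>P) < e) sequentially"
    using order_tendstoD(2)[of _ 0 _ e] assms(2) by simp
  then show ?thesis by (auto simp: eventually_sequentially intro: less_imp_le)
qed

lemma approx_identity_L1:
  assumes f: "integrable P f" and e: "e > 0"
  shows "\<exists>r>0. (\<integral>z. \<bar>conv (mol r) f z - f z\<bar> \<partial>P) \<le> e"
proof -
  have [measurable]: "f \<in> borel_measurable P" using f by auto
  obtain m where m: "(\<integral>z. \<bar>f z - trunc m (f z)\<bar> \<partial>P) \<le> e / 3" using trunc_L1[OF f, of "e/3"] e by auto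
  let ?t = "\<lambda>z. trunc m (f z)"
  have t: "integrable P ?t" by (rule bounded_integrable[OF _ trunc_bound]) simp
  have "eventually (\<lambda>r. r > 0 \<and> (\<integral>z. \<bar>conv (mol r) ?t z - ?t z\<bar> \<partial>P) \<le> e / 3) (at_right 0)"
    using e trunc_bound by (intro eventually_conj eventually_at_right_less approx_identity_bounded[of ?t "real m"]) auto
  then obtain r where r: "r > 0" "(\<integral>z. \<bar>conv (mol r) ?t z - ?t z\<bar> \<partial>P) \<le> e / 3"
    using eventually_happens'[OF trivial_limit_at_right_real] by blast
  note \<sigma> = mol_integrable[OF r(1)]
  let ?d = "\<lambda>z. f z - trunc m (f z)"
  have d: "integrable P ?d" using f t by auto
  note I = conv_integrable[OF \<sigma> f] conv_integrable[OF \<sigma> t] conv_integrable[OF \<sigma> d]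
  have "(\<integral>z. \<bar>conv (mol r) f z - f z\<bar> \<partial>P) \<le> (\<integral>z. \<bar>conv (mol r) ?d z\<bar> + \<bar>conv (mol r) ?t z - ?t z\<bar> + \<bar>?d z\<bar> \<partial>P)"
  proof (rule integral_mono_AE)
    show "AE z in P. \<bar>conv (mol r) f z - f z\<bar> \<le> \<bar>conv (mol r) ?d z\<bar> + \<bar>conv (mol r) ?t z - ?t z\<bar> + \<bar>?d z\<bar>"
      using conv_diff_AE[OF \<sigma> f t] by eventually_elim auto
  qed (use I f t d in auto)
  also have "\<dots> = (\<integral>z. \<bar>conv (mol r) ?d z\<bar> \<partial>P) + (\<integral>z. \<bar>conv (mol r) ?t z - ?t z\<bar> \<partial>P) + (\<integral>z. \<bar>?d z\<bar> \<partial>P)"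
    using I f t d by simp
  also have "(\<integral>z. \<bar>conv (mol r) ?d z\<bar> \<partial>P) \<le> 1 * (\<integral>z. \<bar>?d z\<bar> \<partial>P)"
    using conv_L1[OF \<sigma> d] mol_abs_integral[OF r(1)] by simp
  finally show ?thesis using r m by (intro exI[of _ r]) linarith
qed

section \<open>Invariant functions and the invariant sigma-algebra\<close>

definition inv_fun :: "('a \<Rightarrow> real) \<Rightarrow> bool" where
  "inv_fun f \<longleftrightarrow> f \<in> borel_measurable P \<and> (\<forall>y. AE z in P. f (S y z) = f z)"

lemma conv_invariant:
  assumes f: "integrable P f" "inv_fun f" and \<sigma>: "integrable lborel \<sigma>"
  shows "AE z in P. conv \<sigma> f z = (\<integral>y. \<sigma> y \<partial>lborel) * f z"
proof -
  have "(\<integral>z. \<bar>conv \<sigma> f z - (\<integral>y. \<sigma> y \<partial>lborel) * f z\<bar> \<partial>P) \<le> 0 * (\<integral>y. \<bar>\<sigma> y\<bar> \<partial>lborel)"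
  proof (rule conv_diff_L1[OF \<sigma> f(1)])
    fix y
    have "AE z in P. f (S y z) = f z" using f(2) by (simp add: inv_fun_def)
    then have "(\<integral>z. \<bar>f (S y z) - f z\<bar> \<partial>P) = 0" by (intro integral_eq_zero_AE) (auto elim: eventually_mono)
    then show "(\<integral>z. \<bar>f (S y z) - f z\<bar> \<partial>P) \<le> 0" by simp
  qed simp
  then have "AE z in P. conv \<sigma> f z - (\<integral>y. \<sigma> y \<partial>lborel) * f z = 0"
    using f conv_integrable[OF \<sigma> f(1)] by (intro L1_zero_AE) auto
  then show ?thesis by eventually_elim simp
qed

lemma conv_kernel_lincomb_AE:
  assumes "integrable lborel \<sigma>" "integrable lborel \<tau>" "integrable P f"
  shows "AE z in P. conv (\<lambda>y. a * \<sigma> y + b * \<tau> y) f z = a * conv \<sigma> f z + b * conv \<tau> f z"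
  using conv_AE_integrable[OF assms(1,3)] conv_AE_integrable[OF assms(2,3)]
proof eventually_elim
  case (elim z)
  have "(\<lambda>y. (a * \<sigma> y + b * \<tau> y) * f (S y z)) = (\<lambda>y. a * (\<sigma> y * f (S y z)) + b * (\<tau> y * f (S y z)))"
    by (auto simp: algebra_simps)
  then show ?case using elim by (simp add: conv_def)
qed

text \<open>The L1 distance \<open>N t\<close> between a mollification and its translate by
  \<open>t\<close> is o(t), since its derivative along the flow vanishes. Cutting \<open>t\<close>
  into equal pieces then gives \<open>N t = 0\<close>. Arbitrary vectors follow coordinate by
  coordinate, and \<open>f\<close> itself by letting the radius shrink.\<close>

lemma inv_fun_of_conv_partial:
  assumes f: "integrable P f" and z: "\<And>\<rho> i. Cc_inf UNIV \<rho> \<Longrightarrow> AE z in P. conv (partial \<rho> i) f z = 0"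
  shows "inv_fun f"
proof -
  have [measurable]: "f \<in> borel_measurable P" using f by auto
  have axis0: "AE z in P. conv \<rho> f (S (t *\<^sub>R axis i 1) z) = conv \<rho> f z" if \<rho>: "Cc_inf UNIV \<rho>" for \<rho> t i
  proof (cases "t = 0")
    case True then show ?thesis by (auto intro!: AE_I2 simp: S_zero)
  next
    case False
    define I where "I t = (\<integral>y. \<bar>(\<rho> (y - t *\<^sub>R axis i 1) - \<rho> y) / t + partial \<rho> i y\<bar> \<partial>lborel)" for t
    define F where "F = (\<integral>z. \<bar>f z\<bar> \<partial>P)"
    define N where "N t = (\<integral>z. \<bar>conv \<rho> f (S (t *\<^sub>R axis i 1) z) - conv \<rho> f z\<bar> \<partial>P)" for t
    note \<rho>i = Cc_inf_integrable[OF \<rho>] and \<rho>p = Cc_inf_integrable[OF Cc_inf_partial[OF \<rho>, of i]]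
    note cm = borel_measurable_integrable[OF conv_integrable[OF \<rho>i f]]
    \<comment> \<open>Because the convolution with \<open>partial \<rho> i\<close> vanishes, it may
      be added to the difference quotient for free; the resulting kernel tends to 0 in L1.\<close>
    have N1: "N s \<le> \<bar>s\<bar> * (I s * F)" if s: "s \<noteq> 0" for s
    proof -
      let ?\<sigma> = "\<lambda>y. (\<rho> (y - s *\<^sub>R axis i 1) - \<rho> y) / s + partial \<rho> i y"
      have sh: "integrable lborel (\<lambda>y. \<rho> (y - s *\<^sub>R axis i 1))" by (rule lborel_integral_shift(2)[OF \<rho>i])
      have \<sigma>i: "integrable lborel ?\<sigma>" using sh \<rho>i \<rho>p by auto
      have e1: "AE z in P. conv (\<lambda>y. 1 * \<rho> (y - s *\<^sub>R axis i 1) + (- 1) * \<rho> y) f z = 1 * conv (\<lambda>y. \<rho> (y - s *\<^sub>R axis i 1)) f z + (- 1) * conv \<rho> f z"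
        by (rule conv_kernel_lincomb_AE[OF sh \<rho>i f])
      have e2: "AE z in P. conv (\<lambda>y. s * ?\<sigma> y + (- s) * partial \<rho> i y) f z = s * conv ?\<sigma> f z + (- s) * conv (partial \<rho> i) f z"
        by (rule conv_kernel_lincomb_AE[OF \<sigma>i \<rho>p f])
      have eq: "(\<lambda>y. s * ?\<sigma> y + (- s) * partial \<rho> i y) = (\<lambda>y. 1 * \<rho> (y - s *\<^sub>R axis i 1) + (- 1) * \<rho> y)"
        using s by (auto simp: field_simps)
      have "AE z in P. \<bar>conv \<rho> f (S (s *\<^sub>R axis i 1) z) - conv \<rho> f z\<bar> = \<bar>s\<bar> * \<bar>conv ?\<sigma> f z\<bar>"
        using e1 e2[unfolded eq] z[OF \<rho>, of i] AE_space by eventually_elim (simp add: conv_shift abs_mult)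
      then have "N s = (\<integral>z. \<bar>s\<bar> * \<bar>conv ?\<sigma> f z\<bar> \<partial>P)" unfolding N_def
        using cm conv_integrable[OF \<sigma>i f] by (intro integral_cong_AE) auto
      also have "\<dots> \<le> \<bar>s\<bar> * (I s * F)" using conv_L1[OF \<sigma>i f] by (simp add: I_def F_def mult_left_mono)
      finally show ?thesis .
    qed
    \<comment> \<open>Subadditivity of \<open>N\<close>: \<open>n + 1\<close> steps of length
      \<open>s\<close> cost at most \<open>n + 1\<close> times one step, as the flow preserves the
      measure.\<close>
    have Nn: "N (real n * s) \<le> real n * N s" for n s
    proof (induction n)
      case 0 
      have "N 0 = 0" unfolding N_def using S_zero by (intro integral_eq_zero_AE) auto
      then show ?case by simp
    next
      case (Suc n)
      let ?a = "s *\<^sub>R axis i 1 :: real^'n" and ?b = "(real n * s) *\<^sub>R axis i 1 :: real^'n"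
      have ci: "integrable P (conv \<rho> f)" by (rule conv_integrable[OF \<rho>i f])
      have "N (real (Suc n) * s) = (\<integral>z. \<bar>conv \<rho> f (S ?b (S ?a z)) - conv \<rho> f z\<bar> \<partial>P)"
        unfolding N_def
      proof (rule Bochner_Integration.integral_cong[OF HOL.refl])
        fix z assume "z \<in> space P"
        then have "S (?b + ?a) z = S ?b (S ?a z)" by (rule S_add)
        moreover have "(real (Suc n) * s) *\<^sub>R axis i 1 = ?b + ?a" by (simp add: algebra_simps)
        ultimately show "\<bar>conv \<rho> f (S ((real (Suc n) * s) *\<^sub>R axis i 1) z) - conv \<rho> f z\<bar> = \<bar>conv \<rho> f (S ?b (S ?a z)) - conv \<rho> f z\<bar>" by simp
      qed
      also have "\<dots> \<le> (\<integral>z. \<bar>conv \<rho> f (S ?b (S ?a z)) - conv \<rho> f (S ?a z)\<bar> + \<bar>conv \<rho> f (S ?a z) - conv \<rho> f z\<bar> \<partial>P)"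
        using integrable_S[OF ci] integrable_S[OF integrable_S[OF ci], of ?b] ci by (intro integral_mono) auto
      also have "\<dots> = (\<integral>z. \<bar>conv \<rho> f (S ?b (S ?a z)) - conv \<rho> f (S ?a z)\<bar> \<partial>P) + N s"
        unfolding N_def using integrable_S[OF ci] integrable_S[OF integrable_S[OF ci], of ?b] ci
        by (intro Bochner_Integration.integral_add) auto
      also have "(\<integral>z. \<bar>conv \<rho> f (S ?b (S ?a z)) - conv \<rho> f (S ?a z)\<bar> \<partial>P) = N (real n * s)"
        unfolding N_def using cm by (intro integral_S[of "\<lambda>z. \<bar>conv \<rho> f (S ?b z) - conv \<rho> f z\<bar>"]) simp
      finally show ?case using Suc by (simp add: algebra_simps)
    qed
    have "N t \<le> \<bar>t\<bar> * (I (t / real (Suc n)) * F)" for n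
    proof -
      have "N t \<le> real (Suc n) * N (t / real (Suc n))" using Nn[of "Suc n" "t / real (Suc n)"] by simp
      also have "\<dots> \<le> real (Suc n) * (\<bar>t / real (Suc n)\<bar> * (I (t / real (Suc n)) * F))"
        using False by (intro mult_left_mono N1) auto
      finally show ?thesis by simp
    qed
    moreover have "(\<lambda>n. \<bar>t\<bar> * (I (t / real (Suc n)) * F)) \<longlonglongrightarrow> \<bar>t\<bar> * (0 * F)"
    proof (intro tendsto_intros)
      have "(\<lambda>n. t * inverse (real (Suc n))) \<longlonglongrightarrow> t * 0" by (intro tendsto_intros LIMSEQ_inverse_real_of_nat)
      then have "(\<lambda>n. t / real (Suc n)) \<longlonglongrightarrow> 0" by (simp add: divide_inverse)
      then show "(\<lambda>n. I (t / real (Suc n))) \<longlonglongrightarrow> 0"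
        using Cc_inf_diff_quotient_L1[OF \<rho>, of i] False unfolding tendsto_at_iff_sequentially I_def[symmetric]
        by (auto simp: o_def)
    qed
    ultimately have "N t \<le> 0" using LIMSEQ_le_const[of _ "\<bar>t\<bar> * (0 * F)"] by fastforce
    then have "AE z in P. conv \<rho> f (S (t *\<^sub>R axis i 1) z) - conv \<rho> f z = 0"
      unfolding N_def using conv_integrable[OF \<rho>i f] integrable_S[OF conv_integrable[OF \<rho>i f]] by (intro L1_zero_AE) auto
    then show ?thesis by eventually_elim simp
  qed
  have conv_inv: "AE z in P. conv \<rho> f (S h z) = conv \<rho> f z" if \<rho>: "Cc_inf UNIV \<rho>" for \<rho> h
  proof -
    have "AE z in P. conv \<rho> f (S (\<Sum>i\<in>J. h $ i *\<^sub>R axis i 1) z) = conv \<rho> f z" if "finite J" for J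
      using that
    proof induction
      case empty then show ?case by (auto intro!: AE_I2 simp: S_zero)
    next
      case (insert i J)
      have "AE z in P. conv \<rho> f (S (h $ i *\<^sub>R axis i 1) (S (\<Sum>i\<in>J. h $ i *\<^sub>R axis i 1) z)) = conv \<rho> f (S (\<Sum>i\<in>J. h $ i *\<^sub>R axis i 1) z)"
        by (rule AE_S[OF axis0[OF \<rho>]])
      then show ?case using insert(3) AE_space
        by eventually_elim (use insert(1,2) in \<open>simp add: S_add\<close>)
    qed
    from this[of UNIV] show ?thesis using basis_expansion[of h] by (simp add: scalar_mult_eq_scaleR)
  qed
  have "AE z in P. f (S h z) = f z" for h
  proof -
    have "(\<integral>z. \<bar>f (S h z) - f z\<bar> \<partial>P) \<le> 0"
    proof (rule field_le_epsilon)
      fix e :: real assume "e > 0"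
      then obtain r where r: "r > 0" "(\<integral>z. \<bar>conv (mol r) f z - f z\<bar> \<partial>P) \<le> e / 2" using approx_identity_L1[OF f, of "e/2"] by auto
      note ci = conv_integrable[OF mol_integrable[OF r(1)] f]
      have "(\<integral>z. \<bar>f (S h z) - f z\<bar> \<partial>P) \<le> (\<integral>z. \<bar>conv (mol r) f (S h z) - f (S h z)\<bar> + \<bar>conv (mol r) f z - f z\<bar> \<partial>P)"
      proof (rule integral_mono_AE)
        show "AE z in P. \<bar>f (S h z) - f z\<bar> \<le> \<bar>conv (mol r) f (S h z) - f (S h z)\<bar> + \<bar>conv (mol r) f z - f z\<bar>"
          using conv_inv[OF mol_Cc_inf[OF r(1)], of h] by eventually_elim linarith
      qed (use f ci integrable_S[OF f] integrable_S[OF ci] in auto)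
      also have "\<dots> = (\<integral>z. \<bar>conv (mol r) f (S h z) - f (S h z)\<bar> \<partial>P) + (\<integral>z. \<bar>conv (mol r) f z - f z\<bar> \<partial>P)"
        using f ci integrable_S[OF f] integrable_S[OF ci] by simp
      also have "(\<integral>z. \<bar>conv (mol r) f (S h z) - f (S h z)\<bar> \<partial>P) = (\<integral>z. \<bar>conv (mol r) f z - f z\<bar> \<partial>P)"
        using ci by (intro integral_S[of "\<lambda>z. \<bar>conv (mol r) f z - f z\<bar>"]) auto
      finally show "(\<integral>z. \<bar>f (S h z) - f z\<bar> \<partial>P) \<le> 0 + e" using r by simp
    qed
    then have "AE z in P. f (S h z) - f z = 0" using f integrable_S[OF f] by (intro L1_zero_AE) auto
    then show ?thesis by eventually_elim simp
  qed
  then show ?thesis by (simp add: inv_fun_def)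
qed

text \<open>Invariance modulo null sets that may depend on \<open>y\<close>. With this choice
  measurability for the sigma-algebra coincides with \<open>inv_fun\<close>, and no strictly
  invariant representatives have to be constructed.\<close>

definition inv_sets :: "'a set set" where
  "inv_sets = {A \<in> sets P. \<forall>y. AE z in P. S y z \<in> A \<longleftrightarrow> z \<in> A}"

definition Inv :: "'a measure" where "Inv = sigma (space P) inv_sets"

lemma inv_sets_sigma: "sigma_algebra (space P) inv_sets"
  unfolding sigma_algebra_iff2
proof (intro conjI ballI allI impI)
  show "inv_sets \<subseteq> Pow (space P)" using sets.sets_into_space by (auto simp: inv_sets_def)
  show "{} \<in> inv_sets" by (simp add: inv_sets_def)
  fix A assume A: "A \<in> inv_sets"
  then show "space P - A \<in> inv_sets" unfolding inv_sets_def
  proof safe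
    fix y assume "\<forall>y. AE z in P. (S y z \<in> A) = (z \<in> A)"
    then have "AE z in P. (S y z \<in> A) = (z \<in> A)" by blast
    then show "AE z in P. (S y z \<in> space P - A) = (z \<in> space P - A)" using AE_space by eventually_elim (auto simp: S_space)
  qed auto
next
  fix A :: "nat \<Rightarrow> 'a set" assume A: "range A \<subseteq> inv_sets"
  have "AE z in P. (S y z \<in> \<Union>(range A)) = (z \<in> \<Union>(range A))" for y
  proof -
    have "AE z in P. \<forall>i. (S y z \<in> A i) = (z \<in> A i)" using A by (subst AE_all_countable) (auto simp: inv_sets_def)
    then show ?thesis by eventually_elim auto
  qed
  moreover have "\<Union>(range A) \<in> sets P" using A by (auto simp: inv_sets_def)
  ultimately show "\<Union>(range A) \<in> inv_sets" by (simp add: inv_sets_def)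
qed

lemma sets_Inv: "sets Inv = inv_sets" and space_Inv: "space Inv = space P"
proof -
  interpret I: sigma_algebra "space P" inv_sets by (rule inv_sets_sigma)
  show "sets Inv = inv_sets" "space Inv = space P" unfolding Inv_def using I.space_closed by (auto simp: I.sigma_sets_eq)
qed

lemma subalg_Inv: "subalgebra P Inv"
  unfolding subalgebra_def space_Inv sets_Inv by (auto simp: inv_sets_def)

sublocale Inv: finite_measure_subalgebra P Inv
  by unfold_locales (rule subalg_Inv)

lemma inv_fun_iff: "inv_fun f \<longleftrightarrow> f \<in> borel_measurable Inv"
proof
  assume f: "inv_fun f"
  then have [measurable]: "f \<in> borel_measurable P" by (simp add: inv_fun_def)
  show "f \<in> borel_measurable Inv" unfolding borel_measurable_iff_less sets_Inv space_Inv
  proof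
    fix c
    have "AE z in P. (S y z \<in> {z \<in> space P. f z < c}) = (z \<in> {z \<in> space P. f z < c})" for y
    proof -
      have "AE z in P. f (S y z) = f z" using f by (simp add: inv_fun_def)
      then show ?thesis using AE_space by eventually_elim (auto simp: S_space)
    qed
    then show "{z \<in> space P. f z < c} \<in> inv_sets" by (simp add: inv_sets_def)
  qed
next
  assume f: "f \<in> borel_measurable Inv"
  have fP: "f \<in> borel_measurable P" by (rule measurable_from_subalg[OF subalg_Inv f])
  have "AE z in P. f (S y z) = f z" for y
  proof -
    have s: "{z \<in> space P. f z < of_rat q} \<in> inv_sets" for q :: rat
      using f unfolding borel_measurable_iff_less sets_Inv space_Inv by blast
    have "AE z in P. \<forall>q::rat. (S y z \<in> {z \<in> space P. f z < of_rat q}) = (z \<in> {z \<in> space P. f z < of_rat q})"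
      using s by (subst AE_all_countable) (auto simp: inv_sets_def)
    then show ?thesis using AE_space
    proof eventually_elim
      case (elim z)
      then have q: "f (S y z) < of_rat q \<longleftrightarrow> f z < of_rat q" for q :: rat by (auto simp: S_space)
      show ?case
      proof (rule ccontr)
        assume "f (S y z) \<noteq> f z"
        then consider "f (S y z) < f z" | "f z < f (S y z)" by linarith
        then show False using q of_rat_dense by (metis less_asym not_less_iff_gr_or_eq)
      qed
    qed
  qed
  then show "inv_fun f" using fP by (simp add: inv_fun_def)
qed

abbreviation "EI \<equiv> real_cond_exp P Inv"

lemma inv_EI: "inv_fun (EI f)"
  unfolding inv_fun_iff by simp

lemma EI_integral:
  assumes "inv_fun \<eta>" "f \<in> borel_measurable P" "integrable P (\<lambda>z. \<eta> z * f z)"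
  shows "(\<integral>z. \<eta> z * EI f z \<partial>P) = (\<integral>z. \<eta> z * f z \<partial>P)"
  using assms by (intro Inv.real_cond_exp_intg(2)) (auto simp: inv_fun_iff)

end

context young begin

lemma convex_abs: "convex_on UNIV (\<lambda>t. \<Phi> \<bar>t\<bar>)"
proof (rule convex_onI)
  fix t x y :: real assume t: "0 < t" "t < 1"
  have "\<Phi> \<bar>(1 - t) *\<^sub>R x + t *\<^sub>R y\<bar> \<le> \<Phi> ((1 - t) *\<^sub>R \<bar>x\<bar> + t *\<^sub>R \<bar>y\<bar>)"
    using t abs_triangle_ineq[of "(1 - t) * x" "t * y"] by (intro mono) (auto simp: abs_mult)
  also have "\<dots> \<le> (1 - t) * \<Phi> \<bar>x\<bar> + t * \<Phi> \<bar>y\<bar>"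
    by (rule convex_onD[OF cvx]) (use t in auto)
  finally show "\<Phi> \<bar>(1 - t) *\<^sub>R x + t *\<^sub>R y\<bar> \<le> (1 - t) * \<Phi> \<bar>x\<bar> + t * \<Phi> \<bar>y\<bar>" .
qed auto

lemma modl_sum:
  fixes f :: "'n::finite \<Rightarrow> 'a \<Rightarrow> real"
  assumes [measurable]: "\<And>j. f j \<in> borel_measurable M"
  shows "modl M (\<lambda>x. \<Sum>j\<in>UNIV. f j x) \<le> (\<Sum>j\<in>UNIV. modl M (\<lambda>x. real CARD('n) * f j x))"
proof -
  have "modl M (\<lambda>x. \<Sum>j\<in>UNIV. f j x) \<le> (\<integral>\<^sup>+x. (\<Sum>j\<in>UNIV. ennreal (\<Phi> \<bar>real CARD('n) * f j x\<bar>)) \<partial>M)"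
    unfolding modl_def
  proof (rule nn_integral_mono)
    fix x
    obtain j where j: "\<And>i. \<bar>f i x\<bar> \<le> \<bar>f j x\<bar>"
    proof -
      have "Max (range (\<lambda>i. \<bar>f i x\<bar>)) \<in> range (\<lambda>i. \<bar>f i x\<bar>)" by (rule Max_in) auto
      then obtain j where "Max (range (\<lambda>i. \<bar>f i x\<bar>)) = \<bar>f j x\<bar>" by (rule rangeE)
      then have "\<bar>f i x\<bar> \<le> \<bar>f j x\<bar>" for i by (metis Max_ge finite finite_imageI rangeI)
      then show ?thesis by (rule that)
    qed
    have "\<bar>\<Sum>j\<in>UNIV. f j x\<bar> \<le> (\<Sum>j\<in>UNIV. \<bar>f j x\<bar>)" by (rule sum_abs)
    also have "\<dots> \<le> (\<Sum>i\<in>(UNIV::'n set). \<bar>f j x\<bar>)" by (intro sum_mono j)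
    finally have "\<Phi> \<bar>\<Sum>j\<in>UNIV. f j x\<bar> \<le> \<Phi> \<bar>real CARD('n) * f j x\<bar>" by (intro mono) (auto simp: abs_mult)
    then have "ennreal (\<Phi> \<bar>\<Sum>j\<in>UNIV. f j x\<bar>) \<le> ennreal (\<Phi> \<bar>real CARD('n) * f j x\<bar>)" by (rule ennreal_leI)
    also have "\<dots> \<le> (\<Sum>j\<in>UNIV. ennreal (\<Phi> \<bar>real CARD('n) * f j x\<bar>))" by (rule member_le_sum) auto
    finally show "ennreal (\<Phi> \<bar>\<Sum>j\<in>UNIV. f j x\<bar>) \<le> (\<Sum>j\<in>UNIV. ennreal (\<Phi> \<bar>real CARD('n) * f j x\<bar>))" .
  qed
  also have "\<dots> = (\<Sum>j\<in>UNIV. modl M (\<lambda>x. real CARD('n) * f j x))"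
    unfolding modl_def by (rule nn_integral_sum) measurable
  finally show ?thesis .
qed

end

lemma unif_int_bounded:
  assumes "finite_measure M" and [measurable]: "\<And>n. v n \<in> borel_measurable M" and C: "\<And>n x. x \<in> space M \<Longrightarrow> \<bar>v n x\<bar> \<le> C"
  shows "unif_int M v"
proof -
  interpret finite_measure M by fact
  have vi: "integrable M (v n)" for n by (rule integrable_const_bound[of _ C]) (use C in auto)
  have A: "(\<integral>x. \<bar>v n x\<bar> * indicator A x \<partial>M) \<le> \<bar>C\<bar> * measure M A" if [measurable]: "A \<in> sets M" for n A
  proof -
    have "(\<integral>x. \<bar>v n x\<bar> * indicator A x \<partial>M) \<le> (\<integral>x. \<bar>C\<bar> * indicator A x \<partial>M)"
    proof (rule integral_mono)
      show "integrable M (\<lambda>x. \<bar>v n x\<bar> * indicator A x)"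
        by (intro integrable_mult_bounded[where C=1] integrable_abs vi) (auto simp: indicator_def)
      show "integrable M (\<lambda>x. \<bar>C\<bar> * indicator A x)" by (simp add: integrable_indicator_iff less_top[symmetric])
      show "\<bar>v n x\<bar> * indicator A x \<le> \<bar>C\<bar> * indicator A x" if "x \<in> space M" for x
        using C[OF that, of n] by (intro mult_right_mono) auto
    qed
    then show ?thesis by (simp add: integrable_indicator_iff less_top[symmetric])
  qed
  show ?thesis unfolding unif_int_def
  proof (intro conjI allI impI)
    show "integrable M (v n)" for n by (rule vi)
    have "(\<integral>x. \<bar>v n x\<bar> \<partial>M) = (\<integral>x. \<bar>v n x\<bar> * indicator (space M) x \<partial>M)" for n
      by (rule Bochner_Integration.integral_cong) auto
    then have "(\<integral>x. \<bar>v n x\<bar> \<partial>M) \<le> \<bar>C\<bar> * measure M (space M)" for n using A[of "space M" n] by simp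
    then show "\<exists>B. \<forall>n. (\<integral>x. \<bar>v n x\<bar> \<partial>M) \<le> B" by blast
    fix e :: real assume e: "e > 0"
    have "(\<integral>x. \<bar>v n x\<bar> * indicator A x \<partial>M) \<le> e" if "A \<in> sets M" "measure M A < e / (\<bar>C\<bar> + 1)" for n A
    proof -
      have "\<bar>C\<bar> * measure M A \<le> (\<bar>C\<bar> + 1) * (e / (\<bar>C\<bar> + 1))" using that by (intro mult_mono) auto
      moreover have "\<bar>C\<bar> + 1 \<noteq> 0" by linarith
      ultimately show ?thesis using A[OF that(1), of n] by simp
    qed
    then show "\<exists>d>0. \<forall>n. \<forall>A\<in>sets M. measure M A < d \<longrightarrow> (\<integral>x. \<bar>v n x\<bar> * indicator A x \<partial>M) \<le> e"
      using e by (intro exI[of _ "e / (\<bar>C\<bar> + 1)"]) (auto intro!: divide_pos_pos)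
  qed
qed

section \<open>The mean ergodic theorem\<close>

context flow begin

lemma AE_eq_of_integrals:
  assumes "integrable P f" "integrable P (g :: 'a \<Rightarrow> real)" "\<And>A. A \<in> sets P \<Longrightarrow> (\<integral>z. f z * indicator A z \<partial>P) = (\<integral>z. g z * indicator A z \<partial>P)"
  shows "AE z in P. f z = g z"
  by (rule density_unique_real[OF assms(1,2)]) (use assms(3) in \<open>simp add: set_lebesgue_integral_def mult.commute\<close>)

text \<open>The averages are self-adjoint, so the squared norm of an average pairs the function with its
  double average; weak limits of the latter are invariant and hence orthogonal to the function.\<close>
lemma mean_ergodic_subseq:
  assumes f[measurable]: "f \<in> borel_measurable P" and C: "\<And>z. z \<in> space P \<Longrightarrow> \<bar>f z\<bar> \<le> C"
    and orth: "\<And>\<eta> B. inv_fun \<eta> \<Longrightarrow> (\<And>z. \<bar>\<eta> z\<bar> \<le> B) \<Longrightarrow> (\<integral>z. f z * \<eta> z \<partial>P) = 0"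
    and R: "\<And>n. R n > 0" "filterlim R at_top sequentially"
  shows "\<exists>r. strict_mono r \<and> (\<lambda>n. \<integral>z. \<bar>conv (mol (R (r n))) f z\<bar> \<partial>P) \<longlonglongrightarrow> 0"
proof -
  note mi = mol_integrable[OF R(1)] and ma = mol_abs_integral[OF R(1)]
  have mm[measurable]: "mol (R n) \<in> borel_measurable borel" for n by (rule Cc_inf_borel[OF mol_Cc_inf[OF R(1)]])
  have mr: "(\<lambda>y. mol (R n) (- y)) = mol (R n)" for n by (auto simp: mol_minus)
  have fi: "integrable P f" by (rule bounded_integrable[OF f C])
  define g where "g n = conv (mol (R n)) f" for n
  define h where "h n = conv (mol (R n)) (g n)" for n
  have gm[measurable]: "g n \<in> borel_measurable P" for n unfolding g_def by measurable
  have hm[measurable]: "h n \<in> borel_measurable P" for n unfolding h_def by measurable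
  have gC: "\<bar>g n z\<bar> \<le> C" if "z \<in> space P" for n z using conv_bound[OF that C mi] ma by (simp add: g_def)
  have hC: "\<bar>h n z\<bar> \<le> C" if "z \<in> space P" for n z using conv_bound[OF that gC mi] ma by (simp add: h_def)
  have gi: "integrable P (g n)" for n by (rule bounded_integrable[OF gm gC])
  have hi: "integrable P (h n)" for n by (rule bounded_integrable[OF hm hC])
  have "unif_int P h" by (rule unif_int_bounded[OF _ hm hC]) unfold_locales
  then obtain r \<beta> where r: "strict_mono r" and \<beta>: "integrable P \<beta>" "wconv P (h \<circ> r) \<beta>"
    using dunford_pettis[of P h] finite_measure_axioms by blast
  have [measurable]: "\<beta> \<in> borel_measurable P" using \<beta> by auto
  have Rr: "filterlim (\<lambda>n. R (r n)) at_top sequentially"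
    using filterlim_compose[OF R(2) filterlim_subseq[OF r]] .
  \<comment> \<open>Moving \<open>h n\<close> along the flow changes it in L1 at most by the
    distance of the wide kernel to its translate, which vanishes as the radius grows.\<close>
  have "AE z in P. \<beta> (S y z) = \<beta> z" for y
  proof (rule AE_eq_of_integrals)
    fix A assume A[measurable]: "A \<in> sets P"
    let ?F = "\<lambda>z. indicator A z :: real"
    have 1: "(\<lambda>n. \<integral>z. h (r n) z * ?F z \<partial>P) \<longlonglongrightarrow> (\<integral>z. \<beta> z * ?F z \<partial>P)"
      using wconvD[OF \<beta>(2), of ?F 1] by (auto simp: indicator_def)
    have 2: "(\<lambda>n. \<integral>z. h (r n) z * ?F (S (- y) z) \<partial>P) \<longlonglongrightarrow> (\<integral>z. \<beta> z * ?F (S (- y) z) \<partial>P)"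
      using wconvD[OF \<beta>(2), of "\<lambda>z. ?F (S (- y) z)" 1] by (auto simp: indicator_def)
    have sw: "(\<integral>z. w z * ?F (S (- y) z) \<partial>P) = (\<integral>z. w (S y z) * ?F z \<partial>P)" if [measurable]: "w \<in> borel_measurable P" for w
    proof -
      have "(\<integral>z. w z * ?F (S (- y) z) \<partial>P) = (\<integral>z. w (S y z) * ?F (S (- y) (S y z)) \<partial>P)"
        by (rule integral_S[symmetric]) measurable
      also have "\<dots> = (\<integral>z. w (S y z) * ?F z \<partial>P)" by (rule Bochner_Integration.integral_cong[OF HOL.refl]) (simp add: S_inv)
      finally show ?thesis .
    qed
    have 3: "\<bar>(\<integral>z. h n (S y z) * ?F z \<partial>P) - (\<integral>z. h n z * ?F z \<partial>P)\<bar> \<le> (\<integral>w. \<bar>mol (R n) (w - y) - mol (R n) w\<bar> \<partial>lborel) * (C * measure P (space P))" for n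
    proof -
      let ?\<sigma> = "\<lambda>w. mol (R n) (w - y) - mol (R n) w"
      have si: "integrable lborel (\<lambda>w. mol (R n) (w - y))" by (rule lborel_integral_shift(2)[OF mi])
      then have \<sigma>: "integrable lborel ?\<sigma>" using mi by simp
      have iF: "integrable P (\<lambda>z. w z * ?F z)" if "integrable P w" for w
        by (rule integrable_mult_bounded[OF that, where C=1]) (auto simp: indicator_def)
      have "(\<integral>z. h n (S y z) * ?F z \<partial>P) - (\<integral>z. h n z * ?F z \<partial>P) = (\<integral>z. (h n (S y z) - h n z) * ?F z \<partial>P)"
        using iF[OF integrable_S[OF hi]] iF[OF hi] by (simp add: left_diff_distrib)
      also have "\<bar>\<dots>\<bar> \<le> (\<integral>z. \<bar>h n (S y z) - h n z\<bar> \<partial>P)"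
      proof -
        have "\<bar>\<integral>z. (h n (S y z) - h n z) * ?F z \<partial>P\<bar> \<le> (\<integral>z. \<bar>(h n (S y z) - h n z) * ?F z\<bar> \<partial>P)" by (rule integral_abs_bound)
        also have "\<dots> \<le> (\<integral>z. \<bar>h n (S y z) - h n z\<bar> \<partial>P)"
          using integrable_S[OF hi] hi by (intro integral_mono') (auto simp: indicator_def)
        finally show ?thesis .
      qed
      also have "\<dots> = (\<integral>z. \<bar>conv ?\<sigma> (g n) z\<bar> \<partial>P)"
      proof (rule integral_cong_AE)
        show "AE z in P. \<bar>h n (S y z) - h n z\<bar> = \<bar>conv ?\<sigma> (g n) z\<bar>"
          using conv_kernel_lincomb_AE[OF si mi[of n] gi[of n], of 1 "-1"] AE_space by eventually_elim (simp add: h_def conv_shift)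
      qed measurable
      also have "\<dots> \<le> (\<integral>w. \<bar>?\<sigma> w\<bar> \<partial>lborel) * (\<integral>z. \<bar>g n z\<bar> \<partial>P)" by (rule conv_L1[OF \<sigma> gi])
      also have "\<dots> \<le> (\<integral>w. \<bar>?\<sigma> w\<bar> \<partial>lborel) * (C * measure P (space P))"
      proof (rule mult_left_mono)
        have "(\<integral>z. \<bar>g n z\<bar> \<partial>P) \<le> (\<integral>z. C \<partial>P)" using gi gC by (intro integral_mono) auto
        then show "(\<integral>z. \<bar>g n z\<bar> \<partial>P) \<le> C * measure P (space P)" by (simp add: mult.commute)
      qed simp
      finally show ?thesis .
    qed
    have 4: "(\<lambda>n. (\<integral>w. \<bar>mol (R (r n)) (w - y) - mol (R (r n)) w\<bar> \<partial>lborel) * (C * measure P (space P))) \<longlonglongrightarrow> 0 * (C * measure P (space P))"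
      by (intro tendsto_intros filterlim_compose[OF mol_shift_L1 Rr])
    have "(\<lambda>n. (\<integral>z. h (r n) (S y z) * ?F z \<partial>P) - (\<integral>z. h (r n) z * ?F z \<partial>P)) \<longlonglongrightarrow> 0"
      by (rule Lim_null_comparison[OF _ 4[simplified]]) (use 3 in \<open>auto intro!: always_eventually\<close>)
    moreover have "(\<lambda>n. (\<integral>z. h (r n) (S y z) * ?F z \<partial>P) - (\<integral>z. h (r n) z * ?F z \<partial>P)) \<longlonglongrightarrow> (\<integral>z. \<beta> (S y z) * ?F z \<partial>P) - (\<integral>z. \<beta> z * ?F z \<partial>P)"
      using 2 by (intro tendsto_diff 1) (simp add: sw)
    ultimately show "(\<integral>z. \<beta> (S y z) * ?F z \<partial>P) = (\<integral>z. \<beta> z * ?F z \<partial>P)" using LIMSEQ_unique by fastforce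
  qed (use \<beta> integrable_S in auto)
  then have bi: "inv_fun \<beta>" by (simp add: inv_fun_def)
  \<comment> \<open>The sign of \<open>\<beta>\<close> is bounded and invariant, hence an admissible
    test; it turns orthogonality into the vanishing of the L1 norm of
    \<open>\<beta>\<close>.\<close>
  define \<eta> where "\<eta> z = sgn (\<beta> z)" for z
  have \<eta>m[measurable]: "\<eta> \<in> borel_measurable P" unfolding \<eta>_def[abs_def] by measurable
  have \<eta>1: "\<bar>\<eta> z\<bar> \<le> 1" for z by (simp add: \<eta>_def abs_sgn_eq)
  have \<eta>i: "inv_fun \<eta>" unfolding inv_fun_def
  proof safe
    fix y
    have "AE z in P. \<beta> (S y z) = \<beta> z" using bi by (simp add: inv_fun_def)
    then show "AE z in P. \<eta> (S y z) = \<eta> z" by eventually_elim (simp add: \<eta>_def)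
  qed simp
  have \<eta>I: "integrable P \<eta>" by (rule bounded_integrable[OF \<eta>m \<eta>1])
  have adj: "(\<integral>z. conv (mol (R n)) w z * v z \<partial>P) = (\<integral>z. w z * conv (mol (R n)) v z \<partial>P)"
    if "integrable P w" "v \<in> borel_measurable P" "\<And>z. z \<in> space P \<Longrightarrow> \<bar>v z\<bar> \<le> B" for w v n B
    using conv_adjoint[OF mi that, of n] by (simp add: mr)
  have c\<eta>: "AE z in P. conv (mol (R n)) \<eta> z = \<eta> z" for n
    using conv_invariant[OF \<eta>I \<eta>i mi[of n]] mol_integral[OF R(1)[of n], where 'n='n] by simp
  have h\<eta>: "(\<integral>z. h n z * \<eta> z \<partial>P) = 0" for n
  proof -
    have "(\<integral>z. h n z * \<eta> z \<partial>P) = (\<integral>z. g n z * conv (mol (R n)) \<eta> z \<partial>P)"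
      unfolding h_def by (rule adj[OF gi \<eta>m \<eta>1])
    also have "\<dots> = (\<integral>z. g n z * \<eta> z \<partial>P)" using c\<eta>[of n] by (intro integral_cong_AE) (auto elim: eventually_mono)
    also have "\<dots> = (\<integral>z. f z * conv (mol (R n)) \<eta> z \<partial>P)" unfolding g_def by (rule adj[OF fi \<eta>m \<eta>1])
    also have "\<dots> = (\<integral>z. f z * \<eta> z \<partial>P)" using c\<eta>[of n] by (intro integral_cong_AE) (auto elim: eventually_mono)
    finally show ?thesis using orth[OF \<eta>i \<eta>1] by simp
  qed
  have "(\<lambda>n. \<integral>z. (h \<circ> r) n z * \<eta> z \<partial>P) \<longlonglongrightarrow> (\<integral>z. \<beta> z * \<eta> z \<partial>P)" by (rule wconvD[OF \<beta>(2) \<eta>m \<eta>1])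
  then have "(\<integral>z. \<beta> z * \<eta> z \<partial>P) = 0" using h\<eta> LIMSEQ_unique[of "\<lambda>n. 0"] by (simp add: o_def LIMSEQ_const_iff)
  moreover have "(\<lambda>z. \<beta> z * \<eta> z) = (\<lambda>z. \<bar>\<beta> z\<bar>)" by (auto simp: \<eta>_def abs_sgn)
  ultimately have "AE z in P. \<beta> z = 0" using \<beta> by (intro L1_zero_AE) auto
  then have "(\<integral>z. \<beta> z * f z \<partial>P) = 0" by (intro integral_eq_zero_AE) (auto elim: eventually_mono)
  moreover have "(\<lambda>n. \<integral>z. (h \<circ> r) n z * f z \<partial>P) \<longlonglongrightarrow> (\<integral>z. \<beta> z * f z \<partial>P)" by (rule wconvD[OF \<beta>(2) f C])
  ultimately have hf: "(\<lambda>n. \<integral>z. h (r n) z * f z \<partial>P) \<longlonglongrightarrow> 0" by (simp add: o_def)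
  have g2: "(\<integral>z. h n z * f z \<partial>P) = (\<integral>z. (g n z)\<^sup>2 \<partial>P)" for n
    unfolding h_def using adj[OF gi f C, of n] by (simp add: g_def power2_eq_square)
  have g2i: "integrable P (\<lambda>z. (g n z)\<^sup>2)" for n
    using integrable_mult_bounded[OF gi gm, of n C] gC by (auto simp: power2_eq_square)
  have "(\<lambda>n. \<integral>z. \<bar>g (r n) z\<bar> \<partial>P) \<longlonglongrightarrow> 0"
  proof (rule LIMSEQ_I)
    fix e :: real assume e: "e > 0"
    \<comment> \<open>From \<bar>t\<bar> \<le> d + t^2/d, convergence in L2 gives convergence in L1:
      part of \<open>e\<close> pays for the constant \<open>d\<close>, the rest for the square. The
      summand 1 covers a space of measure 0.\<close>
    define d where "d = e / (2 * (measure P (space P) + 1))"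
    have d: "d > 0" "d * measure P (space P) < e" 
      using e by (auto simp: d_def divide_simps add_pos_nonneg add_nonneg_pos)
    obtain N where N: "\<And>n. n \<ge> N \<Longrightarrow> (\<integral>z. (g (r n) z)\<^sup>2 \<partial>P) < d * (e - d * measure P (space P))"
      using LIMSEQ_D[OF hf, of "d * (e - d * measure P (space P))"] d by (auto simp: g2)
    have "norm ((\<integral>z. \<bar>g (r n) z\<bar> \<partial>P) - 0) < e" if "n \<ge> N" for n
    proof -
      have "(\<integral>z. \<bar>g (r n) z\<bar> \<partial>P) \<le> (\<integral>z. d + (g (r n) z)\<^sup>2 / d \<partial>P)"
      proof (rule integral_mono)
        fix z
        have "\<bar>t\<bar> \<le> d + t\<^sup>2 / d" for t
        proof (cases "\<bar>t\<bar> \<le> d")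
          case False
          then have "\<bar>t\<bar> * d \<le> \<bar>t\<bar> * \<bar>t\<bar>" by (intro mult_left_mono) auto
          then have "\<bar>t\<bar> \<le> t\<^sup>2 / d" using d by (simp add: field_simps power2_eq_square flip: abs_mult)
          then show ?thesis using d by simp
        qed (use d in \<open>simp add: add_increasing2\<close>)
        then show "\<bar>g (r n) z\<bar> \<le> d + (g (r n) z)\<^sup>2 / d" .
      qed (use gi g2i in auto)
      also have "\<dots> = d * measure P (space P) + (\<integral>z. (g (r n) z)\<^sup>2 \<partial>P) / d" using g2i by (simp add: mult.commute)
      also have "\<dots> < d * measure P (space P) + (e - d * measure P (space P))"
      proof -
        have "(\<integral>z. (g (r n) z)\<^sup>2 \<partial>P) / d < e - d * measure P (space P)"
          using N[OF that] d(1) by (subst pos_divide_less_eq) (simp_all add: mult.commute)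
        then show ?thesis by linarith
      qed
      finally show ?thesis by simp
    qed
    then show "\<exists>no. \<forall>n\<ge>no. norm ((\<integral>z. \<bar>g (r n) z\<bar> \<partial>P) - 0) < e" by blast
  qed
  then show ?thesis using r unfolding g_def by blast
qed

text \<open>A failure would produce radii tending to infinity along which the averages stay above
  \<open>e\<close>; the subsequence lemma contradicts this.\<close>

lemma mean_ergodic_bounded:
  assumes f[measurable]: "f \<in> borel_measurable P" and C: "\<And>z. z \<in> space P \<Longrightarrow> \<bar>f z\<bar> \<le> C"
    and orth: "\<And>\<eta> B. inv_fun \<eta> \<Longrightarrow> (\<And>z. \<bar>\<eta> z\<bar> \<le> B) \<Longrightarrow> (\<integral>z. f z * \<eta> z \<partial>P) = 0" and e: "e > 0"
  shows "eventually (\<lambda>R. (\<integral>z. \<bar>conv (mol R) f z\<bar> \<partial>P) \<le> e) at_top"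
proof (rule ccontr)
  assume "\<not> ?thesis"
  then have "\<forall>n::nat. \<exists>R\<ge>real (Suc n). \<not> (\<integral>z. \<bar>conv (mol R) f z\<bar> \<partial>P) \<le> e"
    unfolding eventually_at_top_linorder by blast
  then obtain R where R: "\<And>n::nat. R n \<ge> real (Suc n)" "\<And>n. \<not> (\<integral>z. \<bar>conv (mol (R n)) f z\<bar> \<partial>P) \<le> e" by metis
  have "filterlim R at_top sequentially"
    by (rule filterlim_at_top_mono[OF filterlim_compose[OF filterlim_real_sequentially filterlim_Suc]]) (use R in auto)
  moreover have "R n > 0" for n using R(1)[of n] by simp
  ultimately obtain r where "(\<lambda>n. \<integral>z. \<bar>conv (mol (R (r n))) f z\<bar> \<partial>P) \<longlonglongrightarrow> 0"
    using mean_ergodic_subseq[of f C R] f C orth by blast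
  then have "eventually (\<lambda>n. (\<integral>z. \<bar>conv (mol (R (r n))) f z\<bar> \<partial>P) < e) sequentially" using e by (rule order_tendstoD)
  then obtain n where "(\<integral>z. \<bar>conv (mol (R (r n))) f z\<bar> \<partial>P) < e" by (auto simp: eventually_sequentially)
  then show False using R(2)[of "r n"] by simp
qed

end

section \<open>Curl-free fields\<close>

locale orlicz_flow = flow P S + Y: young \<Phi>
  for P :: "'a measure" and S :: "real^'n \<Rightarrow> 'a \<Rightarrow> 'a" and \<Phi> :: "real \<Rightarrow> real"
begin

text \<open>Jensen's inequality for the probability density \<bar>\<sigma>\<bar>/c, where c is the
  L1 norm of the kernel, followed by Fubini and invariance of the measure. The case c = 0 is split
  off because of the division.\<close>

lemma modl_conv:
  assumes \<sigma>: "integrable lborel \<sigma>" and [measurable]: "f \<in> borel_measurable P"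
  shows "Y.modl P (conv \<sigma> f) \<le> Y.modl P (\<lambda>z. (\<integral>y. \<bar>\<sigma> y\<bar> \<partial>lborel) * f z)"
proof -
  have [measurable]: "\<sigma> \<in> borel_measurable borel" using \<sigma> by auto
  define c where "c = (\<integral>y. \<bar>\<sigma> y\<bar> \<partial>lborel)"
  have cnn: "(\<integral>\<^sup>+y. ennreal \<bar>\<sigma> y\<bar> \<partial>lborel) = ennreal c"
    unfolding c_def using \<sigma> by (intro nn_integral_eq_integral) auto
  have "c \<ge> 0" by (simp add: c_def)
  show ?thesis
  proof (cases "c = 0")
    case True
    then have "AE y in lborel. \<bar>\<sigma> y\<bar> = 0"
      using \<sigma> by (subst (asm) c_def, subst (asm) integral_nonneg_eq_0_iff_AE) auto
    then have "conv \<sigma> f z = 0" for z unfolding conv_def by (intro integral_eq_zero_AE) auto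
    then show ?thesis unfolding Y.modl_def by (simp add: Y.zero)
  next
    case False
    then have c: "c > 0" using \<open>c \<ge> 0\<close> by simp
    define N where "N = density lborel (\<lambda>y. ennreal (\<bar>\<sigma> y\<bar> / c))"
    have N1: "emeasure N (space N) = 1"
    proof -
      have "emeasure N (space N) = (\<integral>\<^sup>+y. ennreal (1 / c) * ennreal \<bar>\<sigma> y\<bar> \<partial>lborel)"
        unfolding N_def using c by (subst emeasure_density) (auto simp: ennreal_mult[symmetric] intro!: nn_integral_cong)
      also have "\<dots> = ennreal (1 / c) * ennreal c" using cnn by (subst nn_integral_cmult) auto
      finally show ?thesis using c by (simp add: ennreal_mult[symmetric])
    qed
    have dens: "(\<integral>\<^sup>+y. F y \<partial>N) = (\<integral>\<^sup>+y. ennreal (\<bar>\<sigma> y\<bar> / c) * F y \<partial>lborel)" if "F \<in> borel_measurable borel" for F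
      unfolding N_def using that by (subst nn_integral_density) auto
    have "Y.modl P (conv \<sigma> f) \<le> (\<integral>\<^sup>+z. (\<integral>\<^sup>+y. ennreal (\<bar>\<sigma> y\<bar> / c) * ennreal (\<Phi> \<bar>c * f (S y z)\<bar>) \<partial>lborel) \<partial>P)"
      unfolding Y.modl_def
    proof (rule nn_integral_mono)
      fix z assume z: "z \<in> space P"
      have Sz[measurable]: "(\<lambda>y. S y z) \<in> measurable borel P" by (intro S_comp measurable_ident_sets measurable_const z) simp
      have "ennreal \<bar>conv \<sigma> f z\<bar> \<le> (\<integral>\<^sup>+y. ennreal (norm (\<sigma> y * f (S y z))) \<partial>lborel)"
        unfolding conv_def using integral_norm_bound_ennreal[of lborel "\<lambda>y. \<sigma> y * f (S y z)"]
        by (cases "integrable lborel (\<lambda>y. \<sigma> y * f (S y z))") (auto simp: not_integrable_integral_eq)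
      also have "\<dots> = (\<integral>\<^sup>+y. ennreal (\<bar>\<sigma> y\<bar> / c) * ennreal \<bar>c * f (S y z)\<bar> \<partial>lborel)"
        using c by (intro nn_integral_cong) (simp add: ennreal_mult[symmetric] abs_mult)
      also have "\<dots> = (\<integral>\<^sup>+y. ennreal \<bar>c * f (S y z)\<bar> \<partial>N)" by (rule dens[symmetric]) measurable
      finally have "ennreal (\<Phi> \<bar>conv \<sigma> f z\<bar>) \<le> (\<integral>\<^sup>+y. ennreal (\<Phi> \<bar>c * f (S y z)\<bar>) \<partial>N)"
        by (intro Y.jensen_nn[OF N1]) (auto simp: N_def)
      also have "\<dots> = (\<integral>\<^sup>+y. ennreal (\<bar>\<sigma> y\<bar> / c) * ennreal (\<Phi> \<bar>c * f (S y z)\<bar>) \<partial>lborel)" by (rule dens) measurable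
      finally show "ennreal (\<Phi> \<bar>conv \<sigma> f z\<bar>) \<le> (\<integral>\<^sup>+y. ennreal (\<bar>\<sigma> y\<bar> / c) * ennreal (\<Phi> \<bar>c * f (S y z)\<bar>) \<partial>lborel)" .
    qed
    also have "\<dots> = (\<integral>\<^sup>+y. (\<integral>\<^sup>+z. ennreal (\<bar>\<sigma> y\<bar> / c) * ennreal (\<Phi> \<bar>c * f (S y z)\<bar>) \<partial>P) \<partial>lborel)"
      by (rule LP.Fubini') measurable
    also have "\<dots> = (\<integral>\<^sup>+y. ennreal (\<bar>\<sigma> y\<bar> / c) * Y.modl P (\<lambda>z. c * f z) \<partial>lborel)"
    proof (rule nn_integral_cong)
      fix y
      have "(\<integral>\<^sup>+z. ennreal (\<Phi> \<bar>c * f (S y z)\<bar>) \<partial>P) = Y.modl P (\<lambda>z. c * f z)"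
        unfolding Y.modl_def by (rule nn_integral_S[of "\<lambda>z. ennreal (\<Phi> \<bar>c * f z\<bar>)"]) measurable
      then show "(\<integral>\<^sup>+z. ennreal (\<bar>\<sigma> y\<bar> / c) * ennreal (\<Phi> \<bar>c * f (S y z)\<bar>) \<partial>P) = ennreal (\<bar>\<sigma> y\<bar> / c) * Y.modl P (\<lambda>z. c * f z)"
        by (subst nn_integral_cmult) auto
    qed
    also have "\<dots> = emeasure N (space N) * Y.modl P (\<lambda>z. c * f z)"
      unfolding N_def by (subst nn_integral_multc, measurable, subst emeasure_density) (auto intro!: arg_cong2[where f="(*)"] nn_integral_cong)
    finally show ?thesis using N1 by (simp add: c_def)
  qed
qed

lemma conv_cmult: "conv \<sigma> (\<lambda>z. l * f z) z = l * conv \<sigma> f z"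
proof -
  have "(\<lambda>y. \<sigma> y * (l * f (S y z))) = (\<lambda>y. l * (\<sigma> y * f (S y z)))" by (auto simp: algebra_simps)
  then show ?thesis unfolding conv_def by simp
qed

lemma modl_conv_scaled:
  assumes \<sigma>: "integrable lborel \<sigma>" and [measurable]: "f \<in> borel_measurable P"
  shows "Y.modl P (\<lambda>z. l * conv \<sigma> f z) \<le> Y.modl P (\<lambda>z. ((\<integral>y. \<bar>\<sigma> y\<bar> \<partial>lborel) * l) * f z)"
proof -
  have "conv \<sigma> (\<lambda>z. l * f z) = (\<lambda>z. l * conv \<sigma> f z)" by (rule ext) (rule conv_cmult)
  then show ?thesis using modl_conv[OF \<sigma>, of "\<lambda>z. l * f z"] by (simp only: mult.assoc) simp
qed

lemma modl_conv_mol: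
  assumes "r > 0" and f: "f \<in> borel_measurable P"
  shows "Y.modl P (\<lambda>z. l * conv (mol r) f z) \<le> Y.modl P (\<lambda>z. l * f z)"
  using modl_conv_scaled[OF mol_integrable[OF assms(1)] f, of l] mol_abs_integral[OF assms(1)] by simp

lemma modl_EI:
  assumes f: "integrable P f" shows "Y.modl P (EI f) \<le> Y.modl P f"
proof (cases "Y.modl P f = \<infinity>")
  case False
  have [measurable]: "f \<in> borel_measurable P" using f by auto
  have qi: "integrable P (\<lambda>z. \<Phi> \<bar>f z\<bar>)"
    using False unfolding Y.modl_def by (intro integrableI_nonneg AE_I2 Y.nonneg) (auto simp: less_top)
  have J: "AE z in P. \<Phi> \<bar>EI f z\<bar> \<le> EI (\<lambda>z. \<Phi> \<bar>f z\<bar>) z"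
    by (rule Inv.real_cond_exp_jensens_inequality(2)[OF f, of UNIV]) (use qi Y.convex_abs in auto)
  have nn: "AE z in P. 0 \<le> EI (\<lambda>z. \<Phi> \<bar>f z\<bar>) z" by (rule Inv.real_cond_exp_pos) (auto intro!: AE_I2 Y.nonneg)
  have "Y.modl P (EI f) \<le> (\<integral>\<^sup>+z. ennreal (EI (\<lambda>z. \<Phi> \<bar>f z\<bar>) z) \<partial>P)"
    unfolding Y.modl_def using J by (intro nn_integral_mono_AE) (auto elim!: eventually_mono intro: ennreal_leI)
  also have "\<dots> = ennreal (\<integral>z. EI (\<lambda>z. \<Phi> \<bar>f z\<bar>) z \<partial>P)"
    by (rule nn_integral_eq_integral[OF Inv.real_cond_exp_int(1)[OF qi] nn])
  also have "\<dots> = ennreal (\<integral>z. \<Phi> \<bar>f z\<bar> \<partial>P)" using Inv.real_cond_exp_int(2)[OF qi] by simp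
  also have "\<dots> = Y.modl P f" unfolding Y.modl_def using qi by (intro nn_integral_eq_integral[symmetric] AE_I2 Y.nonneg) auto
  finally show ?thesis .
qed simp

text \<open>The condition \<open>Q\<close> carries the restriction to positive radii, for which the
  mollifiers are normalised; the filter \<open>G\<close> is that of small or of large radii.\<close>

lemma modl_L1_eventually:
  assumes [measurable]: "\<And>r. F r \<in> borel_measurable P" and C: "C > 0" "\<And>r z. Q r \<Longrightarrow> z \<in> space P \<Longrightarrow> \<bar>F r z\<bar> \<le> C" and l: "l \<ge> 0" and e: "e > 0"
    and ev: "\<And>d. d > 0 \<Longrightarrow> eventually (\<lambda>r. (\<integral>z. \<bar>F r z\<bar> \<partial>P) \<le> d) G" and Q: "eventually Q G"
  shows "eventually (\<lambda>r. Y.modl P (\<lambda>z. l * F r z) \<le> ennreal e) G"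
proof -
  define K where "K = \<Phi> (l * C) / C"
  have K: "K \<ge> 0" using Y.nonneg[of "l * C"] l C by (simp add: K_def)
  have "eventually (\<lambda>r. (\<integral>z. \<bar>F r z\<bar> \<partial>P) \<le> e / (K + 1)) G" by (rule ev) (use e K in auto)
  then show ?thesis using Q
  proof eventually_elim
    case (elim r)
    have Fi: "integrable P (F r)" by (rule bounded_integrable[of _ C]) (use C elim in auto)
    have "Y.modl P (\<lambda>z. l * F r z) \<le> ennreal (K * (\<integral>z. \<bar>F r z\<bar> \<partial>P))"
      unfolding K_def by (rule Y.modl_bounded_L1) (use C elim l Fi in auto)
    also have "\<dots> \<le> ennreal e"
    proof (rule ennreal_leI)
      have "K * (\<integral>z. \<bar>F r z\<bar> \<partial>P) \<le> (K + 1) * (e / (K + 1))" using elim K e by (intro mult_mono) auto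
      then show "K * (\<integral>z. \<bar>F r z\<bar> \<partial>P) \<le> e" using K by simp
    qed
    finally show ?case .
  qed
qed

text \<open>Finite modular at every scale is what makes truncations converge in modular. Under
  Delta_2 this is all of L^\<Phi>, see \<open>orlicz_EPhi\<close>.\<close>

definition EPhi :: "('a \<Rightarrow> real) \<Rightarrow> bool" where
  "EPhi f \<longleftrightarrow> f \<in> borel_measurable P \<and> (\<forall>l. Y.modl P (\<lambda>z. l * f z) < \<infinity>)"

lemma EPhi_integrable: "EPhi f \<Longrightarrow> integrable P f"
proof -
  assume "EPhi f"
  then have "f \<in> borel_measurable P" "Y.modl P (\<lambda>z. 1 * f z) < \<infinity>" unfolding EPhi_def by blast+
  then show "integrable P f" by (intro Y.modl_integrable[OF finite_measure_axioms, where k=1]) auto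
qed

lemma EPhi_trunc: 
  assumes "EPhi f" "e > 0" shows "eventually (\<lambda>m. Y.modl P (\<lambda>z. l * (f z - trunc m (f z))) \<le> ennreal e) sequentially"
proof -
  have "(\<lambda>m. Y.modl P (\<lambda>z. l * (f z - trunc m (f z)))) \<longlonglongrightarrow> 0"
    using assms(1) unfolding EPhi_def by (intro Y.modl_trunc_tendsto) auto
  then have "eventually (\<lambda>m. Y.modl P (\<lambda>z. l * (f z - trunc m (f z))) < ennreal e) sequentially"
    by (rule order_tendstoD) (use assms(2) in simp)
  then show ?thesis by eventually_elim simp
qed

text \<open>Each use of the two-term inequality doubles the scale. The third term would need only 2;
  the common factor 4 keeps the later estimates symmetric and explains the scale
  \<open>4 * l\<close> in them.\<close>

lemma modl_add3:
  assumes [measurable]: "A \<in> borel_measurable P" "B \<in> borel_measurable P" "C \<in> borel_measurable P"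
  shows "Y.modl P (\<lambda>z. l * (A z + B z + C z)) \<le> Y.modl P (\<lambda>z. 4 * l * A z) + Y.modl P (\<lambda>z. 4 * l * B z) + Y.modl P (\<lambda>z. 4 * l * C z)"
proof -
  have "Y.modl P (\<lambda>z. l * (A z + B z + C z)) \<le> Y.modl P (\<lambda>z. 2 * (l * (A z + B z))) + Y.modl P (\<lambda>z. 2 * (l * C z))"
    using Y.modl_add[of "\<lambda>z. l * (A z + B z)" P "\<lambda>z. l * C z"] by (simp add: distrib_left)
  also have "Y.modl P (\<lambda>z. 2 * (l * (A z + B z))) \<le> Y.modl P (\<lambda>z. 2 * (2 * l * A z)) + Y.modl P (\<lambda>z. 2 * (2 * l * B z))"
    using Y.modl_add[of "\<lambda>z. 2 * l * A z" P "\<lambda>z. 2 * l * B z"] by (simp add: distrib_left mult.assoc)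
  also have "Y.modl P (\<lambda>z. 2 * (l * C z)) \<le> Y.modl P (\<lambda>z. 4 * l * C z)"
    by (rule Y.modl_mono) (auto simp: abs_mult)
  finally show ?thesis by (simp add: add_mono mult.assoc)
qed

lemma modl_approx_identity:
  assumes f: "EPhi f" and l: "l \<ge> 0" and e: "e > 0"
  shows "eventually (\<lambda>r. Y.modl P (\<lambda>z. l * (conv (mol r) f z - f z)) \<le> ennreal e) (at_right 0)"
proof -
  have [measurable]: "f \<in> borel_measurable P" and fi: "integrable P f" using EPhi_integrable[OF f] f unfolding EPhi_def by auto
  obtain m where m: "Y.modl P (\<lambda>z. (4 * l) * (f z - trunc m (f z))) \<le> ennreal (e / 3)"
    using EPhi_trunc[OF f, of "e/3" "4 * l"] e by (auto simp: eventually_sequentially)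
  define t where "t z = trunc m (f z)" for z
  define d where "d z = f z - t z" for z
  have [measurable]: "t \<in> borel_measurable P" "d \<in> borel_measurable P" unfolding t_def[abs_def] d_def[abs_def] by measurable
  have tb: "\<bar>t z\<bar> \<le> real m + 1" for z using trunc_bound[of m "f z"] by (simp add: t_def)
  have ti: "integrable P t" by (rule bounded_integrable[OF _ tb]) simp
  have pos: "eventually (\<lambda>r::real. r > 0) (at_right 0)" by (rule eventually_at_right_less)
  \<comment> \<open>The value 0 for nonpositive radii makes \<open>F r\<close> measurable for every
    \<open>r\<close>.\<close>
  define F where "F r z = (if r > 0 then conv (mol r) t z - t z else 0)" for r z
  have Fm: "F r \<in> borel_measurable P" for r
  proof (cases "r > 0")
    case True
    have [measurable]: "(mol r :: real^'n \<Rightarrow> real) \<in> borel_measurable borel" by (rule Cc_inf_borel[OF mol_Cc_inf[OF True]])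
    show ?thesis using True by (simp add: F_def[abs_def])
  qed (simp add: F_def[abs_def])
  have "eventually (\<lambda>r. Y.modl P (\<lambda>z. (4 * l) * F r z) \<le> ennreal (e / 3)) (at_right 0)"
  proof (rule modl_L1_eventually[where Q="\<lambda>r. r > 0" and C="2 * (real m + 1)", OF Fm])
    show "\<bar>F r z\<bar> \<le> 2 * (real m + 1)" if "r > 0" "z \<in> space P" for r z
      using conv_bound[of z t "real m + 1" "mol r", OF that(2) tb mol_integrable[OF that(1)]] mol_abs_integral[OF that(1)] tb[of z] that(1) by (simp add: F_def)
    show "eventually (\<lambda>r. (\<integral>z. \<bar>F r z\<bar> \<partial>P) \<le> d) (at_right 0)" if "d > 0" for d
      using pos approx_identity_bounded[of t "real m + 1", OF _ tb that, simplified] by eventually_elim (simp add: F_def)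
  qed (use l e pos in auto)
  then show ?thesis using pos
  proof eventually_elim
    case (elim r)
    note r = elim(2)
    note \<sigma> = mol_integrable[OF r]
    have [measurable]: "(mol r :: real^'n \<Rightarrow> real) \<in> borel_measurable borel" by (rule Cc_inf_borel[OF mol_Cc_inf[OF r]])
    have "AE z in P. l * (conv (mol r) f z - f z) = l * (conv (mol r) d z + F r z + (- d z))"
      using conv_diff_AE[OF \<sigma> fi ti] by eventually_elim (use r in \<open>simp add: F_def d_def[abs_def]\<close>)
    then have "Y.modl P (\<lambda>z. l * (conv (mol r) f z - f z)) = Y.modl P (\<lambda>z. l * (conv (mol r) d z + F r z + (- d z)))"
      by (rule Y.modl_cong_AE)
    also have "\<dots> \<le> Y.modl P (\<lambda>z. 4 * l * conv (mol r) d z) + Y.modl P (\<lambda>z. 4 * l * F r z) + Y.modl P (\<lambda>z. 4 * l * (- d z))"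
      using Fm[of r] by (intro modl_add3) auto
    also have "\<dots> \<le> ennreal (e / 3) + ennreal (e / 3) + ennreal (e / 3)"
    proof (intro add_mono)
      show "Y.modl P (\<lambda>z. 4 * l * conv (mol r) d z) \<le> ennreal (e / 3)"
        using modl_conv_mol[OF r, of d "4 * l"] m by (simp add: d_def[abs_def] t_def)
      show "Y.modl P (\<lambda>z. 4 * l * (- d z)) \<le> ennreal (e / 3)"
      proof -
        have "\<bar>4 * l * (- x)\<bar> = \<bar>4 * l * x\<bar>" for x :: real by simp
        then show ?thesis using m unfolding Y.modl_def d_def t_def by (simp only:)
      qed
    qed (use elim in auto)
    also have "\<dots> = ennreal e" using e by (simp add: ennreal_plus[symmetric] del: ennreal_plus)
    finally show ?case .
  qed
qed

text \<open>A truncation of \<open>f\<close> no longer has vanishing invariant part, so its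
  conditional expectation \<open>b\<close> is subtracted. As the invariant part of \<open>f\<close>
  is 0, \<open>b\<close> is minus the conditional expectation of the truncation error, and
  conditional expectation does not increase the modular: the correction is as small as the
  error.\<close>

lemma modl_mean_ergodic:
  assumes f: "EPhi f" and E0: "AE z in P. EI f z = 0" and l: "l \<ge> 0" and e: "e > 0"
  shows "eventually (\<lambda>R. Y.modl P (\<lambda>z. l * conv (mol R) f z) \<le> ennreal e) at_top"
proof -
  have [measurable]: "f \<in> borel_measurable P" and fi: "integrable P f" using EPhi_integrable[OF f] f unfolding EPhi_def by auto
  obtain m where m: "Y.modl P (\<lambda>z. (4 * l) * (f z - trunc m (f z))) \<le> ennreal (e / 3)"
    using EPhi_trunc[OF f, of "e/3" "4 * l"] e by (auto simp: eventually_sequentially)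
  define t where "t z = trunc m (f z)" for z
  define d where "d z = f z - t z" for z
  have [measurable]: "t \<in> borel_measurable P" "d \<in> borel_measurable P" unfolding t_def[abs_def] d_def[abs_def] by measurable
  have tb: "\<bar>t z\<bar> \<le> real m" for z using trunc_bound[of m "f z"] by (simp add: t_def)
  have ti: "integrable P t" by (rule bounded_integrable[OF _ tb]) simp
  have di: "integrable P d" unfolding d_def[abs_def] using fi ti by simp
  define b where "b z = trunc m (EI t z)" for z
  have bI: "b \<in> borel_measurable Inv" unfolding b_def[abs_def] by measurable
  have [measurable]: "b \<in> borel_measurable P" by (rule measurable_from_subalg[OF subalg_Inv bI])
  have bb: "\<bar>b z\<bar> \<le> real m" for z by (simp add: b_def trunc_bound)
  have bi: "integrable P b" by (rule bounded_integrable[OF _ bb]) simp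
  have "AE z in P. t z \<le> real m" "AE z in P. - real m \<le> t z" using tb by (auto simp: abs_le_iff minus_le_iff)
  then have "AE z in P. EI t z \<le> real m" "AE z in P. EI t z \<ge> - real m"
    using Inv.real_cond_exp_le_c[OF ti] Inv.real_cond_exp_ge_c[OF ti] by auto
  then have bE: "AE z in P. b z = EI t z" by eventually_elim (simp add: b_def trunc_eq abs_le_iff)
  have "AE z in P. b z = - EI d z"
    using bE E0 Inv.real_cond_exp_diff[OF fi ti] by eventually_elim (simp add: d_def[abs_def])
  then have bmod: "Y.modl P (\<lambda>z. 4 * l * b z) \<le> ennreal (e / 3)"
  proof -
    have *: "AE z in P. \<bar>4 * l * b z\<bar> = \<bar>EI (\<lambda>z. 4 * l * d z) z\<bar>"
      using \<open>AE z in P. b z = - EI d z\<close> Inv.real_cond_exp_cmult[OF di, of "4 * l"]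
    proof eventually_elim
      case (elim z)
      then show ?case by (simp add: abs_mult)
    qed
    have "Y.modl P (\<lambda>z. 4 * l * b z) \<le> Y.modl P (EI (\<lambda>z. 4 * l * d z))"
      using * by (intro Y.modl_mono_AE) (auto elim: eventually_mono)
    also have "\<dots> \<le> Y.modl P (\<lambda>z. 4 * l * d z)" by (rule modl_EI) (use di in simp)
    finally show ?thesis using m by (simp add: d_def t_def)
  qed
  have pos: "eventually (\<lambda>r::real. r > 0) at_top" by (rule eventually_gt_at_top)
  define w where "w z = t z - b z" for z
  have wm[measurable]: "w \<in> borel_measurable P" unfolding w_def[abs_def] by measurable
  have wb: "\<bar>w z\<bar> \<le> 2 * real m + 1" for z using tb[of z] bb[of z] by (auto simp: w_def)
  have orth: "(\<integral>z. w z * \<eta> z \<partial>P) = 0" if \<eta>: "inv_fun \<eta>" "\<And>z. \<bar>\<eta> z\<bar> \<le> B" for \<eta> B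
  proof -
    have [measurable]: "\<eta> \<in> borel_measurable P" using \<eta> by (simp add: inv_fun_def)
    have i: "integrable P (\<lambda>z. v z * \<eta> z)" if "integrable P v" for v
      by (rule integrable_mult_bounded[OF that, where C=B]) (use \<eta> in auto)
    have "(\<integral>z. b z * \<eta> z \<partial>P) = (\<integral>z. \<eta> z * EI t z \<partial>P)" using bE by (intro integral_cong_AE) (auto elim: eventually_mono)
    also have "\<dots> = (\<integral>z. \<eta> z * t z \<partial>P)" using i[OF ti] by (intro EI_integral \<eta>) (auto simp: mult.commute)
    also have "\<dots> = (\<integral>z. t z * \<eta> z \<partial>P)" by (simp only: mult.commute)
    finally show ?thesis using i[OF ti] i[OF bi] by (simp add: w_def left_diff_distrib)
  qed
  define F where "F r z = (if r > 0 then conv (mol r) w z else 0)" for r z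
  have Fm: "F r \<in> borel_measurable P" for r
  proof (cases "r > 0")
    case True
    have [measurable]: "(mol r :: real^'n \<Rightarrow> real) \<in> borel_measurable borel" by (rule Cc_inf_borel[OF mol_Cc_inf[OF True]])
    show ?thesis using True by (simp add: F_def[abs_def])
  qed (simp add: F_def[abs_def])
  have "eventually (\<lambda>r. Y.modl P (\<lambda>z. (4 * l) * F r z) \<le> ennreal (e / 3)) at_top"
  proof (rule modl_L1_eventually[where Q="\<lambda>r. r > 0" and C="2 * real m + 1", OF Fm])
    show "\<bar>F r z\<bar> \<le> 2 * real m + 1" if "r > 0" "z \<in> space P" for r z
      using conv_bound[of z w "2 * real m + 1" "mol r", OF that(2) wb mol_integrable[OF that(1)]] mol_abs_integral[OF that(1)] that(1) by (simp add: F_def)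
    show "eventually (\<lambda>r. (\<integral>z. \<bar>F r z\<bar> \<partial>P) \<le> d) at_top" if "d > 0" for d
    proof -
      have "eventually (\<lambda>R. (\<integral>z. \<bar>conv (mol R) w z\<bar> \<partial>P) \<le> d) at_top"
        by (rule mean_ergodic_bounded[OF wm wb _ that]) (rule orth)
      with pos show ?thesis by eventually_elim (simp add: F_def)
    qed
  qed (use l e pos in auto)
  then show ?thesis using pos
  proof eventually_elim
    case (elim r)
    note r = elim(2)
    note \<sigma> = mol_integrable[OF r]
    have [measurable]: "(mol r :: real^'n \<Rightarrow> real) \<in> borel_measurable borel" by (rule Cc_inf_borel[OF mol_Cc_inf[OF r]])
    have "AE z in P. l * conv (mol r) f z = l * (conv (mol r) d z + F r z + conv (mol r) b z)"
      using conv_diff_AE[OF \<sigma> fi ti] conv_diff_AE[OF \<sigma> ti bi] by eventually_elim (use r in \<open>simp add: F_def d_def[abs_def] w_def[abs_def]\<close>)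
    then have "Y.modl P (\<lambda>z. l * conv (mol r) f z) = Y.modl P (\<lambda>z. l * (conv (mol r) d z + F r z + conv (mol r) b z))"
      by (rule Y.modl_cong_AE)
    also have "\<dots> \<le> Y.modl P (\<lambda>z. 4 * l * conv (mol r) d z) + Y.modl P (\<lambda>z. 4 * l * F r z) + Y.modl P (\<lambda>z. 4 * l * conv (mol r) b z)"
      using Fm[of r] by (intro modl_add3) auto
    also have "\<dots> \<le> ennreal (e / 3) + ennreal (e / 3) + ennreal (e / 3)"
    proof (intro add_mono)
      show "Y.modl P (\<lambda>z. 4 * l * conv (mol r) d z) \<le> ennreal (e / 3)"
        using modl_conv_mol[OF r, of d "4 * l"] m by (simp add: d_def[abs_def] t_def)
      show "Y.modl P (\<lambda>z. 4 * l * conv (mol r) b z) \<le> ennreal (e / 3)"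
        using modl_conv_mol[OF r, of b "4 * l"] bmod by simp
    qed (use elim in auto)
    also have "\<dots> = ennreal e" using e by (simp add: ennreal_plus[symmetric] del: ennreal_plus)
    finally show ?case .
  qed
qed

lemma conv_kernel_sum_AE:
  fixes \<tau> :: "'n \<Rightarrow> real^'n \<Rightarrow> real"
  assumes "\<And>j. integrable lborel (\<tau> j)" "integrable P f"
  shows "AE z in P. conv (\<lambda>y. \<Sum>j\<in>UNIV. \<tau> j y) f z = (\<Sum>j\<in>UNIV. conv (\<tau> j) f z)"
proof -
  have "AE z in P. \<forall>j. integrable lborel (\<lambda>y. \<tau> j y * f (S y z))"
    using conv_AE_integrable[OF assms] by (subst AE_all_countable) auto
  then show ?thesis by eventually_elim (simp add: conv_def sum_distrib_right)
qed

text \<open>A curl-free field without invariant part is a limit of gradients: with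
  \<open>mol \<delta> - mol R = \<Sum>\<^sub>j \<partial>\<^sub>j \<kappa>\<^sub>j\<close>, the potential \<open>- \<Sum>\<^sub>j conv \<kappa>\<^sub>j g\<^sub>j\<close> has gradient
  \<open>conv (mol \<delta>) g - conv (mol R) g\<close>, which tends to \<open>g\<close>.\<close>
theorem curl_free_approx:
  fixes g :: "'n \<Rightarrow> 'a \<Rightarrow> real"
  assumes g: "\<And>i. EPhi (g i)" and E0: "\<And>i. AE z in P. EI (g i) z = 0"
    and curl: "\<And>\<rho> i j. Cc_inf UNIV \<rho> \<Longrightarrow> AE z in P. conv (partial \<rho> j) (g i) z = conv (partial \<rho> i) (g j) z"
    and l: "l \<ge> 0" and e: "e > 0"
  shows "\<exists>\<kappa> m. (\<forall>j. Cc_inf UNIV (\<kappa> j)) \<and>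
    (\<forall>i. Y.modl P (\<lambda>z. l * (g i z - (\<Sum>j\<in>UNIV. conv (partial (\<kappa> j) i) (\<lambda>z. trunc m (g j z)) z))) \<le> ennreal e)"
proof -
  have gm[measurable]: "g i \<in> borel_measurable P" and gi: "integrable P (g i)" for i using EPhi_integrable[OF g] g[of i] unfolding EPhi_def by auto
  have "eventually (\<lambda>r. \<forall>i. Y.modl P (\<lambda>z. (4 * l) * (conv (mol r) (g i) z - g i z)) \<le> ennreal (e / 3)) (at_right 0)"
    by (intro eventually_all_finite modl_approx_identity g) (use l e in auto)
  then have "eventually (\<lambda>r. r > 0 \<and> (\<forall>i. Y.modl P (\<lambda>z. (4 * l) * (conv (mol r) (g i) z - g i z)) \<le> ennreal (e / 3))) (at_right 0)"
    by (intro eventually_conj eventually_at_right_less)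
  then obtain \<delta> where \<delta>: "\<delta> > 0" "\<And>i. Y.modl P (\<lambda>z. (4 * l) * (conv (mol \<delta>) (g i) z - g i z)) \<le> ennreal (e / 3)"
    using eventually_happens'[OF trivial_limit_at_right_real] by blast
  have "eventually (\<lambda>r. \<forall>i. Y.modl P (\<lambda>z. (4 * l) * conv (mol r) (g i) z) \<le> ennreal (e / 3)) at_top"
    by (intro eventually_all_finite modl_mean_ergodic g E0) (use l e in auto)
  then have "eventually (\<lambda>r. r > 0 \<and> (\<forall>i. Y.modl P (\<lambda>z. (4 * l) * conv (mol r) (g i) z) \<le> ennreal (e / 3))) at_top"
    by (intro eventually_conj eventually_gt_at_top)
  then obtain R where R: "R > 0" "\<And>i. Y.modl P (\<lambda>z. (4 * l) * conv (mol R) (g i) z) \<le> ennreal (e / 3)"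
    using eventually_happens'[OF trivial_limit_at_top_linorder] by blast
  obtain \<kappa> :: "'n \<Rightarrow> real^'n \<Rightarrow> real" where \<kappa>: "\<And>j. Cc_inf UNIV (\<kappa> j)" "\<And>y. mol \<delta> y - mol R y = (\<Sum>j\<in>UNIV. partial (\<kappa> j) j y)"
    using mol_diff_divergence[OF \<delta>(1) R(1), where 'n='n] by blast
  note ki = Cc_inf_integrable[OF Cc_inf_partial[OF \<kappa>(1)]]
  have [measurable]: "partial (\<kappa> j) i \<in> borel_measurable borel" for i j by (rule Cc_inf_borel[OF Cc_inf_partial[OF \<kappa>(1)]])
  define n where "n = real CARD('n)"
  have n: "n > 0" by (simp add: n_def)
  define c where "c i j = (\<integral>y. \<bar>partial (\<kappa> j) i y\<bar> \<partial>lborel)" for i j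
  \<comment> \<open>The truncation level comes last: it has to beat the L1 norms of the partials of
    the kernels, which depend on both radii. The factor \<open>n\<close> comes from splitting the
    modular of a sum over the coordinates.\<close>
  have "eventually (\<lambda>m. \<forall>i j. Y.modl P (\<lambda>z. (c i j * (n * (4 * l))) * (g j z - trunc m (g j z))) \<le> ennreal (e / 3 / n)) sequentially"
    by (intro eventually_all_finite EPhi_trunc g) (use e n in auto)
  then obtain m where m: "\<And>i j. Y.modl P (\<lambda>z. (c i j * (n * (4 * l))) * (g j z - trunc m (g j z))) \<le> ennreal (e / 3 / n)"
    by (auto simp: eventually_sequentially)
  define t where "t j z = trunc m (g j z)" for j z
  have [measurable]: "t j \<in> borel_measurable P" for j unfolding t_def[abs_def] by measurable
  have ti: "integrable P (t j)" for j by (rule bounded_integrable[where C="real m"]) (auto simp: t_def trunc_bound)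
  have "Y.modl P (\<lambda>z. l * (g i z - (\<Sum>j\<in>UNIV. conv (partial (\<kappa> j) i) (t j) z))) \<le> ennreal e" for i
  proof -
    define D where "D z = (\<Sum>j\<in>UNIV. conv (partial (\<kappa> j) i) (\<lambda>z. g j z - t j z) z)" for z
    have cm: "conv (mol \<delta>) (g i) \<in> borel_measurable P" "conv (mol R) (g i) \<in> borel_measurable P"
      using conv_integrable[OF mol_integrable[OF \<delta>(1)] gi] conv_integrable[OF mol_integrable[OF R(1)] gi] by auto
    have Dm[measurable]: "D \<in> borel_measurable P" unfolding D_def[abs_def] by measurable
    have e1: "AE z in P. conv (\<lambda>y. 1 * mol \<delta> y + (- 1) * mol R y) (g i) z = 1 * conv (mol \<delta>) (g i) z + (- 1) * conv (mol R) (g i) z"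
      by (rule conv_kernel_lincomb_AE[OF mol_integrable[OF \<delta>(1)] mol_integrable[OF R(1)] gi])
    have e2: "AE z in P. conv (\<lambda>y. \<Sum>j\<in>UNIV. partial (\<kappa> j) j y) (g i) z = (\<Sum>j\<in>UNIV. conv (partial (\<kappa> j) j) (g i) z)"
      by (rule conv_kernel_sum_AE[OF ki gi])
    \<comment> \<open>Curl-freeness moves the index \<open>j\<close> from the derivative to the
      field, so that all summands become derivatives in the one direction \<open>i\<close>.\<close>
    have e3: "AE z in P. \<forall>j. conv (partial (\<kappa> j) j) (g i) z = conv (partial (\<kappa> j) i) (g j) z"
      using curl[OF \<kappa>(1)] by (subst AE_all_countable) auto
    have e4: "AE z in P. \<forall>j. conv (partial (\<kappa> j) i) (\<lambda>z. g j z - t j z) z = conv (partial (\<kappa> j) i) (g j) z - conv (partial (\<kappa> j) i) (t j) z"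
      using conv_diff_AE[OF ki gi ti] by (subst AE_all_countable) auto
    have eq: "(\<lambda>y. 1 * mol \<delta> y + (- 1) * mol R y) = (\<lambda>y. \<Sum>j\<in>UNIV. partial (\<kappa> j) j y)" using \<kappa>(2) by auto
    have "AE z in P. l * (g i z - (\<Sum>j\<in>UNIV. conv (partial (\<kappa> j) i) (t j) z)) = l * (- (conv (mol \<delta>) (g i) z - g i z) + conv (mol R) (g i) z + D z)"
      using e1[unfolded eq] e2 e3 e4
    proof eventually_elim
      case (elim z)
      then have "D z = (conv (mol \<delta>) (g i) z - conv (mol R) (g i) z) - (\<Sum>j\<in>UNIV. conv (partial (\<kappa> j) i) (t j) z)"
        by (simp add: D_def sum_subtractf)
      then show ?case by simp
    qed
    then have "Y.modl P (\<lambda>z. l * (g i z - (\<Sum>j\<in>UNIV. conv (partial (\<kappa> j) i) (t j) z))) = Y.modl P (\<lambda>z. l * (- (conv (mol \<delta>) (g i) z - g i z) + conv (mol R) (g i) z + D z))"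
      by (rule Y.modl_cong_AE)
    also have "\<dots> \<le> Y.modl P (\<lambda>z. 4 * l * (- (conv (mol \<delta>) (g i) z - g i z))) + Y.modl P (\<lambda>z. 4 * l * conv (mol R) (g i) z) + Y.modl P (\<lambda>z. 4 * l * D z)"
      using cm by (intro modl_add3) auto
    also have "\<dots> \<le> ennreal (e / 3) + ennreal (e / 3) + ennreal (e / 3)"
    proof (intro add_mono)
      have "\<bar>4 * l * (- x)\<bar> = \<bar>4 * l * x\<bar>" for x :: real by simp
      then show "Y.modl P (\<lambda>z. 4 * l * (- (conv (mol \<delta>) (g i) z - g i z))) \<le> ennreal (e / 3)"
        using \<delta>(2)[of i] unfolding Y.modl_def by (simp only:)
      show "Y.modl P (\<lambda>z. 4 * l * conv (mol R) (g i) z) \<le> ennreal (e / 3)" using R(2) .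
      have "Y.modl P (\<lambda>z. 4 * l * D z) = Y.modl P (\<lambda>z. \<Sum>j\<in>UNIV. 4 * l * conv (partial (\<kappa> j) i) (\<lambda>z. g j z - t j z) z)"
        by (simp add: D_def sum_distrib_left)
      also have "\<dots> \<le> (\<Sum>j\<in>UNIV. Y.modl P (\<lambda>z. real CARD('n) * (4 * l * conv (partial (\<kappa> j) i) (\<lambda>z. g j z - t j z) z)))"
        by (rule Y.modl_sum) measurable
      also have "\<dots> \<le> (\<Sum>j\<in>(UNIV::'n set). ennreal (e / 3 / n))"
      proof (rule sum_mono)
        fix j
        have "Y.modl P (\<lambda>z. (n * (4 * l)) * conv (partial (\<kappa> j) i) (\<lambda>z. g j z - t j z) z) \<le> Y.modl P (\<lambda>z. (c i j * (n * (4 * l))) * (g j z - t j z))"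
          unfolding c_def by (rule modl_conv_scaled[OF ki]) measurable
        also have "\<dots> \<le> ennreal (e / 3 / n)" using m by (simp add: t_def)
        finally show "Y.modl P (\<lambda>z. real CARD('n) * (4 * l * conv (partial (\<kappa> j) i) (\<lambda>z. g j z - t j z) z)) \<le> ennreal (e / 3 / n)"
          by (simp add: n_def mult.assoc)
      qed
      also have "\<dots> = ennreal (\<Sum>j\<in>(UNIV::'n set). e / 3 / n)" using e n by (intro sum_ennreal) auto
      also have "\<dots> = ennreal (e / 3)" using n by (simp add: n_def)
      finally show "Y.modl P (\<lambda>z. 4 * l * D z) \<le> ennreal (e / 3)" .
    qed
    also have "\<dots> = ennreal e" using e by (simp add: ennreal_plus[symmetric] del: ennreal_plus)
    finally show ?thesis .
  qed
  then show ?thesis using \<kappa>(1) unfolding t_def by blast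
qed

end

section \<open>Stochastic derivatives of mollified bounded functions\<close>

locale orlicz_flow_delta2 = orlicz_flow P S \<Phi>
  for P :: "'a measure" and S :: "real^'n \<Rightarrow> 'a \<Rightarrow> 'a" and \<Phi> :: "real \<Rightarrow> real" +
  assumes d2: "delta2 \<Phi>"
begin

lemma orlicz_EPhi: "orlicz \<Phi> P f \<longleftrightarrow> EPhi f"
proof
  assume "orlicz \<Phi> P f"
  then show "EPhi f" using Y.delta2_modl_finite[OF d2 finite_measure_axioms] unfolding EPhi_def by (auto simp: Y.orlicz_iff)
next
  assume "EPhi f"
  then have "f \<in> borel_measurable P" "Y.modl P (\<lambda>z. 1 * f z) < \<infinity>" unfolding EPhi_def by blast+
  then show "orlicz \<Phi> P f" unfolding Y.orlicz_iff by (auto intro!: exI[of _ 1])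
qed

lemma EPhi_add: assumes "EPhi f" "EPhi g" shows "EPhi (\<lambda>z. f z + g z)"
  unfolding EPhi_def
proof safe
  show "(\<lambda>z. f z + g z) \<in> borel_measurable P" using assms by (auto simp: EPhi_def)
  fix l
  have "Y.modl P (\<lambda>z. l * f z + l * g z) \<le> Y.modl P (\<lambda>z. 2 * (l * f z)) + Y.modl P (\<lambda>z. 2 * (l * g z))"
    using assms by (intro Y.modl_add) (auto simp: EPhi_def)
  also have "\<dots> < \<infinity>" using assms unfolding EPhi_def by (auto simp: mult.assoc[symmetric])
  finally show "Y.modl P (\<lambda>z. l * (f z + g z)) < \<infinity>" by (simp add: distrib_left)
qed

lemma EPhi_cmult: assumes "EPhi f" shows "EPhi (\<lambda>z. c * f z)"
  using assms unfolding EPhi_def by (auto simp: mult.assoc[symmetric])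

lemma EPhi_diff: assumes "EPhi f" "EPhi g" shows "EPhi (\<lambda>z. f z - g z)"
  using EPhi_add[OF assms(1) EPhi_cmult[OF assms(2), of "-1"]] by simp

lemma EPhi_S: assumes "EPhi f" shows "EPhi (\<lambda>z. f (S y z))"
  unfolding EPhi_def
proof safe
  have [measurable]: "f \<in> borel_measurable P" using assms by (auto simp: EPhi_def)
  show "(\<lambda>z. f (S y z)) \<in> borel_measurable P" by measurable
  fix l
  have "Y.modl P (\<lambda>z. l * f (S y z)) = Y.modl P (\<lambda>z. l * f z)"
    unfolding Y.modl_def by (rule nn_integral_S[of "\<lambda>z. ennreal (\<Phi> \<bar>l * f z\<bar>)"]) measurable
  then show "Y.modl P (\<lambda>z. l * f (S y z)) < \<infinity>" using assms by (auto simp: EPhi_def)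
qed

lemma lux_L1:
  obtains L where "L > 0" "\<And>f k. EPhi f \<Longrightarrow> k > 0 \<Longrightarrow> lux \<Phi> P f < k \<Longrightarrow> (\<integral>z. \<bar>f z\<bar> \<partial>P) \<le> k * L"
proof -
  obtain L where L: "L \<ge> 0" "\<And>t. t \<ge> 0 \<Longrightarrow> t \<le> L + 1 * \<Phi> t" using Y.superlinear[of 1] by auto
  show ?thesis
  proof (rule that[of "L * measure P (space P) + 1"])
    show "0 < L * measure P (space P) + 1" using L(1) by (simp add: add_nonneg_pos)
    fix f k assume f: "EPhi f" and k: "k > 0" "lux \<Phi> P f < k"
    have [measurable]: "f \<in> borel_measurable P" using f by (auto simp: EPhi_def)
    have le: "Y.modl P (\<lambda>z. f z / k) \<le> 1" using Y.modl_lux_less[of P f k] f k by (simp add: orlicz_EPhi)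
    have qi: "integrable P (\<lambda>z. \<Phi> \<bar>f z / k\<bar>)"
      using le unfolding Y.modl_def by (intro integrableI_nonneg AE_I2 Y.nonneg) (auto simp del: abs_divide intro: le_less_trans)
    have "ennreal (\<integral>z. \<Phi> \<bar>f z / k\<bar> \<partial>P) \<le> 1"
      using le nn_integral_eq_integral[OF qi] Y.nonneg unfolding Y.modl_def by simp
    then have q1: "(\<integral>z. \<Phi> \<bar>f z / k\<bar> \<partial>P) \<le> 1" by simp
    have "(\<integral>z. \<bar>f z\<bar> \<partial>P) \<le> (\<integral>z. k * (L + \<Phi> \<bar>f z / k\<bar>) \<partial>P)"
    proof (rule integral_mono)
      show "integrable P (\<lambda>z. \<bar>f z\<bar>)" using EPhi_integrable[OF f] by simp
      show "integrable P (\<lambda>z. k * (L + \<Phi> \<bar>f z / k\<bar>))" using qi by (simp del: abs_divide)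
      fix z
      have "\<bar>f z / k\<bar> \<le> L + \<Phi> \<bar>f z / k\<bar>" using L(2)[of "\<bar>f z / k\<bar>"] by simp
      then have "k * \<bar>f z / k\<bar> \<le> k * (L + \<Phi> \<bar>f z / k\<bar>)" using k by (intro mult_left_mono) auto
      then show "\<bar>f z\<bar> \<le> k * (L + \<Phi> \<bar>f z / k\<bar>)" using k by (simp add: abs_divide)
    qed
    also have "\<dots> = k * (L * measure P (space P) + (\<integral>z. \<Phi> \<bar>f z / k\<bar> \<partial>P))" using qi by (simp del: abs_divide add: mult.commute)
    also have "\<dots> \<le> k * (L * measure P (space P) + 1)" using q1 k by (intro mult_left_mono) auto
    finally show "(\<integral>z. \<bar>f z\<bar> \<partial>P) \<le> k * (L * measure P (space P) + 1)" .
  qed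
qed

text \<open>The stochastic derivative is a relation, and an induction over \<open>iter_sd\<close>
  meets arbitrary versions of it; uniqueness identifies them with the explicit convolutions. It
  follows from the embedding of L^\<Phi> into L1.\<close>

lemma stoch_deriv_unique:
  assumes "stoch_deriv \<Phi> P S i f g" "stoch_deriv \<Phi> P S i f g'"
  shows "AE z in P. g z = g' z"
proof -
  obtain L where L: "L > 0" "\<And>f k. EPhi f \<Longrightarrow> k > 0 \<Longrightarrow> lux \<Phi> P f < k \<Longrightarrow> (\<integral>z. \<bar>f z\<bar> \<partial>P) \<le> k * L" using lux_L1 by blast
  have E: "EPhi f" "EPhi g" "EPhi g'" using assms by (auto simp: stoch_deriv_def orlicz_EPhi)
  define q where "q t z = (f (S (t *\<^sub>R axis i 1) z) - f z) / t" for t z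
  have qE: "EPhi (q t)" for t
    using EPhi_cmult[OF EPhi_diff[OF EPhi_S[OF E(1)] E(1)], of "1 / t"] by (simp add: q_def[abs_def])
  note gi = EPhi_integrable[OF E(2)] EPhi_integrable[OF E(3)] and qi = EPhi_integrable[OF qE]
  have "(\<integral>z. \<bar>g z - g' z\<bar> \<partial>P) \<le> 0"
  proof (rule field_le_epsilon)
    fix e :: real assume e: "e > 0"
    define k where "k = e / (2 * L)"
    have k: "k > 0" using e L by (simp add: k_def)
    have "eventually (\<lambda>t. lux \<Phi> P (\<lambda>z. q t z - g z) < k \<and> lux \<Phi> P (\<lambda>z. q t z - g' z) < k) (at 0)"
      using assms k unfolding stoch_deriv_def q_def by (intro eventually_conj order_tendstoD(2)[where y=0]) auto
    then obtain t where t: "lux \<Phi> P (\<lambda>z. q t z - g z) < k" "lux \<Phi> P (\<lambda>z. q t z - g' z) < k"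
      using eventually_happens'[OF trivial_limit_at] by blast
    have "(\<integral>z. \<bar>g z - g' z\<bar> \<partial>P) \<le> (\<integral>z. \<bar>q t z - g z\<bar> + \<bar>q t z - g' z\<bar> \<partial>P)"
      using gi qi[of t] by (intro integral_mono) auto
    also have "\<dots> = (\<integral>z. \<bar>q t z - g z\<bar> \<partial>P) + (\<integral>z. \<bar>q t z - g' z\<bar> \<partial>P)" using gi qi[of t] by simp
    also have "\<dots> \<le> k * L + k * L" by (intro add_mono L(2) EPhi_diff qE E k t)
    also have "\<dots> = e" using L by (simp add: k_def)
    finally show "(\<integral>z. \<bar>g z - g' z\<bar> \<partial>P) \<le> 0 + e" by simp
  qed
  then have "AE z in P. g z - g' z = 0" using gi by (intro L1_zero_AE) auto
  then show ?thesis by eventually_elim simp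
qed

text \<open>A class closed under all stochastic derivatives: the bounded functions
  \<open>\<xi> j\<close> stay fixed and only the kernels are differentiated. Equality holds almost
  everywhere because derivatives are determined only up to null sets; the sum over \<open>j\<close>
  is the shape of the potential of a field.\<close>

definition molclass :: "('n \<Rightarrow> real^'n \<Rightarrow> real) \<Rightarrow> ('n \<Rightarrow> 'a \<Rightarrow> real) \<Rightarrow> ('a \<Rightarrow> real) \<Rightarrow> bool" where
  "molclass \<kappa> \<xi> f \<longleftrightarrow> f \<in> borel_measurable P \<and> (\<forall>j. Cc_inf UNIV (\<kappa> j)) \<and> (\<forall>j. \<xi> j \<in> borel_measurable P) \<and>
     (\<exists>C. \<forall>j. \<forall>z\<in>space P. \<bar>\<xi> j z\<bar> \<le> C) \<and> (AE z in P. f z = (\<Sum>j\<in>UNIV. conv (\<kappa> j) (\<xi> j) z))"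

lemma conv_sum_bound:
  fixes \<sigma> :: "'n \<Rightarrow> real^'n \<Rightarrow> real"
  assumes "\<And>j z. z \<in> space P \<Longrightarrow> \<bar>\<xi> j z\<bar> \<le> C" "\<And>j. integrable lborel (\<sigma> j)" "z \<in> space P"
  shows "\<bar>\<Sum>j\<in>UNIV. conv (\<sigma> j) (\<xi> j) z\<bar> \<le> C * (\<Sum>j\<in>UNIV. \<integral>y. \<bar>\<sigma> j y\<bar> \<partial>lborel)"
proof -
  have "\<bar>\<Sum>j\<in>UNIV. conv (\<sigma> j) (\<xi> j) z\<bar> \<le> (\<Sum>j\<in>UNIV. \<bar>conv (\<sigma> j) (\<xi> j) z\<bar>)" by (rule sum_abs)
  also have "\<dots> \<le> (\<Sum>j\<in>UNIV. C * (\<integral>y. \<bar>\<sigma> j y\<bar> \<partial>lborel))" using assms by (intro sum_mono conv_bound) auto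
  finally show ?thesis by (simp add: sum_distrib_left)
qed

lemma molclass_bounded:
  assumes "molclass \<kappa> \<xi> f" shows "\<exists>C. AE z in P. \<bar>f z\<bar> \<le> C"
proof -
  obtain C where C: "\<And>j z. z \<in> space P \<Longrightarrow> \<bar>\<xi> j z\<bar> \<le> C" using assms unfolding molclass_def by blast
  have eq: "AE z in P. f z = (\<Sum>j\<in>UNIV. conv (\<kappa> j) (\<xi> j) z)" and k: "\<And>j. integrable lborel (\<kappa> j)"
    using assms Cc_inf_integrable unfolding molclass_def by blast+
  show ?thesis
    by (rule exI[of _ "C * (\<Sum>j\<in>UNIV. \<integral>y. \<bar>\<kappa> j y\<bar> \<partial>lborel)"], use eq AE_space in eventually_elim)
       (use conv_sum_bound[of \<xi> C \<kappa>, OF C k] in simp)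
qed

text \<open>The difference quotients converge even uniformly up to null sets: their error is a sum
  of convolutions of bounded functions with kernels that tend to 0 in L1.\<close>

lemma molclass_deriv:
  assumes prob: "prob_space P" and f: "molclass \<kappa> \<xi> f"
  shows "stoch_deriv \<Phi> P S i f (\<lambda>z. - (\<Sum>j\<in>UNIV. conv (partial (\<kappa> j) i) (\<xi> j) z))"
proof -
  obtain C where C': "\<And>j z. z \<in> space P \<Longrightarrow> \<bar>\<xi> j z\<bar> \<le> C" using f unfolding molclass_def by blast
  have C: "\<bar>\<xi> j z\<bar> \<le> \<bar>C\<bar>" if "z \<in> space P" for j z using C'[OF that, of j] by simp
  have eq: "AE z in P. f z = (\<Sum>j\<in>UNIV. conv (\<kappa> j) (\<xi> j) z)" and k: "\<And>j. Cc_inf UNIV (\<kappa> j)"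
    and fm[measurable]: "f \<in> borel_measurable P" and cm[measurable]: "\<And>j. \<xi> j \<in> borel_measurable P"
    using f unfolding molclass_def by blast+
  note ki = Cc_inf_integrable[OF k] and kp = Cc_inf_integrable[OF Cc_inf_partial[OF k]]
  have [measurable]: "\<kappa> j \<in> borel_measurable borel" "partial (\<kappa> j) i \<in> borel_measurable borel" for j
    using Cc_inf_borel[OF k] Cc_inf_borel[OF Cc_inf_partial[OF k]] by auto
  define g where "g z = - (\<Sum>j\<in>UNIV. conv (partial (\<kappa> j) i) (\<xi> j) z)" for z
  have gm[measurable]: "g \<in> borel_measurable P" unfolding g_def[abs_def] by measurable
  have gb: "AE z in P. \<bar>g z\<bar> \<le> \<bar>C\<bar> * (\<Sum>j\<in>UNIV. \<integral>y. \<bar>partial (\<kappa> j) i y\<bar> \<partial>lborel)"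
    using conv_sum_bound[of \<xi> "\<bar>C\<bar>" "\<lambda>j. partial (\<kappa> j) i", OF C kp] by (auto simp: g_def)
  have of: "orlicz \<Phi> P f" using molclass_bounded[OF f] Y.bounded_orlicz[OF finite_measure_axioms fm] by blast
  have og: "orlicz \<Phi> P g" by (rule Y.bounded_orlicz[OF finite_measure_axioms gm gb])
  define I where "I t = (\<Sum>j\<in>UNIV. \<integral>y. \<bar>(\<kappa> j (y - t *\<^sub>R axis i 1) - \<kappa> j y) / t + partial (\<kappa> j) i y\<bar> \<partial>lborel)" for t
  have I0: "(I \<longlongrightarrow> 0) (at 0)"
    unfolding I_def[abs_def] using tendsto_sum[of UNIV, OF Cc_inf_diff_quotient_L1[OF k]] by simp
  define q where "q t z = (f (S (t *\<^sub>R axis i 1) z) - f z) / t - g z" for t z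
  have qE: "EPhi (q t)" for t
    using EPhi_diff[OF EPhi_cmult[OF EPhi_diff[OF EPhi_S EPhi_cmult, of f f _ 1], of "1 / t"], of g] of og
    by (simp add: q_def[abs_def] orlicz_EPhi)
  have qb: "AE z in P. \<bar>q t z\<bar> \<le> \<bar>C\<bar> * I t" if t: "t \<noteq> 0" for t
    using eq AE_S[OF eq, of "t *\<^sub>R axis i 1"] AE_space
  proof eventually_elim
    case (elim z)
    let ?\<sigma> = "\<lambda>j y. (\<kappa> j (y - t *\<^sub>R axis i 1) - \<kappa> j y) / t + partial (\<kappa> j) i y"
    note si = lborel_integral_shift(2)[OF ki, of _ "t *\<^sub>R axis i 1"]
    have \<sigma>i: "integrable lborel (?\<sigma> j)" for j using si[of j] ki[of j] kp[of j i] by simp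
    have b: "integrable lborel (\<lambda>y. \<tau> y * \<xi> j (S y z))" if "integrable lborel \<tau>" for \<tau> j
      by (rule conv_bound_integrable[OF elim(3) C cm that])
    have "conv (?\<sigma> j) (\<xi> j) z = (conv (\<lambda>y. \<kappa> j (y - t *\<^sub>R axis i 1)) (\<xi> j) z - conv (\<kappa> j) (\<xi> j) z) / t + conv (partial (\<kappa> j) i) (\<xi> j) z" for j
    proof -
      have "(\<lambda>y. ?\<sigma> j y * \<xi> j (S y z)) = (\<lambda>y. (\<kappa> j (y - t *\<^sub>R axis i 1) * \<xi> j (S y z) - \<kappa> j y * \<xi> j (S y z)) / t + partial (\<kappa> j) i y * \<xi> j (S y z))"
        by (auto simp: field_simps)
      then show ?thesis unfolding conv_def using b[OF si, of j j] b[OF ki, of j j] b[OF kp, of j i j] by simp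
    qed
    then have "q t z = (\<Sum>j\<in>UNIV. conv (?\<sigma> j) (\<xi> j) z)"
      using elim by (simp add: q_def g_def conv_shift sum.distrib sum_subtractf sum_divide_distrib[symmetric])
    then show ?case using conv_sum_bound[of \<xi> "\<bar>C\<bar>" ?\<sigma>, OF C \<sigma>i elim(3)] by (simp add: I_def)
  qed
  have "((\<lambda>t. lux \<Phi> P (q t)) \<longlongrightarrow> 0) (at 0)"
  proof (rule tendsto_sandwich[of "\<lambda>_. 0" _ _ "\<lambda>t. (\<bar>C\<bar> * I t + \<bar>t\<bar>) * (1 + \<Phi> 1)"])
    show "eventually (\<lambda>t. 0 \<le> lux \<Phi> P (q t)) (at 0)"
      by (intro always_eventually allI Y.lux_nonneg) (simp add: orlicz_EPhi qE)
    \<comment> \<open>The summand \<bar>t\<bar> keeps the bound strictly positive, as the estimate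
      of the norm by a uniform bound requires.\<close>
    have "lux \<Phi> P (q t) \<le> (\<bar>C\<bar> * I t + \<bar>t\<bar>) * (1 + \<Phi> 1)" if t: "t \<noteq> 0" for t
    proof (rule Y.bounded_lux_le[OF prob])
      show "q t \<in> borel_measurable P" using qE by (simp add: EPhi_def)
      have "0 \<le> I t" unfolding I_def by (intro sum_nonneg) simp
      then show "0 < \<bar>C\<bar> * I t + \<bar>t\<bar>" using t by (intro add_nonneg_pos) auto
      show "AE z in P. \<bar>q t z\<bar> \<le> \<bar>C\<bar> * I t + \<bar>t\<bar>" using qb[OF t] by eventually_elim simp
    qed
    then show "eventually (\<lambda>t. lux \<Phi> P (q t) \<le> (\<bar>C\<bar> * I t + \<bar>t\<bar>) * (1 + \<Phi> 1)) (at 0)" by (auto simp: eventually_at_filter)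
    have "((\<lambda>t. (\<bar>C\<bar> * I t + \<bar>t\<bar>) * (1 + \<Phi> 1)) \<longlongrightarrow> (\<bar>C\<bar> * 0 + \<bar>0\<bar>) * (1 + \<Phi> 1)) (at 0)"
      by (intro tendsto_intros I0)
    then show "((\<lambda>t. (\<bar>C\<bar> * I t + \<bar>t\<bar>) * (1 + \<Phi> 1)) \<longlongrightarrow> 0) (at 0)" by simp
  qed simp
  then show ?thesis using of og unfolding stoch_deriv_def q_def g_def by simp
qed

lemma molclass_smooth:
  assumes prob: "prob_space P" and f: "molclass \<kappa> \<xi> f" shows "smooth_omega \<Phi> P S f"
proof -
  have cl: "\<exists>\<kappa>. molclass \<kappa> \<xi> g" if "iter_sd \<Phi> P S f g" for g
    using that
  proof induction
    case refl then show ?case using f by blast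
  next
    case (step g i h)
    then obtain \<kappa> where \<kappa>: "molclass \<kappa> \<xi> g" by blast
    have "AE z in P. h z = - (\<Sum>j\<in>UNIV. conv (partial (\<kappa> j) i) (\<xi> j) z)"
      using stoch_deriv_unique[OF step(2) molclass_deriv[OF prob \<kappa>]] .
    moreover have "conv (\<lambda>y. partial (\<kappa> j) i y * (- 1)) (\<xi> j) z = - conv (partial (\<kappa> j) i) (\<xi> j) z" for j z
      by (simp add: conv_def)
    ultimately have "AE z in P. h z = (\<Sum>j\<in>UNIV. conv (\<lambda>y. partial (\<kappa> j) i y * (- 1)) (\<xi> j) z)"
      by (simp add: sum_negf)
    moreover have "Cc_inf UNIV (\<lambda>y. partial (\<kappa> j) i y * (- 1))" for j
      using \<kappa> by (intro Cc_inf_mult Cc_inf_partial smooth_Rn_const) (simp add: molclass_def)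
    moreover have "h \<in> borel_measurable P" using step(2) by (simp add: stoch_deriv_def orlicz_def)
    ultimately have "molclass (\<lambda>j y. partial (\<kappa> j) i y * (- 1)) \<xi> h" using \<kappa> by (simp add: molclass_def)
    then show ?case by blast
  qed
  show ?thesis unfolding smooth_omega_def
  proof (intro allI impI conjI)
    fix g assume g: "iter_sd \<Phi> P S f g"
    obtain \<kappa> where \<kappa>: "molclass \<kappa> \<xi> g" using cl[OF g] by blast
    show "bounded_ae P g" using molclass_bounded[OF \<kappa>] \<kappa> by (simp add: bounded_ae_def molclass_def)
    show "\<exists>h. stoch_deriv \<Phi> P S i g h" for i using molclass_deriv[OF prob \<kappa>] by blast
  qed
qed

end

section \<open>Oscillating test functions\<close>

lemma AE_zero_generator:
  fixes H :: "'a \<Rightarrow> real"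
  assumes H: "integrable N H" and s: "sets N = sigma_sets (space N) G" and G: "Int_stable G" "G \<subseteq> Pow (space N)"
    and b: "\<And>A. A \<in> G \<Longrightarrow> (\<integral>z. H z * indicator A z \<partial>N) = 0" and sp: "space N \<in> G"
  shows "AE z in N. H z = 0"
proof -
  have i: "integrable N (\<lambda>z. H z * indicator A z)" if "A \<in> sets N" for A
    by (rule integrable_mult_bounded[OF H, where C=1]) (use that in \<open>auto simp: indicator_def\<close>)
  have z: "(\<integral>z. H z * indicator A z \<partial>N) = 0" if "A \<in> sets N" for A
    using G that[unfolded s]
  proof (induction rule: sigma_sets_induct_disjoint)
    case (basic A) then show ?case by (rule b)
  next
    case empty then show ?case by simp
  next
    case (compl A)
    have A: "A \<in> sets N" using compl s by simp
    have "(\<integral>z. H z * indicator (space N - A) z \<partial>N) = (\<integral>z. H z * indicator (space N) z - H z * indicator A z \<partial>N)"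
      by (rule Bochner_Integration.integral_cong) (auto simp: indicator_def)
    also have "\<dots> = 0" using i[OF A] i[of "space N"] compl(2) b[OF sp] by simp
    finally show ?case .
  next
    case (union A)
    have A: "A k \<in> sets N" for k using union(2) s by auto
    have "(\<lambda>n. \<integral>z. (\<Sum>k<n. H z * indicator (A k) z) \<partial>N) \<longlonglongrightarrow> (\<integral>z. H z * indicator (\<Union>k. A k) z \<partial>N)"
    proof (rule integral_dominated_convergence[where w="\<lambda>z. \<bar>H z\<bar>"])
      have un: "(\<Sum>k<n. H z * indicator (A k) z) = H z * indicator (\<Union>k<n. A k) z" for n z
        using union(1) by (subst indicator_UN_disjoint) (auto simp: sum_distrib_left disjoint_family_on_def)
      show "AE z in N. norm (\<Sum>k<n. H z * indicator (A k) z) \<le> \<bar>H z\<bar>" for n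
        unfolding un by (auto simp: indicator_def)
      show "AE z in N. (\<lambda>n. \<Sum>k<n. H z * indicator (A k) z) \<longlonglongrightarrow> H z * indicator (\<Union>k. A k) z"
        unfolding un by (intro AE_I2 tendsto_mult_left LIMSEQ_indicator_UN)
      have [measurable]: "H \<in> borel_measurable N" "\<And>k. A k \<in> sets N" using H A by auto
      show "(\<lambda>z. H z * indicator (\<Union>k. A k) z) \<in> borel_measurable N" "(\<lambda>z. \<Sum>k<n. H z * indicator (A k) z) \<in> borel_measurable N" for n
        by measurable
    qed (use H in auto)
    moreover have "(\<integral>z. (\<Sum>k<n. H z * indicator (A k) z) \<partial>N) = 0" for n
      using union(3) i[OF A] by (subst Bochner_Integration.integral_sum) auto
    ultimately show ?case by (simp add: LIMSEQ_const_iff)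
  qed
  have "AE z in N. H z = (\<lambda>_. 0) z"
    by (rule density_unique_real[OF H]) (use z in \<open>auto simp: set_lebesgue_integral_def mult.commute\<close>)
  then show ?thesis by simp
qed

lemma fst_QOm: "fst \<in> measurable (QOm Q M) (borel :: (real^'n) measure)"
proof -
  have "(\<lambda>x. x) \<in> measurable (QM Q) (borel :: (real^'n) measure)" by (rule measurable_restrict_space1) simp
  then show ?thesis by (rule measurable_compose[OF measurable_fst])
qed

text \<open>Rectangles with an open subset of \<open>Q\<close> as first side form an
  intersection-stable generator of the product sigma-algebra, and the indicator of an open set is a
  bounded pointwise limit of test functions.\<close>

lemma AE_zero_Cc_inf:
  fixes Q :: "(real^'n) set" and M :: "'w measure" and H :: "(real^'n) \<times> 'w \<Rightarrow> real"
  assumes Q: "open Q" and M: "finite_measure M" and H: "integrable (QOm Q M) H"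
    and z: "\<And>\<phi> A. Cc_inf Q \<phi> \<Longrightarrow> A \<in> sets M \<Longrightarrow> (\<integral>z. H z * (\<phi> (fst z) * indicator A (snd z)) \<partial>QOm Q M) = 0"
  shows "AE z in QOm Q M. H z = 0"
proof -
  define Ea where "Ea = {U. open U \<and> U \<subseteq> Q}"
  have "sets (QM Q) = (\<inter>) Q ` sigma_sets UNIV (Collect open)"
    by (simp add: sets_restrict_space) (simp add: borel_def)
  also have "\<dots> = sigma_sets Q ((\<inter>) Q ` Collect open)"
    using Q by (intro sigma_sets_Int) auto
  also have "(\<inter>) Q ` Collect open = Ea" using Q by (auto simp: Ea_def intro!: image_eqI[of _ "(\<inter>) Q"])
  finally have sQ: "sets (QM Q) = sigma_sets Q Ea" .
  define G where "G = {a \<times> b |a b. a \<in> Ea \<and> b \<in> sets M}"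
  have sP: "sets (QOm Q M) = sets (sigma (Q \<times> space M) G)"
  proof -
    have "sets (QOm Q M) = sets (sigma Q Ea \<Otimes>\<^sub>M sigma (space M) (sets M))"
    proof (rule sets_pair_measure_cong)
      have "Ea \<subseteq> Pow Q" by (auto simp: Ea_def)
      then show "sets (QM Q) = sets (sigma Q Ea)" using sQ by simp
      show "sets M = sets (sigma (space M) (sets M))" using sets.space_closed[of M] sets.sigma_sets_eq[of M] by simp
    qed
    also have "sigma Q Ea \<Otimes>\<^sub>M sigma (space M) (sets M) = sigma (Q \<times> space M) G"
      unfolding G_def
    proof (rule sigma_prod)
      show "\<exists>E\<subseteq>Ea. countable E \<and> Q = \<Union>E" using Q by (intro exI[of _ "{Q}"]) (auto simp: Ea_def)
      show "\<exists>E\<subseteq>sets M. countable E \<and> space M = \<Union>E" by (intro exI[of _ "{space M}"]) auto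
    qed (use sets.space_closed[of M] in \<open>auto simp: Ea_def\<close>)
    finally show ?thesis .
  qed
  have spP: "space (QOm Q M) = Q \<times> space M" by (simp add: space_pair_measure space_restrict_space)
  have GP: "G \<subseteq> Pow (Q \<times> space M)" using sets.sets_into_space by (force simp: G_def Ea_def)
  have Hm[measurable]: "H \<in> borel_measurable (QOm Q M)" using H by auto
  show ?thesis
  proof (rule AE_zero_generator[OF H, of G])
    show "sets (QOm Q M) = sigma_sets (space (QOm Q M)) G" unfolding sP spP using GP by simp
    show "Int_stable G"
    proof (rule Int_stableI)
      fix x y assume "x \<in> G" "y \<in> G"
      then obtain a b c d where "x = a \<times> b" "y = c \<times> d" "a \<in> Ea" "c \<in> Ea" "b \<in> sets M" "d \<in> sets M" by (auto simp: G_def)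
      then show "x \<inter> y \<in> G" unfolding G_def by (auto simp: Times_Int_Times Ea_def intro!: exI[of _ "a \<inter> c"] exI[of _ "b \<inter> d"])
    qed
    show "G \<subseteq> Pow (space (QOm Q M))" using GP spP by simp
    show "space (QOm Q M) \<in> G" unfolding spP G_def using Q by (auto simp: Ea_def)
    fix A assume "A \<in> G"
    then obtain U B where UB: "A = U \<times> B" "open U" "U \<subseteq> Q" and [measurable]: "B \<in> sets M" by (auto simp: G_def Ea_def)
    obtain \<phi> where \<phi>: "\<And>k::nat. Cc_inf U (\<phi> k)" "\<And>k x. 0 \<le> \<phi> k x" "\<And>k x. \<phi> k x \<le> 1" "\<And>x. (\<lambda>k. \<phi> k x) \<longlonglongrightarrow> indicator U x"
      using open_approx[OF UB(2)] by blast
    have [measurable]: "\<phi> k \<in> borel_measurable borel" for k by (rule Cc_inf_borel[OF \<phi>(1)])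
    note [measurable] = fst_QOm
    have Am: "A \<in> sets (QOm Q M)" using \<open>A \<in> G\<close> GP unfolding sP by auto
    have "(\<lambda>k. \<integral>z. H z * (\<phi> k (fst z) * indicator B (snd z)) \<partial>QOm Q M) \<longlonglongrightarrow> (\<integral>z. H z * indicator A z \<partial>QOm Q M)"
    proof (rule integral_dominated_convergence[where w="\<lambda>z. \<bar>H z\<bar>"])
      show "AE z in QOm Q M. norm (H z * (\<phi> k (fst z) * indicator B (snd z))) \<le> \<bar>H z\<bar>" for k
      proof (rule AE_I2)
        fix z :: "(real^'n) \<times> 'w"
        have "\<bar>\<phi> k (fst z) * indicator B (snd z)\<bar> \<le> 1" using \<phi>(2,3)[of k "fst z"] by (auto simp: indicator_def)
        then have "\<bar>H z\<bar> * \<bar>\<phi> k (fst z) * indicator B (snd z)\<bar> \<le> \<bar>H z\<bar> * 1" by (intro mult_left_mono) auto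
        then show "norm (H z * (\<phi> k (fst z) * indicator B (snd z))) \<le> \<bar>H z\<bar>" by (simp add: abs_mult)
      qed
      show "AE z in QOm Q M. (\<lambda>k. H z * (\<phi> k (fst z) * indicator B (snd z))) \<longlonglongrightarrow> H z * indicator A z"
      proof (rule AE_I2)
        fix z :: "(real^'n) \<times> 'w"
        have "(\<lambda>k. H z * (\<phi> k (fst z) * indicator B (snd z))) \<longlonglongrightarrow> H z * (indicator U (fst z) * indicator B (snd z))"
          by (intro tendsto_intros \<phi>)
        then show "(\<lambda>k. H z * (\<phi> k (fst z) * indicator B (snd z))) \<longlonglongrightarrow> H z * indicator A z"
          by (cases z) (simp add: UB indicator_times)
      qed
      show "(\<lambda>z. H z * indicator A z) \<in> borel_measurable (QOm Q M)" using Am by measurable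
      show "(\<lambda>z. H z * (\<phi> k (fst z) * indicator B (snd z))) \<in> borel_measurable (QOm Q M)" for k by measurable
    qed (use H in simp)
    moreover have "(\<integral>z. H z * (\<phi> k (fst z) * indicator B (snd z)) \<partial>QOm Q M) = 0" for k
      by (rule z) (use Cc_inf_mono[OF \<phi>(1) UB(3)] in auto)
    ultimately show "(\<integral>z. H z * indicator A z \<partial>QOm Q M) = 0" by (simp add: LIMSEQ_const_iff)
  qed
qed

text \<open>For fixed first coordinate the map is a single \<open>T (a x)\<close>, which preserves
  \<open>M\<close>; Fubini does the rest. A constant \<open>a\<close> yields the product flow, a
  linear one the oscillation x/\<epsilon>.\<close>

lemma shear_preserving:
  fixes N :: "'b measure"
  assumes fl: "flow M T" and N: "sigma_finite_measure N" and a[measurable]: "a \<in> measurable N borel"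
  shows "(\<lambda>z. (fst z, T (a (fst z)) (snd z))) \<in> measurable (N \<Otimes>\<^sub>M M) (N \<Otimes>\<^sub>M M)"
    and "distr (N \<Otimes>\<^sub>M M) (N \<Otimes>\<^sub>M M) (\<lambda>z. (fst z, T (a (fst z)) (snd z))) = N \<Otimes>\<^sub>M M"
proof -
  interpret F: flow M T by fact
  interpret N: sigma_finite_measure N by fact
  interpret NM: pair_sigma_finite N M by unfold_locales
  let ?S = "\<lambda>z. (fst z, T (a (fst z)) (snd z))"
  have "(\<lambda>z. T (a (fst z)) (snd z)) \<in> measurable (N \<Otimes>\<^sub>M M) M"
    by (intro F.S_comp measurable_compose[OF measurable_fst a] measurable_snd)
  then show m[measurable]: "?S \<in> measurable (N \<Otimes>\<^sub>M M) (N \<Otimes>\<^sub>M M)" by (intro measurable_Pair measurable_fst)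
  show "distr (N \<Otimes>\<^sub>M M) (N \<Otimes>\<^sub>M M) ?S = N \<Otimes>\<^sub>M M"
  proof (rule measure_eqI)
    fix A assume "A \<in> sets (distr (N \<Otimes>\<^sub>M M) (N \<Otimes>\<^sub>M M) ?S)"
    then have A[measurable]: "A \<in> sets (N \<Otimes>\<^sub>M M)" by simp
    have "emeasure (distr (N \<Otimes>\<^sub>M M) (N \<Otimes>\<^sub>M M) ?S) A = (\<integral>\<^sup>+z. indicator A (?S z) \<partial>(N \<Otimes>\<^sub>M M))"
      using nn_integral_distr[OF m, of "indicator A"] by simp
    also have "\<dots> = (\<integral>\<^sup>+x. (\<integral>\<^sup>+w. indicator A (x, T (a x) w) \<partial>M) \<partial>N)"
      by (subst F.nn_integral_fst[symmetric]) auto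
    also have "\<dots> = (\<integral>\<^sup>+x. (\<integral>\<^sup>+w. indicator A (x, w) \<partial>M) \<partial>N)"
    proof (rule nn_integral_cong)
      fix x assume x: "x \<in> space N"
      show "(\<integral>\<^sup>+w. indicator A (x, T (a x) w) \<partial>M) = (\<integral>\<^sup>+w. indicator A (x, w) \<partial>M)"
        using x by (intro F.nn_integral_S[of "\<lambda>w. indicator A (x, w)"]) measurable
    qed
    also have "\<dots> = emeasure (N \<Otimes>\<^sub>M M) A"
      by (subst F.nn_integral_fst) auto
    finally show "emeasure (distr (N \<Otimes>\<^sub>M M) (N \<Otimes>\<^sub>M M) ?S) A = emeasure (N \<Otimes>\<^sub>M M) A" .
  qed simp
qed

lemma dynamical_system_flow: "dynamical_system M T \<Longrightarrow> flow M T"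
  unfolding dynamical_system_def flow_def flow_axioms_def
  by (auto intro: prob_space.finite_measure)

lemma flow_product:
  assumes fl: "flow M T" and N: "finite_measure N"
  shows "flow (N \<Otimes>\<^sub>M M) (\<lambda>y z. (fst z, T y (snd z)))"
proof -
  interpret F: flow M T by fact
  interpret N: finite_measure N by fact
  have fin: "finite_measure (N \<Otimes>\<^sub>M M)"
    by (rule finite_measureI) (simp add: space_pair_measure F.emeasure_pair_measure_Times ennreal_mult_eq_top_iff)
  have "(\<lambda>w. T (fst w) (snd (snd w))) \<in> measurable (lborel \<Otimes>\<^sub>M (N \<Otimes>\<^sub>M M)) M"
    by (intro F.S_comp measurable_compose[OF measurable_snd measurable_snd]) (simp add: measurable_fst cong: measurable_cong_sets)
  then have "(\<lambda>w. (fst (snd w), T (fst w) (snd (snd w)))) \<in> measurable (lborel \<Otimes>\<^sub>M (N \<Otimes>\<^sub>M M)) (N \<Otimes>\<^sub>M M)"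
    by (intro measurable_Pair measurable_compose[OF measurable_snd measurable_fst])
  then show ?thesis unfolding flow_def flow_axioms_def
    using fin shear_preserving(2)[OF fl N.sigma_finite_measure_axioms, of "\<lambda>_. _"]
    by (auto simp: case_prod_beta' space_pair_measure F.S_zero F.S_add)
qed

text \<open>Schwarz's theorem: the second difference over a square of side h is h^2 times either
  mixed partial at some point of the square, by two uses of the mean value theorem; both are
  continuous at \<open>x\<close>.\<close>

lemma partial_commute:
  fixes f :: "real^'n \<Rightarrow> real"
  assumes f: "smooth_Rn f"
  shows "partial (partial f i) j = partial (partial f j) i"
proof
  fix x :: "real^'n"
  let ?e = "axis i 1 :: real^'n" and ?d = "axis j 1 :: real^'n"
  have D: "((\<lambda>t. g (a + t *\<^sub>R axis k 1)) has_real_derivative partial g k (a + t *\<^sub>R axis k 1)) (at t)" if "smooth_Rn g" for g a k t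
    using partial_line[OF smooth_Rn_differentiable[OF that], of a] .
  have mvt: "\<exists>s t. 0 < s \<and> s < h \<and> 0 < t \<and> t < h \<and>
      f (x + h *\<^sub>R axis k 1 + h *\<^sub>R axis l 1) - f (x + h *\<^sub>R axis k 1) - f (x + h *\<^sub>R axis l 1) + f x = h * (h * partial (partial f k) l (x + s *\<^sub>R axis k 1 + t *\<^sub>R axis l 1))" if h: "h > 0" for h k l
  proof -
    define F where "F s = f ((x + h *\<^sub>R axis l 1) + s *\<^sub>R axis k 1) - f (x + s *\<^sub>R axis k 1)" for s
    have dF: "(F has_real_derivative (partial f k ((x + h *\<^sub>R axis l 1) + s *\<^sub>R axis k 1) - partial f k (x + s *\<^sub>R axis k 1))) (at s)" for s
      unfolding F_def[abs_def] by (intro DERIV_diff D f)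
    obtain s where s: "0 < s" "s < h" "F h - F 0 = (h - 0) * (partial f k ((x + h *\<^sub>R axis l 1) + s *\<^sub>R axis k 1) - partial f k (x + s *\<^sub>R axis k 1))"
      using MVT2[of 0 h F, OF h dF] by auto
    define G where "G t = partial f k ((x + s *\<^sub>R axis k 1) + t *\<^sub>R axis l 1)" for t
    have dG: "(G has_real_derivative partial (partial f k) l ((x + s *\<^sub>R axis k 1) + t *\<^sub>R axis l 1)) (at t)" for t
      unfolding G_def[abs_def] by (intro D smooth_Rn_partial f)
    obtain t where t: "0 < t" "t < h" "G h - G 0 = (h - 0) * partial (partial f k) l ((x + s *\<^sub>R axis k 1) + t *\<^sub>R axis l 1)"
      using MVT2[of 0 h G, OF h dG] by auto
    have "G h - G 0 = partial f k ((x + h *\<^sub>R axis l 1) + s *\<^sub>R axis k 1) - partial f k (x + s *\<^sub>R axis k 1)"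
      by (simp add: G_def algebra_simps)
    moreover have "F h - F 0 = f (x + h *\<^sub>R axis k 1 + h *\<^sub>R axis l 1) - f (x + h *\<^sub>R axis k 1) - f (x + h *\<^sub>R axis l 1) + f x"
      by (simp add: F_def algebra_simps)
    ultimately show ?thesis using s t by (intro exI[of _ s] exI[of _ t]) simp
  qed
  have lim: "\<exists>h0>0. \<forall>s t. 0 < s \<longrightarrow> s < h0 \<longrightarrow> 0 < t \<longrightarrow> t < h0 \<longrightarrow> \<bar>partial (partial f k) l (x + s *\<^sub>R axis k 1 + t *\<^sub>R axis l 1) - partial (partial f k) l x\<bar> < e" if e: "e > 0" for e k l
  proof -
    have "isCont (partial (partial f k) l) x"
      using smooth_Rn_continuous[OF smooth_Rn_partial[OF smooth_Rn_partial[OF f]]] continuous_on_eq_continuous_at by blast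
    then obtain d where d: "d > 0" "\<And>y. dist y x < d \<Longrightarrow> dist (partial (partial f k) l y) (partial (partial f k) l x) < e"
      unfolding continuous_at_eps_delta using e by blast
    have "\<bar>partial (partial f k) l (x + s *\<^sub>R axis k 1 + t *\<^sub>R axis l 1) - partial (partial f k) l x\<bar> < e" if "0 < s" "s < d / 2" "0 < t" "t < d / 2" for s t
    proof -
      have "dist (x + s *\<^sub>R axis k 1 + t *\<^sub>R axis l 1) x = norm (s *\<^sub>R axis k 1 + t *\<^sub>R axis l 1 :: real^'n)" by (simp add: dist_norm algebra_simps)
      also have "\<dots> \<le> s + t" using norm_triangle_ineq[of "s *\<^sub>R axis k 1 :: real^'n" "t *\<^sub>R axis l 1"] that by simp
      also have "\<dots> < d" using that by simp
      finally show ?thesis using d(2) by (simp add: dist_real_def)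
    qed
    then show ?thesis using d(1) by (intro exI[of _ "d / 2"]) auto
  qed
  have "\<bar>partial (partial f i) j x - partial (partial f j) i x\<bar> \<le> 0"
  proof (rule field_le_epsilon)
    fix e :: real assume e: "e > 0"
    obtain h1 where h1: "h1 > 0" "\<And>s t. 0 < s \<Longrightarrow> s < h1 \<Longrightarrow> 0 < t \<Longrightarrow> t < h1 \<Longrightarrow> \<bar>partial (partial f i) j (x + s *\<^sub>R ?e + t *\<^sub>R ?d) - partial (partial f i) j x\<bar> < e / 2"
      using lim[of "e / 2" i j] e by auto
    obtain h2 where h2: "h2 > 0" "\<And>s t. 0 < s \<Longrightarrow> s < h2 \<Longrightarrow> 0 < t \<Longrightarrow> t < h2 \<Longrightarrow> \<bar>partial (partial f j) i (x + s *\<^sub>R ?d + t *\<^sub>R ?e) - partial (partial f j) i x\<bar> < e / 2"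
      using lim[of "e / 2" j i] e by auto
    define h where "h = min h1 h2"
    have h: "h > 0" using h1 h2 by (simp add: h_def)
    obtain s t where st: "0 < s" "s < h" "0 < t" "t < h" "f (x + h *\<^sub>R ?e + h *\<^sub>R ?d) - f (x + h *\<^sub>R ?e) - f (x + h *\<^sub>R ?d) + f x = h * (h * partial (partial f i) j (x + s *\<^sub>R ?e + t *\<^sub>R ?d))"
      using mvt[OF h, of i j] by blast
    obtain s' t' where st': "0 < s'" "s' < h" "0 < t'" "t' < h" "f (x + h *\<^sub>R ?d + h *\<^sub>R ?e) - f (x + h *\<^sub>R ?d) - f (x + h *\<^sub>R ?e) + f x = h * (h * partial (partial f j) i (x + s' *\<^sub>R ?d + t' *\<^sub>R ?e))"
      using mvt[OF h, of j i] by blast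
    have "x + h *\<^sub>R ?d + h *\<^sub>R ?e = x + h *\<^sub>R ?e + h *\<^sub>R ?d" by (simp add: algebra_simps)
    then have "f (x + h *\<^sub>R ?d + h *\<^sub>R ?e) = f (x + h *\<^sub>R ?e + h *\<^sub>R ?d)" by (rule arg_cong)
    then have "h * (h * partial (partial f i) j (x + s *\<^sub>R ?e + t *\<^sub>R ?d)) = h * (h * partial (partial f j) i (x + s' *\<^sub>R ?d + t' *\<^sub>R ?e))"
      using st(5) st'(5) by linarith
    then have "partial (partial f i) j (x + s *\<^sub>R ?e + t *\<^sub>R ?d) = partial (partial f j) i (x + s' *\<^sub>R ?d + t' *\<^sub>R ?e)" using h by simp
    moreover have "\<bar>partial (partial f i) j (x + s *\<^sub>R ?e + t *\<^sub>R ?d) - partial (partial f i) j x\<bar> < e / 2" using st h_def by (intro h1) auto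
    moreover have "\<bar>partial (partial f j) i (x + s' *\<^sub>R ?d + t' *\<^sub>R ?e) - partial (partial f j) i x\<bar> < e / 2" using st' h_def by (intro h2) auto
    ultimately show "\<bar>partial (partial f i) j x - partial (partial f j) i x\<bar> \<le> 0 + e" by linarith
  qed
  then show "partial (partial f i) j x = partial (partial f j) i x" by simp
qed

section \<open>The flow and the shear on Q x Omega\<close>

locale setting =
  fixes \<Phi> :: "real \<Rightarrow> real" and Q :: "(real^'n) set" and M :: "'w measure" and T :: "real^'n \<Rightarrow> 'w \<Rightarrow> 'w"
  assumes young: "young_function \<Phi>" and delta: "delta2 \<Phi>" and Q: "bounded Q" "open Q" and dyn: "dynamical_system M T"
begin

abbreviation "P \<equiv> QOm Q M"

definition SP :: "real^'n \<Rightarrow> (real^'n) \<times> 'w \<Rightarrow> (real^'n) \<times> 'w" where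
  "SP y z = (fst z, T y (snd z))"

definition shear :: "real \<Rightarrow> (real^'n) \<times> 'w \<Rightarrow> (real^'n) \<times> 'w" where
  "shear c z = (fst z, T (c *\<^sub>R fst z) (snd z))"

lemma finite_QM: "finite_measure (QM Q)"
proof (rule finite_measureI)
  have "emeasure (QM Q) (space (QM Q)) = emeasure lborel Q"
    using Q(2) by (subst emeasure_restrict_space) (auto simp: space_restrict_space borel_open)
  also have "\<dots> < \<infinity>" by (rule emeasure_bounded_finite[OF Q(1)])
  finally show "emeasure (QM Q) (space (QM Q)) \<noteq> \<infinity>" by simp
qed

lemma prob_M: "prob_space M" using dyn by (simp add: dynamical_system_def)

sublocale MF: orlicz_flow_delta2 M T \<Phi>
  using dynamical_system_flow[OF dyn] young delta
  by (auto simp: orlicz_flow_delta2_def orlicz_flow_delta2_axioms_def orlicz_flow_def young_def)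

sublocale PF: orlicz_flow_delta2 P SP \<Phi>
proof -
  have "flow P SP" using flow_product[OF dynamical_system_flow[OF dyn] finite_QM] by (simp add: SP_def[abs_def])
  then show "orlicz_flow_delta2 P SP \<Phi>" using young delta
    by (auto simp: orlicz_flow_delta2_def orlicz_flow_delta2_axioms_def orlicz_flow_def young_def)
qed

sublocale QF: finite_measure "QM Q" by (rule finite_QM)

sublocale QMp: pair_sigma_finite "QM Q" M
  by unfold_locales

sublocale PL: pair_sigma_finite P lborel
  by unfold_locales

lemma space_P: "space P = Q \<times> space M"
  by (simp add: space_pair_measure space_restrict_space)

lemmas fst_P[measurable] = fst_QOm[of Q M]

lemma snd_P[measurable]: "snd \<in> measurable P M" by simp

lemma conv_P: "PF.conv \<sigma> F (x, w) = MF.conv \<sigma> (\<lambda>w. F (x, w)) w"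
  by (simp add: PF.conv_def MF.conv_def SP_def)

lemma conv_P_prod: "PF.conv \<sigma> (\<lambda>z. k (fst z) * h (snd z)) z = k (fst z) * MF.conv \<sigma> h (snd z)"
proof -
  have "(\<lambda>y. \<sigma> y * (k (fst z) * h (T y (snd z)))) = (\<lambda>y. k (fst z) * (\<sigma> y * h (T y (snd z))))" by auto
  then show ?thesis by (simp add: PF.conv_def MF.conv_def SP_def)
qed

lemma shear_meas[measurable]: "shear c \<in> measurable P P"
  and shear_distr: "distr P P (shear c) = P"
proof -
  have m: "(\<lambda>x. c *\<^sub>R x) \<in> measurable (QM Q) borel" by (rule measurable_restrict_space1) simp
  note * = shear_preserving[OF dynamical_system_flow[OF dyn] QF.sigma_finite_measure_axioms m]
  show "shear c \<in> measurable P P" "distr P P (shear c) = P" using * by (auto simp: shear_def[abs_def])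
qed

lemma shear_inv: "z \<in> space P \<Longrightarrow> shear (- c) (shear c z) = z"
  using MF.S_inv by (auto simp: shear_def space_P)

lemma integral_shear:
  fixes u G :: "(real^'n) \<times> 'w \<Rightarrow> real"
  assumes [measurable]: "u \<in> borel_measurable P" "G \<in> borel_measurable P"
  shows "(\<integral>z. u z * G (shear c z) \<partial>P) = (\<integral>z. u (shear (- c) z) * G z \<partial>P)"
proof -
  have "(\<integral>z. u (shear (- c) z) * G z \<partial>P) = (\<integral>z. u (shear (- c) (shear c z)) * G (shear c z) \<partial>P)"
    using integral_distr[of "shear c" P P "\<lambda>z. u (shear (- c) z) * G z"] by (simp add: shear_distr)
  also have "\<dots> = (\<integral>z. u z * G (shear c z) \<partial>P)"
    by (rule Bochner_Integration.integral_cong[OF HOL.refl]) (simp add: shear_inv)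
  finally show ?thesis ..
qed

lemma modl_shear: assumes [measurable]: "u \<in> borel_measurable P" shows "MF.Y.modl P (\<lambda>z. u (shear c z)) = MF.Y.modl P u"
  using nn_integral_distr[of "shear c" P P "\<lambda>z. ennreal (\<Phi> \<bar>u z\<bar>)"] unfolding MF.Y.modl_def by (simp add: shear_distr)

text \<open>For fixed z the kernel is translated by \<open>c *\<^sub>R fst z\<close>, and by
  \<open>conv_shift\<close> the integral over y is the mollification of \<open>h\<close> at the
  sheared point. The compact support of \<open>\<sigma>\<close> makes the integrand integrable
  jointly in y and z.\<close>

lemma kernel_fubini:
  fixes v :: "(real^'n) \<times> 'w \<Rightarrow> real"
  assumes v: "integrable P v" and k[measurable]: "k \<in> borel_measurable borel" and K: "\<And>x. \<bar>k x\<bar> \<le> K"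
    and \<sigma>: "Cc_inf UNIV \<sigma>" and h[measurable]: "h \<in> borel_measurable M" and C: "\<And>w. w \<in> space M \<Longrightarrow> \<bar>h w\<bar> \<le> C"
  shows "(\<integral>y. (\<integral>z. v z * (k (fst z) * \<sigma> (y - c *\<^sub>R fst z) * h (T y (snd z))) \<partial>P) \<partial>lborel)
       = (\<integral>z. v z * (k (fst z) * MF.conv \<sigma> h (snd (shear c z))) \<partial>P)" (is ?A)
    and "integrable lborel (\<lambda>y. \<integral>z. v z * (k (fst z) * \<sigma> (y - c *\<^sub>R fst z) * h (T y (snd z))) \<partial>P)" (is ?B)
    and "\<And>y. integrable P (\<lambda>z. v z * (k (fst z) * \<sigma> (y - c *\<^sub>R fst z) * h (T y (snd z))))" (is "\<And>y. ?D y")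
proof -
  note \<sigma>i = Cc_inf_integrable[OF \<sigma>]
  have [measurable]: "\<sigma> \<in> borel_measurable borel" "v \<in> borel_measurable P" using Cc_inf_borel[OF \<sigma>] v by auto
  have K0: "0 \<le> K" using K[of 0] by simp
  have C0: "0 \<le> C" using C prob_space.not_empty[OF prob_M] by force
  define G where "G z y = v z * (k (fst z) * \<sigma> (y - c *\<^sub>R fst z) * h (T y (snd z)))" for z y
  have Gm[measurable]: "(\<lambda>(z, y). G z y) \<in> borel_measurable (P \<Otimes>\<^sub>M lborel)"
  proof -
    have "(\<lambda>w. T (snd w) (snd (fst w))) \<in> measurable (P \<Otimes>\<^sub>M lborel) M"
      by (intro MF.S_comp measurable_compose[OF measurable_fst snd_P]) simp
    then show ?thesis unfolding G_def case_prod_beta by measurable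
  qed
  obtain D where D: "D > 0" "\<And>x. \<bar>\<sigma> x\<bar> \<le> D" using Cc_inf_bounded[OF \<sigma>] by blast
  have Tz: "T y (snd z) \<in> space M" if "z \<in> space P" for z y using that MF.S_space by (auto simp: space_P)
  show "?D y" for y
  proof (rule integrable_mult_bounded[OF v, where C="K * D * C"])
    show "AE z in P. \<bar>k (fst z) * \<sigma> (y - c *\<^sub>R fst z) * h (T y (snd z))\<bar> \<le> K * D * C"
      using K D C[OF Tz] K0 C0 by (intro AE_I2) (auto simp: abs_mult intro!: mult_mono)
  qed measurable
  have G1: "\<bar>G z y\<bar> \<le> (\<bar>v z\<bar> * (K * C)) * \<bar>\<sigma> (y - c *\<^sub>R fst z)\<bar>" if "z \<in> space P" for z y
  proof -
    have "\<bar>k (fst z)\<bar> * \<bar>h (T y (snd z))\<bar> \<le> K * C" using K C[OF Tz[OF that]] K0 by (intro mult_mono) auto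
    then have "(\<bar>v z\<bar> * \<bar>\<sigma> (y - c *\<^sub>R fst z)\<bar>) * (\<bar>k (fst z)\<bar> * \<bar>h (T y (snd z))\<bar>) \<le> (\<bar>v z\<bar> * \<bar>\<sigma> (y - c *\<^sub>R fst z)\<bar>) * (K * C)"
      by (intro mult_left_mono) auto
    then show ?thesis by (simp add: G_def abs_mult algebra_simps)
  qed
  have si: "integrable lborel (\<lambda>y. \<bar>\<sigma> (y - a)\<bar>)" "(\<integral>y. \<bar>\<sigma> (y - a)\<bar> \<partial>lborel) = (\<integral>y. \<bar>\<sigma> y\<bar> \<partial>lborel)" for a
    using lborel_integral_shift(2)[OF \<sigma>i] lborel_integral_shift(1)[of "\<lambda>y. \<bar>\<sigma> y\<bar>" a] by auto
  have Gz: "G z \<in> borel_measurable lborel" if "z \<in> space P" for z using measurable_Pair2[OF Gm that] by simp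
  have Gi: "integrable lborel (G z)" if z: "z \<in> space P" for z
  proof (rule Bochner_Integration.integrable_bound)
    show "integrable lborel (\<lambda>y. (\<bar>v z\<bar> * (K * C)) * \<bar>\<sigma> (y - c *\<^sub>R fst z)\<bar>)" using si by simp
    show "AE y in lborel. norm (G z y) \<le> norm ((\<bar>v z\<bar> * (K * C)) * \<bar>\<sigma> (y - c *\<^sub>R fst z)\<bar>)"
      using order_trans[OF G1[OF z] abs_ge_self] by (intro AE_I2) simp
  qed (rule Gz[OF z])
  have GI: "integrable (P \<Otimes>\<^sub>M lborel) (\<lambda>(z, y). G z y)"
  proof (rule PL.Fubini_integrable)
    show "integrable P (\<lambda>z. \<integral>y. norm (case (z, y) of (z, y) \<Rightarrow> G z y) \<partial>lborel)"
    proof (rule Bochner_Integration.integrable_bound)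
      show "integrable P (\<lambda>z. \<bar>v z\<bar> * (K * C) * (\<integral>y. \<bar>\<sigma> y\<bar> \<partial>lborel))" using v by simp
      have "(\<lambda>(z, y). norm (G z y)) \<in> borel_measurable (P \<Otimes>\<^sub>M lborel)" using Gm by (simp add: case_prod_beta')
      then show "(\<lambda>z. \<integral>y. norm (case (z, y) of (z, y) \<Rightarrow> G z y) \<partial>lborel) \<in> borel_measurable P"
        using lborel.borel_measurable_lebesgue_integral[of "\<lambda>z y. norm (G z y)" P] by simp
      show "AE z in P. norm (\<integral>y. norm (case (z, y) of (z, y) \<Rightarrow> G z y) \<partial>lborel) \<le> norm (\<bar>v z\<bar> * (K * C) * (\<integral>y. \<bar>\<sigma> y\<bar> \<partial>lborel))"
      proof (rule AE_I2)
        fix z assume z: "z \<in> space P"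
        have "(\<integral>y. \<bar>G z y\<bar> \<partial>lborel) \<le> (\<integral>y. (\<bar>v z\<bar> * (K * C)) * \<bar>\<sigma> (y - c *\<^sub>R fst z)\<bar> \<partial>lborel)"
          using Gi[OF z] si G1[OF z] by (intro integral_mono) auto
        then show "norm (\<integral>y. norm (case (z, y) of (z, y) \<Rightarrow> G z y) \<partial>lborel) \<le> norm (\<bar>v z\<bar> * (K * C) * (\<integral>y. \<bar>\<sigma> y\<bar> \<partial>lborel))"
          using si by (simp add: order_trans[OF _ abs_ge_self])
      qed
    qed
    show "AE z in P. integrable lborel (\<lambda>y. case (z, y) of (z, y) \<Rightarrow> G z y)" using Gi by auto
  qed simp
  show ?B using PL.integrable_snd[OF GI] by (simp add: G_def)
  have "(\<integral>y. (\<integral>z. G z y \<partial>P) \<partial>lborel) = (\<integral>z. (\<integral>y. G z y \<partial>lborel) \<partial>P)" by (rule PL.Fubini_integral[OF GI])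
  also have "\<dots> = (\<integral>z. v z * (k (fst z) * MF.conv \<sigma> h (snd (shear c z))) \<partial>P)"
  proof (rule Bochner_Integration.integral_cong[OF HOL.refl])
    fix z assume z: "z \<in> space P"
    have "(\<lambda>y. G z y) = (\<lambda>y. (v z * k (fst z)) * (\<sigma> (y - c *\<^sub>R fst z) * h (T y (snd z))))" by (auto simp: G_def)
    then have "(\<integral>y. G z y \<partial>lborel) = v z * k (fst z) * MF.conv (\<lambda>y. \<sigma> (y - c *\<^sub>R fst z)) h (snd z)" by (simp add: MF.conv_def)
    also have "MF.conv (\<lambda>y. \<sigma> (y - c *\<^sub>R fst z)) h (snd z) = MF.conv \<sigma> h (snd (shear c z))"
      using z by (simp add: shear_def MF.conv_shift space_P mem_Times_iff)
    finally show "(\<integral>y. G z y \<partial>lborel) = v z * (k (fst z) * MF.conv \<sigma> h (snd (shear c z)))" by simp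
  qed
  finally show ?A by (simp add: G_def)
qed

text \<open>The test function \<open>\<phi>(x) (\<rho> * h)(T(c x)\<omega>)\<close> is an average over \<open>y\<close> of the products
  \<open>\<phi>(x) \<rho>(y - c x) \<cdot> h(T(y)\<omega>)\<close>, which are admissible in the definition of the distributional derivative.\<close>
lemma oscillating_test:
  fixes u w :: "(real^'n) \<times> 'w \<Rightarrow> real"
  assumes u: "integrable P u" and w: "integrable P w" and D: "has_Dx Q M u i w"
    and \<phi>: "Cc_inf Q \<phi>" and \<rho>: "Cc_inf UNIV \<rho>" and h[measurable]: "h \<in> borel_measurable M" and C: "\<And>\<omega>. \<omega> \<in> space M \<Longrightarrow> \<bar>h \<omega>\<bar> \<le> C"
  shows "(\<integral>z. w z * (\<phi> (fst z) * MF.conv \<rho> h (snd (shear c z))) \<partial>P) =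
     - (\<integral>z. u z * (partial \<phi> i (fst z) * MF.conv \<rho> h (snd (shear c z))) \<partial>P)
     + c * (\<integral>z. u z * (\<phi> (fst z) * MF.conv (partial \<rho> i) h (snd (shear c z))) \<partial>P)"
proof -
  obtain K where K: "\<And>x. \<bar>\<phi> x\<bar> \<le> K" using Cc_inf_bounded[OF \<phi>] by blast
  obtain K' where K': "\<And>x. \<bar>partial \<phi> i x\<bar> \<le> K'" using Cc_inf_bounded[OF Cc_inf_partial[OF \<phi>]] by blast
  note m1 = Cc_inf_borel[OF \<phi>] and m2 = Cc_inf_borel[OF Cc_inf_partial[OF \<phi>, of i]]
  note A = kernel_fubini[where k="partial \<phi> i" and c=c, OF u m2 K' \<rho> h C]
    and B = kernel_fubini[where k=\<phi> and c=c, OF u m1 K Cc_inf_partial[OF \<rho>, of i] h C]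
    and E = kernel_fubini[where k=\<phi> and c=c, OF w m1 K \<rho> h C]
  have eq: "(\<integral>z. w z * (\<phi> (fst z) * \<rho> (y - c *\<^sub>R fst z) * h (T y (snd z))) \<partial>P) =
     - (\<integral>z. u z * (partial \<phi> i (fst z) * \<rho> (y - c *\<^sub>R fst z) * h (T y (snd z))) \<partial>P)
     + c * (\<integral>z. u z * (\<phi> (fst z) * partial \<rho> i (y - c *\<^sub>R fst z) * h (T y (snd z))) \<partial>P)" for y
  proof -
    let ?\<rho> = "\<lambda>x. \<rho> (y + (- c) *\<^sub>R x)"
    have sm: "smooth_Rn ?\<rho>" by (rule smooth_Rn_affine[OF Cc_inf_smooth[OF \<rho>]])
    have t: "Cc_inf Q (\<lambda>x. \<phi> x * ?\<rho> x)" by (rule Cc_inf_mult[OF \<phi> sm])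
    \<comment> \<open>The inner derivative of the translated kernel contributes the factor
      \<open>- c\<close>, the source of the term of order 1/\<epsilon>.\<close>
    have p: "partial (\<lambda>x. \<phi> x * ?\<rho> x) i x = \<phi> x * ((- c) * partial \<rho> i (y + (- c) *\<^sub>R x)) + partial \<phi> i x * ?\<rho> x" for x
      unfolding partial_mult[OF smooth_Rn_differentiable[OF Cc_inf_smooth[OF \<phi>]] smooth_Rn_differentiable[OF sm]]
        partial_affine[OF smooth_Rn_differentiable[OF Cc_inf_smooth[OF \<rho>]]] ..
    have b: "bounded_ae M (\<lambda>\<omega>. h (T y \<omega>))" unfolding bounded_ae_def using C MF.S_space by (auto intro!: exI[of _ C])
    have "(\<integral>z. w z * (\<phi> (fst z) * \<rho> (y - c *\<^sub>R fst z) * h (T y (snd z))) \<partial>P) = (\<integral>z. w z * (\<phi> (fst z) * ?\<rho> (fst z)) * h (T y (snd z)) \<partial>P)"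
      by (simp add: mult.assoc)
    also have "\<dots> = - (\<integral>z. u z * partial (\<lambda>x. \<phi> x * ?\<rho> x) i (fst z) * h (T y (snd z)) \<partial>P)"
      using D[unfolded has_Dx_def, rule_format, OF t b] by linarith
    also have "(\<integral>z. u z * partial (\<lambda>x. \<phi> x * ?\<rho> x) i (fst z) * h (T y (snd z)) \<partial>P) =
       (\<integral>z. u z * (partial \<phi> i (fst z) * \<rho> (y - c *\<^sub>R fst z) * h (T y (snd z))) - c * (u z * (\<phi> (fst z) * partial \<rho> i (y - c *\<^sub>R fst z) * h (T y (snd z)))) \<partial>P)"
      by (rule Bochner_Integration.integral_cong[OF HOL.refl]) (simp only: p, simp add: algebra_simps)
    also have "\<dots> = (\<integral>z. u z * (partial \<phi> i (fst z) * \<rho> (y - c *\<^sub>R fst z) * h (T y (snd z))) \<partial>P)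
       - c * (\<integral>z. u z * (\<phi> (fst z) * partial \<rho> i (y - c *\<^sub>R fst z) * h (T y (snd z))) \<partial>P)"
      using A(3)[of y] B(3)[of y] by simp
    finally show ?thesis by simp
  qed
  have "(\<integral>y. (\<integral>z. w z * (\<phi> (fst z) * \<rho> (y - c *\<^sub>R fst z) * h (T y (snd z))) \<partial>P) \<partial>lborel) =
     - (\<integral>y. (\<integral>z. u z * (partial \<phi> i (fst z) * \<rho> (y - c *\<^sub>R fst z) * h (T y (snd z))) \<partial>P) \<partial>lborel)
     + c * (\<integral>y. (\<integral>z. u z * (\<phi> (fst z) * partial \<rho> i (y - c *\<^sub>R fst z) * h (T y (snd z))) \<partial>P) \<partial>lborel)"
    unfolding eq using A(2) B(2) by simp
  then show ?thesis using A(1) B(1) E(1) by simp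
qed

end

section \<open>Norms, invariance and measurability of sections\<close>

context setting
begin

lemma modl_P: assumes [measurable]: "F \<in> borel_measurable P"
  shows "MF.Y.modl P F = (\<integral>\<^sup>+x. MF.Y.modl M (\<lambda>w. F (x, w)) \<partial>QM Q)"
  unfolding MF.Y.modl_def by (rule MF.nn_integral_fst[symmetric]) measurable

lemma section_meas: "F \<in> borel_measurable P \<Longrightarrow> x \<in> Q \<Longrightarrow> (\<lambda>w. F (x, w)) \<in> borel_measurable M"
  using measurable_Pair2[of F "QM Q" M borel x] by (simp add: space_restrict_space)

lemma modl_section_meas: assumes [measurable]: "F \<in> borel_measurable P"
  shows "(\<lambda>x. MF.Y.modl M (\<lambda>w. l * F (x, w))) \<in> borel_measurable (QM Q)"
  unfolding MF.Y.modl_def by measurable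

lemma AE_section_orlicz:
  assumes F: "PF.EPhi F" shows "AE x in QM Q. orlicz \<Phi> M (\<lambda>w. F (x, w))"
proof -
  have [measurable]: "F \<in> borel_measurable P" using F by (simp add: PF.EPhi_def)
  have "MF.Y.modl P (\<lambda>z. 1 * F z) < \<infinity>" using F unfolding PF.EPhi_def by blast
  then have "(\<integral>\<^sup>+x. MF.Y.modl M (\<lambda>w. 1 * F (x, w)) \<partial>QM Q) \<noteq> \<infinity>"
    using modl_P[of F] by simp
  then have "AE x in QM Q. MF.Y.modl M (\<lambda>w. 1 * F (x, w)) \<noteq> \<infinity>"
    by (rule nn_integral_PInf_AE[OF modl_section_meas, rotated]) simp
  then show ?thesis using AE_space
    by eventually_elim (auto simp: MF.Y.orlicz_iff space_restrict_space section_meas less_top intro!: exI[of _ 1])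
qed

text \<open>The norm is an infimum over uncountably many scales, but admissible scales are closed
  upwards, so rational ones decide whether the infimum lies below a given number.\<close>

lemma lux_section_meas:
  assumes F[measurable]: "F \<in> borel_measurable P"
  shows "(\<lambda>x. lux \<Phi> M (\<lambda>w. F (x, w))) \<in> borel_measurable (QM Q)"
proof -
  define a where "a k x = MF.Y.modl M (\<lambda>w. F (x, w) / k)" for k x
  have am[measurable]: "a k \<in> borel_measurable (QM Q)" for k
    using modl_section_meas[OF F, of "1 / k"] by (simp add: a_def[abs_def])
  define A where "A x = {k. k > 0 \<and> a k x \<le> 1}" for x
  have lux: "lux \<Phi> M (\<lambda>w. F (x, w)) = Inf (A x)" for x by (simp add: MF.Y.lux_eq A_def a_def)
  have up: "l \<in> A x" if "k \<in> A x" "k \<le> l" for k l x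
    using that MF.Y.modl_div_mono[of k l M "\<lambda>w. F (x, w)"] by (auto simp: A_def a_def)
  have ne: "A x \<noteq> {} \<longleftrightarrow> (\<exists>q::rat. of_rat q \<in> A x)" for x
  proof
    assume "A x \<noteq> {}"
    then obtain k where k: "k \<in> A x" by blast
    obtain q :: rat where "k < of_rat q" using of_rat_dense[of k "k + 1"] by auto
    then show "\<exists>q::rat. of_rat q \<in> A x" using up[OF k] by (meson less_imp_le)
  qed auto
  have less: "Inf (A x) < c \<longleftrightarrow> (\<exists>q::rat. of_rat q < c \<and> of_rat q \<in> A x)" if ne': "A x \<noteq> {}" for x c
  proof
    assume "Inf (A x) < c"
    then obtain k where k: "k \<in> A x" "k < c" using cInf_lessD[OF ne'] by blast
    obtain q :: rat where "k < of_rat q" "of_rat q < c" using of_rat_dense[OF k(2)] by blast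
    then show "\<exists>q::rat. of_rat q < c \<and> of_rat q \<in> A x" using up[OF k(1)] by (meson less_imp_le)
  next
    assume "\<exists>q::rat. of_rat q < c \<and> of_rat q \<in> A x"
    then obtain q :: rat where q: "of_rat q < c" "of_rat q \<in> A x" by blast
    have "Inf (A x) \<le> of_rat q" by (rule cInf_lower[OF q(2)]) (auto simp: A_def intro!: bdd_belowI[of _ 0])
    then show "Inf (A x) < c" using q(1) by simp
  qed
  have mA[measurable]: "{x \<in> space (QM Q). of_rat q \<in> A x} \<in> sets (QM Q)" for q :: rat
    unfolding A_def by simp
  have "{x \<in> space (QM Q). lux \<Phi> M (\<lambda>w. F (x, w)) < c} \<in> sets (QM Q)" for c
  proof -
    \<comment> \<open>Sections without any admissible scale have the fixed norm
      \<open>Inf {}\<close>; they enter all at once or not at all.\<close>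
    have eq: "{x \<in> space (QM Q). lux \<Phi> M (\<lambda>w. F (x, w)) < c} =
      (\<Union>q\<in>{q::rat. of_rat q < c}. {x \<in> space (QM Q). of_rat q \<in> A x}) \<union>
      (if Inf ({}::real set) < c then space (QM Q) - (\<Union>q::rat. {x \<in> space (QM Q). of_rat q \<in> A x}) else {})" (is "?L = ?R")
    proof (rule set_eqI)
      fix x
      show "x \<in> ?L \<longleftrightarrow> x \<in> ?R"
      proof (cases "A x = {}")
        case True then show ?thesis unfolding lux by auto
      next
        case False
        then have "\<exists>q::rat. of_rat q \<in> A x" using ne by blast
        then show ?thesis unfolding lux using less[OF False, of c] by auto
      qed
    qed
    show ?thesis unfolding eq by (intro sets.Un sets.countable_UN') auto
  qed
  then show ?thesis by (simp add: borel_measurable_iff_less)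
qed

lemma lux_integrable:
  assumes F: "PF.EPhi F" shows "integrable (QM Q) (\<lambda>x. lux \<Phi> M (\<lambda>w. F (x, w)))"
proof -
  have Fm[measurable]: "F \<in> borel_measurable P" using F by (simp add: PF.EPhi_def)
  define m where "m x = MF.Y.modl M (\<lambda>w. F (x, w))" for x
  have mm[measurable]: "m \<in> borel_measurable (QM Q)" using modl_section_meas[OF Fm, of 1] by (simp add: m_def[abs_def])
  have "MF.Y.modl P (\<lambda>z. 1 * F z) < \<infinity>" using F unfolding PF.EPhi_def by blast
  then have fin: "(\<integral>\<^sup>+x. m x \<partial>QM Q) < \<infinity>" using modl_P[of F] by (simp add: m_def)
  have mAE: "AE x in QM Q. m x \<noteq> \<infinity>" by (rule nn_integral_PInf_AE[OF mm]) (use fin in simp)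
  have mi: "integrable (QM Q) (\<lambda>x. enn2real (m x))"
  proof (rule integrableI_nonneg)
    have "(\<integral>\<^sup>+x. ennreal (enn2real (m x)) \<partial>QM Q) = (\<integral>\<^sup>+x. m x \<partial>QM Q)"
      using mAE by (intro nn_integral_cong_AE) (auto elim!: eventually_mono simp: less_top)
    then show "(\<integral>\<^sup>+x. ennreal (enn2real (m x)) \<partial>QM Q) < \<infinity>" using fin by simp
  qed auto
  show ?thesis
  proof (rule Bochner_Integration.integrable_bound)
    show "integrable (QM Q) (\<lambda>x. 1 + enn2real (m x))" using mi by simp
    show "(\<lambda>x. lux \<Phi> M (\<lambda>w. F (x, w))) \<in> borel_measurable (QM Q)" by (rule lux_section_meas) simp
    show "AE x in QM Q. norm (lux \<Phi> M (\<lambda>w. F (x, w))) \<le> norm (1 + enn2real (m x))"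
      using mAE AE_section_orlicz[OF F]
    proof eventually_elim
      case (elim x)
      have "lux \<Phi> M (\<lambda>w. F (x, w)) \<le> 1 * (1 + enn2real (m x))"
        by (rule MF.Y.lux_le_modl) (use elim in \<open>auto simp: MF.Y.orlicz_iff m_def less_top\<close>)
      then show ?case using MF.Y.lux_nonneg[OF elim(2)] by simp
    qed
  qed
qed

text \<open>The quantifiers over y and x have to change places, and the exceptional set for each y
  must not accumulate. Fubini on the triple product handles almost every y; the set of good y is
  closed under addition, which leaves no exception.\<close>

lemma AE_section_invariant:
  assumes u: "PF.EPhi u" and inv: "PF.inv_fun u" shows "AE x in QM Q. invariant \<Phi> M T (\<lambda>w. u (x, w))"
proof -
  have um[measurable]: "u \<in> borel_measurable P" using u by (simp add: PF.EPhi_def)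
  define b where "b y x w = (if u (x, T y w) = u (x, w) then 0 else 1 :: ennreal)" for y x w
  interpret LQ: pair_sigma_finite lborel "QM Q" by unfold_locales
  have bm: "(\<lambda>v. b (fst v) (fst (snd v)) (snd (snd v))) \<in> borel_measurable (lborel \<Otimes>\<^sub>M P)"
  proof -
    have "(\<lambda>v. u (SP (fst v) (snd v))) \<in> borel_measurable (lborel \<Otimes>\<^sub>M P)"
      by (intro measurable_compose[OF _ um] PF.S_comp) (auto simp: measurable_fst cong: measurable_cong_sets)
    moreover have "(\<lambda>v. u (snd v)) \<in> borel_measurable (lborel \<Otimes>\<^sub>M P)" by measurable
    ultimately show ?thesis unfolding b_def SP_def by simp
  qed
  have bm2: "(\<lambda>v. \<integral>\<^sup>+w. b (fst v) (snd v) w \<partial>M) \<in> borel_measurable (lborel \<Otimes>\<^sub>M QM Q)"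
  proof -
    have "(\<lambda>v. (fst (fst v), (snd (fst v), snd v))) \<in> measurable ((lborel \<Otimes>\<^sub>M QM Q) \<Otimes>\<^sub>M M) (lborel \<Otimes>\<^sub>M P)" by measurable
    from measurable_compose[OF this bm] have "(\<lambda>(v, w). b (fst v) (snd v) w) \<in> borel_measurable ((lborel \<Otimes>\<^sub>M QM Q) \<Otimes>\<^sub>M M)"
      by (simp add: case_prod_beta')
    then show ?thesis by (rule MF.borel_measurable_nn_integral)
  qed
  have "(\<integral>\<^sup>+x. (\<integral>\<^sup>+w. b y x w \<partial>M) \<partial>QM Q) = 0" for y
  proof -
    have m: "(\<lambda>z. b y (fst z) (snd z)) \<in> borel_measurable P"
      using measurable_Pair2[OF bm, of y] by simp
    have "AE z in P. u (SP y z) = u z" using inv by (simp add: PF.inv_fun_def)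
    then have "(\<integral>\<^sup>+z. b y (fst z) (snd z) \<partial>P) = 0"
      by (subst nn_integral_0_iff_AE[OF m]) (auto simp: b_def SP_def elim!: eventually_mono)
    then show ?thesis using MF.nn_integral_fst[OF m] by simp
  qed
  then have "(\<integral>\<^sup>+y. (\<integral>\<^sup>+x. (\<integral>\<^sup>+w. b y x w \<partial>M) \<partial>QM Q) \<partial>lborel) = 0" by simp
  then have "(\<integral>\<^sup>+x. (\<integral>\<^sup>+y. (\<integral>\<^sup>+w. b y x w \<partial>M) \<partial>lborel) \<partial>QM Q) = 0"
    using LQ.Fubini'[of "\<lambda>y x. \<integral>\<^sup>+w. b y x w \<partial>M"] bm2 by (simp add: case_prod_beta')
  moreover have "(\<lambda>x. \<integral>\<^sup>+y. (\<integral>\<^sup>+w. b y x w \<partial>M) \<partial>lborel) \<in> borel_measurable (QM Q)"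
  proof -
    have "(\<lambda>v. (snd v, fst v)) \<in> measurable (QM Q \<Otimes>\<^sub>M lborel) (lborel \<Otimes>\<^sub>M QM Q)" by measurable
    from measurable_compose[OF this bm2] have "(\<lambda>(x, y). \<integral>\<^sup>+w. b y x w \<partial>M) \<in> borel_measurable (QM Q \<Otimes>\<^sub>M lborel)"
      by (simp add: case_prod_beta')
    then show ?thesis by (rule lborel.borel_measurable_nn_integral)
  qed
  ultimately have "AE x in QM Q. (\<integral>\<^sup>+y. (\<integral>\<^sup>+w. b y x w \<partial>M) \<partial>lborel) = 0"
    by (simp add: nn_integral_0_iff_AE)
  then show ?thesis using AE_section_orlicz[OF u] AE_space
  proof eventually_elim
    case (elim x)
    have x: "x \<in> Q" using elim(3) by (simp add: space_restrict_space)
    define f where "f w = u (x, w)" for w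
    have fm[measurable]: "f \<in> borel_measurable M" unfolding f_def[abs_def] by (rule section_meas[OF um x])
    define Y where "Y = {y. AE w in M. f (T y w) = f w}"
    have "(\<lambda>y. \<integral>\<^sup>+w. b y x w \<partial>M) \<in> borel_measurable lborel"
      using measurable_Pair1[OF bm2, of x] x by (simp add: space_restrict_space)
    then have AEy: "AE y in lborel. (\<integral>\<^sup>+w. b y x w \<partial>M) = 0" using elim(1) by (simp add: nn_integral_0_iff_AE)
    have Yae: "AE y in lborel. y \<in> Y" using AEy
    proof eventually_elim
      case (elim y)
      have "(\<lambda>w. b y x w) \<in> borel_measurable M" unfolding b_def f_def[symmetric] by measurable
      then have "AE w in M. b y x w = 0" using elim by (simp add: nn_integral_0_iff_AE)
      then show ?case by (auto simp: Y_def b_def f_def elim!: eventually_mono split: if_splits)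
    qed
    have Yadd: "y1 + y2 \<in> Y" if "y1 \<in> Y" "y2 \<in> Y" for y1 y2
    proof -
      have "AE w in M. f (T y1 (T y2 w)) = f (T y2 w)" using MF.AE_S[of "\<lambda>w. f (T y1 w) = f w" y2] that by (simp add: Y_def)
      moreover have "AE w in M. f (T y2 w) = f w" using that by (simp add: Y_def)
      ultimately have "AE w in M. f (T (y1 + y2) w) = f w" using AE_space by eventually_elim (simp add: MF.S_add)
      then show ?thesis by (simp add: Y_def)
    qed
    text \<open>A subgroup of full measure is everything: it meets its reflection at half of any point.\<close>
    have "y \<in> Y" for y
    proof -
      have eq: "distr lborel borel (\<lambda>x. y + (- 1) *\<^sub>R x) = (lborel :: (real^'n) measure)"
        using lborel_affine[of "- 1" y] by (simp add: density_1)
      have "AE y' in distr lborel borel (\<lambda>x. y + (- 1) *\<^sub>R x). y' \<in> Y" using Yae unfolding eq .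
      then have "AE y' in lborel. y + (- 1) *\<^sub>R y' \<in> Y" by (rule AE_distrD[rotated]) simp
      with Yae have "AE y' in lborel. y' \<in> Y \<and> y - y' \<in> Y" by eventually_elim simp
      moreover have "ae_filter (lborel :: (real^'n) measure) \<noteq> bot"
        by (simp add: ae_filter_eq_bot_iff)
      ultimately obtain y' where "y' \<in> Y" "y - y' \<in> Y" using eventually_happens' by blast
      then have "y' + (y - y') \<in> Y" by (rule Yadd)
      then show ?thesis by simp
    qed
    then show ?case using elim(2) by (simp add: invariant_def Y_def f_def)
  qed
qed

end

lemma wconv_AE_bounded:
  assumes w: "wconv M v u" and [measurable]: "\<And>n. v n \<in> borel_measurable M" "u \<in> borel_measurable M" "F \<in> borel_measurable M"
    and C: "AE x in M. \<bar>F x\<bar> \<le> C"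
  shows "(\<lambda>n. \<integral>x. v n x * F x \<partial>M) \<longlonglongrightarrow> (\<integral>x. u x * F x \<partial>M)"
proof -
  define F' where "F' x = max (- \<bar>C\<bar>) (min \<bar>C\<bar> (F x))" for x
  have [measurable]: "F' \<in> borel_measurable M" unfolding F'_def[abs_def] by measurable
  have eq: "(\<integral>x. t x * F' x \<partial>M) = (\<integral>x. t x * F x \<partial>M)" if [measurable]: "t \<in> borel_measurable M" for t
    using C by (intro integral_cong_AE) (auto elim!: eventually_mono simp: F'_def)
  have "(\<lambda>n. \<integral>x. v n x * F' x \<partial>M) \<longlonglongrightarrow> (\<integral>x. u x * F' x \<partial>M)"
    by (rule wconvD[OF w, of _ "\<bar>C\<bar>"]) (auto simp: F'_def)
  then show ?thesis by (simp add: eq)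
qed

context young
begin

lemma orlicz_weak_compact_family:
  fixes v :: "'k::finite \<Rightarrow> nat \<Rightarrow> 'a \<Rightarrow> real"
  assumes "finite_measure M" and "\<And>i n. v i n \<in> borel_measurable M" and k: "k > 0"
    and b: "\<And>i n. modl M (\<lambda>x. v i n x / k) \<le> 1"
  shows "\<exists>r w. strict_mono r \<and> (\<forall>i. integrable M (w i) \<and> orlicz \<Phi> M (w i) \<and> wconv M (\<lambda>n. v i (r n)) (w i))"
proof -
  have "\<exists>r w. strict_mono r \<and> (\<forall>i\<in>J. integrable M (w i) \<and> orlicz \<Phi> M (w i) \<and> wconv M (\<lambda>n. v i (r n)) (w i))" if "finite J" for J
    using that
  proof induction
    case empty show ?case by (auto intro!: exI[of _ id] simp: strict_mono_def)
  next
    case (insert j J)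
    then obtain r w where r: "strict_mono r" and w: "\<And>i. i \<in> J \<Longrightarrow> integrable M (w i) \<and> orlicz \<Phi> M (w i) \<and> wconv M (\<lambda>n. v i (r n)) (w i)" by blast
    obtain r' u where r': "strict_mono r'" "integrable M u" "orlicz \<Phi> M u" "wconv M ((\<lambda>n. v j (r n)) \<circ> r') u"
      using orlicz_weak_compact[OF assms(1), of "\<lambda>n. v j (r n)" k] assms by blast
    have "wconv M (\<lambda>n. v i ((r \<circ> r') n)) (w i)" if "i \<in> J" for i
      using wconv_subseq[of M "\<lambda>n. v i (r n)" "w i" r'] w[OF that] r'(1) by (simp add: o_def)
    moreover have "strict_mono (r \<circ> r')" using r r'(1) by (rule strict_mono_o)
    ultimately show ?case using w r' insert(2)
      by (intro exI[of _ "r \<circ> r'"] exI[of _ "w(j := u)"]) (auto simp: o_def)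
  qed
  from this[of UNIV] show ?thesis by simp
qed

end

section \<open>Weak limits tested with mollified functions\<close>

context setting
begin

lemma AE_snd: assumes "AE w in M. R w" shows "AE z in P. R (snd z)"
proof -
  obtain N where N: "\<And>w. w \<in> space M - N \<Longrightarrow> R w" "N \<in> null_sets M" using AE_E3[OF assms] by blast
  have Qs: "Q \<in> sets (QM Q)" using sets.top[of "QM Q"] by (simp add: space_restrict_space)
  have "Q \<times> N \<in> null_sets P"
    using N(2) MF.emeasure_pair_measure_Times[OF Qs null_setsD2[OF N(2)]] Qs by (intro null_setsI) (auto dest: null_setsD1)
  moreover have "{z \<in> space P. \<not> R (snd z)} \<subseteq> Q \<times> N"
  proof
    fix z assume z: "z \<in> {z \<in> space P. \<not> R (snd z)}"
    then have "fst z \<in> Q" "snd z \<in> space M" by (auto simp: space_P)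
    moreover have "snd z \<in> N" using N(1)[of "snd z"] z \<open>snd z \<in> space M\<close> by blast
    ultimately show "z \<in> Q \<times> N" by (simp add: mem_Times_iff)
  qed
  ultimately show ?thesis by (rule AE_I')
qed

text \<open>The test function as it appears after the shear: the oscillation is gone and the family
  is closed under partials in \<open>\<phi>\<close> and in \<open>\<rho>\<close>.\<close>

definition G :: "(real^'n \<Rightarrow> real) \<Rightarrow> (real^'n \<Rightarrow> real) \<Rightarrow> ('w \<Rightarrow> real) \<Rightarrow> (real^'n) \<times> 'w \<Rightarrow> real" where
  "G \<phi> \<rho> h z = \<phi> (fst z) * MF.conv \<rho> h (snd z)"

definition bmeas :: "('w \<Rightarrow> real) \<Rightarrow> bool" where
  "bmeas h \<longleftrightarrow> h \<in> borel_measurable M \<and> (\<exists>C. \<forall>w\<in>space M. \<bar>h w\<bar> \<le> C)"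

lemma G_meas[measurable]:
  assumes "Cc_inf Q \<phi>" "Cc_inf UNIV \<rho>" "bmeas h" shows "G \<phi> \<rho> h \<in> borel_measurable P"
proof -
  have [measurable]: "\<phi> \<in> borel_measurable borel" "\<rho> \<in> borel_measurable borel" "h \<in> borel_measurable M"
    using assms Cc_inf_borel by (auto simp: bmeas_def)
  show ?thesis unfolding G_def[abs_def] by measurable
qed

lemma G_bound:
  assumes "Cc_inf Q \<phi>" "Cc_inf UNIV \<rho>" "bmeas h" obtains B where "\<And>z. z \<in> space P \<Longrightarrow> \<bar>G \<phi> \<rho> h z\<bar> \<le> B"
proof -
  obtain K where K: "\<And>x. \<bar>\<phi> x\<bar> \<le> K" using Cc_inf_bounded[OF assms(1)] by blast
  obtain C where C: "\<And>w. w \<in> space M \<Longrightarrow> \<bar>h w\<bar> \<le> C" using assms(3) by (auto simp: bmeas_def)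
  define D where "D = C * (\<integral>y. \<bar>\<rho> y\<bar> \<partial>lborel)"
  have "\<bar>G \<phi> \<rho> h z\<bar> \<le> K * D" if "z \<in> space P" for z
  proof -
    have "\<bar>MF.conv \<rho> h (snd z)\<bar> \<le> D" unfolding D_def
      using that C Cc_inf_integrable[OF assms(2)] by (intro MF.conv_bound) (auto simp: space_P)
    moreover have "0 \<le> K" using K[of 0] by simp
    ultimately show ?thesis unfolding G_def abs_mult by (intro mult_mono K) auto
  qed
  then show ?thesis by (rule that)
qed

lemma wconv_G:
  assumes "wconv P v u" "Cc_inf Q \<phi>" "Cc_inf UNIV \<rho>" "bmeas h"
  shows "(\<lambda>n. \<integral>z. v n z * G \<phi> \<rho> h z \<partial>P) \<longlonglongrightarrow> (\<integral>z. u z * G \<phi> \<rho> h z \<partial>P)"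
proof -
  obtain B where "\<And>z. z \<in> space P \<Longrightarrow> \<bar>G \<phi> \<rho> h z\<bar> \<le> B" using G_bound[OF assms(2-4)] by blast
  then show ?thesis by (rule wconvD[OF assms(1) G_meas[OF assms(2-4)]])
qed

text \<open>The shear preserves the measure, so the oscillation moves from the test function to
  \<open>u\<close> and \<open>w\<close>. The test functions are then fixed along the sequence, as
  weak convergence demands.\<close>

lemma G_sheared:
  assumes u: "integrable P u" and w: "integrable P w" and D: "has_Dx Q M u i w"
    and \<phi>: "Cc_inf Q \<phi>" and \<rho>: "Cc_inf UNIV \<rho>" and h: "bmeas h"
  shows "(\<integral>z. w (shear (- c) z) * G \<phi> \<rho> h z \<partial>P) =
    - (\<integral>z. u (shear (- c) z) * G (partial \<phi> i) \<rho> h z \<partial>P) + c * (\<integral>z. u (shear (- c) z) * G \<phi> (partial \<rho> i) h z \<partial>P)"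
proof -
  obtain C where C: "\<And>w. w \<in> space M \<Longrightarrow> \<bar>h w\<bar> \<le> C" and hm: "h \<in> borel_measurable M" using h by (auto simp: bmeas_def)
  have um: "u \<in> borel_measurable P" "w \<in> borel_measurable P" using u w by auto
  have e: "(\<integral>z. t (shear (- c) z) * G \<phi>' \<rho>' h z \<partial>P) = (\<integral>z. t z * (\<phi>' (fst z) * MF.conv \<rho>' h (snd (shear c z))) \<partial>P)"
    if "t \<in> borel_measurable P" "Cc_inf Q \<phi>'" "Cc_inf UNIV \<rho>'" for t \<phi>' \<rho>'
    using integral_shear[OF that(1) G_meas[OF that(2,3) h], of c] by (simp add: G_def shear_def)
  show ?thesis
    using oscillating_test[OF u w D \<phi> \<rho> hm C, of c] e um \<phi> \<rho> Cc_inf_partial[OF \<phi>] Cc_inf_partial[OF \<rho>] by simp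
qed

lemma conv_P_adjoint:
  assumes H: "integrable P H" and \<sigma>: "integrable lborel \<sigma>" and \<phi>: "Cc_inf Q \<phi>" and A: "A \<in> sets M"
  shows "(\<integral>z. PF.conv \<sigma> H z * (\<phi> (fst z) * indicator A (snd z)) \<partial>P) = (\<integral>z. H z * G \<phi> (\<lambda>y. \<sigma> (- y)) (indicator A) z \<partial>P)"
proof -
  obtain K where K: "\<And>x. \<bar>\<phi> x\<bar> \<le> K" using Cc_inf_bounded[OF \<phi>] by blast
  have [measurable]: "\<phi> \<in> borel_measurable borel" "A \<in> sets M" using Cc_inf_borel[OF \<phi>] A by auto
  have "(\<integral>z. PF.conv \<sigma> H z * (\<phi> (fst z) * indicator A (snd z)) \<partial>P) = (\<integral>z. H z * PF.conv (\<lambda>y. \<sigma> (- y)) (\<lambda>z. \<phi> (fst z) * indicator A (snd z)) z \<partial>P)"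
  proof (rule PF.conv_adjoint[OF \<sigma> H, where C=K])
    show "\<bar>\<phi> (fst z) * indicator A (snd z)\<bar> \<le> K" for z using K[of "fst z"] by (auto simp: indicator_def order_trans[OF abs_ge_zero K])
  qed measurable
  then show ?thesis by (simp add: conv_P_prod G_def)
qed

lemma Cc_inf_reflect:
  fixes \<rho> :: "real^'n \<Rightarrow> real"
  assumes \<rho>: "Cc_inf UNIV \<rho>"
  shows "Cc_inf UNIV (\<lambda>y. \<rho> (- y))" and "partial \<rho> i (- y) = - partial (\<lambda>y. \<rho> (- y)) i y"
  using Cc_inf_affine[OF \<rho>, of "-1" 0] partial_affine[where a=0 and c="-1" and x=y and i=i, OF smooth_Rn_differentiable[OF Cc_inf_smooth[OF \<rho>]]] by auto

lemma G_reflect: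
  assumes "Cc_inf UNIV \<rho>"
  shows "G \<phi> (\<lambda>y. partial \<rho> i (- y)) h z = - G \<phi> (partial (\<lambda>y. \<rho> (- y)) i) h z"
  by (simp add: G_def Cc_inf_reflect(2)[OF assms] MF.conv_def)

lemma bmeas_indicator: "A \<in> sets M \<Longrightarrow> bmeas (indicator A)"
  by (auto simp: bmeas_def indicator_def)

text \<open>By adjointness the hypothesis says that all averaged derivatives of \<open>u0\<close>
  vanish against products of test functions and indicators; the reflection of the kernel only
  changes a sign.\<close>

lemma invariant_of_G:
  assumes u0: "integrable P u0"
    and z: "\<And>\<phi> \<rho> h i. Cc_inf Q \<phi> \<Longrightarrow> Cc_inf UNIV \<rho> \<Longrightarrow> bmeas h \<Longrightarrow> (\<integral>z. u0 z * G \<phi> (partial \<rho> i) h z \<partial>P) = 0"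
  shows "PF.inv_fun u0"
proof (rule PF.inv_fun_of_conv_partial[OF u0])
  fix \<rho> :: "real^'n \<Rightarrow> real" and i assume \<rho>: "Cc_inf UNIV \<rho>"
  note pi = Cc_inf_integrable[OF Cc_inf_partial[OF \<rho>, of i]]
  show "AE z in P. PF.conv (partial \<rho> i) u0 z = 0"
  proof (rule AE_zero_Cc_inf[OF Q(2) MF.finite_measure_axioms PF.conv_integrable[OF pi u0]])
    fix \<phi> :: "real^'n \<Rightarrow> real" and A assume \<phi>: "Cc_inf Q \<phi>" and A: "A \<in> sets M"
    show "(\<integral>z. PF.conv (partial \<rho> i) u0 z * (\<phi> (fst z) * indicator A (snd z)) \<partial>P) = 0"
      unfolding conv_P_adjoint[OF u0 pi \<phi> A] G_reflect[OF \<rho>]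
      using z[OF \<phi> Cc_inf_reflect(1)[OF \<rho>] bmeas_indicator[OF A], of i] by simp
  qed
qed

lemma curl_of_G:
  assumes W: "\<And>i. integrable P (W i)"
    and z: "\<And>\<phi> \<rho> h i j. Cc_inf Q \<phi> \<Longrightarrow> Cc_inf UNIV \<rho> \<Longrightarrow> bmeas h \<Longrightarrow> (\<integral>z. W i z * G \<phi> (partial \<rho> j) h z \<partial>P) = (\<integral>z. W j z * G \<phi> (partial \<rho> i) h z \<partial>P)"
    and \<rho>: "Cc_inf UNIV \<rho>"
  shows "AE z in P. PF.conv (partial \<rho> j) (W i) z = PF.conv (partial \<rho> i) (W j) z"
proof -
  note pi = Cc_inf_integrable[OF Cc_inf_partial[OF \<rho>]]
  note ci = PF.conv_integrable[OF pi W]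
  have "AE z in P. PF.conv (partial \<rho> j) (W i) z - PF.conv (partial \<rho> i) (W j) z = 0"
  proof (rule AE_zero_Cc_inf[OF Q(2) MF.finite_measure_axioms])
    show "integrable P (\<lambda>z. PF.conv (partial \<rho> j) (W i) z - PF.conv (partial \<rho> i) (W j) z)" using ci by simp
    fix \<phi> :: "real^'n \<Rightarrow> real" and A assume \<phi>: "Cc_inf Q \<phi>" and A: "A \<in> sets M"
    obtain K where K: "\<And>x. \<bar>\<phi> x\<bar> \<le> K" using Cc_inf_bounded[OF \<phi>] by blast
    have [measurable]: "\<phi> \<in> borel_measurable borel" "A \<in> sets M" using Cc_inf_borel[OF \<phi>] A by auto
    have ii: "integrable P (\<lambda>z. t z * (\<phi> (fst z) * indicator A (snd z)))" if "integrable P t" for t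
    proof (rule integrable_mult_bounded[OF that, where C=K])
      show "AE z in P. \<bar>\<phi> (fst z) * indicator A (snd z)\<bar> \<le> K"
        using K by (intro AE_I2) (auto simp: indicator_def order_trans[OF abs_ge_zero K])
    qed measurable
    have "(\<integral>z. (PF.conv (partial \<rho> j) (W i) z - PF.conv (partial \<rho> i) (W j) z) * (\<phi> (fst z) * indicator A (snd z)) \<partial>P) =
      (\<integral>z. PF.conv (partial \<rho> j) (W i) z * (\<phi> (fst z) * indicator A (snd z)) \<partial>P) - (\<integral>z. PF.conv (partial \<rho> i) (W j) z * (\<phi> (fst z) * indicator A (snd z)) \<partial>P)"
      unfolding left_diff_distrib by (rule Bochner_Integration.integral_diff[OF ii[OF ci] ii[OF ci]])
    also have "\<dots> = 0"
      unfolding conv_P_adjoint[OF W pi \<phi> A] G_reflect[OF \<rho>]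
      using z[OF \<phi> Cc_inf_reflect(1)[OF \<rho>] bmeas_indicator[OF A], of i j] by simp
    finally show "(\<integral>z. (PF.conv (partial \<rho> j) (W i) z - PF.conv (partial \<rho> i) (W j) z) * (\<phi> (fst z) * indicator A (snd z)) \<partial>P) = 0" .
  qed
  then show ?thesis by eventually_elim simp
qed

text \<open>Integrating out x against \<open>k\<close> leaves an invariant function of w, against
  which \<open>h\<close> and its conditional expectation have the same integral.
  \<open>\<eta>\<close> stands for a bounded version of the latter.\<close>

lemma invariant_EI_test:
  assumes H: "integrable P H" "PF.inv_fun H" and k[measurable]: "k \<in> borel_measurable borel" and K: "\<And>x. \<bar>k x\<bar> \<le> K"
    and h: "bmeas h" and \<eta>: "bmeas \<eta>" "AE w in M. \<eta> w = MF.EI h w"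
  shows "(\<integral>z. H z * (k (fst z) * h (snd z)) \<partial>P) = (\<integral>z. H z * (k (fst z) * \<eta> (snd z)) \<partial>P)"
proof -
  define U where "U F w = (\<integral>x. F (x, w) * k x \<partial>QM Q)" for F and w :: 'w
  have ii: "integrable P (\<lambda>z. F z * k (fst z))" if F: "integrable P F" for F
    by (rule integrable_mult_bounded[OF F, where C=K]) (use K in auto)
  have fub: "(\<integral>z. F z * (k (fst z) * t (snd z)) \<partial>P) = (\<integral>w. U F w * t w \<partial>M)" and fubi: "integrable M (\<lambda>w. U F w * t w)"
    if F: "integrable P F" and t: "bmeas t" for F t
  proof -
    obtain C where C: "\<And>w. w \<in> space M \<Longrightarrow> \<bar>t w\<bar> \<le> C" and [measurable]: "t \<in> borel_measurable M" using t by (auto simp: bmeas_def)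
    have i: "integrable P (\<lambda>(x, w). F (x, w) * k x * t w)"
    proof -
      have "integrable P (\<lambda>z. F z * k (fst z) * t (snd z))"
        by (rule integrable_mult_bounded[OF ii[OF F], where C=C]) (use C in \<open>auto simp: space_P\<close>)
      then show ?thesis by (simp add: case_prod_beta')
    qed
    show "(\<integral>z. F z * (k (fst z) * t (snd z)) \<partial>P) = (\<integral>w. U F w * t w \<partial>M)"
      using QMp.integral_snd[OF i] by (simp add: U_def case_prod_beta' mult.assoc[symmetric])
    show "integrable M (\<lambda>w. U F w * t w)" using QMp.integrable_snd[OF i] by (simp add: U_def)
  qed
  have Ui: "integrable M (U H)" using fubi[OF H(1), of "\<lambda>_. 1"] by (auto simp: bmeas_def intro!: exI[of _ 1])
  have [measurable]: "H \<in> borel_measurable P" "U H \<in> borel_measurable M" using H(1) Ui by auto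
  have "MF.inv_fun (U H)" unfolding MF.inv_fun_def
  proof safe
    fix y
    have US: "U H (T y w) = U (\<lambda>z. H (SP y z)) w" for w by (simp add: U_def SP_def)
    show "AE w in M. U H (T y w) = U H w"
    proof (rule MF.AE_eq_of_integrals[OF MF.integrable_S[OF Ui] Ui])
      fix A assume A: "A \<in> sets M"
      then have [measurable]: "A \<in> sets M" by simp
      have "(\<integral>w. U H (T y w) * indicator A w \<partial>M) = (\<integral>z. H (SP y z) * (k (fst z) * indicator A (snd z)) \<partial>P)"
        unfolding US by (rule fub[OF PF.integrable_S[OF H(1)] bmeas_indicator[OF A], symmetric])
      also have "\<dots> = (\<integral>z. H z * (k (fst z) * indicator A (snd z)) \<partial>P)"
      proof (rule integral_cong_AE)
        have "AE z in P. H (SP y z) = H z" using H(2) by (simp add: PF.inv_fun_def)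
        then show "AE z in P. H (SP y z) * (k (fst z) * indicator A (snd z)) = H z * (k (fst z) * indicator A (snd z))" by eventually_elim simp
      qed measurable
      also have "\<dots> = (\<integral>w. U H w * indicator A w \<partial>M)" by (rule fub[OF H(1) bmeas_indicator[OF A]])
      finally show "(\<integral>w. U H (T y w) * indicator A w \<partial>M) = (\<integral>w. U H w * indicator A w \<partial>M)" .
    qed
  qed simp
  then have "(\<integral>w. U H w * MF.EI h w \<partial>M) = (\<integral>w. U H w * h w \<partial>M)"
    using h fubi[OF H(1) h] by (intro MF.EI_integral) (auto simp: bmeas_def)
  moreover have "(\<integral>w. U H w * \<eta> w \<partial>M) = (\<integral>w. U H w * MF.EI h w \<partial>M)"
    using \<eta> by (intro integral_cong_AE) (auto simp: bmeas_def elim!: eventually_mono)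
  ultimately show ?thesis using fub[OF H(1) h] fub[OF H(1) \<eta>(1)] by simp
qed

text \<open>The distributional derivative must be tested with every bounded \<open>\<psi>\<close>,
  while the limit identity is known only for invariant \<open>\<eta>\<close>. As \<open>u0\<close>
  and the conditional expectation of \<open>W\<close> are both invariant, \<open>\<psi>\<close> may
  be replaced by its own conditional expectation, and against that \<open>W\<close> and its
  conditional expectation agree.\<close>

lemma has_Dx_EI:
  assumes u0: "integrable P u0" "PF.inv_fun u0" and W: "integrable P W"
    and lim: "\<And>\<phi> \<eta>. Cc_inf Q \<phi> \<Longrightarrow> bmeas \<eta> \<Longrightarrow> MF.inv_fun \<eta> \<Longrightarrow>
       (\<integral>z. W z * (\<phi> (fst z) * \<eta> (snd z)) \<partial>P) = - (\<integral>z. u0 z * (partial \<phi> i (fst z) * \<eta> (snd z)) \<partial>P)"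
  shows "has_Dx Q M u0 i (PF.EI W)"
  unfolding has_Dx_def
proof (intro allI impI)
  fix \<phi> \<psi> assume \<phi>: "Cc_inf Q \<phi>" and "bounded_ae M \<psi>"
  then obtain C where \<psi>[measurable]: "\<psi> \<in> borel_measurable M" and C: "AE w in M. \<bar>\<psi> w\<bar> \<le> C" by (auto simp: bounded_ae_def)
  \<comment> \<open>Clamping at the bound, used for \<open>\<psi>\<close> and for its conditional
    expectation, yields versions bounded everywhere; the absolute value keeps the interval
    nonempty.\<close>
  define cl where "cl t = max (- \<bar>C\<bar>) (min \<bar>C\<bar> t)" for t
  have clb: "\<bar>cl t\<bar> \<le> \<bar>C\<bar>" and cle: "\<bar>t\<bar> \<le> \<bar>C\<bar> \<Longrightarrow> cl t = t" for t by (auto simp: cl_def)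
  have [measurable]: "cl \<in> borel_measurable borel" unfolding cl_def[abs_def] by measurable
  define h where "h w = cl (\<psi> w)" for w
  have hm[measurable]: "h \<in> borel_measurable M" unfolding h_def[abs_def] by measurable
  have hb: "bmeas h" unfolding bmeas_def using hm clb by (auto simp: h_def)
  have h\<psi>: "AE w in M. h w = \<psi> w" using C by eventually_elim (simp add: h_def cle)
  have hi: "integrable M h" by (rule MF.bounded_integrable[where C="\<bar>C\<bar>"]) (use clb in \<open>auto simp: h_def\<close>)
  define \<eta> where "\<eta> w = cl (MF.EI h w)" for w
  have \<eta>I: "\<eta> \<in> borel_measurable MF.Inv" unfolding \<eta>_def[abs_def] by measurable
  have \<eta>m[measurable]: "\<eta> \<in> borel_measurable M" by (rule measurable_from_subalg[OF MF.subalg_Inv \<eta>I])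
  have \<eta>b: "bmeas \<eta>" unfolding bmeas_def using \<eta>m clb by (auto simp: \<eta>_def)
  have \<eta>inv: "MF.inv_fun \<eta>" using \<eta>I by (simp add: MF.inv_fun_iff)
  have "AE w in M. h w \<le> \<bar>C\<bar>" "AE w in M. h w \<ge> - \<bar>C\<bar>" using clb by (auto simp: h_def abs_le_iff minus_le_iff)
  then have "AE w in M. MF.EI h w \<le> \<bar>C\<bar>" "AE w in M. MF.EI h w \<ge> - \<bar>C\<bar>"
    using MF.Inv.real_cond_exp_le_c[OF hi] MF.Inv.real_cond_exp_ge_c[OF hi] by auto
  then have \<eta>e: "AE w in M. \<eta> w = MF.EI h w" by eventually_elim (simp add: \<eta>_def cle abs_le_iff)
  obtain K where K: "\<And>x. \<bar>\<phi> x\<bar> \<le> K" using Cc_inf_bounded[OF \<phi>] by blast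
  obtain K' where K': "\<And>x. \<bar>partial \<phi> i x\<bar> \<le> K'" using Cc_inf_bounded[OF Cc_inf_partial[OF \<phi>]] by blast
  have [measurable]: "\<phi> \<in> borel_measurable borel" "partial \<phi> i \<in> borel_measurable borel"
    using Cc_inf_borel[OF \<phi>] Cc_inf_borel[OF Cc_inf_partial[OF \<phi>]] by auto
  have [measurable]: "u0 \<in> borel_measurable P" "W \<in> borel_measurable P" using u0 W by auto
  have sw: "(\<integral>z. t z * k (fst z) * \<psi> (snd z) \<partial>P) = (\<integral>z. t z * (k (fst z) * h (snd z)) \<partial>P)"
    if [measurable]: "t \<in> borel_measurable P" "k \<in> borel_measurable borel" for t k
    using AE_snd[OF h\<psi>] by (intro integral_cong_AE) (auto elim!: eventually_mono simp: mult.assoc)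
  have Ei: "integrable P (PF.EI W)" using W by (rule PF.Inv.real_cond_exp_int(1))
  have EIm[measurable]: "PF.EI W \<in> borel_measurable P" using Ei by auto
  have inv: "PF.inv_fun (\<lambda>z. \<phi> (fst z) * \<eta> (snd z))" unfolding PF.inv_fun_def
  proof safe
    fix y
    have "AE w in M. \<eta> (T y w) = \<eta> w" using \<eta>inv by (simp add: MF.inv_fun_def)
    from AE_snd[OF this] show "AE z in P. \<phi> (fst (SP y z)) * \<eta> (snd (SP y z)) = \<phi> (fst z) * \<eta> (snd z)"
      by eventually_elim (simp add: SP_def)
  qed measurable
  have Wi: "integrable P (\<lambda>z. \<phi> (fst z) * \<eta> (snd z) * W z)"
  proof -
    have "integrable P (\<lambda>z. W z * (\<phi> (fst z) * \<eta> (snd z)))"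
    proof (rule integrable_mult_bounded[OF W, where C="K * \<bar>C\<bar>"])
      show "AE z in P. \<bar>\<phi> (fst z) * \<eta> (snd z)\<bar> \<le> K * \<bar>C\<bar>"
        using K clb order_trans[OF abs_ge_zero K] by (intro AE_I2) (auto simp: abs_mult \<eta>_def intro!: mult_mono)
    qed measurable
    then show ?thesis by (simp add: mult.commute)
  qed
  have EW: "(\<integral>z. PF.EI W z * (\<phi> (fst z) * \<eta> (snd z)) \<partial>P) = (\<integral>z. W z * (\<phi> (fst z) * \<eta> (snd z)) \<partial>P)"
    using PF.EI_integral[OF inv _ Wi] by (simp add: mult.commute)
  have "(\<integral>z. u0 z * partial \<phi> i (fst z) * \<psi> (snd z) \<partial>P) = (\<integral>z. u0 z * (partial \<phi> i (fst z) * h (snd z)) \<partial>P)" by (rule sw) measurable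
  also have "\<dots> = (\<integral>z. u0 z * (partial \<phi> i (fst z) * \<eta> (snd z)) \<partial>P)" by (rule invariant_EI_test[where k="partial \<phi> i", OF u0 _ K' hb \<eta>b \<eta>e]) measurable
  also have "\<dots> = - (\<integral>z. W z * (\<phi> (fst z) * \<eta> (snd z)) \<partial>P)" using lim[OF \<phi> \<eta>b \<eta>inv] by simp
  also have "\<dots> = - (\<integral>z. PF.EI W z * (\<phi> (fst z) * \<eta> (snd z)) \<partial>P)" using EW by simp
  also have "\<dots> = - (\<integral>z. PF.EI W z * (\<phi> (fst z) * h (snd z)) \<partial>P)"
    using invariant_EI_test[where k=\<phi>, OF Ei PF.inv_EI _ K hb \<eta>b \<eta>e] by simp
  also have "\<dots> = - (\<integral>z. PF.EI W z * \<phi> (fst z) * \<psi> (snd z) \<partial>P)" using sw[of "PF.EI W" \<phi>] by simp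
  finally show "(\<integral>z. u0 z * partial \<phi> i (fst z) * \<psi> (snd z) \<partial>P) = - (\<integral>z. PF.EI W z * \<phi> (fst z) * \<psi> (snd z) \<partial>P)" .
qed

lemma AE_section_gradient:
  fixes g :: "'n \<Rightarrow> (real^'n) \<times> 'w \<Rightarrow> real"
  assumes g: "\<And>i. PF.EPhi (g i)" and E0: "\<And>i. AE z in P. PF.EI (g i) z = 0"
    and curl: "\<And>\<rho> i j. Cc_inf UNIV \<rho> \<Longrightarrow> AE z in P. PF.conv (partial \<rho> j) (g i) z = PF.conv (partial \<rho> i) (g j) z"
  shows "AE x in QM Q. in_W1sharp_grad \<Phi> M T (\<lambda>i w. g i (x, w))"
proof -
  have gm[measurable]: "g i \<in> borel_measurable P" for i using g[of i] by (simp add: PF.EPhi_def)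
  \<comment> \<open>Scale and accuracy are coupled: a modular of at most 1 at scale
    \<open>Suc n\<close> means a norm of at most 1/(n+1), while the integrals over \<open>Q\<close>
    of the section modulars still tend to 0.\<close>
  have "\<forall>n::nat. \<exists>\<kappa> m. (\<forall>j. Cc_inf UNIV (\<kappa> j)) \<and>
    (\<forall>i. MF.Y.modl P (\<lambda>z. real (Suc n) * (g i z - (\<Sum>j\<in>UNIV. PF.conv (partial (\<kappa> j) i) (\<lambda>z. trunc m (g j z)) z))) \<le> ennreal (1 / real (Suc n)))"
    by (intro allI PF.curl_free_approx g E0 curl) auto
  then obtain \<kappa> m where \<kappa>: "\<And>n j. Cc_inf UNIV (\<kappa> n j)"
    and le: "\<And>n i. MF.Y.modl P (\<lambda>z. real (Suc n) * (g i z - (\<Sum>j\<in>UNIV. PF.conv (partial (\<kappa> n j) i) (\<lambda>z. trunc (m n) (g j z)) z))) \<le> ennreal (1 / real (Suc n))"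
    unfolding choice_iff by blast
  have km[measurable]: "partial (\<kappa> n j) i \<in> borel_measurable borel" for n j i by (rule Cc_inf_borel[OF Cc_inf_partial[OF \<kappa>]])
  define D where "D n i z = g i z - (\<Sum>j\<in>UNIV. PF.conv (partial (\<kappa> n j) i) (\<lambda>z. trunc (m n) (g j z)) z)" for n i z
  have Dm[measurable]: "D n i \<in> borel_measurable P" for n i unfolding D_def[abs_def] by measurable
  define a where "a n x = (\<Sum>i\<in>UNIV. MF.Y.modl M (\<lambda>w. real (Suc n) * D n i (x, w)))" for n x
  have am[measurable]: "a n \<in> borel_measurable (QM Q)" for n
    unfolding a_def[abs_def] by (intro borel_measurable_sum modl_section_meas) measurable
  have an: "(\<integral>\<^sup>+x. a n x \<partial>QM Q) \<le> ennreal (real CARD('n) * (1 / real (Suc n)))" for n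
  proof -
    have "(\<integral>\<^sup>+x. a n x \<partial>QM Q) = (\<Sum>i\<in>UNIV. (\<integral>\<^sup>+x. MF.Y.modl M (\<lambda>w. real (Suc n) * D n i (x, w)) \<partial>QM Q))"
      unfolding a_def by (rule nn_integral_sum) (rule modl_section_meas, measurable)
    also have "\<dots> = (\<Sum>i\<in>UNIV. MF.Y.modl P (\<lambda>z. real (Suc n) * D n i z))"
      by (rule sum.cong[OF HOL.refl]) (simp add: modl_P)
    also have "\<dots> \<le> (\<Sum>i\<in>(UNIV::'n set). ennreal (1 / real (Suc n)))" by (rule sum_mono) (use le in \<open>simp add: D_def\<close>)
    also have "\<dots> = ennreal (\<Sum>i\<in>(UNIV::'n set). 1 / real (Suc n))" by (rule sum_ennreal) simp
    finally show ?thesis by simp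
  qed
  have "(\<lambda>n. ennreal (real CARD('n) * (1 / real (Suc n)))) \<longlonglongrightarrow> ennreal (real CARD('n) * 0)"
    using LIMSEQ_inverse_real_of_nat by (intro tendsto_intros) (simp add: inverse_eq_divide)
  then have b0: "(\<lambda>n. ennreal (real CARD('n) * (1 / real (Suc n)))) \<longlonglongrightarrow> 0" by simp
  have "(\<lambda>n. \<integral>\<^sup>+x. a n x \<partial>QM Q) \<longlonglongrightarrow> 0"
    by (rule tendsto_sandwich[OF _ _ tendsto_const b0]) (use an in auto)
  then have "liminf (\<lambda>n. \<integral>\<^sup>+x. a n x \<partial>QM Q) = 0" by (intro lim_imp_Liminf) auto
  then have "(\<integral>\<^sup>+x. liminf (\<lambda>n. a n x) \<partial>QM Q) = 0" using nn_integral_liminf[of a "QM Q"] am by simp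
  then have "AE x in QM Q. liminf (\<lambda>n. a n x) = 0" by (subst (asm) nn_integral_0_iff_AE) auto
  moreover have "AE x in QM Q. \<forall>i. orlicz \<Phi> M (\<lambda>w. g i (x, w))"
    using AE_section_orlicz[OF g] by (subst AE_all_countable) auto
  ultimately show ?thesis using AE_space
  proof eventually_elim
    case (elim x)
    have x: "x \<in> Q" using elim(3) by (simp add: space_restrict_space)
    show ?case unfolding in_W1sharp_grad_def
    proof (intro conjI allI impI)
      show "orlicz \<Phi> M (\<lambda>w. g i (x, w))" for i using elim(2) by blast
      fix e :: real assume e: "e > 0"
      obtain n0 :: nat where n0: "real CARD('n) / e < real n0" using reals_Archimedean2 by blast
      \<comment> \<open>A vanishing liminf gives, for this x, an index beyond any \<open>n0\<close>
        with section modular below 1. The index depends on x, the kernels and truncation levels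
        attached to it do not.\<close>
      have "(INF n\<in>{n0..}. a n x) \<le> liminf (\<lambda>n. a n x)" unfolding liminf_SUP_INF by (rule SUP_upper) simp
      then have "(INF n\<in>{n0..}. a n x) < 1" using elim(1) by simp
      then obtain n where n: "n \<ge> n0" "a n x < 1" by (auto simp: INF_less_iff)
      define t where "t j w = trunc (m n) (g j (x, w))" for j w
      \<comment> \<open>The sign compensates the minus in the stochastic derivative, so that the
        gradient of \<open>U\<close> is the approximating sum itself.\<close>
      define k where "k j y = \<kappa> n j y * (- 1)" for j y
      have kC: "Cc_inf UNIV (k j)" for j unfolding k_def[abs_def] by (rule Cc_inf_mult[OF \<kappa> smooth_Rn_const])
      have kp: "partial (k j) i = (\<lambda>y. - partial (\<kappa> n j) i y)" for i j
        unfolding k_def[abs_def] using smooth_Rn_differentiable[OF Cc_inf_smooth[OF \<kappa>]]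
        by (intro ext) (subst partial_mult, auto simp: partial_const)
      have [measurable]: "k j \<in> borel_measurable borel" for j by (rule Cc_inf_borel[OF kC])
      have [measurable]: "(\<lambda>w. g j (x, w)) \<in> borel_measurable M" for j by (rule section_meas[OF gm x])
      have tm[measurable]: "t j \<in> borel_measurable M" for j unfolding t_def[abs_def] by measurable
      define U where "U w = (\<Sum>j\<in>UNIV. MF.conv (k j) (t j) w)" for w
      have Um: "U \<in> borel_measurable M" unfolding U_def[abs_def] by measurable
      have mc: "MF.molclass k t U" unfolding MF.molclass_def
        using Um kC tm trunc_bound by (auto simp: U_def t_def intro!: exI[of _ "real (m n)"])
      define DU where "DU i w = - (\<Sum>j\<in>UNIV. MF.conv (partial (k j) i) (t j) w)" for i w
      have DU: "g i (x, w) - DU i w = D n i (x, w)" for i w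
      proof -
        have "MF.conv (partial (k j) i) (t j) w = - PF.conv (partial (\<kappa> n j) i) (\<lambda>z. trunc (m n) (g j z)) (x, w)" for j
          unfolding conv_P kp t_def[abs_def] by (simp add: MF.conv_def)
        then show ?thesis by (simp add: DU_def D_def sum_negf)
      qed
      have l: "lux \<Phi> M (\<lambda>w. g i (x, w) - DU i w) \<le> 1 / real (Suc n)" for i
      proof (rule MF.Y.lux_le)
        have "MF.Y.modl M (\<lambda>w. real (Suc n) * D n i (x, w)) \<le> a n x" unfolding a_def by (rule member_le_sum) auto
        then have "MF.Y.modl M (\<lambda>w. real (Suc n) * D n i (x, w)) \<le> 1" using n(2) by (meson less_imp_le order_trans)
        then show "MF.Y.modl M (\<lambda>w. (g i (x, w) - DU i w) / (1 / real (Suc n))) \<le> 1" unfolding DU by (simp add: mult.commute)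
      qed simp
      have "(\<Sum>i\<in>UNIV. lux \<Phi> M (\<lambda>w. g i (x, w) - DU i w)) \<le> (\<Sum>i\<in>(UNIV::'n set). 1 / real (Suc n))" by (intro sum_mono l)
      also have "\<dots> = real CARD('n) / real (Suc n)" by simp
      also have "\<dots> < e"
      proof -
        have "real CARD('n) < e * real n0" using n0 e by (simp add: field_simps)
        also have "\<dots> \<le> e * real (Suc n)" using n(1) e by (intro mult_left_mono) auto
        finally show ?thesis by (simp add: divide_less_eq mult.commute)
      qed
      finally have "(\<Sum>i\<in>UNIV. lux \<Phi> M (\<lambda>w. g i (x, w) - DU i w)) < e" .
      moreover have "stoch_deriv \<Phi> M T i U (DU i)" for i
        unfolding DU_def[abs_def] by (rule MF.molclass_deriv[OF prob_M mc])
      ultimately show "\<exists>u Du. smooth_omega \<Phi> M T u \<and> (\<forall>i. stoch_deriv \<Phi> M T i u (Du i)) \<and> (\<Sum>i\<in>UNIV. lux \<Phi> M (\<lambda>w. g i (x, w) - Du i w)) < e"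
        using MF.molclass_smooth[OF prob_M mc] by (intro exI[of _ U] exI[of _ DU]) simp
    qed
  qed
qed

lemma lux_sum_orlicz:
  fixes g :: "'n \<Rightarrow> (real^'n) \<times> 'w \<Rightarrow> real"
  assumes g: "\<And>i. PF.EPhi (g i)" and dp: "delta_prime (young_conj \<Phi>)"
  shows "orlicz \<Phi> (QM Q) (\<lambda>x. \<Sum>i\<in>UNIV. lux \<Phi> M (\<lambda>w. g i (x, w)))"
proof -
  have gm[measurable]: "g i \<in> borel_measurable P" for i using g[of i] by (simp add: PF.EPhi_def)
  define L where "L i x = lux \<Phi> M (\<lambda>w. g i (x, w))" for i x
  have Lm[measurable]: "L i \<in> borel_measurable (QM Q)" for i unfolding L_def[abs_def] by (rule lux_section_meas) simp
  obtain b where b: "b > 0" "\<And>x y. x \<ge> 0 \<Longrightarrow> y \<ge> 0 \<Longrightarrow> \<Phi> x * \<Phi> y \<le> \<Phi> (b * x * y)"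
    using MF.Y.delta_prime_conj[OF dp] by blast
  have fin: "MF.Y.modl (QM Q) (L i) < \<infinity>" for i
  proof -
    have "MF.Y.modl (QM Q) (L i) \<le> (\<integral>\<^sup>+x. MF.Y.modl M (\<lambda>w. b * g i (x, w)) \<partial>QM Q)"
      unfolding MF.Y.modl_def[of "QM Q"]
    proof (rule nn_integral_mono_AE, use AE_section_orlicz[OF g, of i] in eventually_elim)
      case (elim x)
      have "ennreal (\<Phi> (L i x)) \<le> MF.Y.modl M (\<lambda>w. b * g i (x, w))"
        unfolding L_def by (rule MF.Y.delta_prime_lux[OF b elim])
      then show ?case using MF.Y.lux_nonneg[OF elim] by (simp add: L_def)
    qed
    also have "\<dots> = MF.Y.modl P (\<lambda>z. b * g i z)" by (simp add: modl_P)
    also have "\<dots> < \<infinity>" using g[of i] by (simp add: PF.EPhi_def)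
    finally show ?thesis .
  qed
  \<comment> \<open>Dividing by the dimension in advance cancels the factor that
    \<open>modl_sum\<close> introduces.\<close>
  have "MF.Y.modl (QM Q) (\<lambda>x. \<Sum>i\<in>UNIV. L i x / real CARD('n)) \<le> (\<Sum>i\<in>UNIV. MF.Y.modl (QM Q) (\<lambda>x. real CARD('n) * (L i x / real CARD('n))))"
    by (rule MF.Y.modl_sum) measurable
  also have "\<dots> < \<infinity>" using fin by simp
  finally have "MF.Y.modl (QM Q) (\<lambda>x. (\<Sum>i\<in>UNIV. L i x) / real CARD('n)) < \<infinity>" by (simp add: sum_divide_distrib)
  then have "orlicz \<Phi> (QM Q) (\<lambda>x. \<Sum>i\<in>UNIV. L i x)"
    unfolding MF.Y.orlicz_iff by (auto intro!: exI[of _ "real CARD('n)"])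
  then show ?thesis by (simp add: L_def)
qed

end

section \<open>Two-scale convergence and the splitting of the limit gradient\<close>

context setting
begin

text \<open>Integration through the shear removes the oscillation from the test function. A function
  in C^\<infinity>(Omega) is only essentially bounded, so the version of weak convergence for such
  tests is used.\<close>

lemma two_scale_of_wconv:
  assumes [measurable]: "\<And>n. u n \<in> borel_measurable P" "u0 \<in> borel_measurable P"
    and w: "wconv P (\<lambda>n z. u n (shear (- inverse (eps n)) z)) u0"
  shows "two_scale_conv \<Phi> Q M T eps u u0"
  unfolding two_scale_conv_def
proof (intro allI impI)
  fix f assume "two_scale_test \<Phi> Q M T f"
  then obtain m :: nat and \<phi> \<psi> where \<phi>: "\<And>k. k < m \<Longrightarrow> Cc_inf Q (\<phi> k)" and \<psi>: "\<And>k. k < m \<Longrightarrow> smooth_omega \<Phi> M T (\<psi> k)"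
    and f: "f = (\<lambda>x w. \<Sum>k<m. \<phi> k x * \<psi> k w)" unfolding two_scale_test_def by blast
  have bae: "bounded_ae M (\<psi> k)" if "k < m" for k
    using \<psi>[OF that] iter_sd.refl[of \<Phi> M T "\<psi> k"] unfolding smooth_omega_def by blast
  define F where "F z = f (fst z) (snd z)" for z
  have Fs: "F z = (\<Sum>k<m. \<phi> k (fst z) * \<psi> k (snd z))" for z by (simp add: F_def f)
  have [measurable]: "\<phi> k \<in> borel_measurable borel" "\<psi> k \<in> borel_measurable M" if "k < m" for k
    using Cc_inf_borel[OF \<phi>[OF that]] bae[OF that] by (auto simp: bounded_ae_def)
  have Fm[measurable]: "F \<in> borel_measurable P"
  proof -
    have "(\<lambda>z. \<phi> k (fst z) * \<psi> k (snd z)) \<in> borel_measurable P" if k: "k \<in> {..<m}" for k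
      using k by (intro borel_measurable_times) (auto intro!: measurable_compose[OF fst_P] measurable_compose[OF snd_P])
    then show ?thesis unfolding Fs[abs_def] by (rule borel_measurable_sum)
  qed
  have "\<forall>k. \<exists>B. k < m \<longrightarrow> (AE z in P. \<bar>\<phi> k (fst z) * \<psi> k (snd z)\<bar> \<le> B)"
  proof
    fix k
    show "\<exists>B. k < m \<longrightarrow> (AE z in P. \<bar>\<phi> k (fst z) * \<psi> k (snd z)\<bar> \<le> B)"
    proof (cases "k < m")
      case k: True
      obtain K where K: "\<And>x. \<bar>\<phi> k x\<bar> \<le> K" using Cc_inf_bounded[OF \<phi>[OF k]] by blast
      obtain C where "AE w in M. \<bar>\<psi> k w\<bar> \<le> C" using bae[OF k] by (auto simp: bounded_ae_def)
      then have "AE z in P. \<bar>\<psi> k (snd z)\<bar> \<le> C" by (rule AE_snd)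
      moreover have "0 \<le> K" using K[of 0] by simp
      ultimately have "AE z in P. \<bar>\<phi> k (fst z) * \<psi> k (snd z)\<bar> \<le> K * C"
        by (auto simp: abs_mult intro!: mult_mono K elim!: eventually_mono)
      then show ?thesis by blast
    qed simp
  qed
  then obtain B where B: "\<And>k. k < m \<Longrightarrow> AE z in P. \<bar>\<phi> k (fst z) * \<psi> k (snd z)\<bar> \<le> B k"
    unfolding choice_iff by blast
  have "AE z in P. \<forall>k\<in>{..<m}. \<bar>\<phi> k (fst z) * \<psi> k (snd z)\<bar> \<le> B k" using B by (subst AE_finite_all) auto
  then have Fb: "AE z in P. \<bar>F z\<bar> \<le> (\<Sum>k<m. B k)"
  proof eventually_elim
    case (elim z)
    have "\<bar>F z\<bar> \<le> (\<Sum>k<m. \<bar>\<phi> k (fst z) * \<psi> k (snd z)\<bar>)" unfolding Fs by (rule sum_abs)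
    also have "\<dots> \<le> (\<Sum>k<m. B k)" using elim by (intro sum_mono) auto
    finally show ?case .
  qed
  have "(\<lambda>n. \<integral>z. u n (shear (- inverse (eps n)) z) * F z \<partial>P) \<longlonglongrightarrow> (\<integral>z. u0 z * F z \<partial>P)"
    by (rule wconv_AE_bounded[OF w _ _ _ Fb]) measurable
  moreover have "(\<integral>z. u n (shear (- inverse (eps n)) z) * F z \<partial>P) = (\<integral>z. u n z * f (fst z) (T (inverse (eps n) *\<^sub>R fst z) (snd z)) \<partial>P)" for n
  proof -
    have "(\<integral>z. u n (shear (- inverse (eps n)) z) * F z \<partial>P) = (\<integral>z. u n z * F (shear (inverse (eps n)) z) \<partial>P)"
      by (rule integral_shear[symmetric]) measurable
    then show ?thesis by (simp add: F_def shear_def)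
  qed
  ultimately show "(\<lambda>n. \<integral>z. u n z * f (fst z) (T (inverse (eps n) *\<^sub>R fst z) (snd z)) \<partial>P) \<longlonglongrightarrow> (\<integral>z. u0 z * f (fst z) (snd z) \<partial>P)"
    by (simp add: F_def)
qed

lemma G_invariant_AE:
  assumes \<rho>: "Cc_inf UNIV \<rho>" and \<eta>: "bmeas \<eta>" "MF.inv_fun \<eta>"
  shows "AE z in P. G \<phi> \<rho> \<eta> z = (\<integral>y. \<rho> y \<partial>lborel) * (\<phi> (fst z) * \<eta> (snd z))"
proof -
  have "integrable M \<eta>" using \<eta>(1) MF.bounded_integrable unfolding bmeas_def by blast
  from AE_snd[OF MF.conv_invariant[OF this \<eta>(2) Cc_inf_integrable[OF \<rho>]]] show ?thesis
    by eventually_elim (simp add: G_def)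
qed

lemma oscillating_limit:
  fixes u :: "nat \<Rightarrow> (real^'n) \<times> 'w \<Rightarrow> real" and Du :: "nat \<Rightarrow> 'n \<Rightarrow> (real^'n) \<times> 'w \<Rightarrow> real"
  assumes u: "\<And>n. integrable P (u n)" and Du: "\<And>n i. integrable P (Du n i)" "\<And>n i. has_Dx Q M (u n) i (Du n i)"
    and eps: "\<And>n. eps n \<noteq> 0" "eps \<longlonglongrightarrow> 0"
    and u0: "integrable P u0" "wconv P (\<lambda>n z. u n (shear (- inverse (eps n)) z)) u0"
    and W: "\<And>i. integrable P (W i)" "\<And>i. wconv P (\<lambda>n z. Du n i (shear (- inverse (eps n)) z)) (W i)"
  shows "PF.inv_fun u0" and "has_Dx Q M u0 i (PF.EI (W i))"
    and "Cc_inf UNIV \<rho> \<Longrightarrow> AE z in P. PF.conv (partial \<rho> j) (W i) z = PF.conv (partial \<rho> i) (W j) z"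
proof -
  define v where "v n z = u n (shear (- inverse (eps n)) z)" for n z
  define w where "w i n z = Du n i (shear (- inverse (eps n)) z)" for i n z
  have vc: "wconv P v u0" and wc: "wconv P (w i) (W i)" for i using u0(2) W(2) by (simp_all add: v_def[abs_def] w_def[abs_def])
  have id: "(\<integral>z. w i n z * G \<phi> \<rho> h z \<partial>P) = - (\<integral>z. v n z * G (partial \<phi> i) \<rho> h z \<partial>P) + inverse (eps n) * (\<integral>z. v n z * G \<phi> (partial \<rho> i) h z \<partial>P)"
    if "Cc_inf Q \<phi>" "Cc_inf UNIV \<rho>" "bmeas h" for \<phi> :: "real^'n \<Rightarrow> real" and \<rho> :: "real^'n \<Rightarrow> real" and h i n
    unfolding v_def w_def by (rule G_sheared[OF u Du that])
  have z: "(\<integral>z. u0 z * G \<phi> (partial \<rho> i) h z \<partial>P) = 0" if \<phi>: "Cc_inf Q \<phi>" and \<rho>: "Cc_inf UNIV \<rho>" and h: "bmeas h" for \<phi> \<rho> :: "real^'n \<Rightarrow> real" and h i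
  proof -
    \<comment> \<open>The identity is solved for the term with the factor 1/\<epsilon>; all other
      integrals converge, so multiplication by \<epsilon> sends them to 0.\<close>
    have "(\<integral>z. v n z * G \<phi> (partial \<rho> i) h z \<partial>P) = eps n * ((\<integral>z. w i n z * G \<phi> \<rho> h z \<partial>P) + (\<integral>z. v n z * G (partial \<phi> i) \<rho> h z \<partial>P))" for n
      using eps(1)[of n] by (simp add: id[OF \<phi> \<rho> h])
    moreover have "(\<lambda>n. eps n * ((\<integral>z. w i n z * G \<phi> \<rho> h z \<partial>P) + (\<integral>z. v n z * G (partial \<phi> i) \<rho> h z \<partial>P)))
      \<longlonglongrightarrow> 0 * ((\<integral>z. W i z * G \<phi> \<rho> h z \<partial>P) + (\<integral>z. u0 z * G (partial \<phi> i) \<rho> h z \<partial>P))"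
      by (intro tendsto_mult tendsto_add eps(2) wconv_G vc wc Cc_inf_partial \<phi> \<rho> h)
    ultimately have "(\<lambda>n. \<integral>z. v n z * G \<phi> (partial \<rho> i) h z \<partial>P) \<longlonglongrightarrow> 0" by simp
    with wconv_G[OF vc \<phi> Cc_inf_partial[OF \<rho>] h] show ?thesis by (rule LIMSEQ_unique)
  qed
  show inv: "PF.inv_fun u0" by (rule invariant_of_G[OF u0(1) z])
  show "AE z in P. PF.conv (partial \<rho> j) (W i) z = PF.conv (partial \<rho> i) (W j) z" if "Cc_inf UNIV \<rho>" for \<rho> :: "real^'n \<Rightarrow> real" and i j
  proof (rule curl_of_G[OF W(1) _ that])
    fix \<phi> \<rho> :: "real^'n \<Rightarrow> real" and h i j assume \<phi>: "Cc_inf Q \<phi>" and \<rho>: "Cc_inf UNIV \<rho>" and h: "bmeas h"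
    \<comment> \<open>The 1/\<epsilon> terms carry the two mixed second partials of
      \<open>\<rho>\<close> and cancel before the limit is taken. What remains has first partials of
      \<open>\<rho>\<close>, so its limit vanishes by \<open>z\<close>.\<close>
    have "(\<integral>z. w i n z * G \<phi> (partial \<rho> j) h z \<partial>P) - (\<integral>z. w j n z * G \<phi> (partial \<rho> i) h z \<partial>P) =
      (\<integral>z. v n z * G (partial \<phi> j) (partial \<rho> i) h z \<partial>P) - (\<integral>z. v n z * G (partial \<phi> i) (partial \<rho> j) h z \<partial>P)" for n
      unfolding id[OF \<phi> Cc_inf_partial[OF \<rho>] h] partial_commute[OF Cc_inf_smooth[OF \<rho>], of i j] by simp
    moreover have "(\<lambda>n. (\<integral>z. v n z * G (partial \<phi> j) (partial \<rho> i) h z \<partial>P) - (\<integral>z. v n z * G (partial \<phi> i) (partial \<rho> j) h z \<partial>P))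
      \<longlonglongrightarrow> (\<integral>z. u0 z * G (partial \<phi> j) (partial \<rho> i) h z \<partial>P) - (\<integral>z. u0 z * G (partial \<phi> i) (partial \<rho> j) h z \<partial>P)"
      by (intro tendsto_diff wconv_G vc Cc_inf_partial \<phi> \<rho> h)
    moreover have "(\<lambda>n. (\<integral>z. w i n z * G \<phi> (partial \<rho> j) h z \<partial>P) - (\<integral>z. w j n z * G \<phi> (partial \<rho> i) h z \<partial>P))
      \<longlonglongrightarrow> (\<integral>z. W i z * G \<phi> (partial \<rho> j) h z \<partial>P) - (\<integral>z. W j z * G \<phi> (partial \<rho> i) h z \<partial>P)"
      by (intro tendsto_diff wconv_G wc Cc_inf_partial \<phi> \<rho> h)
    ultimately have "(\<integral>z. W i z * G \<phi> (partial \<rho> j) h z \<partial>P) - (\<integral>z. W j z * G \<phi> (partial \<rho> i) h z \<partial>P) =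
      (\<integral>z. u0 z * G (partial \<phi> j) (partial \<rho> i) h z \<partial>P) - (\<integral>z. u0 z * G (partial \<phi> i) (partial \<rho> j) h z \<partial>P)"
      using LIMSEQ_unique by simp
    then show "(\<integral>z. W i z * G \<phi> (partial \<rho> j) h z \<partial>P) = (\<integral>z. W j z * G \<phi> (partial \<rho> i) h z \<partial>P)"
      by (simp add: z[OF Cc_inf_partial[OF \<phi>] \<rho> h])
  qed
  show "has_Dx Q M u0 i (PF.EI (W i))" for i
  proof (rule has_Dx_EI[OF u0(1) inv W(1)])
    fix \<phi> :: "real^'n \<Rightarrow> real" and \<eta> assume \<phi>: "Cc_inf Q \<phi>" and \<eta>: "bmeas \<eta>" "MF.inv_fun \<eta>"
    \<comment> \<open>Any kernel of mass 1 would do: mollification leaves the invariant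
      \<open>\<eta>\<close> unchanged.\<close>
    define \<rho> :: "real^'n \<Rightarrow> real" where "\<rho> = mol 1"
    have \<rho>: "Cc_inf UNIV \<rho>" and \<rho>1: "(\<integral>y. \<rho> y \<partial>lborel) = 1" using mol_Cc_inf[of 1] mol_integral[of 1] by (auto simp: \<rho>_def)
    have vm: "v n \<in> borel_measurable P" for n
      using measurable_compose[OF shear_meas, of "u n" borel "- inverse (eps n)"] u[of n] by (auto simp: v_def[abs_def])
    \<comment> \<open>Mollifying an invariant function multiplies it by the mass of the kernel, and
      a partial derivative of a test function has mass 0. The 1/\<epsilon> term is thus 0 for each
      \<open>n\<close>.\<close>
    have v0: "(\<integral>z. v n z * G \<phi> (partial \<rho> i) \<eta> z \<partial>P) = 0" for n
    proof -
      have "AE z in P. v n z * G \<phi> (partial \<rho> i) \<eta> z = 0"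
        using G_invariant_AE[OF Cc_inf_partial[OF \<rho>] \<eta>, of \<phi> i] by eventually_elim (simp add: Cc_inf_integral_partial[OF \<rho>])
      then show ?thesis using integral_cong_AE[of "\<lambda>z. v n z * G \<phi> (partial \<rho> i) \<eta> z" P "\<lambda>_. 0"]
        borel_measurable_times[OF vm G_meas[OF \<phi> Cc_inf_partial[OF \<rho>] \<eta>(1)]] by simp
    qed
    have "(\<integral>z. w i n z * G \<phi> \<rho> \<eta> z \<partial>P) = - (\<integral>z. v n z * G (partial \<phi> i) \<rho> \<eta> z \<partial>P)" for n
      by (simp add: id[OF \<phi> \<rho> \<eta>(1)] v0)
    moreover have "(\<lambda>n. - (\<integral>z. v n z * G (partial \<phi> i) \<rho> \<eta> z \<partial>P)) \<longlonglongrightarrow> - (\<integral>z. u0 z * G (partial \<phi> i) \<rho> \<eta> z \<partial>P)"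
      by (intro tendsto_minus wconv_G vc Cc_inf_partial \<phi> \<rho> \<eta>(1))
    ultimately have "(\<integral>z. W i z * G \<phi> \<rho> \<eta> z \<partial>P) = - (\<integral>z. u0 z * G (partial \<phi> i) \<rho> \<eta> z \<partial>P)"
      using wconv_G[OF wc \<phi> \<rho> \<eta>(1), of i] LIMSEQ_unique by simp
    moreover have "(\<integral>z. t z * G \<phi>' \<rho> \<eta> z \<partial>P) = (\<integral>z. t z * (\<phi>' (fst z) * \<eta> (snd z)) \<partial>P)"
      if t[measurable]: "t \<in> borel_measurable P" and \<phi>': "Cc_inf Q \<phi>'" for t \<phi>'
    proof (rule integral_cong_AE)
      have [measurable]: "\<phi>' \<in> borel_measurable borel" "\<eta> \<in> borel_measurable M" using Cc_inf_borel[OF \<phi>'] \<eta>(1) by (auto simp: bmeas_def)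
      show "(\<lambda>z. t z * G \<phi>' \<rho> \<eta> z) \<in> borel_measurable P" by (rule borel_measurable_times[OF t G_meas[OF \<phi>' \<rho> \<eta>(1)]])
      show "(\<lambda>z. t z * (\<phi>' (fst z) * \<eta> (snd z))) \<in> borel_measurable P" by measurable
      show "AE z in P. t z * G \<phi>' \<rho> \<eta> z = t z * (\<phi>' (fst z) * \<eta> (snd z))"
        using G_invariant_AE[OF \<rho> \<eta>, of \<phi>'] by eventually_elim (simp add: \<rho>1)
    qed
    ultimately show "(\<integral>z. W i z * (\<phi> (fst z) * \<eta> (snd z)) \<partial>P) = - (\<integral>z. u0 z * (partial \<phi> i (fst z) * \<eta> (snd z)) \<partial>P)"
      using u0(1) W(1)[of i] \<phi> Cc_inf_partial[OF \<phi>] by simp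
  qed
qed

lemma EPhi_EI: assumes "PF.EPhi f" shows "PF.EPhi (PF.EI f)"
  unfolding PF.EPhi_def
proof safe
  note fi = PF.EPhi_integrable[OF assms]
  show m: "PF.EI f \<in> borel_measurable P" using PF.Inv.real_cond_exp_int(1)[OF fi] by auto
  fix l
  have "MF.Y.modl P (\<lambda>z. l * PF.EI f z) = MF.Y.modl P (PF.EI (\<lambda>z. l * f z))"
    by (rule MF.Y.modl_cong_AE) (use PF.Inv.real_cond_exp_cmult[OF fi, of l] in \<open>auto elim: eventually_mono\<close>)
  also have "\<dots> \<le> MF.Y.modl P (\<lambda>z. l * f z)" using fi by (intro PF.modl_EI) simp
  also have "\<dots> < \<infinity>" using assms unfolding PF.EPhi_def by blast
  finally show "MF.Y.modl P (\<lambda>z. l * PF.EI f z) < \<infinity>" .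
qed

lemma EI_diff_EI: assumes "integrable P f" shows "AE z in P. PF.EI (\<lambda>z. f z - PF.EI f z) z = 0"
proof -
  have Ei: "integrable P (PF.EI f)" using assms by (rule PF.Inv.real_cond_exp_int(1))
  have "PF.EI f \<in> borel_measurable PF.Inv" using PF.inv_EI by (simp add: PF.inv_fun_iff)
  from PF.Inv.real_cond_exp_diff[OF assms Ei] PF.Inv.real_cond_exp_F_meas[OF Ei this] show ?thesis
    by eventually_elim simp
qed

text \<open>Kernels of mass 0 do not see invariant functions; subtracting the invariant part
  therefore preserves curl-freeness.\<close>

lemma conv_partial_diff_EI:
  assumes f: "integrable P f" and \<rho>: "Cc_inf UNIV \<rho>"
  shows "AE z in P. PF.conv (partial \<rho> i) (\<lambda>z. f z - PF.EI f z) z = PF.conv (partial \<rho> i) f z"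
proof -
  have Ei: "integrable P (PF.EI f)" using f by (rule PF.Inv.real_cond_exp_int(1))
  note pi = Cc_inf_integrable[OF Cc_inf_partial[OF \<rho>, of i]]
  from PF.conv_diff_AE[OF pi f Ei] PF.conv_invariant[OF Ei PF.inv_EI pi] show ?thesis
    by eventually_elim (simp add: Cc_inf_integral_partial[OF \<rho>])
qed

lemma modl_shear_lux:
  assumes f: "orlicz \<Phi> P f" and k: "lux \<Phi> P f < k"
  shows "MF.Y.modl P (\<lambda>z. f (shear c z) / k) \<le> 1"
proof -
  have [measurable]: "f \<in> borel_measurable P" using f by (simp add: orlicz_def)
  have "MF.Y.modl P (\<lambda>z. f (shear c z) / k) = MF.Y.modl P (\<lambda>z. f z / k)" using modl_shear[of "\<lambda>z. f z / k" c] by simp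
  then show ?thesis using MF.Y.modl_lux_less[OF f k] by simp
qed

end

theorem theorem29:
  fixes \<Phi> :: "real \<Rightarrow> real"
    and Q :: "(real^'n) set"
    and M :: "'w measure"
    and T :: "real^'n \<Rightarrow> 'w \<Rightarrow> 'w"
    and eps :: "nat \<Rightarrow> real"
    and u :: "nat \<Rightarrow> (real^'n) \<times> 'w \<Rightarrow> real"
    and Du :: "nat \<Rightarrow> 'n \<Rightarrow> (real^'n) \<times> 'w \<Rightarrow> real"
  assumes young: "young_function \<Phi>"
    and d2: "delta2 \<Phi>" and d2c: "delta2 (young_conj \<Phi>)"
    and sep: "orlicz_separable \<Phi> M"
    and Q: "bounded Q" "open Q"
    and dyn: "dynamical_system M T"
    and E: "fundamental_seq eps"
    and uW: "\<And>n. W1Dx \<Phi> Q M (u n) (Du n)"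
    and ubd: "\<exists>C. \<forall>n. lux \<Phi> (QOm Q M) (u n) \<le> C"
    and Dubd: "\<exists>C. \<forall>n. (\<Sum>i\<in>UNIV. lux \<Phi> (QOm Q M) (Du n i)) \<le> C"
  shows "\<exists>u0 Du0 (g :: 'n \<Rightarrow> (real^'n) \<times> 'w \<Rightarrow> real) r.
     W1Dx \<Phi> Q M u0 Du0 \<and>
     (AE x in QM Q. invariant \<Phi> M T (\<lambda>\<omega>. u0 (x, \<omega>))) \<and>
     (\<forall>i. orlicz \<Phi> (QOm Q M) (g i)) \<and>
     (AE x in QM Q. in_W1sharp_grad \<Phi> M T (\<lambda>i \<omega>. g i (x, \<omega>))) \<and>
     integrable (QM Q) (\<lambda>x. \<Sum>i\<in>UNIV. lux \<Phi> M (\<lambda>\<omega>. g i (x, \<omega>))) \<and>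
     strict_mono r \<and>
     two_scale_conv \<Phi> Q M T (eps \<circ> r) (u \<circ> r) u0 \<and>
     (\<forall>i. two_scale_conv \<Phi> Q M T (eps \<circ> r) (\<lambda>n. Du (r n) i) (\<lambda>z. Du0 i z + g i z)) \<and>
     (delta_prime (young_conj \<Phi>) \<longrightarrow>
        orlicz \<Phi> (QM Q) (\<lambda>x. \<Sum>i\<in>UNIV. lux \<Phi> M (\<lambda>\<omega>. g i (x, \<omega>))))"
proof -
  interpret setting \<Phi> Q M T by unfold_locales (fact young d2 Q dyn)+
  have uo: "orlicz \<Phi> P (u n)" and Duo: "orlicz \<Phi> P (Du n i)" and DuD: "has_Dx Q M (u n) i (Du n i)" for n i
    using uW[of n] by (auto simp: W1Dx_def)
  note int_o = MF.Y.orlicz_integrable[OF PF.finite_measure_axioms]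
  obtain C1 where C1: "\<And>n. lux \<Phi> P (u n) \<le> C1" using ubd by blast
  obtain C2 where C2: "\<And>n. (\<Sum>i\<in>UNIV. lux \<Phi> P (Du n i)) \<le> C2" using Dubd by blast
  \<comment> \<open>A single scale strictly above all norms of the sequence and of its derivatives,
    so that all modulars at this scale are at most 1.\<close>
  define k where "k = \<bar>C1\<bar> + \<bar>C2\<bar> + 1"
  have k: "k > 0" by (simp add: k_def)
  have uk: "lux \<Phi> P (u n) < k" for n using C1[of n] unfolding k_def by arith
  have Duk: "lux \<Phi> P (Du n i) < k" for n i
  proof -
    have "lux \<Phi> P (Du n i) \<le> (\<Sum>i\<in>UNIV. lux \<Phi> P (Du n i))"
      by (rule member_le_sum) (auto intro: MF.Y.lux_nonneg[OF Duo])
    then show ?thesis using C2[of n] unfolding k_def by arith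
  qed
  define v where "v n z = u n (shear (- inverse (eps n)) z)" for n z
  define w where "w i n z = Du n i (shear (- inverse (eps n)) z)" for i n z
  have [measurable]: "u n \<in> borel_measurable P" "Du n i \<in> borel_measurable P" for n i
    using uo[of n] Duo[of n i] by (simp_all add: orlicz_def)
  have vm: "v n \<in> borel_measurable P" and wm: "w i n \<in> borel_measurable P" for i n
    unfolding v_def[abs_def] w_def[abs_def] by measurable
  have vk: "MF.Y.modl P (\<lambda>z. v n z / k) \<le> 1" and wk: "MF.Y.modl P (\<lambda>z. w i n z / k) \<le> 1" for i n
    unfolding v_def w_def by (intro modl_shear_lux uo Duo uk Duk)+
  obtain r1 u0 where r1: "strict_mono r1" and u0i: "integrable P u0" and u0o: "orlicz \<Phi> P u0" and vc: "wconv P (v \<circ> r1) u0"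
    using MF.Y.orlicz_weak_compact[of P v k, OF PF.finite_measure_axioms vm k vk] by (elim exE conjE) (rule that)
  obtain r2 W where r2: "strict_mono r2"
    and W': "\<forall>i. integrable P (W i) \<and> orlicz \<Phi> P (W i) \<and> wconv P (\<lambda>n. w i (r1 (r2 n))) (W i)"
    using MF.Y.orlicz_weak_compact_family[of P "\<lambda>i n. w i (r1 n)" k, OF PF.finite_measure_axioms wm k wk] by (elim exE conjE) (rule that)
  have W: "integrable P (W i)" "orlicz \<Phi> P (W i)" "wconv P (\<lambda>n. w i (r1 (r2 n))) (W i)" for i using W' by blast+
  define r where "r = r1 \<circ> r2"
  have r: "strict_mono r" unfolding r_def using r1 r2 by (rule strict_mono_o)
  \<comment> \<open>The subsequence for \<open>u\<close> was extracted before that for the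
    derivatives, so its weak limit is passed on to the composed subsequence.\<close>
  have vcr: "wconv P (\<lambda>n z. (u \<circ> r) n (shear (- inverse ((eps \<circ> r) n)) z)) u0"
    using wconv_subseq[OF vc r2] by (simp add: r_def v_def[abs_def] o_def)
  have wcr: "wconv P (\<lambda>n z. Du (r n) i (shear (- inverse ((eps \<circ> r) n)) z)) (W i)" for i
    using W(3)[of i] by (simp add: r_def w_def[abs_def] o_def)
  have e: "(eps \<circ> r) n \<noteq> 0" for n using E unfolding fundamental_seq_def by (metis comp_apply less_irrefl)
  have e0: "(eps \<circ> r) \<longlonglongrightarrow> 0" using E r by (auto simp: fundamental_seq_def intro: LIMSEQ_subseq_LIMSEQ)
  have ui: "integrable P ((u \<circ> r) n)" and Dui: "integrable P (Du (r n) i)" and DuD': "has_Dx Q M ((u \<circ> r) n) i (Du (r n) i)" for n i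
    using int_o[OF uo] int_o[OF Duo] DuD by simp_all
  note lim = oscillating_limit[where u="u \<circ> r" and Du="\<lambda>n. Du (r n)", OF ui Dui DuD' e e0 u0i vcr W(1) wcr]
  define Du0 where "Du0 i = PF.EI (W i)" for i
  define g where "g i z = W i z - Du0 i z" for i z
  have WE: "PF.EPhi (W i)" for i using W(2) by (simp add: PF.orlicz_EPhi)
  have D0E: "PF.EPhi (Du0 i)" for i unfolding Du0_def by (rule EPhi_EI[OF WE])
  have gE: "PF.EPhi (g i)" for i unfolding g_def[abs_def] by (rule PF.EPhi_diff[OF WE D0E])
  have g0: "AE z in P. PF.EI (g i) z = 0" for i unfolding g_def[abs_def] Du0_def by (rule EI_diff_EI[OF W(1)])
  have gcurl: "AE z in P. PF.conv (partial \<rho> j) (g i) z = PF.conv (partial \<rho> i) (g j) z" if \<rho>: "Cc_inf UNIV \<rho>" for \<rho> :: "real^'n \<Rightarrow> real" and i j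
    using lim(3)[OF \<rho>, of j i] conv_partial_diff_EI[OF W(1)[of i] \<rho>, of j] conv_partial_diff_EI[OF W(1)[of j] \<rho>, of i]
    unfolding g_def[abs_def] Du0_def by eventually_elim simp
  have "W1Dx \<Phi> Q M u0 Du0" unfolding W1Dx_def using u0o D0E lim(2) by (auto simp: PF.orlicz_EPhi Du0_def)
  moreover have "AE x in QM Q. invariant \<Phi> M T (\<lambda>\<omega>. u0 (x, \<omega>))"
    using u0o lim(1) by (intro AE_section_invariant) (simp_all add: PF.orlicz_EPhi)
  moreover have "orlicz \<Phi> P (g i)" for i using gE by (simp add: PF.orlicz_EPhi)
  moreover have "AE x in QM Q. in_W1sharp_grad \<Phi> M T (\<lambda>i \<omega>. g i (x, \<omega>))" by (rule AE_section_gradient[OF gE g0 gcurl])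
  moreover have "integrable (QM Q) (\<lambda>x. \<Sum>i\<in>UNIV. lux \<Phi> M (\<lambda>\<omega>. g i (x, \<omega>)))"
    by (intro Bochner_Integration.integrable_sum lux_integrable gE)
  moreover have "two_scale_conv \<Phi> Q M T (eps \<circ> r) (u \<circ> r) u0"
    using u0i ui by (intro two_scale_of_wconv vcr) auto
  moreover have "two_scale_conv \<Phi> Q M T (eps \<circ> r) (\<lambda>n. Du (r n) i) (\<lambda>z. Du0 i z + g i z)" for i
    using W(1)[of i] by (intro two_scale_of_wconv) (auto simp: g_def wcr[unfolded o_def])
  moreover have "orlicz \<Phi> (QM Q) (\<lambda>x. \<Sum>i\<in>UNIV. lux \<Phi> M (\<lambda>\<omega>. g i (x, \<omega>)))" if "delta_prime (young_conj \<Phi>)"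
    by (rule lux_sum_orlicz[OF gE that])
  ultimately show ?thesis using r by (intro exI[of _ u0] exI[of _ Du0] exI[of _ g] exI[of _ r]) blast
qed

end
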